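(* Let $k$ be an algebraically closed field of characteristic zero, $A=k[[x_1,\dots,x_n]]$, and $\pi\in A$ with $\pi(0)=0$. Let $\theta$ denote the Faltings–Knörrer functor and $\theta\theta$ its two-fold iterate (first with new variables $x,y$, then with new variables $u,v$). Then $\theta\theta$ defines an equivalence of triangulated categories $$\mathrm{MF}^{\epsilon}(\pi)\;\xrightarrow{\ \sim\ }\;\mathrm{MF}^{-\epsilon}(xy+uv-\pi),\qquad \epsilon\in\{+,-\},$$ where the target consists of matrix factorizations over $A[[x,y,u,v]]$. In particular orthogonal ($+$) and symplectic ($-$) matrix factorizations are exchanged.
   Context: Matrix factorizations. Let $S$ be a complete local noetherian $k$-algebra with residue field $k$, and $w$ in its maximal ideal. A matrix factorization (MF) of $w$ over $S$ is a $\mathbb Z/2$-graded free $S$-module of finite rank $M=M_0\oplus M_1$ with an odd $S$-linear map $Q=\begin{pmatrix}0&\psi\\ \varphi&0\end{pmatrix}$, $\varphi:M_0\to M_1$, $\psi:M_1\to M_0$, with $Q^2=w\cdot 1$. We write $M=(\varphi,\psi)$. The shift $M[1]$ is $M_1\xrightarrow{-\psi}M_0\xrightarrow{-\varphi}M_1$. For MFs $M,M'$ of $w$, $\hom(M,M')$ is the $\mathbb Z/2$-graded module of all $S$-linear maps, with differential $D(f)=Q'f-(-1)^{|f|}fQ$, and $\mathrm{Ext}^\bullet(M,M')=\ker D/\operatorname{im}D$. The homotopy category $\mathrm{MF}(w)$ has the MFs of $w$ as objects and $\mathrm{Ext}^0(M,M')$ as morphisms; it is triangulated with shift $M\mapsto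 M[1]$ and the usual cones. Duals. $M^T$ is $M_0^*\xrightarrow{{}^t\psi}M_1^*\xrightarrow{{}^t\varphi}M_0^*$, and $M^*=M^T[1]$ is $M_1^*\xrightarrow{-{}^t\varphi}M_0^*\xrightarrow{-{}^t\psi}M_1^*$ (transposes without signs). Bilinear structures. A quadratic (resp. symplectic) form on $M$ is an isomorphism of MFs $b:M\to M^*$, regarded as a degree-one map $M\to M^T$, $b=\begin{pmatrix}0&b_1\\ b_0&0\end{pmatrix}$, $b_0:M_0\to M_1^*$, $b_1:M_1\to M_0^*$, with ${}^tb=-b$ (resp. ${}^tb=b$), i.e. ${}^tb_0=-b_1$ (resp. $b_1$), and $b^{-1}\,{}^tQ\,b=-Q$. A twisted quadratic (resp. symplectic) form is an isomorphism $q:M\to M^T$ with ${}^tq=q$ (resp. ${}^tq=-q$) and $q^{-1}\,{}^tQ\,q=Q$. The sign $\epsilon=+$ stands for (twisted) quadratic, also called orthogonal, and $\epsilon=-$ for (twisted) symplectic. $\mathrm{MF}^{\pm}(w)$ (resp. $\mathrm{MF}^{\omega,\pm}(w)$) is the category whose objects are MFs of $w$ equipped with a form (resp. twisted form) of type $\pm$; morphisms are the morphisms of the underlying MFs in $\mathrm{MF}(w)$, and the shift and triangles are those of the underlying MFs. Tensor product. For MFs $M$ of $w$ and $M'$ of $w'$ (scalars extended to a common ring), $M\otimes M'$ is the $\mathbb Z/2$-graded tensor product with odd operator $Q\otimes1+1\otimes Q'$ (Koszul sign rule); it is an MF of $w+w'$. Tensor products of (twisted) forms are taken with the Koszul sign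 rule $(f\otimes g)(m\otimes m')=(-1)^{|g||m|}f(m)\otimes g(m')$. Functor $\theta$. For an MF $(P,Q)$ of $\pi$ over $A$, $\theta(P,Q)=(Q,-P)\otimes(x,y)$, where $(x,y)$ is the rank-one MF $k[[x,y]]\xrightarrow{x}k[[x,y]]\xrightarrow{y}k[[x,y]]$ of $xy$. It is an MF of $xy-\pi$ over $A[[x,y]]$, equivalently (up to isomorphism) $\varphi=\begin{pmatrix}x&P\\ Q&y\end{pmatrix}$, $\psi=\begin{pmatrix}y&-P\\ -Q&x\end{pmatrix}$. The MF $(x,y)$ carries an essentially unique quadratic form, $\beta_0=1,\ \beta_1=-1$. A form or twisted form on $(P,Q)$ is transferred to $(Q,-P)$ (by interchanging its two components, with a change of sign of one component in the twisted case) and tensored with $\beta$. A twisted form of type $\epsilon$ on $(P,Q)$ thus gives a form of type $\epsilon$ on $\theta(P,Q)$, and a form of type $\epsilon$ gives a twisted form of type $-\epsilon$. Identification of potentials. Literally, $\theta\theta$ takes values in MFs of $uv-(xy-\pi)$. These are identified with MFs of $xy+uv-\pi$ by $(\varphi,\psi)\mapsto(\varphi,-\psi)$ together with $u\mapsto-u$; forms are transferred without changing their type.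
   Formalization: "Equivalence of triangulated categories" is read as an equivalence commuting with shift and preserving and reflecting the inherited triangles; the categories with forms are not claimed triangulated, as cones may carry no form (e.g. symplectic, potential x^5). *)

theory Defs
  imports
    "Jordan_Normal_Form.Matrix"
    "HOL-Computational_Algebra.Polynomial"
    "HOL-Library.Multiset"
    "HOL-Library.Product_Plus"
begin

section \<open>Formal power series in several variables\<close>

text \<open>
  The variables are \<open>X\<^sub>0, X\<^sub>1, X\<^sub>2, \<dots>\<close>; a monomial is the multiset of its variables, so that
  the exponent of \<open>X\<^sub>i\<close> in \<open>m\<close> is \<open>count m i\<close>. A monomial has only finitely many divisors,
  hence the convolution product below is a finite sum. The ring \<open>k[[X\<^sub>0, \<dots>, X\<^bsub>n-1\<^esub>]]\<close> is the
  subring \<open>power_series n\<close> of the series involving no variable \<open>X\<^sub>i\<close> with \<open>i \<ge> n\<close>.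
\<close>

typedef 'a mpow = "UNIV :: (nat multiset \<Rightarrow> 'a) set"
  morphisms mcoeff MPow
  by simp

lemma mcoeff_MPow [simp]: "mcoeff (MPow f) = f"
  by (simp add: MPow_inverse)

lemma mpow_eqI: "(\<And>m. mcoeff f m = mcoeff g m) \<Longrightarrow> f = g"
  by (metis ext mcoeff_inject)

lemma finite_submultisets: "finite {a. a \<subseteq># (m :: 'b multiset)}"
proof (induction m)
  case empty
  have "{a. a \<subseteq># ({#} :: 'b multiset)} = {{#}}" by auto
  then show ?case by simp
next
  case (add x m)
  have "{a. a \<subseteq># add_mset x m} \<subseteq> {a. a \<subseteq># m} \<union> add_mset x ` {a. a \<subseteq># m}"
  proof
    fix a assume "a \<in> {a. a \<subseteq># add_mset x m}"
    then have a: "a \<subseteq># add_mset x m" by simp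
    show "a \<in> {a. a \<subseteq># m} \<union> add_mset x ` {a. a \<subseteq># m}"
    proof (cases "x \<in># a")
      case True
      then obtain b where "a = add_mset x b" by (meson mset_add)
      with a show ?thesis by auto
    next
      case False
      with a have "a \<subseteq># m"
        by (metis diff_single_trivial subset_eq_diff_conv add_mset_add_single)
      then show ?thesis by simp
    qed
  qed
  then show ?case using add.IH by (meson finite_UnI finite_imageI finite_subset)
qed

instantiation mpow :: (comm_ring_1) comm_ring_1
begin

definition zero_mpow where "0 = MPow (\<lambda>_. 0)"
definition one_mpow where "1 = MPow (\<lambda>m. if m = {#} then 1 else 0)"
definition plus_mpow where "f + g = MPow (\<lambda>m. mcoeff f m + mcoeff g m)"
definition minus_mpow where "f - g = MPow (\<lambda>m. mcoeff f m - mcoeff g m)"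
definition uminus_mpow where "- f = MPow (\<lambda>m. - mcoeff f m)"
definition times_mpow where
  "f * g = MPow (\<lambda>m. \<Sum>a\<in>{a. a \<subseteq># m}. mcoeff f a * mcoeff g (m - a))"

instance
proof
  fix f g h :: "'a mpow"
  show "f * g * h = f * (g * h)"
  proof (rule mpow_eqI)
    fix m
    let ?S = "\<lambda>m :: nat multiset. {a. a \<subseteq># m}"
    have "mcoeff (f * g * h) m =
        (\<Sum>c\<in>?S m. \<Sum>a\<in>?S c. mcoeff f a * mcoeff g (c - a) * mcoeff h (m - c))"
      by (simp add: times_mpow_def sum_distrib_right)
    also have "\<dots> = (\<Sum>(c, a)\<in>Sigma (?S m) ?S.
        mcoeff f a * mcoeff g (c - a) * mcoeff h (m - c))"
      by (rule sum.Sigma) (auto simp: finite_submultisets)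
    also have "\<dots> = (\<Sum>(a, b)\<in>Sigma (?S m) (\<lambda>a. ?S (m - a)).
        mcoeff f a * mcoeff g b * mcoeff h (m - a - b))"
    proof (rule sum.reindex_bij_witness[where i = "\<lambda>(a, b). (a + b, a)" and j = "\<lambda>(c, a). (a, c - a)"])
      fix p assume "p \<in> Sigma (?S m) ?S"
      then obtain c a where p: "p = (c, a)" "c \<subseteq># m" "a \<subseteq># c" by auto
      then have eq: "a + (c - a) = c" by simp
      have "c - a \<subseteq># m - a" using p by (simp add: subset_eq_diff_conv)
      moreover have "a \<subseteq># m" using p subset_mset.order_trans by blast
      ultimately show "(case p of (c, a) \<Rightarrow> (a, c - a)) \<in> Sigma (?S m) (\<lambda>a. ?S (m - a))"
        using p by simp
      show "(case case p of (c, a) \<Rightarrow> (a, c - a) of (a, b) \<Rightarrow> (a + b, a)) = p"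
        using p eq by simp
      have "m - a - (c - a) = m - c"
        using eq by (metis diff_diff_add_mset)
      then show "(case case p of (c, a) \<Rightarrow> (a, c - a) of
          (a, b) \<Rightarrow> mcoeff f a * mcoeff g b * mcoeff h (m - a - b)) =
          (case p of (c, a) \<Rightarrow> mcoeff f a * mcoeff g (c - a) * mcoeff h (m - c))"
        using p by simp
    next
      fix p assume "p \<in> Sigma (?S m) (\<lambda>a. ?S (m - a))"
      then obtain a b where p: "p = (a, b)" "a \<subseteq># m" "b \<subseteq># m - a" by auto
      then show "(case case p of (a, b) \<Rightarrow> (a + b, a) of (c, a) \<Rightarrow> (a, c - a)) = p" by simp
      have "a + b \<subseteq># m"
        using p by (metis add.commute subset_mset.le_diff_conv2)
      then show "(case p of (a, b) \<Rightarrow> (a + b, a)) \<in> Sigma (?S m) ?S"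
        using p by simp
    qed
    also have "\<dots> = (\<Sum>a\<in>?S m. \<Sum>b\<in>?S (m - a).
        mcoeff f a * mcoeff g b * mcoeff h (m - a - b))"
      by (rule sum.Sigma[symmetric]) (auto simp: finite_submultisets)
    also have "\<dots> = mcoeff (f * (g * h)) m"
      by (simp add: times_mpow_def sum_distrib_left mult.assoc)
    finally show "mcoeff (f * g * h) m = mcoeff (f * (g * h)) m" .
  qed
  show "f * g = g * f"
  proof (rule mpow_eqI)
    fix m
    have "(\<Sum>a\<in>{a. a \<subseteq># m}. mcoeff f a * mcoeff g (m - a)) =
        (\<Sum>a\<in>{a. a \<subseteq># m}. mcoeff g a * mcoeff f (m - a))"
      by (rule sum.reindex_bij_witness[where i = "\<lambda>a. m - a" and j = "\<lambda>a. m - a"])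
        (auto simp: double_diff mult.commute subset_mset.diff_diff_right)
    then show "mcoeff (f * g) m = mcoeff (g * f) m" by (simp add: times_mpow_def)
  qed
  show "1 * f = f"
  proof (rule mpow_eqI)
    fix m
    have "mcoeff (1 * f) m = (\<Sum>a\<in>{a. a \<subseteq># m}. if a = {#} then mcoeff f m else 0)"
      unfolding times_mpow_def one_mpow_def by (auto intro!: sum.cong)
    also have "\<dots> = mcoeff f m"
      using finite_submultisets[of m] by (simp add: sum.delta)
    finally show "mcoeff (1 * f) m = mcoeff f m" .
  qed
  show "(f + g) * h = f * h + g * h"
    by (rule mpow_eqI) (simp add: times_mpow_def plus_mpow_def distrib_right sum.distrib)
  show "f + g + h = f + (g + h)" "f + g = g + f" "0 + f = f" "- f + f = 0" "f - g = f + - g"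
    by (rule mpow_eqI, simp add: plus_mpow_def zero_mpow_def uminus_mpow_def minus_mpow_def
        add.assoc add.commute)+
  show "(0 :: 'a mpow) \<noteq> 1"
  proof
    assume "(0 :: 'a mpow) = 1"
    then have "mcoeff (0 :: 'a mpow) {#} = mcoeff 1 {#}" by simp
    then show False by (simp add: zero_mpow_def one_mpow_def)
  qed
qed

end

definition power_series :: "nat \<Rightarrow> 'a::comm_ring_1 mpow set" where
  "power_series n = {f. \<forall>m. mcoeff f m \<noteq> 0 \<longrightarrow> set_mset m \<subseteq> {..<n}}"

definition Var :: "nat \<Rightarrow> 'a::comm_ring_1 mpow" where
  "Var i = MPow (\<lambda>m. if m = {#i#} then 1 else 0)"

text \<open>The substitution \<open>X\<^sub>i \<mapsto> - X\<^sub>i\<close>.\<close>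

definition neg_var :: "nat \<Rightarrow> 'a::comm_ring_1 mpow \<Rightarrow> 'a mpow" where
  "neg_var i f = MPow (\<lambda>m. (- 1) ^ count m i * mcoeff f m)"


section \<open>Categories with shift and triangles\<close>

text \<open>
  Hom sets need not be disjoint, so the identity, the composition and the action of functors on
  morphisms take the objects as arguments; \<open>Cmp C X Y Z g f\<close> is the composite of \<open>f : X \<rightarrow> Y\<close>
  and \<open>g : Y \<rightarrow> Z\<close>.
  A triangle \<open>X \<rightarrow> Y \<rightarrow> Z \<rightarrow> X[1]\<close> is a tuple \<open>(X, Y, Z, f, g, h)\<close>.
\<close>

record ('o, 'm) shift_cat =
  Obj :: "'o set"
  Mor :: "'o \<Rightarrow> 'o \<Rightarrow> 'm set"
  Idt :: "'o \<Rightarrow> 'm"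
  Cmp :: "'o \<Rightarrow> 'o \<Rightarrow> 'o \<Rightarrow> 'm \<Rightarrow> 'm \<Rightarrow> 'm"
  ShO :: "'o \<Rightarrow> 'o"
  ShM :: "'o \<Rightarrow> 'o \<Rightarrow> 'm \<Rightarrow> 'm"

record ('o, 'm) tri_cat = "('o, 'm) shift_cat" +
  Tri :: "('o \<times> 'o \<times> 'o \<times> 'm \<times> 'm \<times> 'm) set"

definition is_category :: "('o, 'm, 'z) shift_cat_scheme \<Rightarrow> bool" where
  "is_category C \<longleftrightarrow>
    (\<forall>X\<in>Obj C. Idt C X \<in> Mor C X X) \<and>
    (\<forall>X\<in>Obj C. \<forall>Y\<in>Obj C. \<forall>Z\<in>Obj C. \<forall>f\<in>Mor C X Y. \<forall>g\<in>Mor C Y Z.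
      Cmp C X Y Z g f \<in> Mor C X Z) \<and>
    (\<forall>X\<in>Obj C. \<forall>Y\<in>Obj C. \<forall>f\<in>Mor C X Y.
      Cmp C X X Y f (Idt C X) = f \<and> Cmp C X Y Y (Idt C Y) f = f) \<and>
    (\<forall>W\<in>Obj C. \<forall>X\<in>Obj C. \<forall>Y\<in>Obj C. \<forall>Z\<in>Obj C.
      \<forall>f\<in>Mor C W X. \<forall>g\<in>Mor C X Y. \<forall>h\<in>Mor C Y Z.
        Cmp C W X Z (Cmp C X Y Z h g) f = Cmp C W Y Z h (Cmp C W X Y g f))"

definition is_functor :: "('o, 'm, 'z) shift_cat_scheme \<Rightarrow> ('p, 'n, 'y) shift_cat_scheme
    \<Rightarrow> ('o \<Rightarrow> 'p) \<Rightarrow> ('o \<Rightarrow> 'o \<Rightarrow> 'm \<Rightarrow> 'n) \<Rightarrow> bool" where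
  "is_functor C D Fo Fm \<longleftrightarrow>
    (\<forall>X\<in>Obj C. Fo X \<in> Obj D) \<and>
    (\<forall>X\<in>Obj C. \<forall>Y\<in>Obj C. \<forall>f\<in>Mor C X Y. Fm X Y f \<in> Mor D (Fo X) (Fo Y)) \<and>
    (\<forall>X\<in>Obj C. Fm X X (Idt C X) = Idt D (Fo X)) \<and>
    (\<forall>X\<in>Obj C. \<forall>Y\<in>Obj C. \<forall>Z\<in>Obj C. \<forall>f\<in>Mor C X Y. \<forall>g\<in>Mor C Y Z.
      Fm X Z (Cmp C X Y Z g f) = Cmp D (Fo X) (Fo Y) (Fo Z) (Fm Y Z g) (Fm X Y f))"

definition isos :: "('o, 'm, 'z) shift_cat_scheme \<Rightarrow> 'o \<Rightarrow> 'o \<Rightarrow> 'm set" where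
  "isos C X Y = {f \<in> Mor C X Y. \<exists>g\<in>Mor C Y X.
    Cmp C X Y X g f = Idt C X \<and> Cmp C Y X Y f g = Idt C Y}"

definition natural_iso :: "('o, 'm, 'z) shift_cat_scheme \<Rightarrow> ('p, 'n, 'y) shift_cat_scheme
    \<Rightarrow> ('o \<Rightarrow> 'p) \<Rightarrow> ('o \<Rightarrow> 'o \<Rightarrow> 'm \<Rightarrow> 'n) \<Rightarrow> ('o \<Rightarrow> 'p) \<Rightarrow> ('o \<Rightarrow> 'o \<Rightarrow> 'm \<Rightarrow> 'n)
    \<Rightarrow> ('o \<Rightarrow> 'n) \<Rightarrow> bool" where
  "natural_iso C D Fo Fm Go Gm \<eta> \<longleftrightarrow>
    (\<forall>X\<in>Obj C. \<eta> X \<in> isos D (Fo X) (Go X)) \<and>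
    (\<forall>X\<in>Obj C. \<forall>Y\<in>Obj C. \<forall>f\<in>Mor C X Y.
      Cmp D (Fo X) (Fo Y) (Go Y) (\<eta> Y) (Fm X Y f) = Cmp D (Fo X) (Go X) (Go Y) (Gm X Y f) (\<eta> X))"

definition is_equivalence :: "('o, 'm, 'z) shift_cat_scheme \<Rightarrow> ('p, 'n, 'y) shift_cat_scheme
    \<Rightarrow> ('o \<Rightarrow> 'p) \<Rightarrow> ('o \<Rightarrow> 'o \<Rightarrow> 'm \<Rightarrow> 'n) \<Rightarrow> bool" where
  "is_equivalence C D Fo Fm \<longleftrightarrow> is_functor C D Fo Fm \<and>
    (\<exists>Go Gm \<eta> \<mu>. is_functor D C Go Gm \<and>
      natural_iso C C (\<lambda>X. Go (Fo X)) (\<lambda>X Y f. Gm (Fo X) (Fo Y) (Fm X Y f))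
        (\<lambda>X. X) (\<lambda>_ _ f. f) \<eta> \<and>
      natural_iso D D (\<lambda>X. Fo (Go X)) (\<lambda>X Y f. Fm (Go X) (Go Y) (Gm X Y f))
        (\<lambda>X. X) (\<lambda>_ _ f. f) \<mu>)"

definition triangle_typed :: "('o, 'm, 'z) shift_cat_scheme
    \<Rightarrow> 'o \<times> 'o \<times> 'o \<times> 'm \<times> 'm \<times> 'm \<Rightarrow> bool" where
  "triangle_typed C = (\<lambda>(X, Y, Z, f, g, h). X \<in> Obj C \<and> Y \<in> Obj C \<and> Z \<in> Obj C \<and>
    f \<in> Mor C X Y \<and> g \<in> Mor C Y Z \<and> h \<in> Mor C Z (ShO C X))"

definition triangle_iso :: "('o, 'm, 'z) shift_cat_scheme
    \<Rightarrow> 'o \<times> 'o \<times> 'o \<times> 'm \<times> 'm \<times> 'm \<Rightarrow> 'o \<times> 'o \<times> 'o \<times> 'm \<times> 'm \<times> 'm \<Rightarrow> bool" where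
  "triangle_iso C = (\<lambda>(X, Y, Z, f, g, h) (X', Y', Z', f', g', h').
    \<exists>\<alpha>\<in>isos C X X'. \<exists>\<beta>\<in>isos C Y Y'. \<exists>\<gamma>\<in>isos C Z Z'.
      Cmp C X Y Y' \<beta> f = Cmp C X X' Y' f' \<alpha> \<and>
      Cmp C Y Z Z' \<gamma> g = Cmp C Y Y' Z' g' \<beta> \<and>
      Cmp C Z (ShO C X) (ShO C X') (ShM C X X' \<alpha>) h = Cmp C Z Z' (ShO C X') h' \<gamma>)"

text \<open>
  An equivalence of categories compatible with the shift and the triangles. The triangles of the
  two sides have to correspond in both directions: for triangulated categories one direction
  implies the other, but here no axioms on the triangles are required.
\<close>

definition triangulated_equivalence :: "('o, 'm, 'z) tri_cat_scheme \<Rightarrow> ('p, 'n, 'y) tri_cat_scheme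
    \<Rightarrow> ('o \<Rightarrow> 'p) \<Rightarrow> ('o \<Rightarrow> 'o \<Rightarrow> 'm \<Rightarrow> 'n) \<Rightarrow> bool" where
  "triangulated_equivalence C D Fo Fm \<longleftrightarrow>
    is_category C \<and> is_equivalence C C (ShO C) (ShM C) \<and>
    is_category D \<and> is_equivalence D D (ShO D) (ShM D) \<and>
    is_equivalence C D Fo Fm \<and>
    (\<exists>\<eta>. natural_iso C D
        (\<lambda>X. Fo (ShO C X)) (\<lambda>X Y f. Fm (ShO C X) (ShO C Y) (ShM C X Y f))
        (\<lambda>X. ShO D (Fo X)) (\<lambda>X Y f. ShM D (Fo X) (Fo Y) (Fm X Y f)) \<eta> \<and>
      (\<forall>X Y Z f g h. triangle_typed C (X, Y, Z, f, g, h) \<longrightarrow>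
        ((X, Y, Z, f, g, h) \<in> Tri C \<longleftrightarrow>
          (Fo X, Fo Y, Fo Z, Fm X Y f, Fm Y Z g,
            Cmp D (Fo Z) (Fo (ShO C X)) (ShO D (Fo X)) (\<eta> X) (Fm Z (ShO C X) h)) \<in> Tri D)))"


section \<open>Matrix factorizations\<close>

text \<open>
  Matrix factorizations over the subring \<open>S\<close> of a commutative ring. Graded free modules are
  \<open>S\<^sup>r \<oplus> S\<^sup>s\<close> (in degrees 0 and 1), and a homogeneous map is the pair of matrices of its
  restrictions to the even and to the odd part of its source, whatever its parity. In particular
  a matrix factorization is the pair \<open>(\<phi>, \<psi>)\<close>, that is, the odd map \<open>Q\<close>. Sums and signs of
  such pairs are componentwise.
\<close>

type_synonym 'a hmap = "'a mat \<times> 'a mat"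

definition mats :: "'a set \<Rightarrow> nat \<Rightarrow> nat \<Rightarrow> 'a mat set" where
  "mats S r c = {A \<in> carrier_mat r c. elements_mat A \<subseteq> S}"

definition rk0 :: "'a hmap \<Rightarrow> nat" where "rk0 M = dim_col (fst M)"
definition rk1 :: "'a hmap \<Rightarrow> nat" where "rk1 M = dim_row (fst M)"

definition is_MF :: "'a set \<Rightarrow> 'a::comm_ring_1 \<Rightarrow> 'a hmap \<Rightarrow> bool" where
  "is_MF S w M \<longleftrightarrow>
    fst M \<in> mats S (rk1 M) (rk0 M) \<and> snd M \<in> mats S (rk0 M) (rk1 M) \<and>
    snd M * fst M = w \<cdot>\<^sub>m 1\<^sub>m (rk0 M) \<and> fst M * snd M = w \<cdot>\<^sub>m 1\<^sub>m (rk1 M)"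

definition even_maps :: "'a set \<Rightarrow> 'a hmap \<Rightarrow> 'a hmap \<Rightarrow> 'a hmap set" where
  "even_maps S M M' = mats S (rk0 M') (rk0 M) \<times> mats S (rk1 M') (rk1 M)"

definition odd_maps :: "'a set \<Rightarrow> 'a hmap \<Rightarrow> 'a hmap \<Rightarrow> 'a hmap set" where
  "odd_maps S M M' = mats S (rk1 M') (rk0 M) \<times> mats S (rk0 M') (rk1 M)"

text \<open>The differential \<open>D f = Q' f - (-1)\<^bsup>|f|\<^esup> f Q\<close> on even and on odd maps.\<close>

definition D_even :: "'a::comm_ring_1 hmap \<Rightarrow> 'a hmap \<Rightarrow> 'a hmap \<Rightarrow> 'a hmap" where
  "D_even M M' f = (fst M' * fst f - snd f * fst M, snd M' * snd f - fst f * snd M)"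

definition D_odd :: "'a::comm_ring_1 hmap \<Rightarrow> 'a hmap \<Rightarrow> 'a hmap \<Rightarrow> 'a hmap" where
  "D_odd M M' h = (snd M' * fst h + snd h * fst M, fst M' * snd h + fst h * snd M)"

definition cocycles :: "'a set \<Rightarrow> 'a::comm_ring_1 hmap \<Rightarrow> 'a hmap \<Rightarrow> 'a hmap set" where
  "cocycles S M M' = {f \<in> even_maps S M M'.
    D_even M M' f = (0\<^sub>m (rk1 M') (rk0 M), 0\<^sub>m (rk0 M') (rk1 M))}"

definition homotopic :: "'a set \<Rightarrow> 'a::comm_ring_1 hmap \<Rightarrow> 'a hmap \<Rightarrow> 'a hmap rel" where
  "homotopic S M M' = {(f, g). f \<in> cocycles S M M' \<and> g \<in> cocycles S M M' \<and>
    (\<exists>h\<in>odd_maps S M M'. f - g = D_odd M M' h)}"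

definition Ext0 :: "'a set \<Rightarrow> 'a::comm_ring_1 hmap \<Rightarrow> 'a hmap \<Rightarrow> 'a hmap set set" where
  "Ext0 S M M' = cocycles S M M' // homotopic S M M'"

definition mf_id :: "'a::comm_ring_1 hmap \<Rightarrow> 'a hmap" where
  "mf_id M = (1\<^sub>m (rk0 M), 1\<^sub>m (rk1 M))"

definition even_comp :: "'a::comm_ring_1 hmap \<Rightarrow> 'a hmap \<Rightarrow> 'a hmap" where
  "even_comp g f = (fst g * fst f, snd g * snd f)"

definition mf_shift :: "'a::comm_ring_1 hmap \<Rightarrow> 'a hmap" where
  "mf_shift M = (- snd M, - fst M)"

text \<open>
  The cone of \<open>f : M \<rightarrow> N\<close> is \<open>M[1] \<oplus> N\<close>, with even part \<open>M\<^sub>1 \<oplus> N\<^sub>0\<close> and odd part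
  \<open>M\<^sub>0 \<oplus> N\<^sub>1\<close>.
\<close>

definition cone :: "'a::comm_ring_1 hmap \<Rightarrow> 'a hmap \<Rightarrow> 'a hmap \<Rightarrow> 'a hmap" where
  "cone M N f =
    (four_block_mat (- snd M) (0\<^sub>m (rk0 M) (rk0 N)) (snd f) (fst N),
     four_block_mat (- fst M) (0\<^sub>m (rk1 M) (rk1 N)) (fst f) (snd N))"

definition cone_incl :: "'a::comm_ring_1 hmap \<Rightarrow> 'a hmap \<Rightarrow> 'a hmap" where
  "cone_incl M N = (0\<^sub>m (rk1 M) (rk0 N) @\<^sub>r 1\<^sub>m (rk0 N), 0\<^sub>m (rk0 M) (rk1 N) @\<^sub>r 1\<^sub>m (rk1 N))"

definition cone_proj :: "'a::comm_ring_1 hmap \<Rightarrow> 'a hmap \<Rightarrow> 'a hmap" where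
  "cone_proj M N =
    (transpose_mat (1\<^sub>m (rk1 M) @\<^sub>r 0\<^sub>m (rk0 N) (rk1 M)),
     transpose_mat (1\<^sub>m (rk0 M) @\<^sub>r 0\<^sub>m (rk1 N) (rk0 M)))"

definition MF_shift_cat :: "'a set \<Rightarrow> 'a::comm_ring_1 \<Rightarrow> ('a hmap, 'a hmap set) shift_cat" where
  "MF_shift_cat S w = \<lparr>
    Obj = {M. is_MF S w M},
    Mor = Ext0 S,
    Idt = (\<lambda>M. homotopic S M M `` {mf_id M}),
    Cmp = (\<lambda>L M N G F. \<Union>g\<in>G. \<Union>f\<in>F. homotopic S L N `` {even_comp g f}),
    ShO = mf_shift,
    ShM = (\<lambda>M N F. \<Union>f\<in>F. homotopic S (mf_shift M) (mf_shift N) `` {prod.swap f}) \<rparr>"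

definition cone_triangle :: "'a set \<Rightarrow> 'a::comm_ring_1 hmap \<Rightarrow> 'a hmap \<Rightarrow> 'a hmap
    \<Rightarrow> 'a hmap \<times> 'a hmap \<times> 'a hmap \<times> 'a hmap set \<times> 'a hmap set \<times> 'a hmap set" where
  "cone_triangle S M N f = (M, N, cone M N f,
    homotopic S M N `` {f},
    homotopic S N (cone M N f) `` {cone_incl M N},
    homotopic S (cone M N f) (mf_shift M) `` {cone_proj M N})"

definition MF_triangles :: "'a set \<Rightarrow> 'a::comm_ring_1
    \<Rightarrow> ('a hmap \<times> 'a hmap \<times> 'a hmap \<times> 'a hmap set \<times> 'a hmap set \<times> 'a hmap set) set" where
  "MF_triangles S w = {T. triangle_typed (MF_shift_cat S w) T \<and>
    (\<exists>M N f. is_MF S w M \<and> is_MF S w N \<and> f \<in> cocycles S M N \<and>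
      triangle_iso (MF_shift_cat S w) T (cone_triangle S M N f))}"


section \<open>Forms\<close>

text \<open>
  Transposes are taken without signs. A matrix factorization and its transpose are odd maps, and
  so is a (quadratic or symplectic) form, viewed as a map from \<open>M\<close> to its transpose.
\<close>

definition odd_transpose :: "'a hmap \<Rightarrow> 'a hmap" where
  "odd_transpose b = (transpose_mat (snd b), transpose_mat (fst b))"

definition mf_dual :: "'a::comm_ring_1 hmap \<Rightarrow> 'a hmap" where
  "mf_dual M = mf_shift (odd_transpose M)"

datatype form_type = Orthogonal | Symplectic

fun opposite :: "form_type \<Rightarrow> form_type" where
  "opposite Orthogonal = Symplectic"
| "opposite Symplectic = Orthogonal"

text \<open>
  A form is a strict isomorphism onto the dual (not just one up to homotopy). That \<open>b\<close> is a
  cocycle of maps from \<open>M\<close> to its dual says \<open>\<^sup>tQ b = - b Q\<close>.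
\<close>

definition is_form :: "'a set \<Rightarrow> form_type \<Rightarrow> 'a::comm_ring_1 hmap \<Rightarrow> 'a hmap \<Rightarrow> bool" where
  "is_form S \<epsilon> M b \<longleftrightarrow>
    b \<in> cocycles S M (mf_dual M) \<and>
    (\<exists>c\<in>cocycles S (mf_dual M) M. even_comp c b = mf_id M \<and> even_comp b c = mf_id (mf_dual M)) \<and>
    odd_transpose b = (case \<epsilon> of Orthogonal \<Rightarrow> - b | Symplectic \<Rightarrow> b)"

text \<open>
  The category of matrix factorizations with a form; all its structure is that of the underlying
  matrix factorizations. The form chosen on a shift is immaterial, since morphisms ignore forms.
\<close>

definition MF_form :: "'a set \<Rightarrow> form_type \<Rightarrow> 'a::comm_ring_1
    \<Rightarrow> ('a hmap \<times> 'a hmap, 'a hmap set) tri_cat" where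
  "MF_form S \<epsilon> w = (let C = MF_shift_cat S w; Ob = {(M, b). is_MF S w M \<and> is_form S \<epsilon> M b} in \<lparr>
    Obj = Ob,
    Mor = (\<lambda>X Y. Mor C (fst X) (fst Y)),
    Idt = (\<lambda>X. Idt C (fst X)),
    Cmp = (\<lambda>X Y Z. Cmp C (fst X) (fst Y) (fst Z)),
    ShO = (\<lambda>(M, b). (ShO C M, prod.swap b)),
    ShM = (\<lambda>X Y. ShM C (fst X) (fst Y)),
    Tri = {(X, Y, Z, f, g, h). X \<in> Ob \<and> Y \<in> Ob \<and> Z \<in> Ob \<and>
      (fst X, fst Y, fst Z, f, g, h) \<in> MF_triangles S w} \<rparr>)"


section \<open>Tensor products\<close>

definition kron :: "'a::comm_ring_1 mat \<Rightarrow> 'a mat \<Rightarrow> 'a mat" where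
  "kron A B = mat (dim_row A * dim_row B) (dim_col A * dim_col B)
    (\<lambda>(i, j). A $$ (i div dim_row B, j div dim_col B) * B $$ (i mod dim_row B, j mod dim_col B))"

definition block_diag :: "'a::comm_ring_1 mat \<Rightarrow> 'a mat \<Rightarrow> 'a mat" where
  "block_diag A B = four_block_mat A (0\<^sub>m (dim_row A) (dim_col B)) (0\<^sub>m (dim_row B) (dim_col A)) B"

definition block_anti :: "'a::comm_ring_1 mat \<Rightarrow> 'a mat \<Rightarrow> 'a mat" where
  "block_anti A B = four_block_mat (0\<^sub>m (dim_row B) (dim_col A)) B A (0\<^sub>m (dim_row A) (dim_col B))"

text \<open>
  The even part of \<open>M \<otimes> M'\<close> is \<open>M\<^sub>0 \<otimes> M'\<^sub>0 \<oplus> M\<^sub>1 \<otimes> M'\<^sub>1\<close>, the odd part is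
  \<open>M\<^sub>1 \<otimes> M'\<^sub>0 \<oplus> M\<^sub>0 \<otimes> M'\<^sub>1\<close>. The tensor product of homogeneous maps
  \<open>(f \<otimes> g)(m \<otimes> m') = (-1)\<^bsup>|g||m|\<^esup> f(m) \<otimes> g(m')\<close> is given by \<open>tensor_even\<close> for even \<open>g\<close> and by
  \<open>tensor_odd\<close> for odd \<open>g\<close>; with this order of the summands both are independent of the parity
  of \<open>f\<close>.
\<close>

definition tensor_even :: "'a::comm_ring_1 hmap \<Rightarrow> 'a hmap \<Rightarrow> 'a hmap" where
  "tensor_even f g =
    (block_diag (kron (fst f) (fst g)) (kron (snd f) (snd g)),
     block_diag (kron (snd f) (fst g)) (kron (fst f) (snd g)))"

definition tensor_odd :: "'a::comm_ring_1 hmap \<Rightarrow> 'a hmap \<Rightarrow> 'a hmap" where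
  "tensor_odd f g =
    (block_anti (kron (fst f) (fst g)) (- kron (snd f) (snd g)),
     block_anti (- kron (snd f) (fst g)) (kron (fst f) (snd g)))"

definition mf_tensor :: "'a::comm_ring_1 hmap \<Rightarrow> 'a hmap \<Rightarrow> 'a hmap" where
  "mf_tensor M M' = tensor_even M (mf_id M') + tensor_odd (mf_id M) M'"


section \<open>The Faltings--Knoerrer functor\<close>

definition rank_one :: "'a \<Rightarrow> 'a \<Rightarrow> 'a hmap" where
  "rank_one x y = (mat 1 1 (\<lambda>_. x), mat 1 1 (\<lambda>_. y))"

text \<open>The quadratic form on \<open>rank_one x y\<close>.\<close>

definition rank_one_form :: "'a::comm_ring_1 hmap" where
  "rank_one_form = (1\<^sub>m 1, - 1\<^sub>m 1)"

definition theta :: "'a::comm_ring_1 \<Rightarrow> 'a \<Rightarrow> 'a hmap \<Rightarrow> 'a hmap" where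
  "theta x y M = mf_tensor (snd M, - fst M) (rank_one x y)"

text \<open>
  A morphism \<open>(f\<^sub>0, f\<^sub>1)\<close> from \<open>(P, Q)\<close> to \<open>(P', Q')\<close> is the morphism \<open>(f\<^sub>1, f\<^sub>0)\<close> from
  \<open>(Q, -P)\<close> to \<open>(Q', -P')\<close>.
\<close>

definition theta_mor :: "'a::comm_ring_1 hmap \<Rightarrow> 'a hmap" where
  "theta_mor f = tensor_even (prod.swap f) (1\<^sub>m 1, 1\<^sub>m 1)"

text \<open>
  The action on forms (with values in twisted forms) and on twisted forms (with values in forms);
  a twisted form is an even isomorphism \<open>q : M \<rightarrow> M\<^sup>T\<close> with \<open>\<^sup>tq = \<plusminus>q\<close>. A twisted form \<open>(q\<^sub>0, q\<^sub>1)\<close>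
  on \<open>(P, Q)\<close> becomes the twisted form \<open>(q\<^sub>1, -q\<^sub>0)\<close> on \<open>(Q, -P)\<close>.
\<close>

definition theta_form :: "'a::comm_ring_1 hmap \<Rightarrow> 'a hmap" where
  "theta_form b = tensor_odd (prod.swap b) rank_one_form"

definition theta_twisted :: "'a::comm_ring_1 hmap \<Rightarrow> 'a hmap" where
  "theta_twisted q = tensor_odd (snd q, - fst q) rank_one_form"

text \<open>
  The iterate, first with \<open>x, y = X\<^sub>n, X\<^bsub>n+1\<^esub>\<close> and then with \<open>u, v = X\<^bsub>n+2\<^esub>, X\<^bsub>n+3\<^esub>\<close>, followed by
  the passage from the potential \<open>uv - (xy - \<pi>)\<close> to \<open>xy + uv - \<pi>\<close> by \<open>(\<phi>, \<psi>) \<mapsto> (\<phi>, -\<psi>)\<close> and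
  \<open>u \<mapsto> -u\<close>.
\<close>

definition theta_theta :: "nat \<Rightarrow> 'k::comm_ring_1 mpow hmap \<Rightarrow> 'k mpow hmap" where
  "theta_theta n M =
    (let N = theta (Var (n + 2)) (Var (n + 3)) (theta (Var n) (Var (n + 1)) M);
         s = map_mat (neg_var (n + 2))
     in (s (fst N), - s (snd N)))"

definition theta_theta_obj :: "nat \<Rightarrow> 'k::comm_ring_1 mpow hmap \<times> 'k mpow hmap
    \<Rightarrow> 'k mpow hmap \<times> 'k mpow hmap" where
  "theta_theta_obj n = (\<lambda>(M, b).
    (theta_theta n M,
     map_prod (map_mat (neg_var (n + 2))) (map_mat (neg_var (n + 2)))
       (theta_twisted (theta_form b))))"

definition theta_theta_mor :: "nat \<Rightarrow> 'k::comm_ring_1 mpow hmap \<times> 'k mpow hmap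
    \<Rightarrow> 'k mpow hmap \<times> 'k mpow hmap \<Rightarrow> 'k mpow hmap set \<Rightarrow> 'k mpow hmap set" where
  "theta_theta_mor n X Y F = (\<Union>f\<in>F.
    homotopic (power_series (n + 4)) (theta_theta n (fst X)) (theta_theta n (fst Y)) ``
      {map_prod (map_mat (neg_var (n + 2))) (map_mat (neg_var (n + 2)))
        (theta_mor (theta_mor f))})"

end

theory Submission
  imports Defs
begin

text \<open>
  The iterate \<open>\<theta>\<theta>\<close> is the composite of two Knoerrer functors with a change of sign of the
  potential in between. Writing a matrix factorization as an odd \<open>Q\<close> with \<open>Q\<^sup>2 = w\<close>, the Knoerrer
  functor sends \<open>Q\<close> to the block matrix with rows \<open>(Q, -y)\<close> and \<open>(x, -Q)\<close>, whose square is
  \<open>w - xy\<close>, and a morphism \<open>F\<close> to the block diagonal \<open>(F, F)\<close>. The proof has three parts.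
  
  Knoerrer periodicity. Over \<open>R[[x, y]]\<close> a cocycle, or a homotopy, between two values of the functor
  is determined up to a boundary by its upper left block at \<open>x = y = 0\<close>; this gives bijections on
  homotopy classes (\<open>kn_faithful\<close>, \<open>kn_full\<close>). Conversely let \<open>P\<^sup>2 = w - xy\<close> with \<open>P\<close> zero modulo the
  maximal ideal. The coefficients of \<open>x\<close> and of \<open>y\<close> in \<open>P\<close> satisfy the relations of a Clifford
  algebra modulo the maximal ideal, and the idempotent of that algebra lifts to one that commutes
  with \<open>Q = P(0, 0)\<close>. The restriction of \<open>-Q\<close> to its image is a matrix factorization of \<open>w\<close> whose
  image under the functor is isomorphic to \<open>P\<close> (\<open>kn_essentially_surjective\<close>). Every matrix
  factorization is homotopy equivalent to one that vanishes modulo the maximal ideal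
  (\<open>reduction\<close>), so this covers all of them.
  
  Forms. There are natural isomorphisms from the image of the dual to the dual of the image, and
  they are antisymmetric with respect to transposition (\<open>zouter_strict_iso\<close>, \<open>theta_theta_form_eq\<close>,
  \<open>theta_theta_form_transpose\<close>): this sign exchanges orthogonal and symplectic forms. As morphisms
  ignore forms, only essential surjectivity has to be reconsidered. A form on an object \<open>N\<close> is
  transported to the homotopy equivalent image of a reduced \<open>M\<close>, and by fullness it comes from a
  homotopy equivalence between \<open>M\<close> and its dual which is symmetric up to homotopy. Averaging with
  its transpose makes it symmetric, and between reduced objects a homotopy equivalence is a strict
  isomorphism (\<open>hequiv_reduced_strict_iso\<close>, \<open>strict_equiv_forms\<close>).
  
  Triangles. The functor commutes with cones and shifts up to strict isomorphisms that respect the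
  structure maps of the cone. Since a triangle is isomorphic to the cone of its own first map
  (\<open>tri_iff_own_cone\<close>), the functor preserves and reflects triangles (\<open>tri_mor\<close>).
  
  In order to make the block computations plain ring identities, graded maps between modules of
  all ranks are encoded in a single ring of matrices over an infinite index set.
\<close>


section \<open>Row- and column-finite matrices\<close>

text \<open>
  A basis vector is described by its parity (\<open>True\<close> for odd) and its position. The two finiteness
  conditions make the matrices a ring that is closed under transposition, although the index set
  is infinite.
\<close>

datatype gidx = Ix (gpar: bool) (gpos: nat)

typedef (overloaded) 'a gmat = "{F :: gidx \<Rightarrow> gidx \<Rightarrow> 'a::zero.
    (\<forall>j. finite {i. F i j \<noteq> 0}) \<and> (\<forall>i. finite {j. F i j \<noteq> 0})}"
  morphisms ent GMat
  by (rule exI[of _ "\<lambda>_ _. 0"]) simp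

lemma ent_eqI: "(\<And>i j. ent F i j = ent G i j) \<Longrightarrow> F = G"
  by (metis ent_inject ext)

lemma finite_col [simp]: "finite {i. ent F i j \<noteq> 0}"
  and finite_row [simp]: "finite {j. ent F i j \<noteq> 0}"
  using ent[of F] by simp_all

lemma ent_GMat:
  assumes "\<And>j. finite {i. F i j \<noteq> 0}" "\<And>i. finite {j. F i j \<noteq> 0}"
  shows "ent (GMat F) = F"
  using assms by (simp add: GMat_inverse)

instantiation gmat :: (comm_ring_1) ring_1
begin

definition zero_gmat where "0 = GMat (\<lambda>_ _. 0)"
definition one_gmat where "1 = GMat (\<lambda>i j. if i = j then 1 else 0)"
definition plus_gmat where "F + G = GMat (\<lambda>i j. ent F i j + ent G i j)"
definition minus_gmat where "F - G = GMat (\<lambda>i j. ent F i j - ent G i j)"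
definition uminus_gmat where "- F = GMat (\<lambda>i j. - ent F i j)"
definition times_gmat where
  "F * G = GMat (\<lambda>i j. \<Sum>k\<in>{k. ent G k j \<noteq> 0}. ent F i k * ent G k j)"

lemma ent_0 [simp]: "ent (0 :: 'a gmat) i j = 0"
  by (simp add: zero_gmat_def ent_GMat)

lemma ent_1: "ent (1 :: 'a gmat) i j = (if i = j then 1 else 0)"
proof -
  have "{j. (if i = j then 1 else 0 :: 'a) \<noteq> 0} = {i}" for i :: gidx by (auto split: if_splits)
  then show ?thesis by (simp add: one_gmat_def ent_GMat)
qed

lemma ent_add [simp]: "ent (F + G :: 'a gmat) i j = ent F i j + ent G i j"
proof -
  have "finite {i. ent F i j + ent G i j \<noteq> 0}" for j
    by (rule finite_subset[of _ "{i. ent F i j \<noteq> 0} \<union> {i. ent G i j \<noteq> 0}"]) auto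
  moreover have "finite {j. ent F i j + ent G i j \<noteq> 0}" for i
    by (rule finite_subset[of _ "{j. ent F i j \<noteq> 0} \<union> {j. ent G i j \<noteq> 0}"]) auto
  ultimately show ?thesis by (simp add: plus_gmat_def ent_GMat)
qed

lemma ent_minus [simp]: "ent (- F :: 'a gmat) i j = - ent F i j"
  by (simp add: uminus_gmat_def ent_GMat)

lemma ent_diff [simp]: "ent (F - G :: 'a gmat) i j = ent F i j - ent G i j"
proof -
  have "finite {i. ent F i j - ent G i j \<noteq> 0}" for j
    by (rule finite_subset[of _ "{i. ent F i j \<noteq> 0} \<union> {i. ent G i j \<noteq> 0}"]) auto
  moreover have "finite {j. ent F i j - ent G i j \<noteq> 0}" for i
    by (rule finite_subset[of _ "{j. ent F i j \<noteq> 0} \<union> {j. ent G i j \<noteq> 0}"]) auto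
  ultimately show ?thesis by (simp only: minus_gmat_def ent_GMat)
qed

lemma ent_times_col:
  "ent (F * G :: 'a gmat) i j = (\<Sum>k\<in>{k. ent G k j \<noteq> 0}. ent F i k * ent G k j)"
proof -
  let ?h = "\<lambda>i j. \<Sum>k\<in>{k. ent G k j \<noteq> 0}. ent F i k * ent G k j"
  have "{i. ?h i j \<noteq> 0} \<subseteq> (\<Union>k\<in>{k. ent G k j \<noteq> 0}. {i. ent F i k \<noteq> 0})" for j
  proof
    fix i assume "i \<in> {i. ?h i j \<noteq> 0}"
    then have "?h i j \<noteq> 0" by blast
    then obtain k where "k \<in> {k. ent G k j \<noteq> 0}" "ent F i k * ent G k j \<noteq> 0"
      by (rule sum.not_neutral_contains_not_neutral)
    then have "ent G k j \<noteq> 0" "ent F i k \<noteq> 0" by auto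
    then show "i \<in> (\<Union>k\<in>{k. ent G k j \<noteq> 0}. {i. ent F i k \<noteq> 0})" by blast
  qed
  then have 1: "finite {i. ?h i j \<noteq> 0}" for j by (rule finite_subset) simp
  have "{j. ?h i j \<noteq> 0} \<subseteq> (\<Union>k\<in>{k. ent F i k \<noteq> 0}. {j. ent G k j \<noteq> 0})" for i
  proof
    fix j assume "j \<in> {j. ?h i j \<noteq> 0}"
    then have "?h i j \<noteq> 0" by blast
    then obtain k where "k \<in> {k. ent G k j \<noteq> 0}" "ent F i k * ent G k j \<noteq> 0"
      by (rule sum.not_neutral_contains_not_neutral)
    then have "ent G k j \<noteq> 0" "ent F i k \<noteq> 0" by auto
    then show "j \<in> (\<Union>k\<in>{k. ent F i k \<noteq> 0}. {j. ent G k j \<noteq> 0})" by blast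
  qed
  then have 2: "finite {j. ?h i j \<noteq> 0}" for i by (rule finite_subset) simp
  show ?thesis using ent_GMat[of ?h, OF 1 2] by (simp only: times_gmat_def)
qed

lemma ent_times:
  assumes "finite K" "\<And>k. k \<notin> K \<Longrightarrow> ent F i k * ent G k j = 0"
  shows "ent (F * G :: 'a gmat) i j = (\<Sum>k\<in>K. ent F i k * ent G k j)"
proof -
  let ?L = "{k. ent G k j \<noteq> 0}"
  have "(\<Sum>k\<in>?L. ent F i k * ent G k j) = (\<Sum>k\<in>?L \<union> K. ent F i k * ent G k j)"
    by (rule sum.mono_neutral_left) (use assms in auto)
  also have "\<dots> = (\<Sum>k\<in>K. ent F i k * ent G k j)"
    by (rule sum.mono_neutral_right) (use assms in auto)
  finally show ?thesis by (simp add: ent_times_col)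
qed

lemma ent_times_single:
  assumes "\<And>k. k \<noteq> l \<Longrightarrow> ent F i k * ent G k j = 0"
  shows "ent (F * G :: 'a gmat) i j = ent F i l * ent G l j"
  using ent_times[of "{l}" F i G j] assms by simp

instance
proof
  fix F G H :: "'a gmat"
  show "F * G * H = F * (G * H)"
  proof (rule ent_eqI)
    fix i l
    let ?K = "{k. ent H k l \<noteq> 0}"
    let ?J = "\<Union>k\<in>?K. {j. ent G j k \<noteq> 0}"
    have "finite ?J" by simp
    have FG: "ent (F * G) i k = (\<Sum>j\<in>?J. ent F i j * ent G j k)" if "k \<in> ?K" for k
    proof (rule ent_times[OF \<open>finite ?J\<close>])
      fix j assume "j \<notin> ?J"
      with that have "ent G j k = 0" by blast
      then show "ent F i j * ent G j k = 0" by simp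
    qed
    have "ent (F * G * H) i l = (\<Sum>k\<in>?K. ent (F * G) i k * ent H k l)"
      by (rule ent_times_col)
    also have "\<dots> = (\<Sum>k\<in>?K. \<Sum>j\<in>?J. ent F i j * (ent G j k * ent H k l))"
      by (rule sum.cong[OF refl]) (simp only: FG sum_distrib_right mult.assoc)
    also have "\<dots> = (\<Sum>j\<in>?J. \<Sum>k\<in>?K. ent F i j * (ent G j k * ent H k l))"
      by (rule sum.swap)
    also have "\<dots> = (\<Sum>j\<in>?J. ent F i j * (\<Sum>k\<in>?K. ent G j k * ent H k l))"
      by (simp only: sum_distrib_left)
    also have "\<dots> = (\<Sum>j\<in>?J. ent F i j * ent (G * H) j l)"
      by (simp only: ent_times_col)
    also have "\<dots> = ent (F * (G * H)) i l"
    proof (rule ent_times[symmetric])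
      fix j assume "j \<notin> ?J"
      then have "ent G j k = 0" if "k \<in> ?K" for k using that by blast
      then have "(\<Sum>k\<in>?K. ent G j k * ent H k l) = 0" by (intro sum.neutral) simp
      then show "ent F i j * ent (G * H) j l = 0" by (simp only: ent_times_col mult_zero_right)
    qed simp
    finally show "ent (F * G * H) i l = ent (F * (G * H)) i l" .
  qed
  show "1 * F = F"
  proof (rule ent_eqI)
    fix i j show "ent (1 * F) i j = ent F i j"
      by (subst ent_times_single[of i]) (simp_all add: ent_1)
  qed
  show "F * 1 = F"
  proof (rule ent_eqI)
    fix i j show "ent (F * 1) i j = ent F i j"
      by (subst ent_times_single[of j]) (simp_all add: ent_1)
  qed
  show "(F + G) * H = F * H + G * H"
    by (rule ent_eqI) (simp add: ent_times_col distrib_right sum.distrib)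
  show "F * (G + H) = F * G + F * H"
  proof (rule ent_eqI)
    fix i j
    let ?K = "{k. ent G k j \<noteq> 0} \<union> {k. ent H k j \<noteq> 0}"
    have K: "finite ?K" by simp
    have "ent (F * G) i j = (\<Sum>k\<in>?K. ent F i k * ent G k j)"
      "ent (F * H) i j = (\<Sum>k\<in>?K. ent F i k * ent H k j)"
      "ent (F * (G + H)) i j = (\<Sum>k\<in>?K. ent F i k * ent (G + H) k j)"
      by (rule ent_times[OF K], simp)+
    then show "ent (F * (G + H)) i j = ent (F * G + F * H) i j"
      by (simp only: ent_add distrib_left sum.distrib)
  qed
  show "(0 :: 'a gmat) \<noteq> 1"
  proof
    assume "(0 :: 'a gmat) = 1"
    then have "ent (0 :: 'a gmat) (Ix True 0) (Ix True 0) = ent 1 (Ix True 0) (Ix True 0)" by simp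
    then show False by (simp add: ent_1)
  qed
  show "F + G + H = F + (G + H)" "F + G = G + F" "0 + F = F" "- F + F = 0" "F - G = F + - G"
    by (rule ent_eqI, simp add: add.assoc add.commute)+
qed

end

definition sc :: "'a \<Rightarrow> 'a::comm_ring_1 gmat" where
  "sc c = GMat (\<lambda>i j. if i = j then c else 0)"

lemma ent_sc: "ent (sc c) i j = (if i = j then c else 0)"
proof -
  have "finite {j. (if i = j then c else 0 :: 'a) \<noteq> 0}" for i :: gidx
    by (rule finite_subset[of _ "{i}"]) (auto split: if_splits)
  then show ?thesis by (simp add: sc_def ent_GMat)
qed

lemma ent_sc_mult [simp]: "ent (sc c * F) i j = c * ent F i j"
  by (subst ent_times_single[of i]) (auto simp: ent_sc)

lemma sc_central: "F * sc c = sc c * F"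
proof (rule ent_eqI)
  fix i j show "ent (F * sc c) i j = ent (sc c * F) i j"
    by (subst ent_times_single[of j]) (simp_all add: ent_sc mult.commute)
qed

lemma sc_left_commute: "F * (sc c * G) = sc c * (F * G)"
  by (metis mult.assoc sc_central)

lemma sc_add: "sc (a + b) = sc a + sc b"
  and sc_diff: "sc (a - b) = sc a - sc b"
  and sc_minus: "sc (- a) = - sc a"
  and sc_0 [simp]: "sc 0 = 0"
  and sc_1 [simp]: "sc 1 = 1"
  and sc_mult: "sc (a * b) = sc a * sc b"
  by (rule ent_eqI, simp add: ent_sc ent_1)+

definition tr :: "'a::comm_ring_1 gmat \<Rightarrow> 'a gmat" where
  "tr F = GMat (\<lambda>i j. ent F j i)"

lemma ent_tr [simp]: "ent (tr F) i j = ent F j i"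
  by (simp add: tr_def ent_GMat)

lemma tr_tr [simp]: "tr (tr F) = F"
  and tr_add [simp]: "tr (F + G) = tr F + tr G"
  and tr_diff [simp]: "tr (F - G) = tr F - tr G"
  and tr_minus [simp]: "tr (- F) = - tr F"
  and tr_0 [simp]: "tr 0 = 0"
  and tr_1 [simp]: "tr 1 = 1"
  and tr_sc [simp]: "tr (sc c) = sc c"
  by (rule ent_eqI, simp add: ent_1 ent_sc)+

lemma tr_mult [simp]: "tr (F * G) = tr G * tr F"
proof (rule ent_eqI)
  fix i j
  have "ent (tr G * tr F) i j = (\<Sum>k\<in>{k. ent G k i \<noteq> 0}. ent (tr G) i k * ent (tr F) k j)"
    by (rule ent_times) auto
  then show "ent (tr (F * G)) i j = ent (tr G * tr F) i j"
    by (simp add: ent_times_col mult.commute)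
qed

text \<open>
  All structural maps below (identities, inclusions, projections, the change of parity) are given
  by partially defined injections of the index set.
\<close>

definition pinj :: "(gidx \<Rightarrow> gidx) \<Rightarrow> gidx set \<Rightarrow> 'a::comm_ring_1 gmat" where
  "pinj f A = GMat (\<lambda>i j. if j \<in> A \<and> i = f j then 1 else 0)"

lemma ent_pinj:
  assumes "inj_on f A"
  shows "ent (pinj f A) i j = (if j \<in> A \<and> i = f j then 1 else 0)"
proof -
  have "finite {i. (if j \<in> A \<and> i = f j then 1 else 0 :: 'a) \<noteq> 0}" for j by simp
  moreover have "finite {j. (if j \<in> A \<and> i = f j then 1 else 0 :: 'a) \<noteq> 0}" for i
  proof (cases "i \<in> f ` A")
    case True
    then obtain j where "j \<in> A" "i = f j" by auto
    with assms have "{j. (if j \<in> A \<and> i = f j then 1 else 0 :: 'a) \<noteq> 0} \<subseteq> {j}"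
      by (auto dest: inj_onD)
    then show ?thesis using finite_subset by blast
  next
    case False
    then have "{j. (if j \<in> A \<and> i = f j then 1 else 0 :: 'a) \<noteq> 0} = {}" by auto
    then show ?thesis by simp
  qed
  ultimately show ?thesis by (simp add: pinj_def ent_GMat)
qed

lemma ent_mult_pinj:
  assumes "inj_on f A"
  shows "ent (F * pinj f A) i j = (if j \<in> A then ent F i (f j) else 0)"
  by (subst ent_times_single[of "f j"]) (use assms in \<open>auto simp: ent_pinj\<close>)

lemma ent_tr_pinj_mult:
  assumes "inj_on f A"
  shows "ent (tr (pinj f A) * F) i j = (if i \<in> A then ent F (f i) j else 0)"
  by (subst ent_times_single[of "f i"]) (use assms in \<open>auto simp: ent_pinj\<close>)


section \<open>Graded maps between finite free modules\<close>

definition rkof :: "nat \<times> nat \<Rightarrow> bool \<Rightarrow> nat" where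
  "rkof X b = (if b then snd X else fst X)"

definition idx :: "nat \<times> nat \<Rightarrow> gidx set" where
  "idx X = {i. gpos i < rkof X (gpar i)}"

lemma mem_idx [simp]: "Ix b i \<in> idx X \<longleftrightarrow> i < rkof X b"
  by (simp add: idx_def)

lemma finite_idx [simp]: "finite (idx X)"
proof -
  have "idx X \<subseteq> Ix False ` {..<fst X} \<union> Ix True ` {..<snd X}"
    proof
      fix i assume "i \<in> idx X" then show "i \<in> Ix False ` {..<fst X} \<union> Ix True ` {..<snd X}"
        by (cases i) (auto simp: rkof_def split: if_splits)
    qed
  then show ?thesis by (rule finite_subset) auto
qed

text \<open>
  Maps of parity \<open>p\<close> from the free module of graded rank \<open>X\<close> to that of graded rank \<open>Y\<close>, with
  entries in \<open>S\<close>, extended by zero.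
\<close>

definition hm :: "'a set \<Rightarrow> bool \<Rightarrow> nat \<times> nat \<Rightarrow> nat \<times> nat \<Rightarrow> 'a::comm_ring_1 gmat set" where
  "hm S p X Y = {F. \<forall>i j. ent F i j \<in> S \<and>
    (ent F i j \<noteq> 0 \<longrightarrow> i \<in> idx Y \<and> j \<in> idx X \<and> gpar i = (gpar j \<noteq> p))}"

definition idm :: "nat \<times> nat \<Rightarrow> 'a::comm_ring_1 gmat" where
  "idm X = pinj id (idx X)"

lemma hmI:
  assumes "\<And>i j. ent F i j \<in> S"
    and "\<And>i j. ent F i j \<noteq> 0 \<Longrightarrow> i \<in> idx Y \<and> j \<in> idx X \<and> gpar i = (gpar j \<noteq> p)"
  shows "F \<in> hm S p X Y"
  using assms by (auto simp: hm_def)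

lemma hm_entD:
  assumes "F \<in> hm S p X Y"
  shows "ent F i j \<in> S" "ent F i j \<noteq> 0 \<Longrightarrow> i \<in> idx Y" "ent F i j \<noteq> 0 \<Longrightarrow> j \<in> idx X"
    "ent F i j \<noteq> 0 \<Longrightarrow> gpar i = (gpar j \<noteq> p)"
  using assms by (auto simp: hm_def)

lemma hm_zero:
  "F \<in> hm S p X Y \<Longrightarrow> \<not> (i \<in> idx Y \<and> j \<in> idx X \<and> gpar i = (gpar j \<noteq> p)) \<Longrightarrow> ent F i j = 0"
  unfolding hm_def by blast

lemma hmI_zero:
  assumes "\<And>i j. ent F i j \<in> S"
    and "\<And>i j. \<not> (i \<in> idx Y \<and> j \<in> idx X \<and> gpar i = (gpar j \<noteq> p)) \<Longrightarrow> ent F i j = 0"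
  shows "F \<in> hm S p X Y"
  using assms unfolding hm_def by blast

lemma hm_mono: "F \<in> hm S p X Y \<Longrightarrow> S \<subseteq> S' \<Longrightarrow> F \<in> hm S' p X Y"
  by (auto simp: hm_def)

lemma ent_idm: "ent (idm X) i j = (if j \<in> idx X \<and> i = j then 1 else 0)"
  by (simp add: idm_def ent_pinj)

lemma hm_idm_right: "F \<in> hm S p X Y \<Longrightarrow> F * idm X = F"
  by (rule ent_eqI) (auto simp: idm_def ent_mult_pinj dest: hm_entD(3))

lemma tr_idm [simp]: "tr (idm X) = idm X"
  by (rule ent_eqI) (auto simp: ent_idm)

lemma hm_tr: "F \<in> hm S p X Y \<Longrightarrow> tr F \<in> hm S p Y X"
  by (auto simp: hm_def)

lemma hm_idm_left: "F \<in> hm S p X Y \<Longrightarrow> idm Y * F = F"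
  by (metis hm_tr hm_idm_right tr_idm tr_mult tr_tr)

text \<open>
  The set of admissible entries is not required to be a ring here, because these rules are also
  applied to the powers of the maximal ideal.
\<close>

lemma hm_add:
  "F \<in> hm S p X Y \<Longrightarrow> G \<in> hm S p X Y \<Longrightarrow> (\<And>a b. a \<in> S \<Longrightarrow> b \<in> S \<Longrightarrow> a + b \<in> S) \<Longrightarrow>
    F + G \<in> hm S p X Y"
  by (rule hmI_zero) (auto simp: hm_entD(1) hm_zero)

lemma hm_diff:
  "F \<in> hm S p X Y \<Longrightarrow> G \<in> hm S p X Y \<Longrightarrow> (\<And>a b. a \<in> S \<Longrightarrow> b \<in> S \<Longrightarrow> a - b \<in> S) \<Longrightarrow>
    F - G \<in> hm S p X Y"
  by (rule hmI_zero) (auto simp: hm_entD(1) hm_zero)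

lemma hm_minus: "F \<in> hm S p X Y \<Longrightarrow> (\<And>a. a \<in> S \<Longrightarrow> - a \<in> S) \<Longrightarrow> - F \<in> hm S p X Y"
  by (auto simp: hm_def)

lemma hm_mult:
  assumes G: "G \<in> hm A p Y Z" and F: "F \<in> hm B q X Y"
    and mult: "\<And>a b. a \<in> A \<Longrightarrow> b \<in> B \<Longrightarrow> a * b \<in> C"
    and add: "\<And>a b. a \<in> C \<Longrightarrow> b \<in> C \<Longrightarrow> a + b \<in> C" and zero: "0 \<in> C"
  shows "G * F \<in> hm C (p \<noteq> q) X Z"
proof (rule hmI)
  fix i j
  have sumC: "sum f K \<in> C" if "finite K" "\<And>k. k \<in> K \<Longrightarrow> f k \<in> C" for f and K :: "gidx set"
    using that by (induction K rule: finite_induct) (auto simp: zero add)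
  show "ent (G * F) i j \<in> C"
    unfolding ent_times_col using hm_entD(1)[OF G] hm_entD(1)[OF F] by (intro sumC) (auto intro: mult)
  assume "ent (G * F) i j \<noteq> 0"
  then obtain k where "ent G i k * ent F k j \<noteq> 0"
    unfolding ent_times_col by (meson sum.neutral)
  then have "ent G i k \<noteq> 0" "ent F k j \<noteq> 0" by auto
  then show "i \<in> idx Z \<and> j \<in> idx X \<and> gpar i = (gpar j \<noteq> (p \<noteq> q))"
    using hm_entD(2-4)[OF G, of i k] hm_entD(2-4)[OF F, of k j] by auto
qed

locale subring =
  fixes S :: "'a::comm_ring_1 set"
  assumes one [simp]: "1 \<in> S" and diff [simp]: "a \<in> S \<Longrightarrow> b \<in> S \<Longrightarrow> a - b \<in> S"
    and mult [simp]: "a \<in> S \<Longrightarrow> b \<in> S \<Longrightarrow> a * b \<in> S"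
begin

lemma zero [simp]: "0 \<in> S"
  using diff[of 1 1] by simp

lemma minus [simp]: "a \<in> S \<Longrightarrow> - a \<in> S"
  using diff[of 0 a] by simp

lemma add [simp]: "a \<in> S \<Longrightarrow> b \<in> S \<Longrightarrow> a + b \<in> S"
  using diff[of a "- b"] by simp

lemma h0: "0 \<in> hm S p X Y"
  by (rule hmI) auto

lemma hid: "idm X \<in> hm S False X X"
  by (rule hmI) (auto simp: ent_idm split: if_splits)

lemma hadd: "F \<in> hm S p X Y \<Longrightarrow> G \<in> hm S p X Y \<Longrightarrow> F + G \<in> hm S p X Y"
  by (rule hm_add) auto

lemma hdiff: "F \<in> hm S p X Y \<Longrightarrow> G \<in> hm S p X Y \<Longrightarrow> F - G \<in> hm S p X Y"
  by (rule hm_diff) auto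

lemma hminus: "F \<in> hm S p X Y \<Longrightarrow> - F \<in> hm S p X Y"
  by (rule hm_minus) auto

lemma hmul: "G \<in> hm S p Y Z \<Longrightarrow> F \<in> hm S q X Y \<Longrightarrow> r = (p \<noteq> q) \<Longrightarrow> G * F \<in> hm S r X Z"
  using hm_mult[of G S p Y Z F S q X S] by simp

lemma hsc: "c \<in> S \<Longrightarrow> F \<in> hm S p X Y \<Longrightarrow> sc c * F \<in> hm S p X Y"
  by (rule hmI_zero) (auto simp: hm_entD(1) hm_zero)

lemmas hm_intros = h0 hid hadd hdiff hminus hmul hsc

end


subsection \<open>The sum of a shifted module and a module\<close>

text \<open>
  \<open>X[1] \<oplus> Y\<close>, with the inclusions \<open>in1\<close>, \<open>in2\<close> and the projections \<open>pr1\<close>, \<open>pr2\<close>. Both cones and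
  the Knoerrer functor have this shape. The maps \<open>in1\<close> and \<open>pr1\<close> are odd.
\<close>

definition sumr :: "nat \<times> nat \<Rightarrow> nat \<times> nat \<Rightarrow> nat \<times> nat" where
  "sumr X Y = (snd X + fst Y, fst X + snd Y)"

lemma rkof_sumr [simp]: "rkof (sumr X Y) b = rkof X (\<not> b) + rkof Y b"
  by (simp add: sumr_def rkof_def)

definition flip :: "gidx \<Rightarrow> gidx" where "flip i = Ix (\<not> gpar i) (gpos i)"

lemma flip_Ix [simp]: "flip (Ix b i) = Ix (\<not> b) i"
  by (simp add: flip_def)

lemma flip_flip [simp]: "flip (flip i) = i"
  by (simp add: flip_def)

lemma inj_flip [simp]: "inj_on flip A"
  by (rule inj_onI) (auto simp: flip_def gidx.expand)

definition in1 :: "nat \<times> nat \<Rightarrow> 'a::comm_ring_1 gmat" where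
  "in1 X = pinj flip (idx X)"

definition offset :: "nat \<times> nat \<Rightarrow> gidx \<Rightarrow> gidx" where
  "offset X i = Ix (gpar i) (gpos i + rkof X (\<not> gpar i))"

lemma offset_Ix [simp]: "offset X (Ix b i) = Ix b (i + rkof X (\<not> b))"
  by (simp add: offset_def)

lemma inj_offset [simp]: "inj_on (offset X) A"
  by (rule inj_onI) (auto simp: offset_def gidx.expand)

definition in2 :: "nat \<times> nat \<Rightarrow> nat \<times> nat \<Rightarrow> 'a::comm_ring_1 gmat" where
  "in2 X Y = pinj (offset X) (idx Y)"

definition pr1 :: "nat \<times> nat \<Rightarrow> 'a::comm_ring_1 gmat" where
  "pr1 X = tr (in1 X)"

definition pr2 :: "nat \<times> nat \<Rightarrow> nat \<times> nat \<Rightarrow> 'a::comm_ring_1 gmat" where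
  "pr2 X Y = tr (in2 X Y)"

lemma tr_in1 [simp]: "tr (in1 X) = pr1 X" and tr_in2 [simp]: "tr (in2 X Y) = pr2 X Y"
  and tr_pr1 [simp]: "tr (pr1 X) = in1 X" and tr_pr2 [simp]: "tr (pr2 X Y) = in2 X Y"
  by (simp_all add: pr1_def pr2_def)

lemma ent_in1: "ent (in1 X) i j = (if j \<in> idx X \<and> i = flip j then 1 else 0)"
  by (simp add: in1_def ent_pinj)

lemma ent_in2: "ent (in2 X Y) i j = (if j \<in> idx Y \<and> i = offset X j then 1 else 0)"
  by (simp add: in2_def ent_pinj)

lemma ent_pr1: "ent (pr1 X) i j = (if i \<in> idx X \<and> j = flip i then 1 else 0)"
  by (simp only: pr1_def ent_tr ent_in1)

lemma ent_pr2: "ent (pr2 X Y) i j = (if i \<in> idx Y \<and> j = offset X i then 1 else 0)"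
  by (simp only: pr2_def ent_tr ent_in2)

lemma pr1_in1: "pr1 X * in1 X = (idm X :: 'a::comm_ring_1 gmat)"
  by (rule ent_eqI, unfold pr1_def, subst in1_def)
    (auto simp: ent_tr_pinj_mult ent_in1 ent_idm inj_onD[OF inj_flip])

lemma pr2_in2: "pr2 X Y * in2 X Y = (idm Y :: 'a::comm_ring_1 gmat)"
  by (rule ent_eqI, unfold pr2_def, subst in2_def)
    (auto simp: ent_tr_pinj_mult ent_in2 ent_idm inj_onD[OF inj_offset])

lemma pr1_in2: "pr1 X * in2 X Y = (0 :: 'a::comm_ring_1 gmat)"
  by (rule ent_eqI, unfold pr1_def, subst in1_def)
    (auto simp: ent_tr_pinj_mult ent_in2 ent_idm idx_def flip_def offset_def)

lemma pr2_in1: "pr2 X Y * in1 X = (0 :: 'a::comm_ring_1 gmat)"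
  using arg_cong[OF pr1_in2[of X Y, where ?'a = 'a], of tr] by simp

lemma ent_in1_mult: "ent (in1 X * F) i j = (if flip i \<in> idx X then ent F (flip i) j else 0)"
proof -
  have "ent (in1 X * F) i j = ent (in1 X) i (flip i) * ent F (flip i) j"
    by (rule ent_times_single) (auto simp: ent_in1)
  also have "ent (in1 X) i (flip i) = (if flip i \<in> idx X then 1 else 0)"
    by (simp add: ent_in1)
  finally show ?thesis by simp
qed

lemma ent_in2_mult:
  "ent (in2 X Y * F) i j = (let k = Ix (gpar i) (gpos i - rkof X (\<not> gpar i))
    in if k \<in> idx Y \<and> i = offset X k then ent F k j else 0)"
proof -
  let ?k = "Ix (gpar i) (gpos i - rkof X (\<not> gpar i))"
  have "ent (in2 X Y * F) i j = ent (in2 X Y) i ?k * ent F ?k j"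
  proof (rule ent_times_single)
    fix k assume "k \<noteq> ?k"
    then have "i \<noteq> offset X k" by (cases k) auto
    then show "ent (in2 X Y) i k * ent F k j = 0" by (simp add: ent_in2)
  qed
  also have "ent (in2 X Y) i ?k = (if ?k \<in> idx Y \<and> i = offset X ?k then 1 else 0)"
    by (rule ent_in2)
  finally show ?thesis by (simp add: Let_def)
qed

lemma in_pr: "in1 X * pr1 X + in2 X Y * pr2 X Y = (idm (sumr X Y) :: 'a::comm_ring_1 gmat)"
proof (rule ent_eqI)
  fix i j :: gidx
  obtain b k where i: "i = Ix b k" by (cases i)
  obtain c l where j: "j = Ix c l" by (cases j)
  have "ent (in1 X * pr1 X) i j = (if i = j \<and> k < rkof X (\<not> b) then 1 else 0 :: 'a)"
    by (auto simp: ent_in1_mult ent_pr1 i j)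
  moreover have "ent (in2 X Y * pr2 X Y) i j =
      (if i = j \<and> \<not> k < rkof X (\<not> b) \<and> k < rkof X (\<not> b) + rkof Y b then 1 else 0 :: 'a)"
    by (auto simp: ent_in2_mult ent_pr2 i j)
  ultimately show "ent (in1 X * pr1 X + in2 X Y * pr2 X Y) i j = ent (idm (sumr X Y) :: 'a gmat) i j"
    by (auto simp: ent_idm i j)
qed

context subring begin

lemma hin1: "in1 X \<in> hm S True X (sumr X Y)"
  by (rule hmI) (auto simp: ent_in1 flip_def idx_def split: if_splits)

lemma hin2: "in2 X Y \<in> hm S False Y (sumr X Y)"
  by (rule hmI) (auto simp: ent_in2 offset_def idx_def split: if_splits)

lemma hpr1: "pr1 X \<in> hm S True (sumr X Y) X"
  using hm_tr[OF hin1] by simp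

lemma hpr2: "pr2 X Y \<in> hm S False (sumr X Y) Y"
  using hm_tr[OF hin2] by simp

end

lemma subring_UNIV: "subring UNIV"
  by standard auto


section \<open>Completeness of power series\<close>

lemma mcoeff_0 [simp]: "mcoeff 0 m = 0"
  and mcoeff_1: "mcoeff 1 m = (if m = {#} then 1 else 0)"
  and mcoeff_add [simp]: "mcoeff (f + g) m = mcoeff f m + mcoeff g m"
  and mcoeff_diff [simp]: "mcoeff (f - g) m = mcoeff f m - mcoeff g m"
  and mcoeff_minus [simp]: "mcoeff (- f) m = - mcoeff f m"
  by (simp_all add: zero_mpow_def one_mpow_def plus_mpow_def minus_mpow_def uminus_mpow_def)

lemma mcoeff_mult: "mcoeff (f * g) m = (\<Sum>a\<in>{a. a \<subseteq># m}. mcoeff f a * mcoeff g (m - a))"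
  by (simp add: times_mpow_def)

lemma mcoeff_const_mult: "mcoeff (f * g) {#} = mcoeff f {#} * mcoeff g {#}"
  by (simp add: mcoeff_mult)

text \<open>
  The \<open>k\<close>-th power of the maximal ideal, if there are finitely many variables.
\<close>

definition deg_ge :: "nat \<Rightarrow> 'a::comm_ring_1 mpow set" where
  "deg_ge k = {f. \<forall>m. size m < k \<longrightarrow> mcoeff f m = 0}"

lemma deg_ge_0 [simp]: "deg_ge 0 = UNIV"
  by (simp add: deg_ge_def)

lemma deg_ge_1: "f \<in> deg_ge (Suc 0) \<longleftrightarrow> mcoeff f {#} = 0"
  by (auto simp: deg_ge_def)

lemma deg_ge_mono: "k \<le> l \<Longrightarrow> deg_ge l \<subseteq> deg_ge k"
  by (auto simp: deg_ge_def)

lemma deg_ge_mult: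
  assumes "f \<in> deg_ge k" "g \<in> deg_ge l"
  shows "f * g \<in> deg_ge (k + l)"
proof -
  have "mcoeff f a * mcoeff g (m - a) = 0" if "size m < k + l" "a \<subseteq># m" for a m
  proof (cases "size a < k")
    case False
    then have "size (m - a) < l" using that size_mset_mono[of a m] by (simp add: size_Diff_submset)
    then show ?thesis using assms by (simp add: deg_ge_def)
  qed (use assms in \<open>simp add: deg_ge_def\<close>)
  then show ?thesis by (auto simp: deg_ge_def mcoeff_mult intro!: sum.neutral)
qed

lemma zero_deg_ge [simp]: "0 \<in> deg_ge k"
  and deg_ge_add: "f \<in> deg_ge k \<Longrightarrow> g \<in> deg_ge k \<Longrightarrow> f + g \<in> deg_ge k"
  and deg_ge_diff: "f \<in> deg_ge k \<Longrightarrow> g \<in> deg_ge k \<Longrightarrow> f - g \<in> deg_ge k"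
  by (auto simp: deg_ge_def)

lemma hm_deg_mono: "F \<in> hm (deg_ge l) p X Y \<Longrightarrow> k \<le> l \<Longrightarrow> F \<in> hm (deg_ge k) p X Y"
  using hm_mono deg_ge_mono by blast

lemma hm_deg0: "F \<in> hm S p X Y \<Longrightarrow> F \<in> hm (deg_ge 0) p X Y"
  using hm_mono[of F S p X Y UNIV] by simp

lemma hm_deg_add: "F \<in> hm (deg_ge k) p X Y \<Longrightarrow> G \<in> hm (deg_ge k) p X Y \<Longrightarrow> F + G \<in> hm (deg_ge k) p X Y"
  by (rule hm_add) (auto intro: deg_ge_add)

lemma hm_deg_diff: "F \<in> hm (deg_ge k) p X Y \<Longrightarrow> G \<in> hm (deg_ge k) p X Y \<Longrightarrow> F - G \<in> hm (deg_ge k) p X Y"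
  by (rule hm_diff) (auto intro: deg_ge_diff)

lemma hm_deg_mult:
  "G \<in> hm (deg_ge k) p Y Z \<Longrightarrow> F \<in> hm (deg_ge l) q X Y \<Longrightarrow> r = (p \<noteq> q) \<Longrightarrow> n \<le> k + l \<Longrightarrow>
    G * F \<in> hm (deg_ge n) r X Z"
  using hm_mult[of G "deg_ge k" p Y Z F "deg_ge l" q X "deg_ge (k + l)"]
  by (auto intro: deg_ge_mult deg_ge_add hm_deg_mono)

lemma hm_deg_eq_0:
  assumes "\<And>k. F \<in> hm (deg_ge (Suc k)) p X Y"
  shows "F = 0"
proof (rule ent_eqI, rule mpow_eqI)
  fix i j and m :: "nat multiset"
  have "ent F i j \<in> deg_ge (Suc (size m))" using hm_entD(1)[OF assms] .
  then show "mcoeff (ent F i j) m = mcoeff (ent 0 i j) m" by (simp add: deg_ge_def)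
qed

definition series_in :: "nat set \<Rightarrow> 'a::comm_ring_1 mpow set" where
  "series_in V = {f. \<forall>m. mcoeff f m \<noteq> 0 \<longrightarrow> set_mset m \<subseteq> V}"

lemma power_series_eq: "power_series n = series_in {..<n}"
  by (simp add: power_series_def series_in_def)

lemma series_in_mono: "V \<subseteq> W \<Longrightarrow> series_in V \<subseteq> series_in W"
  by (auto simp: series_in_def)

lemma subring_series_in: "subring (series_in V :: 'a::comm_ring_1 mpow set)"
proof
  show "1 \<in> (series_in V :: 'a mpow set)" by (simp add: series_in_def mcoeff_1)
  fix f g :: "'a mpow" assume fg: "f \<in> series_in V" "g \<in> series_in V"
  show "f - g \<in> series_in V" using fg by (auto simp: series_in_def) (metis diff_self subsetD)
  show "f * g \<in> series_in V"
  proof (unfold series_in_def, intro CollectI allI impI)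
    fix m assume "mcoeff (f * g) m \<noteq> 0"
    then obtain a where a: "a \<subseteq># m" "mcoeff f a * mcoeff g (m - a) \<noteq> 0"
      unfolding mcoeff_mult by (metis (no_types, lifting) mem_Collect_eq sum.neutral)
    then have "mcoeff f a \<noteq> 0" "mcoeff g (m - a) \<noteq> 0" by auto
    then have "set_mset a \<subseteq> V" "set_mset (m - a) \<subseteq> V" using fg unfolding series_in_def by blast+
    moreover have "m = a + (m - a)" using a by simp
    ultimately show "set_mset m \<subseteq> V" by (metis Un_least set_mset_union)
  qed
qed

lemma const_in_series_in: "MPow (\<lambda>m. if m = {#} then c else 0) \<in> series_in V"
  by (simp add: series_in_def)

definition hmat :: "bool \<Rightarrow> nat \<times> nat \<Rightarrow> nat \<times> nat \<Rightarrow> (gidx \<Rightarrow> gidx \<Rightarrow> 'a) \<Rightarrow> 'a::comm_ring_1 gmat" where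
  "hmat p X Y g = GMat (\<lambda>i j. if i \<in> idx Y \<and> j \<in> idx X \<and> gpar i = (gpar j \<noteq> p) then g i j else 0)"

lemma ent_hmat: "ent (hmat p X Y g) i j =
    (if i \<in> idx Y \<and> j \<in> idx X \<and> gpar i = (gpar j \<noteq> p) then g i j else 0)"
proof -
  let ?g = "\<lambda>i j. if i \<in> idx Y \<and> j \<in> idx X \<and> gpar i = (gpar j \<noteq> p) then g i j else 0"
  have "finite {i. ?g i j \<noteq> 0}" for j
    by (rule finite_subset[of _ "idx Y"]) (auto split: if_splits)
  moreover have "finite {j. ?g i j \<noteq> 0}" for i
    by (rule finite_subset[of _ "idx X"]) (auto split: if_splits)
  ultimately show ?thesis by (simp add: hmat_def ent_GMat)
qed

lemma hmat_in_hm: "(\<And>i j. g i j \<in> S) \<Longrightarrow> 0 \<in> S \<Longrightarrow> hmat p X Y g \<in> hm S p X Y"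
  by (rule hmI_zero) (auto simp: ent_hmat)

text \<open>
  The coefficients of the limit in degree \<open>k\<close> are those of \<open>E k\<close>, since later steps do not change
  them.
\<close>

lemma cauchy_limit:
  assumes E: "\<And>k. E k \<in> hm (series_in V) p X Y"
    and step: "\<And>k. E (Suc k) - E k \<in> hm (deg_ge (Suc k)) p X Y"
  shows "\<exists>L\<in>hm (series_in V) p X Y. \<forall>k. L - E k \<in> hm (deg_ge (Suc k)) p X Y"
proof -
  define L where "L = hmat p X Y (\<lambda>i j. MPow (\<lambda>m. mcoeff (ent (E (size m)) i j) m))"
  have L: "L \<in> hm (series_in V) p X Y" unfolding L_def
  proof (rule hmat_in_hm)
    fix i j
    have "mcoeff (ent (E (size m)) i j) m \<noteq> 0 \<Longrightarrow> set_mset m \<subseteq> V" for m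
      using hm_entD(1)[OF E[of "size m"], of i j] by (auto simp: series_in_def)
    then show "MPow (\<lambda>m. mcoeff (ent (E (size m)) i j) m) \<in> series_in V"
      by (auto simp: series_in_def)
  qed (simp add: series_in_def)
  have entL: "mcoeff (ent L i j) m = mcoeff (ent (E (size m)) i j) m" for i j m
    using hm_zero[OF E, of i j] by (simp add: L_def ent_hmat)
  have stable: "mcoeff (ent (E (size m + d)) i j) m = mcoeff (ent (E (size m)) i j) m" for i j m d
  proof (induction d)
    case (Suc d)
    have "mcoeff (ent (E (Suc (size m + d))) i j - ent (E (size m + d)) i j) m = 0"
      using hm_entD(1)[OF step[of "size m + d"], of i j] by (simp add: deg_ge_def)
    then show ?case using Suc by simp
  qed simp
  have "L - E k \<in> hm (deg_ge (Suc k)) p X Y" for k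
  proof (rule hmI_zero)
    fix i j
    have "mcoeff (ent L i j) m = mcoeff (ent (E k) i j) m" if "size m \<le> k" for m
      using stable[of m "k - size m" i j] that by (simp add: entL)
    then show "ent (L - E k) i j \<in> deg_ge (Suc k)" by (simp add: deg_ge_def less_Suc_eq_le)
    show "\<not> (i \<in> idx Y \<and> j \<in> idx X \<and> gpar i = (gpar j \<noteq> p)) \<Longrightarrow> ent (L - E k) i j = 0"
      using hm_zero[OF L] hm_zero[OF E] by simp
  qed
  with L show ?thesis by blast
qed

lemma mult_eq_assoc: "A * B = C \<Longrightarrow> A * (B * Z) = C * (Z :: 'a::semigroup_mult)"
  by (metis mult.assoc)

text \<open>
  The partial sums of the geometric series form a Cauchy sequence.
\<close>

lemma geometric_inverse:
  assumes N: "N \<in> hm (series_in V) False X X" "N \<in> hm (deg_ge 1) False X X"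
  shows "\<exists>T\<in>hm (series_in V) False X X. (idm X - N) * T = idm X \<and> T * (idm X - N) = idm X"
proof -
  interpret subring "series_in V" by (rule subring_series_in)
  define s where "s = rec_nat (idm X) (\<lambda>_ T. idm X + N * T)"
  have s0: "s 0 = idm X" and sS: "s (Suc k) = idm X + N * s k" for k by (simp_all add: s_def)
  have sh: "s k \<in> hm (series_in V) False X X" for k
    by (induction k) (auto simp: s0 sS intro!: hm_intros N)
  have step: "s (Suc k) - s k \<in> hm (deg_ge (Suc k)) False X X" for k
  proof (induction k)
    case 0
    have "s (Suc 0) - s 0 = N" by (simp add: s0 sS hm_idm_right[OF N(1)])
    then show ?case using N(2) by simp
  next
    case (Suc k)
    have "s (Suc (Suc k)) - s (Suc k) = N * (s (Suc k) - s k)"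
      by (simp only: sS[of "Suc k"] sS[of k]) (simp add: algebra_simps)
    then show ?case by (simp only:) (rule hm_deg_mult[OF N(2) Suc.IH], simp_all)
  qed
  obtain L where L: "L \<in> hm (series_in V) False X X" "\<And>k. L - s k \<in> hm (deg_ge (Suc k)) False X X"
    using cauchy_limit[OF sh step] by blast
  have comm: "N * s k = s k * N" for k
  proof (induction k)
    case (Suc k)
    then show ?case
      by (simp add: sS hm_idm_right[OF N(1)] hm_idm_left[OF N(1)] algebra_simps mult_eq_assoc[OF Suc])
  qed (simp add: s0 hm_idm_right[OF N(1)] hm_idm_left[OF N(1)])
  have id: "idm X * L = L" "L * idm X = L" using hm_idm_left hm_idm_right L(1) by blast+
  have "(idm X - N) * L - idm X = 0"
  proof (rule hm_deg_eq_0)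
    fix k
    have "(idm X - N) * L - idm X = (L - s (Suc k)) - N * (L - s k)"
      by (simp add: algebra_simps id sS)
    moreover have "N * (L - s k) \<in> hm (deg_ge (Suc k)) False X X"
      by (rule hm_deg_mult[OF N(2) L(2)]) auto
    moreover have "L - s (Suc k) \<in> hm (deg_ge (Suc k)) False X X"
      by (rule hm_deg_mono[OF L(2)]) simp
    ultimately show "(idm X - N) * L - idm X \<in> hm (deg_ge (Suc k)) False X X"
      by (simp add: hm_deg_diff)
  qed
  moreover have "N * L - L * N = 0"
  proof (rule hm_deg_eq_0)
    fix k
    have "N * L - L * N = N * (L - s k) - (L - s k) * N" by (simp add: algebra_simps comm)
    moreover have "N * (L - s k) \<in> hm (deg_ge (Suc k)) False X X" "(L - s k) * N \<in> hm (deg_ge (Suc k)) False X X"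
      by (rule hm_deg_mult[OF N(2) L(2)] hm_deg_mult[OF L(2) N(2)]; simp)+
    ultimately show "N * L - L * N \<in> hm (deg_ge (Suc k)) False X X" by (simp add: hm_deg_diff)
  qed
  ultimately have "(idm X - N) * L = idm X" "L * (idm X - N) = idm X"
    by (simp_all add: algebra_simps id)
  then show ?thesis using L(1) by blast
qed

text \<open>
  Invertibility may be tested modulo the maximal ideal: \<open>A B\<close> and \<open>B A\<close> are inverted by the
  geometric series.
\<close>

lemma inverse_lifting:
  assumes A: "A \<in> hm (series_in V) False X Y" and B: "B \<in> hm (series_in V) False Y X"
    and AB: "idm Y - A * B \<in> hm (deg_ge 1) False Y Y" and BA: "idm X - B * A \<in> hm (deg_ge 1) False X X"
  shows "\<exists>C\<in>hm (series_in V) False Y X. A * C = idm Y \<and> C * A = idm X"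
proof -
  interpret subring "series_in V" by (rule subring_series_in)
  have "idm Y - A * B \<in> hm (series_in V) False Y Y" "idm X - B * A \<in> hm (series_in V) False X X"
    by (auto intro!: hm_intros A B)
  then obtain T U where "T \<in> hm (series_in V) False Y Y" "(idm Y - (idm Y - A * B)) * T = idm Y"
    "U \<in> hm (series_in V) False X X" "U * (idm X - (idm X - B * A)) = idm X"
    using geometric_inverse[OF _ AB] geometric_inverse[OF _ BA] by metis
  then have T: "T \<in> hm (series_in V) False Y Y" "A * B * T = idm Y"
    and U: "U \<in> hm (series_in V) False X X" "U * (B * A) = idm X" by simp_all
  have UB: "U * B \<in> hm (series_in V) False Y X" and BT: "B * T \<in> hm (series_in V) False Y X"
    by (auto intro!: hm_intros U T B)
  have "U * B = U * B * (A * B * T)" using T hm_idm_right[OF UB] by simp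
  also have "\<dots> = U * (B * A) * (B * T)" by (simp add: mult.assoc)
  also have "\<dots> = B * T" using U hm_idm_left[OF BT] by simp
  finally have "B * T * A = idm X" using U by (metis mult.assoc)
  moreover have "A * (B * T) = idm Y" using T by (simp add: mult.assoc)
  ultimately show ?thesis using BT by blast
qed

lemma unit_in_series_in:
  fixes f :: "'k::field mpow"
  assumes f: "f \<in> series_in V" and nz: "mcoeff f {#} \<noteq> 0"
  shows "\<exists>g\<in>series_in V. f * g = 1"
proof -
  interpret subring "series_in V :: 'k mpow set" by (rule subring_series_in)
  let ?c = "MPow (\<lambda>m. if m = {#} then inverse (mcoeff f {#}) else 0)"
  define U :: "nat \<times> nat" where "U = (1, 0)"
  let ?i = "Ix False 0"
  have i: "?i \<in> idx U" by (simp add: U_def rkof_def)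
  have c: "?c \<in> series_in V" by (rule const_in_series_in)
  have eq: "idm U - sc a * idm U * (sc b * idm U) = sc (1 - a * b) * idm U" for a b :: "'k mpow"
  proof -
    have "sc a * idm U * (sc b * idm U) = sc a * (sc b * (idm U * idm U))"
      by (simp only: mult.assoc sc_left_commute[of "idm U"])
    also have "\<dots> = sc (a * b) * idm U"
      by (simp only: hm_idm_right[OF hid] sc_mult mult.assoc)
    finally show ?thesis by (simp add: sc_diff left_diff_distrib)
  qed
  have small: "sc (1 - a * b) * idm U \<in> hm (deg_ge 1) False U U"
    if "mcoeff a {#} * mcoeff b {#} = 1" for a b :: "'k mpow"
    by (rule hmI_zero) (auto simp: deg_ge_1 ent_idm mcoeff_const_mult mcoeff_1 that)
  have "\<exists>C\<in>hm (series_in V) False U U. sc f * idm U * C = idm U \<and> C * (sc f * idm U) = idm U"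
  proof (rule inverse_lifting)
    show "sc f * idm U \<in> hm (series_in V) False U U" "sc ?c * idm U \<in> hm (series_in V) False U U"
      by (auto intro!: hm_intros f c)
    show "idm U - sc f * idm U * (sc ?c * idm U) \<in> hm (deg_ge 1) False U U"
      "idm U - sc ?c * idm U * (sc f * idm U) \<in> hm (deg_ge 1) False U U"
      unfolding eq by (rule small, simp add: nz)+
  qed
  then obtain C where C: "C \<in> hm (series_in V) False U U" "sc f * (idm U * C) = idm U"
    by (auto simp: mult.assoc)
  then have "sc f * C = idm U" using hm_idm_left[OF C(1)] by simp
  then have "ent (sc f * C) ?i ?i = 1" using i by (simp add: ent_idm)
  then show ?thesis using hm_entD(1)[OF C(1)] by auto
qed


section \<open>Idempotents\<close>

text \<open>
  Newton's iteration \<open>e \<mapsto> 3e\<^sup>2 - 2e\<^sup>3\<close>, written with \<open>a = e\<^sup>2 - e\<close>, turns an idempotent modulo the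
  maximal ideal into a strict one, and it preserves whatever commutes with \<open>e\<close>.
\<close>

lemma idempotent_lifting:
  assumes e: "e \<in> hm (series_in V) False X X" and a: "e * e - e \<in> hm (deg_ge 1) False X X"
  shows "\<exists>E\<in>hm (series_in V) False X X. E * E = E \<and> E - e \<in> hm (deg_ge 1) False X X \<and>
    (\<forall>p. \<forall>Q\<in>hm UNIV p X X. e * Q = Q * e \<longrightarrow> E * Q = Q * E)"
proof -
  interpret subring "series_in V" by (rule subring_series_in)
  define s where "s = rec_nat e (\<lambda>_ e. e + (e * e - e) - ((e * e - e) * e + (e * e - e) * e))"
  have s0: "s 0 = e" and
    sS: "s (Suc k) = s k + (s k * s k - s k) - ((s k * s k - s k) * s k + (s k * s k - s k) * s k)" for k
    by (simp_all add: s_def)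
  have sh: "s k \<in> hm (series_in V) False X X" for k
    by (induction k) (auto simp: s0 sS intro!: hm_intros e)
  have small: "s k * s k - s k \<in> hm (deg_ge (Suc k)) False X X" for k
  proof (induction k)
    case (Suc k)
    define b where "b = s k * s k - s k"
    have "s (Suc k) * s (Suc k) - s (Suc k) = b * (b * (b + b + b + b)) - (b * b + b * b + b * b)"
      unfolding sS b_def by (simp add: algebra_simps)
    moreover have b: "b \<in> hm (deg_ge (Suc k)) False X X" using Suc by (simp add: b_def)
    have bb: "b * b \<in> hm (deg_ge (Suc (Suc k))) False X X"
      by (rule hm_deg_mult[OF b b]) auto
    moreover have "b * (b * (b + b + b + b)) \<in> hm (deg_ge (Suc (Suc k))) False X X"
      unfolding mult.assoc[symmetric]
      by (rule hm_deg_mult[OF bb]) (rule hm_deg_add b hm_deg0 | simp)+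
    ultimately show ?case by (simp add: hm_deg_diff hm_deg_add)
  qed (use a in \<open>simp add: s0\<close>)
  have step: "s (Suc k) - s k \<in> hm (deg_ge (Suc k)) False X X" for k
  proof -
    have "s (Suc k) - s k = (s k * s k - s k) - ((s k * s k - s k) * s k + (s k * s k - s k) * s k)"
      by (subst sS) simp
    moreover have "(s k * s k - s k) * s k \<in> hm (deg_ge (Suc k)) False X X"
      by (rule hm_deg_mult[OF small hm_deg0[OF sh]]) auto
    ultimately show ?thesis by (simp only: small hm_deg_diff hm_deg_add)
  qed
  obtain L where L: "L \<in> hm (series_in V) False X X" "\<And>k. L - s k \<in> hm (deg_ge (Suc k)) False X X"
    using cauchy_limit[OF sh step] by blast
  have "L * L - L = 0"
  proof (rule hm_deg_eq_0)
    fix k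
    have "L * L - L = (L - s k) * L + s k * (L - s k) + (s k * s k - s k) - (L - s k)"
      by (simp add: algebra_simps)
    moreover have "(L - s k) * L \<in> hm (deg_ge (Suc k)) False X X"
      by (rule hm_deg_mult[OF L(2) hm_deg0[OF L(1)]]) auto
    moreover have "s k * (L - s k) \<in> hm (deg_ge (Suc k)) False X X"
      by (rule hm_deg_mult[OF hm_deg0[OF sh] L(2)]) auto
    ultimately show "L * L - L \<in> hm (deg_ge (Suc k)) False X X"
      by (simp only: small L hm_deg_diff hm_deg_add)
  qed
  moreover have "L * Q = Q * L" if Q: "Q \<in> hm UNIV p X X" and comm: "e * Q = Q * e" for Q p
  proof -
    have Qd: "Q \<in> hm (deg_ge 0) p X X" using Q by simp
    have sQ: "s k * Q = Q * s k" for k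
    proof (induction k)
      case (Suc k)
      then show ?case
        unfolding sS by (simp add: algebra_simps mult_eq_assoc[OF Suc])
    qed (simp add: s0 comm)
    have "L * Q - Q * L = 0"
    proof (rule hm_deg_eq_0)
      fix k
      have "L * Q - Q * L = (L - s k) * Q - Q * (L - s k)" by (simp add: algebra_simps sQ)
      moreover have "(L - s k) * Q \<in> hm (deg_ge (Suc k)) p X X" "Q * (L - s k) \<in> hm (deg_ge (Suc k)) p X X"
        by (rule hm_deg_mult[OF L(2) Qd] hm_deg_mult[OF Qd L(2)]; simp)+
      ultimately show "L * Q - Q * L \<in> hm (deg_ge (Suc k)) p X X" by (simp only: hm_deg_diff)
    qed
    then show ?thesis by simp
  qed
  moreover have "L - e \<in> hm (deg_ge 1) False X X" using L(2)[of 0] by (simp add: s0)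
  ultimately show ?thesis using L(1) by auto
qed


definition munit :: "gidx \<Rightarrow> gidx \<Rightarrow> 'a::comm_ring_1 gmat" where
  "munit i j = pinj (\<lambda>_. i) {j}"

lemma ent_munit: "ent (munit i j) k l = (if k = i \<and> l = j then 1 else 0)"
  by (auto simp: munit_def ent_pinj)

lemma tr_munit: "tr (munit i j) = munit j i"
  by (rule ent_eqI) (auto simp: ent_munit)

lemma ent_mult_munit: "ent (F * munit i j) k l = (if l = j then ent F k i else 0)"
  by (simp add: munit_def ent_mult_pinj)

lemma ent_munit_mult: "ent (munit i j * F) k l = (if k = i then ent F j l else 0)"
proof -
  have "ent (munit i j * F) k l = ent (tr F * munit j i) l k"
    by (metis ent_tr tr_mult tr_munit tr_tr)
  then show ?thesis by (simp add: ent_mult_munit)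
qed

lemma munit_sandwich: "munit a i * (F * munit j b) = sc (ent F i j) * munit a b"
  by (rule ent_eqI) (simp add: ent_munit_mult ent_mult_munit ent_munit ent_sc)

lemma munit_sandwich_assoc: "munit a i * (F * (munit j b * Z)) = sc (ent F i j) * (munit a b * Z)"
  using arg_cong[OF munit_sandwich[of a i F j b], of "\<lambda>G. G * Z"] by (simp only: mult.assoc)

lemma munit_in_hm:
  "subring S \<Longrightarrow> i \<in> idx Y \<Longrightarrow> j \<in> idx X \<Longrightarrow> gpar i = (gpar j \<noteq> p) \<Longrightarrow> munit i j \<in> hm S p X Y"
  by (rule hmI) (auto simp: ent_munit subring.zero subring.one split: if_splits)

text \<open>
  The number of nonzero columns is the measure by which idempotents are exhausted.
\<close>

definition cols :: "'a::comm_ring_1 gmat \<Rightarrow> gidx set" where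
  "cols F = {j. \<exists>i. ent F i j \<noteq> 0}"

lemma cols_hm: "F \<in> hm S p X Y \<Longrightarrow> cols F \<subseteq> idx X"
  by (auto simp: cols_def dest: hm_entD(3))

lemma cols_mult: "cols (G * F) \<subseteq> cols F"
proof
  fix j assume "j \<in> cols (G * F)"
  then obtain i where "ent (G * F) i j \<noteq> 0" by (auto simp: cols_def)
  then obtain k where "ent G i k * ent F k j \<noteq> 0"
    unfolding ent_times_col by (meson sum.neutral)
  then have "ent F k j \<noteq> 0" by auto
  then show "j \<in> cols F" by (auto simp: cols_def)
qed

lemma cols_decrease:
  assumes "F * E = F" and "E \<in> hm S p X Y" and "ent E i j \<noteq> 0" and "F * munit j j = 0"
  shows "card (cols F) < card (cols E)"
proof (rule psubset_card_mono)
  show "finite (cols E)" using cols_hm[OF assms(2)] finite_idx finite_subset by blast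
  have "cols F \<subseteq> cols E" using cols_mult[of F E] assms(1) by simp
  moreover have "j \<in> cols E" using assms(3) by (auto simp: cols_def)
  moreover have "ent F k j = 0" for k
    using ent_mult_munit[of F j j k j] assms(4) by simp
  then have "j \<notin> cols F" by (simp add: cols_def)
  ultimately show "cols F \<subset> cols E" by blast
qed

lemma unit_entry_or_small:
  fixes F :: "'k::field mpow gmat"
  assumes F: "F \<in> hm (series_in V) p X Y" and big: "F \<notin> hm (deg_ge 1) p X Y"
  obtains i j g where "g \<in> series_in V" "ent F i j * g = 1"
proof -
  have "\<exists>i j. ent F i j \<notin> deg_ge (Suc 0)"
  proof (rule ccontr)
    assume "\<nexists>i j. ent F i j \<notin> deg_ge (Suc 0)"
    then have "F \<in> hm (deg_ge 1) p X Y"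
      using hm_zero[OF F] by (intro hmI_zero) auto
    with big show False ..
  qed
  then obtain i j where ij: "mcoeff (ent F i j) {#} \<noteq> 0" by (auto simp: deg_ge_1)
  then show ?thesis using unit_in_series_in[OF hm_entD(1)[OF F] ij] that by blast
qed

text \<open>
  An idempotent over a local ring is either divisible by the maximal ideal, hence zero, or it has
  an invertible entry; then a summand of rank one splits off, and what is left has fewer nonzero
  columns.
\<close>

lemma idempotent_splits:
  fixes E :: "'k::field mpow gmat"
  assumes "E \<in> hm (series_in V) False X X" "E * E = E"
  shows "\<exists>Y. \<exists>f\<in>hm (series_in V) False Y X. \<exists>p\<in>hm (series_in V) False X Y. f * p = E \<and> p * f = idm Y"
  using assms
proof (induction "card (cols E)" arbitrary: E rule: less_induct)
  case less
  interpret subring "series_in V :: 'k mpow set" by (rule subring_series_in)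
  note E = less.prems
  show ?case
  proof (cases "E \<in> hm (deg_ge 1) False X X")
    case True
    have "E \<in> hm (deg_ge (Suc k)) False X X" for k
    proof (induction k)
      case (Suc k)
      then show ?case using hm_deg_mult[OF True Suc, of False "Suc (Suc k)"] E(2) by simp
    qed (use True in simp)
    then have "E = 0" by (rule hm_deg_eq_0)
    moreover have "idm (0, 0) = (0 :: 'k mpow gmat)"
      by (rule ent_eqI) (simp add: ent_idm idx_def rkof_def)
    ultimately show ?thesis by (intro exI[of _ "(0, 0)"] bexI[of _ 0]) (auto simp: h0)
  next
    case False
    obtain i j g where g: "g \<in> series_in V" "ent E i j * g = 1"
      by (rule unit_entry_or_small[OF E(1) False])
    then have nz: "ent E i j \<noteq> 0" by auto
    then have ij: "i \<in> idx X" "j \<in> idx X" "gpar i = gpar j"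
      using hm_entD(2-4)[OF E(1) nz] by auto
    define u where "u = Ix (\<not> gpar j) 0"
    define U where "U = (if gpar j then (1, 0) else (0, 1) :: nat \<times> nat)"
    have u: "u \<in> idx U" by (simp add: u_def U_def rkof_def)
    have gu: "gpar u = (\<not> gpar j)" by (simp add: u_def)
    have idU: "idm U = (munit u u :: 'k mpow gmat)"
    proof (rule ent_eqI)
      fix k l show "ent (idm U) k l = ent (munit u u :: 'k mpow gmat) k l"
        by (cases k; cases l) (auto simp: ent_idm ent_munit u_def U_def rkof_def split: if_splits)
    qed
    define f where "f = sc g * (E * munit j u)"
    define p where "p = munit u i * E"
    have f: "f \<in> hm (series_in V) True U X" unfolding f_def
      by (rule hsc[OF g(1)] hmul[OF E(1)] munit_in_hm[OF subring_series_in])+ (auto simp: ij u gu)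
    have p: "p \<in> hm (series_in V) True X U" unfolding p_def
      by (rule hmul[OF munit_in_hm[OF subring_series_in] E(1)]) (auto simp: ij u gu)
    have Ef: "E * f = f" and pE: "p * E = p"
      unfolding f_def p_def by (simp_all add: sc_left_commute[of E] mult.assoc mult_eq_assoc[OF E(2)] E(2))
    have pf: "p * f = idm U"
    proof -
      have "p * f = sc g * (munit u i * (E * (E * munit j u)))"
        unfolding f_def p_def by (simp only: mult.assoc sc_left_commute[of E] sc_left_commute[of "munit u i"])
      also have "\<dots> = sc g * (sc (ent E i j) * munit u u)"
        by (simp only: mult_eq_assoc[OF E(2)] munit_sandwich)
      also have "\<dots> = sc (ent E i j * g) * munit u u"
        by (simp only: sc_mult mult.assoc sc_left_commute[of "sc g"])
      finally show ?thesis by (simp add: g idU)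
    qed
    note pf' = mult_eq_assoc[OF pf] and Ef' = mult_eq_assoc[OF Ef] and pE' = mult_eq_assoc[OF pE]
    have idp: "idm U * p = p" by (rule hm_idm_left[OF p])
    define E' where "E' = E - f * p"
    have E': "E' \<in> hm (series_in V) False X X" unfolding E'_def by (auto intro!: hm_intros E f p)
    have E'E: "E' * E = E'" and EE': "E' * f = 0" "p * E' = 0"
      unfolding E'_def by (simp_all add: algebra_simps E(2) pE pf pf' Ef idp hm_idm_right[OF f])
    have "E' * (E - f * p) = E'"
      by (simp add: right_diff_distrib E'E mult_eq_assoc[OF EE'(1)])
    then have E'2: "E' * E' = E'" by (simp only: flip: E'_def)
    have "p * munit j u = sc (ent E i j) * idm U"
      unfolding p_def idU by (simp only: mult.assoc munit_sandwich)
    then have "f * (p * munit j u) = E * munit j u"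
      by (simp only: sc_left_commute[of f] hm_idm_right[OF f])
        (simp add: f_def g mult.assoc[symmetric] sc_mult[symmetric])
    then have "E' * munit j u = 0" by (simp add: E'_def left_diff_distrib mult.assoc)
    then have "E' * munit j u * munit u j = 0" by simp
    moreover have "munit j u * munit u j = (munit j j :: 'k mpow gmat)"
      by (rule ent_eqI) (simp add: ent_mult_munit ent_munit)
    ultimately have "E' * munit j j = 0" by (simp add: mult.assoc)
    from cols_decrease[OF E'E E(1) nz this] obtain Y f' p' where
      f': "f' \<in> hm (series_in V) False Y X" and p': "p' \<in> hm (series_in V) False X Y"
      and f'p': "f' * p' = E'" and p'f': "p' * f' = idm Y"
      using less.hyps[OF _ E' E'2] by blast
    have pf0: "p * f' = 0"
    proof -
      have "p * f' = p * (f' * (p' * f'))" by (simp add: p'f' hm_idm_right[OF f'])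
      also have "\<dots> = p * E' * f'" by (simp only: f'p'[symmetric] mult.assoc)
      finally show ?thesis by (simp add: EE')
    qed
    have p'f: "p' * f = 0"
    proof -
      have "p' * f = (p' * f') * p' * f" by (simp add: p'f' hm_idm_left[OF p'])
      also have "\<dots> = p' * (E' * f)" by (simp only: f'p'[symmetric] mult.assoc)
      finally show ?thesis by (simp add: EE')
    qed
    let ?f = "f * pr1 U + f' * pr2 U Y" and ?p = "in1 U * p + in2 U Y * p'"
    have "?f \<in> hm (series_in V) False (sumr U Y) X" "?p \<in> hm (series_in V) False X (sumr U Y)"
      by (rule hadd hmul[OF f hpr1] hmul[OF f' hpr2] hmul[OF hin1 p] hmul[OF hin2 p'] | simp)+
    moreover have "?f * ?p = E"
      by (simp add: algebra_simps mult_eq_assoc[OF pr1_in1] mult_eq_assoc[OF pr2_in2]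
          mult_eq_assoc[OF pr1_in2] mult_eq_assoc[OF pr2_in1] idp hm_idm_left[OF p'] f'p' E'_def)
    moreover have "?p * ?f = idm (sumr U Y)"
      by (simp add: algebra_simps pf' mult_eq_assoc[OF pf0] mult_eq_assoc[OF p'f] mult_eq_assoc[OF p'f']
          hm_idm_left[OF hpr1] hm_idm_left[OF hpr2] flip: in_pr)
    ultimately show ?thesis by blast
  qed
qed

text \<open>
  If \<open>c\<close> is an invertible entry of \<open>QE\<close>, in position \<open>(i, j)\<close>, then the odd map
  \<open>h = c\<^sup>-\<^sup>1 E e\<^sub>j\<^sub>i E\<close> satisfies \<open>hQh = h\<close> and \<open>h\<^sup>2 = 0\<close>, so \<open>Qh + hQ\<close> is a null-homotopic
  idempotent; it is removed from \<open>E\<close>.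
\<close>

lemma reduce_idempotent:
  fixes E Q :: "'k::field mpow gmat"
  assumes "E \<in> hm (series_in V) False X X" "E * E = E" "E * Q = Q * E"
    and Q: "Q \<in> hm (series_in V) True X X" "Q * Q = sc w * idm X"
  shows "\<exists>E'\<in>hm (series_in V) False X X. \<exists>H\<in>hm (series_in V) True X X.
    E' * E' = E' \<and> E' * Q = Q * E' \<and> E - E' = Q * H + H * Q \<and> Q * E' \<in> hm (deg_ge 1) True X X"
  using assms(1-3)
proof (induction "card (cols E)" arbitrary: E rule: less_induct)
  case less
  interpret subring "series_in V :: 'k mpow set" by (rule subring_series_in)
  note E = less.prems
  have QE: "Q * E \<in> hm (series_in V) True X X" by (rule hmul[OF Q(1) E(1)]) simp
  show ?case
  proof (cases "Q * E \<in> hm (deg_ge 1) True X X")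
    case True
    then show ?thesis using E h0 by (intro bexI[of _ E] bexI[of _ 0]) auto
  next
    case False
    obtain i j g where g: "g \<in> series_in V" "ent (Q * E) i j * g = 1"
      by (rule unit_entry_or_small[OF QE False])
    then have nz: "ent (Q * E) i j \<noteq> 0" by auto
    then have ij: "i \<in> idx X" "j \<in> idx X" "gpar i = (\<not> gpar j)"
      using hm_entD(2-4)[OF QE nz] by auto
    have 0: "ent E i j = 0" by (rule hm_zero[OF E(1)]) (simp add: ij)
    have "\<exists>k. ent E k j \<noteq> 0" using nz cols_mult[of Q E] by (auto simp: cols_def)
    then obtain k where nz': "ent E k j \<noteq> 0" by blast
    define h where "h = sc g * (E * (munit j i * E))"
    have h: "h \<in> hm (series_in V) True X X" unfolding h_def
      by (rule hsc[OF g(1)] hmul[OF E(1)] hmul[OF munit_in_hm[OF subring_series_in] E(1)])+ (auto simp: ij)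
    have Eh: "E * h = h" and hE: "h * E = h"
      unfolding h_def by (simp_all add: sc_left_commute[of E] mult.assoc mult_eq_assoc[OF E(2)] E(2))
    have hh: "h * h = 0"
    proof -
      have "h * h = sc g * (sc g * (E * (munit j i * (E * (munit j i * E)))))"
        unfolding h_def by (simp add: mult.assoc sc_left_commute[of E] sc_left_commute[of "munit j i"] mult_eq_assoc[OF E(2)])
      then show ?thesis by (simp add: munit_sandwich_assoc 0)
    qed
    define c where "c = ent (Q * E) i j"
    have gc: "sc g * (sc c * Z) = Z" for Z
    proof -
      have "sc g * (sc c * Z) = sc (g * c) * Z" by (simp only: sc_mult mult.assoc)
      then show ?thesis by (simp add: c_def g mult.commute[of g])
    qed
    have sandwich: "munit j i * (Q * (E * munit j l)) = sc c * munit j l" for l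
      using munit_sandwich[of j i "Q * E" j l] by (simp add: c_def mult.assoc)
    have sandwich': "munit j i * (Q * (E * (munit j l * Z))) = sc c * (munit j l * Z)" for l Z
      using arg_cong[OF sandwich, of "\<lambda>G. G * Z"] by (simp only: mult.assoc)
    have hQh: "h * (Q * h) = h"
      unfolding h_def
      by (simp add: mult.assoc sc_left_commute[of E] sc_left_commute[of Q] sc_left_commute[of "munit j i"]
          mult_eq_assoc[OF E(2)] mult_eq_assoc[OF E(3)] sandwich' gc)
    have QQh: "Q * (Q * h) = sc w * h"
      by (simp add: mult_eq_assoc[OF Q(2)] mult.assoc hm_idm_left[OF h])
    have hQQ: "h * (Q * Q) = sc w * h"
      by (simp add: Q(2) sc_left_commute[of h] hm_idm_right[OF h])
    have EQh: "E * (Q * h) = Q * h" by (simp add: mult_eq_assoc[OF E(3)] mult.assoc Eh)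
    have hQE: "h * (Q * E) = h * Q" by (simp add: E(3)[symmetric] mult_eq_assoc[OF hE])
    define P where "P = Q * h + h * Q"
    have P: "P \<in> hm (series_in V) False X X" unfolding P_def by (auto intro!: hm_intros h Q(1))
    have EP: "E * P = P" unfolding P_def by (simp add: algebra_simps EQh mult_eq_assoc[OF Eh])
    have PE: "P * E = P" unfolding P_def by (simp add: algebra_simps hQE hE)
    have hQh': "h * (Q * (h * Z)) = h * Z" for Z using arg_cong[OF hQh, of "\<lambda>G. G * Z"] by (simp only: mult.assoc)
    have PP: "P * P = P" unfolding P_def
      by (simp add: algebra_simps hQh hQh' mult_eq_assoc[OF hh] QQh)
        (simp add: sc_left_commute[of h] hh)
    have QP: "Q * P = P * Q" unfolding P_def by (simp add: algebra_simps QQh hQQ)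
    define E' where "E' = E - P"
    have E': "E' \<in> hm (series_in V) False X X" unfolding E'_def by (auto intro!: hm_intros E P)
    have E'2: "E' * E' = E'" and E'E: "E' * E = E'" and E'Q: "E' * Q = Q * E'"
      unfolding E'_def by (simp_all add: algebra_simps E EP PE PP QP)
    have "E' * munit j j = 0"
    proof -
      have "h * (Q * munit j j) = E * munit j j"
        unfolding h_def by (simp add: mult.assoc mult_eq_assoc[OF E(3)] sandwich sc_left_commute[of E] gc)
      moreover have "h * munit j j = 0"
        unfolding h_def by (simp add: mult.assoc munit_sandwich 0)
      ultimately show ?thesis by (simp add: E'_def P_def algebra_simps)
    qed
    from cols_decrease[OF E'E E(1) nz' this] obtain E'' H where
      *: "E'' \<in> hm (series_in V) False X X" "H \<in> hm (series_in V) True X X"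
        "E'' * E'' = E''" "E'' * Q = Q * E''" "E' - E'' = Q * H + H * Q" "Q * E'' \<in> hm (deg_ge 1) True X X"
      using less.hyps[OF _ E' E'2 E'Q] by blast
    have "E - E'' = Q * (H + h) + (H + h) * Q"
      using *(5) by (simp add: E'_def P_def algebra_simps)
    then show ?thesis using * hadd[OF *(2) h] by blast
  qed
qed


section \<open>Adjoining a variable\<close>

lemma mcoeff_Var_mult: "mcoeff (Var i * g) m = (if i \<in># m then mcoeff g (m - {#i#}) else 0)"
proof -
  have "mcoeff (Var i * g) m = (\<Sum>a\<in>{a. a \<subseteq># m}. if a = {#i#} then mcoeff g (m - {#i#}) else 0)"
    unfolding mcoeff_mult Var_def by (rule sum.cong) auto
  also have "\<dots> = (if {#i#} \<subseteq># m then mcoeff g (m - {#i#}) else 0)"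
    using finite_submultisets[of m] by (simp add: sum.delta)
  finally show ?thesis by simp
qed

text \<open>\<open>B = A \<oplus> x B\<close>, and \<open>x\<close> is regular on \<open>B\<close>: the relation between \<open>A\<close> and \<open>B = A[[x]]\<close>.\<close>

definition adjoins :: "'a::comm_ring_1 \<Rightarrow> 'a set \<Rightarrow> 'a set \<Rightarrow> bool" where
  "adjoins x A B \<longleftrightarrow> A \<subseteq> B \<and> x \<in> B \<and>
    (\<forall>f\<in>B. \<exists>f0\<in>A. \<exists>f1\<in>B. f = f0 + x * f1) \<and>
    (\<forall>f0\<in>A. \<forall>f1\<in>B. f0 + x * f1 = 0 \<longrightarrow> f0 = 0 \<and> f1 = 0)"

lemma adjoins_split: "adjoins x A B \<Longrightarrow> f \<in> B \<Longrightarrow> \<exists>f0\<in>A. \<exists>f1\<in>B. f = f0 + x * f1"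
  by (simp add: adjoins_def)

lemma adjoins_unique:
  assumes "adjoins x A B" "f0 \<in> A" "f1 \<in> B" "f0 + x * f1 = 0"
  shows "f0 = 0 \<and> f1 = 0"
proof -
  have "\<forall>f0\<in>A. \<forall>f1\<in>B. f0 + x * f1 = 0 \<longrightarrow> f0 = 0 \<and> f1 = 0"
    using assms(1) unfolding adjoins_def by (elim conjE)
  from this[rule_format, OF assms(2-4)] show ?thesis .
qed

lemma adjoins_Var:
  assumes "v \<notin> V"
  shows "adjoins (Var v :: 'a::comm_ring_1 mpow) (series_in V) (series_in (insert v V))"
  unfolding adjoins_def
proof (intro conjI ballI impI)
  show "series_in V \<subseteq> series_in (insert v V)" by (rule series_in_mono) auto
  show "Var v \<in> series_in (insert v V)" by (auto simp: series_in_def Var_def)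
next
  fix f :: "'a mpow" assume f: "f \<in> series_in (insert v V)"
  let ?f0 = "MPow (\<lambda>m. if v \<in># m then 0 else mcoeff f m)" and ?f1 = "MPow (\<lambda>m. mcoeff f (add_mset v m))"
  have "?f0 \<in> series_in V" using f by (auto simp: series_in_def split: if_splits)
  moreover have "?f1 \<in> series_in (insert v V)"
  proof (unfold series_in_def, intro CollectI allI impI)
    fix m assume "mcoeff ?f1 m \<noteq> 0"
    then have "mcoeff f (add_mset v m) \<noteq> 0" by simp
    then have "set_mset (add_mset v m) \<subseteq> insert v V" using f unfolding series_in_def by blast
    then show "set_mset m \<subseteq> insert v V" by auto
  qed
  moreover have "f = ?f0 + Var v * ?f1" by (rule mpow_eqI) (simp add: mcoeff_Var_mult)
  ultimately show "\<exists>f0\<in>series_in V. \<exists>f1\<in>series_in (insert v V). f = f0 + Var v * f1" by blast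
next
  fix f0 f1 :: "'a mpow" assume f: "f0 \<in> series_in V" "f0 + Var v * f1 = 0"
  have 0: "mcoeff f0 m + mcoeff (Var v * f1) m = 0" for m using f(2) by (metis mcoeff_0 mcoeff_add)
  show "f0 = 0"
  proof (rule mpow_eqI)
    fix m show "mcoeff f0 m = mcoeff 0 m"
      using 0[of m] f(1) assms by (auto simp: series_in_def mcoeff_Var_mult split: if_splits)
  qed
  show "f1 = 0"
  proof (rule mpow_eqI)
    fix m show "mcoeff f1 m = mcoeff 0 m"
      using 0[of "add_mset v m"] \<open>f0 = 0\<close> by (simp add: mcoeff_Var_mult)
  qed
qed

lemma adjoins_minus:
  assumes x: "adjoins x A B" and B: "subring B"
  shows "adjoins (- x) A B"
proof -
  note minus = subring.minus[OF B]
  have "\<exists>f0\<in>A. \<exists>f1\<in>B. f = f0 + - x * f1" if f: "f \<in> B" for f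
  proof -
    obtain f0 f1 where "f0 \<in> A" "f1 \<in> B" and eq: "f = f0 + x * f1"
      using adjoins_split[OF x f] by (elim bexE)
    moreover have "f = f0 + - x * - f1" by (simp add: eq)
    ultimately show ?thesis using minus by (intro bexI[of _ f0] bexI[of _ "- f1"])
  qed
  moreover have "f0 = 0 \<and> f1 = 0" if "f0 \<in> A" "f1 \<in> B" "f0 + - x * f1 = 0" for f0 f1
    using adjoins_unique[OF x that(1) minus[OF that(2)]] that(3) by simp
  moreover have "A \<subseteq> B" "- x \<in> B" using x minus by (simp_all add: adjoins_def)
  ultimately show ?thesis unfolding adjoins_def by (intro conjI ballI impI) simp_all
qed

text \<open>
  A map of free modules is decomposed entrywise.
\<close>

lemma hm_decompose:
  assumes x: "adjoins x A B" and "subring A" "subring B" and F: "F \<in> hm B p X Y"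
  obtains F0 F1 where "F0 \<in> hm A p X Y" "F1 \<in> hm B p X Y" "F = F0 + sc x * F1"
proof -
  have "\<exists>f. fst f \<in> A \<and> snd f \<in> B \<and> ent F i j = fst f + x * snd f" for i j
  proof -
    obtain f0 f1 where "f0 \<in> A" "f1 \<in> B" "ent F i j = f0 + x * f1"
      using adjoins_split[OF x hm_entD(1)[OF F, of i j]] by (elim bexE)
    then show ?thesis by (intro exI[of _ "(f0, f1)"]) simp
  qed
  then obtain f where f: "\<And>i j. fst (f i j) \<in> A \<and> snd (f i j) \<in> B \<and>
    ent F i j = fst (f i j) + x * snd (f i j)" by metis
  show ?thesis
  proof (rule that)
    show "hmat p X Y (\<lambda>i j. fst (f i j)) \<in> hm A p X Y" "hmat p X Y (\<lambda>i j. snd (f i j)) \<in> hm B p X Y"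
      using f subring.zero[OF assms(2)] subring.zero[OF assms(3)] by (auto intro!: hmat_in_hm)
    show "F = hmat p X Y (\<lambda>i j. fst (f i j)) + sc x * hmat p X Y (\<lambda>i j. snd (f i j))"
    proof (rule ent_eqI)
      fix i j show "ent F i j = ent (hmat p X Y (\<lambda>i j. fst (f i j)) + sc x * hmat p X Y (\<lambda>i j. snd (f i j))) i j"
      proof (cases "i \<in> idx Y \<and> j \<in> idx X \<and> gpar i = (gpar j \<noteq> p)")
        case True
        then show ?thesis using f[of i j] by (simp add: ent_hmat)
      next
        case False
        then have "ent (hmat p X Y g) i j = 0" for g :: "gidx \<Rightarrow> gidx \<Rightarrow> 'a"
          unfolding ent_hmat by (rule if_not_P)
        then show ?thesis by (simp add: hm_zero[OF F False])
      qed
    qed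
  qed
qed

lemma hm_decompose_unique:
  assumes "adjoins x A B" "F0 \<in> hm A p X Y" "F1 \<in> hm B p X Y" "F0 + sc x * F1 = 0"
  shows "F0 = 0" "F1 = 0"
proof -
  have "ent F0 i j = 0 \<and> ent F1 i j = 0" for i j
  proof (rule adjoins_unique[OF assms(1) hm_entD(1)[OF assms(2)] hm_entD(1)[OF assms(3)]])
    show "ent F0 i j + x * ent F1 i j = 0" using arg_cong[OF assms(4), of "\<lambda>F. ent F i j"] by simp
  qed
  then show "F0 = 0" "F1 = 0" by (auto intro: ent_eqI)
qed


section \<open>Block calculus\<close>

definition smul :: "'a::comm_ring_1 \<Rightarrow> 'a gmat \<Rightarrow> 'a gmat" (infixr "\<odot>" 75) where
  "c \<odot> F = sc c * F"

lemma smul_mult_left [simp]: "(c \<odot> F) * G = c \<odot> (F * G)"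
  and smul_mult_right [simp]: "F * (c \<odot> G) = c \<odot> (F * G)"
  and smul_add: "c \<odot> (F + G) = c \<odot> F + c \<odot> G"
  and smul_diff: "c \<odot> (F - G) = c \<odot> F - c \<odot> G"
  and smul_minus [simp]: "c \<odot> (- F) = - (c \<odot> F)"
  and smul_0 [simp]: "c \<odot> 0 = 0"
  and smul_minus_left [simp]: "(- c) \<odot> F = - (c \<odot> F)"
  and smul_diff_left: "(c - d) \<odot> F = c \<odot> F - d \<odot> F"
  and smul_add_left: "(c + d) \<odot> F = c \<odot> F + d \<odot> F"
  and smul_smul [simp]: "c \<odot> (d \<odot> F) = (c * d) \<odot> F"
  and tr_smul [simp]: "tr (c \<odot> F) = c \<odot> tr F"
  and smul_1 [simp]: "1 \<odot> F = F"
  by (simp_all add: smul_def mult.assoc sc_left_commute[of F] distrib_left distrib_right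
      right_diff_distrib left_diff_distrib sc_minus sc_diff sc_add sc_mult sc_central[of "tr F"])

lemma ent_smul [simp]: "ent (c \<odot> F) i j = c * ent F i j"
  by (simp add: smul_def)

lemmas smul_simps = smul_add smul_diff

definition const_part :: "'k::comm_ring_1 mpow gmat \<Rightarrow> 'k gmat" where
  "const_part F = GMat (\<lambda>i j. mcoeff (ent F i j) {#})"

lemma ent_const_part: "ent (const_part F) i j = mcoeff (ent F i j) {#}"
proof -
  have "finite {i. mcoeff (ent F i j) {#} \<noteq> 0}" for j
    by (rule finite_subset[OF _ finite_col[of F j]]) auto
  moreover have "finite {j. mcoeff (ent F i j) {#} \<noteq> 0}" for i
    by (rule finite_subset[OF _ finite_row[of F i]]) auto
  ultimately show ?thesis by (simp add: const_part_def ent_GMat)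
qed

lemma const_part_add [simp]: "const_part (F + G) = const_part F + const_part G"
  and const_part_diff [simp]: "const_part (F - G) = const_part F - const_part G"
  and const_part_minus [simp]: "const_part (- F) = - const_part F"
  and const_part_0 [simp]: "const_part 0 = 0"
  by (rule ent_eqI, simp add: ent_const_part)+

lemma mcoeff_sum: "mcoeff (sum f A) m = (\<Sum>a\<in>A. mcoeff (f a) m)"
  by (induction A rule: infinite_finite_induct) auto

lemma const_part_mult [simp]: "const_part (F * G) = const_part F * const_part G"
proof (rule ent_eqI)
  fix i j
  have "ent (const_part F * const_part G) i j = (\<Sum>k\<in>{k. ent G k j \<noteq> 0}. ent (const_part F) i k * ent (const_part G) k j)"
    by (rule ent_times) (auto simp: ent_const_part)
  then show "ent (const_part (F * G)) i j = ent (const_part F * const_part G) i j"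
    by (simp add: ent_const_part ent_times_col mcoeff_sum mcoeff_const_mult)
qed

lemma const_part_smul [simp]: "const_part (c \<odot> F) = mcoeff c {#} \<odot> const_part F"
  by (rule ent_eqI) (simp add: ent_const_part mcoeff_const_mult)

lemma smul_0_left [simp]: "0 \<odot> F = 0"
  by (rule ent_eqI) simp

lemma const_part_pinj: "inj_on f A \<Longrightarrow> const_part (pinj f A) = pinj f A"
  by (rule ent_eqI) (auto simp: ent_const_part ent_pinj mcoeff_1)

lemma const_part_idm [simp]: "const_part (idm X) = idm X"
  and const_part_in1 [simp]: "const_part (in1 X) = in1 X"
  and const_part_in2 [simp]: "const_part (in2 X Y) = in2 X Y"
  by (simp_all add: idm_def in1_def in2_def const_part_pinj)

lemma const_part_tr [simp]: "const_part (tr F) = tr (const_part F)"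
  by (rule ent_eqI) (simp add: ent_const_part)

lemma const_part_pr1 [simp]: "const_part (pr1 X) = pr1 X" and const_part_pr2 [simp]: "const_part (pr2 X Y) = pr2 X Y"
  using const_part_tr[of "in1 X"] const_part_tr[of "in2 X Y"] by simp_all

lemma hm_deg1_iff: "F \<in> hm S p X Y \<Longrightarrow> F \<in> hm (deg_ge 1) p X Y \<longleftrightarrow> const_part F = 0"
proof
  assume "F \<in> hm (deg_ge 1) p X Y"
  then show "const_part F = 0" by (intro ent_eqI) (auto simp: ent_const_part deg_ge_1 dest: hm_entD(1))
next
  assume F: "F \<in> hm S p X Y" and "const_part F = 0"
  then have "mcoeff (ent F i j) {#} = 0" for i j by (metis ent_0 ent_const_part)
  then show "F \<in> hm (deg_ge 1) p X Y" using hm_zero[OF F] by (intro hmI_zero) (auto simp: deg_ge_1)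
qed

lemma const_part_hm: "F \<in> hm S p X Y \<Longrightarrow> const_part F \<in> hm UNIV p X Y"
  by (rule hmI_zero) (auto simp: ent_const_part hm_zero)

text \<open>
  Identities of modules are idempotents of the one ring of matrices, not its unit. After this
  normalization of products the block identities become ordinary ring identities, which the
  simplifier decides.
\<close>

lemma idm_absorb:
  assumes "F \<in> hm S p X Y"
  shows "idm Y * F = F" "F * idm X = F" "idm Y * (F * Z) = F * Z" "F * (idm X * Z) = F * Z"
  using hm_idm_left[OF assms] hm_idm_right[OF assms] by (simp_all flip: mult.assoc)

lemma idm_idm [simp]: "idm X * idm X = (idm X :: 'a::comm_ring_1 gmat)"
    "idm X * (idm X * Z) = (idm X * Z :: 'a::comm_ring_1 gmat)"
  by (rule idm_absorb[OF subring.hid[OF subring_UNIV]])+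

lemmas block_absorb [simp] =
  idm_absorb[OF subring.hin1[OF subring_UNIV]] idm_absorb[OF subring.hin2[OF subring_UNIV]]
  idm_absorb[OF subring.hpr1[OF subring_UNIV]] idm_absorb[OF subring.hpr2[OF subring_UNIV]]

lemmas block_simps [simp] =
  pr1_in1 pr2_in2 pr1_in2 pr2_in1 pr1_in1[THEN mult_eq_assoc] pr2_in2[THEN mult_eq_assoc]
  pr1_in2[THEN mult_eq_assoc] pr2_in1[THEN mult_eq_assoc]

lemma block_expand:
  assumes "F \<in> hm S p (sumr X X') (sumr Y Y')"
  shows "F = in1 Y * (pr1 Y * (F * in1 X)) * pr1 X + in1 Y * (pr1 Y * (F * in2 X X')) * pr2 X X' +
    in2 Y Y' * (pr2 Y Y' * (F * in1 X)) * pr1 X + in2 Y Y' * (pr2 Y Y' * (F * in2 X X')) * pr2 X X'"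
proof -
  have "F = idm (sumr Y Y') * F * idm (sumr X X')"
    by (simp add: idm_absorb[OF assms] mult.assoc)
  then show ?thesis by (simp only: in_pr[symmetric]) (simp only: algebra_simps)
qed

lemma (in subring) hsmul: "c \<in> S \<Longrightarrow> F \<in> hm S p X Y \<Longrightarrow> c \<odot> F \<in> hm S p X Y"
  by (simp add: smul_def hsc)


section \<open>Matrix factorizations as odd square roots\<close>

type_synonym 'a mfo = "(nat \<times> nat) \<times> 'a gmat"

text \<open>
  A matrix factorization is encoded as its graded rank together with the odd map \<open>Q\<close>, and its even
  cocycles are the even maps that commute with the two odd maps.
\<close>

definition mfs :: "'a set \<Rightarrow> 'a::comm_ring_1 \<Rightarrow> 'a mfo set" where
  "mfs S w = {M. snd M \<in> hm S True (fst M) (fst M) \<and> snd M * snd M = w \<odot> idm (fst M)}"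

definition cocyc :: "'a set \<Rightarrow> 'a mfo \<Rightarrow> 'a mfo \<Rightarrow> 'a::comm_ring_1 gmat set" where
  "cocyc S M N = {F \<in> hm S False (fst M) (fst N). snd N * F = F * snd M}"

definition homot :: "'a set \<Rightarrow> 'a mfo \<Rightarrow> 'a mfo \<Rightarrow> 'a::comm_ring_1 gmat \<Rightarrow> 'a gmat \<Rightarrow> bool" where
  "homot S M N F G \<longleftrightarrow> (\<exists>H\<in>hm S True (fst M) (fst N). F - G = snd N * H + H * snd M)"

definition strict_iso :: "'a set \<Rightarrow> 'a mfo \<Rightarrow> 'a mfo \<Rightarrow> 'a::comm_ring_1 gmat \<Rightarrow> bool" where
  "strict_iso S M N F \<longleftrightarrow> F \<in> cocyc S M N \<and> (\<exists>G\<in>cocyc S N M. G * F = idm (fst M) \<and> F * G = idm (fst N))"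

definition hequiv :: "'a set \<Rightarrow> 'a mfo \<Rightarrow> 'a mfo \<Rightarrow> 'a::comm_ring_1 gmat \<Rightarrow> bool" where
  "hequiv S M N F \<longleftrightarrow> F \<in> cocyc S M N \<and>
    (\<exists>G\<in>cocyc S N M. homot S M M (G * F) (idm (fst M)) \<and> homot S N N (F * G) (idm (fst N)))"

text \<open>
  \<open>Q\<close> vanishes modulo the maximal ideal. Such a matrix factorization has no contractible summands,
  and homotopies between maps of such objects vanish modulo the maximal ideal.
\<close>

definition reduced :: "'k::comm_ring_1 mpow mfo \<Rightarrow> bool" where
  "reduced M \<longleftrightarrow> const_part (snd M) = 0"

context subring begin

lemma cocyc_hm: "F \<in> cocyc S M N \<Longrightarrow> F \<in> hm S False (fst M) (fst N)"
  and cocyc_comm: "F \<in> cocyc S M N \<Longrightarrow> snd N * F = F * snd M"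
  and mfs_hm: "M \<in> mfs S w \<Longrightarrow> snd M \<in> hm S True (fst M) (fst M)"
  and mfs_sq: "M \<in> mfs S w \<Longrightarrow> snd M * snd M = w \<odot> idm (fst M)"
  by (auto simp: cocyc_def mfs_def)

lemma cocyc_id: "M \<in> mfs S w \<Longrightarrow> idm (fst M) \<in> cocyc S M M"
  by (simp add: cocyc_def hid idm_absorb[OF mfs_hm])

lemma cocyc_mult:
  assumes F: "F \<in> cocyc S L M" and G: "G \<in> cocyc S M N"
  shows "G * F \<in> cocyc S L N"
proof -
  have "snd N * (G * F) = G * F * snd L"
    by (simp add: mult_eq_assoc[OF cocyc_comm[OF G]] cocyc_comm[OF F] mult.assoc)
  moreover have "G * F \<in> hm S False (fst L) (fst N)"
    by (rule hmul[OF cocyc_hm[OF G] cocyc_hm[OF F]]) simp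
  ultimately show ?thesis by (simp add: cocyc_def)
qed

lemma cocyc_add: "F \<in> cocyc S M N \<Longrightarrow> G \<in> cocyc S M N \<Longrightarrow> F + G \<in> cocyc S M N"
  and cocyc_diff: "F \<in> cocyc S M N \<Longrightarrow> G \<in> cocyc S M N \<Longrightarrow> F - G \<in> cocyc S M N"
  by (simp_all add: cocyc_def hadd hdiff hminus algebra_simps)

lemma cocyc_smul: "c \<in> S \<Longrightarrow> F \<in> cocyc S M N \<Longrightarrow> c \<odot> F \<in> cocyc S M N"
  by (simp add: cocyc_def hsmul)

lemma htyI: "H \<in> hm S True (fst M) (fst N) \<Longrightarrow> F - G = snd N * H + H * snd M \<Longrightarrow> homot S M N F G"
  by (auto simp: homot_def)

lemma homot_refl [simp]: "homot S M N F F"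
  by (rule htyI[OF h0]) simp

lemma homot_sym:
  assumes "homot S M N F G" shows "homot S M N G F"
proof -
  obtain H where H: "H \<in> hm S True (fst M) (fst N)" "F - G = snd N * H + H * snd M"
    using assms by (auto simp: homot_def)
  have "G - F = - (F - G)" by simp
  also have "\<dots> = snd N * (- H) + (- H) * snd M" unfolding H(2) by simp
  finally show ?thesis by (rule htyI[OF hminus[OF H(1)]])
qed

lemma homot_trans:
  assumes "homot S M N F G" "homot S M N G K" shows "homot S M N F K"
proof -
  obtain H H' where H: "H \<in> hm S True (fst M) (fst N)" "F - G = snd N * H + H * snd M"
    "H' \<in> hm S True (fst M) (fst N)" "G - K = snd N * H' + H' * snd M"
    using assms by (auto simp: homot_def)
  have "F - K = (F - G) + (G - K)" by simp
  also have "\<dots> = snd N * (H + H') + (H + H') * snd M" unfolding H by (simp add: algebra_simps)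
  finally show ?thesis by (rule htyI[OF hadd[OF H(1,3)]])
qed

lemma homot_add:
  assumes "homot S M N F G" "homot S M N F' G'" shows "homot S M N (F + F') (G + G')"
proof -
  obtain H H' where H: "H \<in> hm S True (fst M) (fst N)" "F - G = snd N * H + H * snd M"
    "H' \<in> hm S True (fst M) (fst N)" "F' - G' = snd N * H' + H' * snd M"
    using assms by (auto simp: homot_def)
  have "F + F' - (G + G') = (F - G) + (F' - G')" by simp
  also have "\<dots> = snd N * (H + H') + (H + H') * snd M" unfolding H by (simp add: algebra_simps)
  finally show ?thesis by (rule htyI[OF hadd[OF H(1,3)]])
qed

lemma homot_smul:
  assumes "c \<in> S" "homot S M N F G" shows "homot S M N (c \<odot> F) (c \<odot> G)"
proof -
  obtain H where H: "H \<in> hm S True (fst M) (fst N)" "F - G = snd N * H + H * snd M"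
    using assms by (auto simp: homot_def)
  have "c \<odot> F - c \<odot> G = snd N * (c \<odot> H) + (c \<odot> H) * snd M"
    using arg_cong[OF H(2), of "\<lambda>Z. c \<odot> Z"] by (simp add: smul_simps)
  then show ?thesis by (rule htyI[OF hsmul[OF assms(1) H(1)]])
qed

lemma homot_mult_left:
  assumes "homot S L M F G" "K \<in> cocyc S M N" shows "homot S L N (K * F) (K * G)"
proof -
  obtain H where H: "H \<in> hm S True (fst L) (fst M)" "F - G = snd M * H + H * snd L"
    using assms by (auto simp: homot_def)
  have "K * F - K * G = K * (F - G)" by (simp add: algebra_simps)
  also have "\<dots> = snd N * (K * H) + (K * H) * snd L"
    unfolding H(2) by (simp add: algebra_simps mult_eq_assoc[OF cocyc_comm[OF assms(2)]])
  finally show ?thesis by (rule htyI[OF hmul[OF cocyc_hm[OF assms(2)] H(1)], rotated]) simp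
qed

lemma homot_mult_right:
  assumes "homot S M N F G" "K \<in> cocyc S L M" shows "homot S L N (F * K) (G * K)"
proof -
  obtain H where H: "H \<in> hm S True (fst M) (fst N)" "F - G = snd N * H + H * snd M"
    using assms by (auto simp: homot_def)
  have "F * K - G * K = (F - G) * K" by (simp add: algebra_simps)
  also have "\<dots> = snd N * (H * K) + (H * K) * snd L"
    unfolding H(2) by (simp add: algebra_simps cocyc_comm[OF assms(2)])
  finally show ?thesis by (rule htyI[OF hmul[OF H(1) cocyc_hm[OF assms(2)]], rotated]) simp
qed

lemma homot_mult:
  assumes "homot S L M F F'" "homot S M N G G'" "F \<in> cocyc S L M" "G' \<in> cocyc S M N"
  shows "homot S L N (G * F) (G' * F')"
  using homot_trans[OF homot_mult_right[OF assms(2,3)] homot_mult_left[OF assms(1,4)]] .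

lemma strict_iso_hequiv: "strict_iso S M N F \<Longrightarrow> hequiv S M N F"
  unfolding strict_iso_def hequiv_def by (metis homot_refl)

lemma hequiv_cocyc: "hequiv S M N F \<Longrightarrow> F \<in> cocyc S M N"
  by (simp add: hequiv_def)

lemma hequiv_homot:
  assumes F: "hequiv S M N F" and FG: "homot S M N F G" and G: "G \<in> cocyc S M N"
  shows "hequiv S M N G"
proof -
  obtain K where K: "K \<in> cocyc S N M" "homot S M M (K * F) (idm (fst M))" "homot S N N (F * K) (idm (fst N))"
    using F by (auto simp: hequiv_def)
  have "homot S M M (K * G) (idm (fst M))" "homot S N N (G * K) (idm (fst N))"
    using homot_trans[OF homot_mult_left[OF homot_sym[OF FG] K(1)] K(2)]
      homot_trans[OF homot_mult_right[OF homot_sym[OF FG] K(1)] K(3)] .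
  with G K(1) show ?thesis by (auto simp: hequiv_def)
qed

lemma hequiv_comp:
  assumes "hequiv S L M F" "hequiv S M N G" "L \<in> mfs S w" "M \<in> mfs S w" "N \<in> mfs S w"
  shows "hequiv S L N (G * F)"
proof -
  obtain F' where F': "F' \<in> cocyc S M L" "homot S L L (F' * F) (idm (fst L))" "homot S M M (F * F') (idm (fst M))"
    using assms(1) by (auto simp: hequiv_def)
  obtain G' where G': "G' \<in> cocyc S N M" "homot S M M (G' * G) (idm (fst M))" "homot S N N (G * G') (idm (fst N))"
    using assms(2) by (auto simp: hequiv_def)
  note F = hequiv_cocyc[OF assms(1)] and G = hequiv_cocyc[OF assms(2)]
  have "homot S L L (F' * (G' * G * F)) (F' * (idm (fst M) * F))"
    by (rule homot_mult_left[OF homot_mult_right[OF G'(2) F] F'(1)])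
  then have 1: "homot S L L (F' * G' * (G * F)) (idm (fst L))"
    using homot_trans[OF _ F'(2)] by (simp add: mult.assoc idm_absorb[OF cocyc_hm[OF F]])
  have "homot S N N (G * (F * F' * G')) (G * (idm (fst M) * G'))"
    by (rule homot_mult_left[OF homot_mult_right[OF F'(3) G'(1)] G])
  then have 2: "homot S N N (G * F * (F' * G')) (idm (fst N))"
    using homot_trans[OF _ G'(3)] by (simp add: mult.assoc idm_absorb[OF cocyc_hm[OF G'(1)]])
  show ?thesis using 1 2 cocyc_mult[OF F G] cocyc_mult[OF G'(1) F'(1)] by (auto simp: hequiv_def)
qed

lemma strict_iso_comp:
  assumes "strict_iso S L M F" "strict_iso S M N G"
  shows "strict_iso S L N (G * F)"
proof -
  obtain F' where F': "F' \<in> cocyc S M L" "F' * F = idm (fst L)" "F * F' = idm (fst M)"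
    using assms(1) by (auto simp: strict_iso_def)
  obtain G' where G': "G' \<in> cocyc S N M" "G' * G = idm (fst M)" "G * G' = idm (fst N)"
    using assms(2) by (auto simp: strict_iso_def)
  have F: "F \<in> cocyc S L M" and G: "G \<in> cocyc S M N" using assms by (auto simp: strict_iso_def)
  have "F' * G' * (G * F) = idm (fst L)"
    by (simp add: mult.assoc mult_eq_assoc[OF G'(2)] idm_absorb[OF cocyc_hm[OF F]] F')
  moreover have "G * F * (F' * G') = idm (fst N)"
    by (simp add: mult.assoc mult_eq_assoc[OF F'(3)] idm_absorb[OF cocyc_hm[OF G'(1)]] G')
  ultimately show ?thesis using cocyc_mult[OF F G] cocyc_mult[OF G'(1) F'(1)] by (auto simp: strict_iso_def)
qed

lemma hequiv_id: "M \<in> mfs S w \<Longrightarrow> hequiv S M M (idm (fst M))"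
  unfolding hequiv_def by (intro conjI bexI[of _ "idm (fst M)"]) (simp_all add: cocyc_id)

end

lemma homot_reduced:
  assumes "reduced M" "reduced N" "homot S M N F G"
  shows "const_part F = const_part G"
proof -
  obtain H where "F - G = snd N * H + H * snd M" using assms by (auto simp: homot_def)
  then have "const_part (F - G) = 0" using assms by (simp add: reduced_def)
  then show ?thesis by simp
qed

text \<open>
  By \<open>inverse_lifting\<close> an inverse modulo the maximal ideal suffices. It does not have to be a
  cocycle, since the strict inverse of a cocycle is one automatically.
\<close>

lemma strict_iso_from_const_part:
  fixes M N :: "'k::field mpow mfo"
  assumes F: "F \<in> cocyc (series_in V) M N"
    and MN: "M \<in> mfs (series_in V) w" "N \<in> mfs (series_in V) w"
    and G: "G \<in> hm (series_in V) False (fst N) (fst M)"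
    and inv: "const_part F * const_part G = idm (fst N)" "const_part G * const_part F = idm (fst M)"
  shows "strict_iso (series_in V) M N F"
proof -
  interpret subring "series_in V :: 'k mpow set" by (rule subring_series_in)
  note F' = cocyc_hm[OF F]
  have FG: "idm (fst N) - F * G \<in> hm (series_in V) False (fst N) (fst N)"
    "idm (fst M) - G * F \<in> hm (series_in V) False (fst M) (fst M)"
    by (auto intro!: hm_intros F' G)
  have "idm (fst N) - F * G \<in> hm (deg_ge 1) False (fst N) (fst N)"
    "idm (fst M) - G * F \<in> hm (deg_ge 1) False (fst M) (fst M)"
    unfolding hm_deg1_iff[OF FG(1)] hm_deg1_iff[OF FG(2)] by (simp_all add: inv)
  then obtain C where C: "C \<in> hm (series_in V) False (fst N) (fst M)" "F * C = idm (fst N)" "C * F = idm (fst M)"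
    using inverse_lifting[OF F' G] by blast
  have "snd M * C = C * F * (snd M * C)"
    by (simp add: C(3) idm_absorb[OF mfs_hm[OF MN(1)]])
  also have "\<dots> = C * (snd N * (F * C))"
    by (simp add: mult.assoc mult_eq_assoc[OF cocyc_comm[OF F]])
  also have "\<dots> = C * snd N" by (simp add: C(2) idm_absorb[OF mfs_hm[OF MN(2)]])
  finally have "C \<in> cocyc (series_in V) N M" using C(1) by (simp add: cocyc_def)
  with F C show ?thesis by (auto simp: strict_iso_def)
qed

lemma hequiv_reduced_strict_iso:
  fixes M N :: "'k::field mpow mfo"
  assumes F: "hequiv (series_in V) M N F"
    and MN: "M \<in> mfs (series_in V) w" "N \<in> mfs (series_in V) w" "reduced M" "reduced N"
  shows "strict_iso (series_in V) M N F"
proof -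
  interpret subring "series_in V :: 'k mpow set" by (rule subring_series_in)
  obtain G where G: "G \<in> cocyc (series_in V) N M" "homot (series_in V) M M (G * F) (idm (fst M))"
    "homot (series_in V) N N (F * G) (idm (fst N))" using F by (auto simp: hequiv_def)
  show ?thesis
    using homot_reduced[OF MN(3,3) G(2)] homot_reduced[OF MN(4,4) G(3)]
    by (intro strict_iso_from_const_part[OF hequiv_cocyc[OF F] MN(1,2) cocyc_hm[OF G(1)]]) simp_all
qed

text \<open>
  \<open>reduce_idempotent\<close> starts from the identity: it yields a homotopic idempotent on whose image \<open>Q\<close>
  is small, and that image is free.
\<close>

lemma reduction:
  fixes N :: "'k::field mpow mfo"
  assumes N: "N \<in> mfs (series_in V) w"
  shows "\<exists>M\<in>mfs (series_in V) w. reduced M \<and> (\<exists>F. hequiv (series_in V) M N F)"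
proof -
  interpret subring "series_in V :: 'k mpow set" by (rule subring_series_in)
  obtain X Q where NXQ: "N = (X, Q)" by (cases N)
  have Q: "Q \<in> hm (series_in V) True X X" "Q * Q = w \<odot> idm X"
    using mfs_hm[OF N] mfs_sq[OF N] by (auto simp: NXQ)
  obtain E H where E: "E \<in> hm (series_in V) False X X" "H \<in> hm (series_in V) True X X"
    "E * E = E" "E * Q = Q * E" "idm X - E = Q * H + H * Q" "Q * E \<in> hm (deg_ge 1) True X X"
  proof -
    have "idm X * Q = Q * idm X" by (simp add: idm_absorb[OF Q(1)])
    from reduce_idempotent[OF hid idm_idm(1) this Q(1) Q(2)[unfolded smul_def]] show ?thesis
      using that by (elim bexE conjE)
  qed
  obtain Y f p where f: "f \<in> hm (series_in V) False Y X" and p: "p \<in> hm (series_in V) False X Y"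
    and fp: "f * p = E" and pf: "p * f = idm Y"
    using idempotent_splits[OF E(1,3)] by blast
  note fp' = mult_eq_assoc[OF fp] and pf' = mult_eq_assoc[OF pf]
  have Ef: "E * f = f" and pE: "p * E = p"
    by (simp_all add: mult.assoc pf flip: fp) (simp_all add: pf' idm_absorb[OF f] idm_absorb[OF p])
  define M where "M = (Y, p * (Q * f))"
  have QQ: "Q * (Q * Z) = w \<odot> (idm X * Z)" for Z by (simp add: mult_eq_assoc[OF Q(2)])
  have sq: "p * (Q * f) * (p * (Q * f)) = w \<odot> idm Y"
  proof -
    have "p * (Q * f) * (p * (Q * f)) = p * (Q * (E * (Q * f)))" by (simp add: mult.assoc fp')
    also have "\<dots> = p * (E * (Q * (Q * f)))" by (simp add: mult_eq_assoc[OF E(4)] mult.assoc)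
    finally show ?thesis by (simp add: mult_eq_assoc[OF pE] QQ idm_absorb[OF f] pf)
  qed
  have "p * (Q * f) \<in> hm (series_in V) True Y Y"
    by (rule hmul[OF p hmul[OF Q(1) f refl]]) simp
  then have M: "M \<in> mfs (series_in V) w" using sq by (simp add: mfs_def M_def)
  have "const_part (Q * E) = 0" using hm_deg1_iff[OF hmul[OF Q(1) E(1) refl]] E(6) by simp
  then have "const_part (p * (Q * E * f)) = 0" by (simp only: const_part_mult) (simp only: mult_zero_left mult_zero_right)
  then have "reduced M" by (simp add: reduced_def M_def mult.assoc Ef)
  moreover have "hequiv (series_in V) M N f"
  proof -
    have "f \<in> cocyc (series_in V) M N" using f
      by (simp add: cocyc_def M_def NXQ fp' mult_eq_assoc[OF E(4)] mult.assoc Ef)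
    moreover have "p \<in> cocyc (series_in V) N M" using p
      by (simp add: cocyc_def M_def NXQ mult.assoc fp mult_eq_assoc[OF pE] flip: E(4))
    moreover have "homot (series_in V) N N (f * p) (idm X)"
      by (rule homot_sym, rule htyI[of H]) (simp_all add: NXQ E fp)
    ultimately show ?thesis unfolding hequiv_def
      by (intro conjI bexI[of _ p]) (simp_all add: M_def NXQ pf)
  qed
  ultimately show ?thesis using M by blast
qed


section \<open>The Knoerrer functor\<close>

definition kmat :: "'a::comm_ring_1 \<Rightarrow> 'a \<Rightarrow> nat \<times> nat \<Rightarrow> 'a gmat \<Rightarrow> 'a gmat" where
  "kmat x y X Q = in1 X * Q * pr1 X - in2 X X * Q * pr2 X X +
    x \<odot> (in2 X X * pr1 X) - y \<odot> (in1 X * pr2 X X)"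

definition kn :: "'a::comm_ring_1 \<Rightarrow> 'a \<Rightarrow> 'a mfo \<Rightarrow> 'a mfo" where
  "kn x y M = (sumr (fst M) (fst M), kmat x y (fst M) (snd M))"

definition kn_mor :: "nat \<times> nat \<Rightarrow> nat \<times> nat \<Rightarrow> 'a::comm_ring_1 gmat \<Rightarrow> 'a gmat" where
  "kn_mor X Y F = in1 Y * F * pr1 X + in2 Y Y * F * pr2 X X"

lemma fst_kn [simp]: "fst (kn x y M) = sumr (fst M) (fst M)"
  and snd_kn [simp]: "snd (kn x y M) = kmat x y (fst M) (snd M)"
  by (simp_all add: kn_def)

lemma kmat_rules:
  assumes "Q \<in> hm S p X X"
  shows "pr1 X * kmat x y X Q = Q * pr1 X - y \<odot> pr2 X X"
    and "pr2 X X * kmat x y X Q = x \<odot> pr1 X - Q * pr2 X X"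
    and "kmat x y X Q * in1 X = in1 X * Q + x \<odot> in2 X X"
    and "kmat x y X Q * in2 X X = - (in2 X X * Q) - y \<odot> in1 X"
  unfolding kmat_def by (simp_all add: algebra_simps idm_absorb[OF assms] smul_simps)

lemma kn_mor_rules:
  assumes "F \<in> hm S p X Y"
  shows "pr1 Y * kn_mor X Y F = F * pr1 X" "pr2 Y Y * kn_mor X Y F = F * pr2 X X"
    and "kn_mor X Y F * in1 X = in1 Y * F" "kn_mor X Y F * in2 X X = in2 Y Y * F"
  unfolding kn_mor_def by (simp_all add: algebra_simps idm_absorb[OF assms])

lemma kn_mor_comp:
  assumes "G \<in> hm S p Y Z" "F \<in> hm S' q X Y"
  shows "kn_mor Y Z G * kn_mor X Y F = kn_mor X Z (G * F)"
  unfolding kn_mor_def by (simp add: algebra_simps idm_absorb[OF assms(1)] idm_absorb[OF assms(2)])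

lemma kn_mor_id: "kn_mor X X (idm X) = idm (sumr X X)"
  unfolding kn_mor_def in_pr[symmetric] by (simp add: mult.assoc)

lemma kn_mor_diff: "kn_mor X Y (F - G) = kn_mor X Y F - kn_mor X Y G"
  by (simp add: kn_mor_def algebra_simps)

lemma block_ext:
  assumes "F \<in> hm S p (sumr X X') (sumr Y Y')" "G \<in> hm S' p' (sumr X X') (sumr Y Y')"
    and "pr1 Y * (F * in1 X) = pr1 Y * (G * in1 X)" "pr1 Y * (F * in2 X X') = pr1 Y * (G * in2 X X')"
    and "pr2 Y Y' * (F * in1 X) = pr2 Y Y' * (G * in1 X)" "pr2 Y Y' * (F * in2 X X') = pr2 Y Y' * (G * in2 X X')"
  shows "F = G"
  by (subst block_expand[OF assms(1)], subst block_expand[OF assms(2)]) (simp only: assms(3-6))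

context subring begin

lemma hblk:
  shows "F \<in> hm S p X Y \<Longrightarrow> in1 Y * (F * pr1 X) \<in> hm S p (sumr X X') (sumr Y Y')"
    and "F \<in> hm S q X' Y \<Longrightarrow> p = (\<not> q) \<Longrightarrow> in1 Y * (F * pr2 X X') \<in> hm S p (sumr X X') (sumr Y Y')"
    and "F \<in> hm S q X Y' \<Longrightarrow> p = (\<not> q) \<Longrightarrow> in2 Y Y' * (F * pr1 X) \<in> hm S p (sumr X X') (sumr Y Y')"
    and "F \<in> hm S p X' Y' \<Longrightarrow> in2 Y Y' * (F * pr2 X X') \<in> hm S p (sumr X X') (sumr Y Y')"
  by (rule hmul[OF hin1 hmul[OF _ hpr1 refl]] hmul[OF hin1 hmul[OF _ hpr2 refl]]
      hmul[OF hin2 hmul[OF _ hpr1 refl]] hmul[OF hin2 hmul[OF _ hpr2 refl]], assumption, simp)+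

lemma hext:
  assumes "F \<in> hm S p (sumr X X') (sumr Y Y')"
  shows "pr1 Y * (F * in1 X) \<in> hm S p X Y"
    and "q = (\<not> p) \<Longrightarrow> pr1 Y * (F * in2 X X') \<in> hm S q X' Y"
    and "q = (\<not> p) \<Longrightarrow> pr2 Y Y' * (F * in1 X) \<in> hm S q X Y'"
    and "pr2 Y Y' * (F * in2 X X') \<in> hm S p X' Y'"
  by (rule hmul[OF hpr1 hmul[OF assms hin1 refl]] hmul[OF hpr1 hmul[OF assms hin2 refl]]
      hmul[OF hpr2 hmul[OF assms hin1 refl]] hmul[OF hpr2 hmul[OF assms hin2 refl]], simp)+

lemma kmat_hm:
  assumes "Q \<in> hm S True X X" "x \<in> S" "y \<in> S"
  shows "kmat x y X Q \<in> hm S True (sumr X X) (sumr X X)"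
proof -
  have "in2 X X * pr1 X \<in> hm S True (sumr X X) (sumr X X)" "in1 X * pr2 X X \<in> hm S True (sumr X X) (sumr X X)"
    using hblk(3)[OF hid, of True X X X] hblk(2)[OF hid, of True X X X] by simp_all
  then show ?thesis unfolding kmat_def mult.assoc
    by (intro hdiff hadd hsmul hblk(1,4) assms)
qed

lemma kn_mor_hm: "F \<in> hm S p X Y \<Longrightarrow> kn_mor X Y F \<in> hm S p (sumr X X) (sumr Y Y)"
  unfolding kn_mor_def mult.assoc by (intro hadd hblk(1,4))

lemma cocyc_boundary:
  assumes H: "H \<in> hm S True (fst M) (fst N)" and M: "M \<in> mfs S w" and N: "N \<in> mfs S w"
  shows "snd N * H + H * snd M \<in> cocyc S M N"
proof -
  have "snd N * (snd N * H + H * snd M) = (snd N * H + H * snd M) * snd M"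
    by (simp add: algebra_simps mult_eq_assoc[OF mfs_sq[OF N]] mfs_sq[OF M] idm_absorb[OF H])
  moreover have "snd N * H + H * snd M \<in> hm S False (fst M) (fst N)"
    by (intro hadd hmul[OF mfs_hm[OF N] H] hmul[OF H mfs_hm[OF M]]) simp_all
  ultimately show ?thesis by (simp add: cocyc_def)
qed

lemma kn_mfs:
  assumes M: "M \<in> mfs S w" and xy: "x \<in> S" "y \<in> S"
  shows "kn x y M \<in> mfs S (w - x * y)"
proof -
  note Q = mfs_hm[OF M]
  have "kmat x y (fst M) (snd M) * kmat x y (fst M) (snd M) = (w - x * y) \<odot> idm (sumr (fst M) (fst M))"
    by (rule block_ext[OF hmul[OF kmat_hm[OF Q xy] kmat_hm[OF Q xy] refl] hm_mono[OF _ subset_UNIV]])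
      (rule subring.hsmul[OF subring_UNIV UNIV_I subring.hid[OF subring_UNIV]],
       simp_all add: mult.assoc kmat_rules[OF Q] kmat_rules[OF Q, THEN mult_eq_assoc] algebra_simps
         idm_absorb[OF Q] mfs_sq[OF M] smul_simps smul_diff_left)
  then show ?thesis using kmat_hm[OF Q xy] by (simp add: mfs_def)
qed

lemma kn_mor_cocyc:
  assumes F: "F \<in> cocyc S M N" and M: "M \<in> mfs S w" and N: "N \<in> mfs S w" and xy: "x \<in> S" "y \<in> S"
  shows "kn_mor (fst M) (fst N) F \<in> cocyc S (kn x y M) (kn x y N)"
proof -
  note F' = cocyc_hm[OF F] and Q = mfs_hm[OF M] and P = mfs_hm[OF N]
  have "kmat x y (fst N) (snd N) * kn_mor (fst M) (fst N) F = kn_mor (fst M) (fst N) F * kmat x y (fst M) (snd M)"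
    unfolding kmat_def kn_mor_def
    by (simp add: algebra_simps idm_absorb[OF F'] idm_absorb[OF Q] idm_absorb[OF P] cocyc_comm[OF F]
        mult_eq_assoc[OF cocyc_comm[OF F]] smul_simps)
  then show ?thesis using kn_mor_hm[OF F'] by (simp add: cocyc_def)
qed

lemma kn_mor_homot:
  assumes "homot S M N F G" and M: "M \<in> mfs S w" and N: "N \<in> mfs S w"
  shows "homot S (kn x y M) (kn x y N) (kn_mor (fst M) (fst N) F) (kn_mor (fst M) (fst N) G)"
proof -
  obtain H where H: "H \<in> hm S True (fst M) (fst N)" "F - G = snd N * H + H * snd M"
    using assms(1) by (auto simp: homot_def)
  define K where "K = in1 (fst N) * H * pr1 (fst M) - in2 (fst N) (fst N) * H * pr2 (fst M) (fst M)"
  have "K \<in> hm S True (fst (kn x y M)) (fst (kn x y N))"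
    unfolding K_def mult.assoc fst_kn by (intro hdiff hblk(1,4) H(1))
  moreover have "kn_mor (fst M) (fst N) F - kn_mor (fst M) (fst N) G =
      kn_mor (fst M) (fst N) (snd N * H + H * snd M)"
    by (simp only: kn_mor_diff[symmetric] H(2))
  moreover have "\<dots> = snd (kn x y N) * K + K * snd (kn x y M)"
    unfolding snd_kn K_def kmat_def kn_mor_def
    by (simp add: algebra_simps idm_absorb[OF H(1)] idm_absorb[OF mfs_hm[OF M]] idm_absorb[OF mfs_hm[OF N]]
        smul_simps)
  ultimately show ?thesis by (intro htyI[of K]) simp_all
qed

end

text \<open>
  The rings \<open>R \<subseteq> T\<^sub>0 = R[[y]] \<subseteq> T = R[[x, y]]\<close> enter only through the decompositions
  \<open>T = T\<^sub>0 \<oplus> x T\<close> and \<open>T\<^sub>0 = R \<oplus> y T\<^sub>0\<close>.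
\<close>

locale knoerrer =
  R: subring R + T0: subring T0 + T: subring T for R T0 T :: "'a::comm_ring_1 set" +
  fixes x y :: 'a
  assumes adjoin_y: "adjoins y R T0" and adjoin_x: "adjoins x T0 T"
begin

lemma sub: "R \<subseteq> T0" "T0 \<subseteq> T" "R \<subseteq> T" "x \<in> T" "y \<in> T" "y \<in> T0"
  using adjoin_x adjoin_y by (auto simp: adjoins_def)

lemma split_x:
  assumes "F \<in> hm T p X Y"
  obtains F0 F1 where "F0 \<in> hm T0 p X Y" "F1 \<in> hm T p X Y" "F = F0 + x \<odot> F1"
  using hm_decompose[OF adjoin_x T0.subring_axioms T.subring_axioms assms] unfolding smul_def .

lemma split_y:
  assumes "F \<in> hm T0 p X Y"
  obtains F0 F1 where "F0 \<in> hm R p X Y" "F1 \<in> hm T0 p X Y" "F = F0 + y \<odot> F1"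
  using hm_decompose[OF adjoin_y R.subring_axioms T0.subring_axioms assms] unfolding smul_def .

lemma unique_x:
  assumes "F0 \<in> hm T0 p X Y" "F1 \<in> hm T p X Y" "F0 + x \<odot> F1 = 0"
  shows "F0 = 0" "F1 = 0"
  using hm_decompose_unique[OF adjoin_x assms(1,2)] assms(3) by (simp_all add: smul_def)

lemma unique_y:
  assumes "F0 \<in> hm R p X Y" "F1 \<in> hm T0 p X Y" "F0 + y \<odot> F1 = 0"
  shows "F0 = 0" "F1 = 0"
  using hm_decompose_unique[OF adjoin_y assms(1,2)] assms(3) by (simp_all add: smul_def)

lemma RT0: "F \<in> hm R p X Y \<Longrightarrow> F \<in> hm T0 p X Y" and RT: "F \<in> hm R p X Y \<Longrightarrow> F \<in> hm T p X Y"
  and T0T: "F \<in> hm T0 p X Y \<Longrightarrow> F \<in> hm T p X Y"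
  using hm_mono sub by blast+

text \<open>
  The component \<open>f\<close> is the value at \<open>x = y = 0\<close>; its uniqueness is what turns an identity over
  \<open>R[[x, y]]\<close> into one over \<open>R\<close>.
\<close>

lemma split_xy:
  assumes "F \<in> hm T p X Y"
  obtains f a b where "f \<in> hm R p X Y" "b \<in> hm T0 p X Y" "a \<in> hm T p X Y" "F = f + y \<odot> b + x \<odot> a"
  using split_x[OF assms] split_y by metis

lemma unique_xy:
  assumes f: "f \<in> hm R p X Y" and b: "b \<in> hm T p X Y" and a: "a \<in> hm T p X Y"
    and 0: "f + y \<odot> b + x \<odot> a = 0"
  shows "f = 0"
proof -
  obtain b0 b1 where b01: "b0 \<in> hm T0 p X Y" "b1 \<in> hm T p X Y" "b = b0 + x \<odot> b1"
    by (rule split_x[OF b])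
  have "(f + y \<odot> b0) + x \<odot> (y \<odot> b1 + a) = 0"
    using 0 unfolding b01(3) by (simp add: smul_simps algebra_simps)
  moreover have "f + y \<odot> b0 \<in> hm T0 p X Y" "y \<odot> b1 + a \<in> hm T p X Y"
    by (intro T0.hadd T0.hsmul T.hadd T.hsmul RT0 f b01 a sub)+
  ultimately have "f + y \<odot> b0 = 0" using unique_x(1) by blast
  then show ?thesis using unique_y(1)[OF f b01(1)] by blast
qed

lemma mfs_RT: "M \<in> mfs R w \<Longrightarrow> M \<in> mfs T w"
  by (simp add: mfs_def RT)

lemma cocyc_RT: "F \<in> cocyc R M N \<Longrightarrow> F \<in> cocyc T M N"
  by (simp add: cocyc_def RT)

lemma homot_RT: "homot R M N F G \<Longrightarrow> homot T M N F G"
  unfolding homot_def using RT by blast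

text \<open>
  The upper left block of a homotopy, put to \<open>x = y = 0\<close>, is a homotopy over \<open>R\<close>.
\<close>

lemma kn_faithful:
  assumes F: "F \<in> cocyc R M N" and G: "G \<in> cocyc R M N" and M: "M \<in> mfs R w" and N: "N \<in> mfs R w"
    and homot: "homot T (kn x y M) (kn x y N) (kn_mor (fst M) (fst N) F) (kn_mor (fst M) (fst N) G)"
  shows "homot R M N F G"
proof -
  let ?X = "fst M" and ?Y = "fst N" and ?Q = "snd M" and ?P = "snd N"
  note Q = R.mfs_hm[OF M] and P = R.mfs_hm[OF N]
  have FG: "F - G \<in> hm R False ?X ?Y" using R.cocyc_hm[OF R.cocyc_diff[OF F G]] .
  obtain H where H: "H \<in> hm T True (sumr ?X ?X) (sumr ?Y ?Y)"
    "kn_mor ?X ?Y (F - G) = kmat x y ?Y ?P * H + H * kmat x y ?X ?Q"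
    using homot by (auto simp: homot_def kn_mor_diff)
  define H11 H12 H21 where "H11 = pr1 ?Y * (H * in1 ?X)" and "H12 = pr1 ?Y * (H * in2 ?X ?X)"
    and "H21 = pr2 ?Y ?Y * (H * in1 ?X)"
  have HH: "H11 \<in> hm T True ?X ?Y" "H12 \<in> hm T False ?X ?Y" "H21 \<in> hm T False ?X ?Y"
    unfolding H11_def H12_def H21_def
    by (rule T.hmul[OF T.hpr1 T.hmul[OF H(1) T.hin1 refl]] T.hmul[OF T.hpr1 T.hmul[OF H(1) T.hin2 refl]]
        T.hmul[OF T.hpr2 T.hmul[OF H(1) T.hin1 refl]]; simp)+
  have "pr1 ?Y * (kn_mor ?X ?Y (F - G) * in1 ?X) = pr1 ?Y * ((kmat x y ?Y ?P * H + H * kmat x y ?X ?Q) * in1 ?X)"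
    by (simp only: H(2))
  then have eq: "F - G = ?P * H11 - y \<odot> H21 + H11 * ?Q + x \<odot> H12"
    unfolding H11_def H12_def H21_def
    by (simp only: kn_mor_rules[OF FG])
      (simp add: algebra_simps kmat_rules[OF Q] kmat_rules[OF P, THEN mult_eq_assoc] smul_simps
        idm_absorb[OF R.cocyc_hm[OF F]] idm_absorb[OF R.cocyc_hm[OF G]])
  obtain h a b where h: "h \<in> hm R True ?X ?Y" and b: "b \<in> hm T0 True ?X ?Y" and a: "a \<in> hm T True ?X ?Y"
    and H11: "H11 = h + y \<odot> b + x \<odot> a" by (rule split_xy[OF HH(1)])
  have "(F - G - (?P * h + h * ?Q)) + y \<odot> (H21 - ?P * b - b * ?Q) + x \<odot> (- H12 - ?P * a - a * ?Q) = 0"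
    using eq unfolding H11 by (simp add: algebra_simps smul_simps)
  then have "F - G - (?P * h + h * ?Q) = 0"
    by (rule unique_xy[rotated 3, where p = False and X = ?X and Y = ?Y])
      (rule R.hdiff FG R.hadd R.hmul[OF P h] R.hmul[OF h Q] T.hdiff HH T.hmul[OF RT[OF P] T0T[OF b]]
        T.hmul[OF T0T[OF b] RT[OF Q]] T.hminus T.hmul[OF RT[OF P] a] T.hmul[OF a RT[OF Q]] | simp)+
  then show ?thesis by (intro R.htyI[OF h]) simp
qed

text \<open>
  The upper left block of \<open>F\<close> at \<open>x = y = 0\<close> is a cocycle \<open>f\<close> over \<open>R\<close>. The part of the block that is
  divisible by \<open>x\<close> or \<open>y\<close> is the corresponding block of a boundary. What then remains has upper left
  block zero, and comparing coefficients of \<open>x\<close> shows that it is itself the boundary of a map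
  concentrated in the lower right block.
\<close>

lemma kn_full:
  assumes F: "F \<in> cocyc T (kn x y M) (kn x y N)" and M: "M \<in> mfs R w" and N: "N \<in> mfs R w"
  shows "\<exists>f\<in>cocyc R M N. homot T (kn x y M) (kn x y N) (kn_mor (fst M) (fst N) f) F"
proof -
  let ?X = "fst M" and ?Y = "fst N" and ?Q = "snd M" and ?P = "snd N"
  let ?KM = "kmat x y ?X ?Q" and ?KN = "kmat x y ?Y ?P"
  note Q = R.mfs_hm[OF M] and P = R.mfs_hm[OF N]
  have kM: "kn x y M \<in> mfs T (w - x * y)" and kN: "kn x y N \<in> mfs T (w - x * y)"
    by (intro T.kn_mfs mfs_RT M N sub)+
  note Qr = kmat_rules[OF Q] kmat_rules(3,4)[OF Q, THEN mult_eq_assoc]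
  note Pr = kmat_rules(1,2)[OF P, THEN mult_eq_assoc]
  have F': "F \<in> hm T False (sumr ?X ?X) (sumr ?Y ?Y)" using T.cocyc_hm[OF F] by simp
  define F11 F12 F21 where "F11 = pr1 ?Y * (F * in1 ?X)" and "F12 = pr1 ?Y * (F * in2 ?X ?X)"
    and "F21 = pr2 ?Y ?Y * (F * in1 ?X)"
  have FF: "F11 \<in> hm T False ?X ?Y" "F12 \<in> hm T True ?X ?Y" "F21 \<in> hm T True ?X ?Y"
    unfolding F11_def F12_def F21_def by (intro T.hext[OF F'] | simp)+
  have "pr1 ?Y * (?KN * F * in1 ?X) = pr1 ?Y * (F * ?KM * in1 ?X)"
    using T.cocyc_comm[OF F] by simp
  then have eq: "?P * F11 - y \<odot> F21 = F11 * ?Q + x \<odot> F12"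
    unfolding F11_def F12_def F21_def by (simp add: algebra_simps Qr Pr smul_simps)
  obtain f a b where f: "f \<in> hm R False ?X ?Y" and b: "b \<in> hm T0 False ?X ?Y" and a: "a \<in> hm T False ?X ?Y"
    and F11: "F11 = f + y \<odot> b + x \<odot> a" by (rule split_xy[OF FF(1)])
  have "(?P * f - f * ?Q) + y \<odot> (?P * b - b * ?Q - F21) + x \<odot> (?P * a - a * ?Q - F12) = 0"
    using eq unfolding F11 by (simp add: algebra_simps smul_simps)
  then have "?P * f - f * ?Q = 0"
    by (rule unique_xy[rotated 3, where p = True and X = ?X and Y = ?Y])
      (rule R.hdiff R.hmul[OF P f] R.hmul[OF f Q] T.hdiff FF T.hmul[OF RT[OF P] T0T[OF b]]
        T.hmul[OF T0T[OF b] RT[OF Q]] T.hmul[OF RT[OF P] a] T.hmul[OF a RT[OF Q]] | simp)+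
  then have fz: "f \<in> cocyc R M N" using f by (simp add: cocyc_def)
  define H where "H = in1 ?Y * (a * pr2 ?X ?X) - in2 ?Y ?Y * (b * pr1 ?X)"
  have H: "H \<in> hm T True (sumr ?X ?X) (sumr ?Y ?Y)"
    unfolding H_def by (intro T.hdiff T.hblk(2)[OF a] T.hblk(3)[OF T0T[OF b]]) simp_all
  define G where "G = F - kn_mor ?X ?Y f - (?KN * H + H * ?KM)"
  have "G \<in> cocyc T (kn x y M) (kn x y N)"
    unfolding G_def using T.cocyc_boundary[OF _ kM kN, of H] H
    by (intro T.cocyc_diff F T.kn_mor_cocyc[OF cocyc_RT[OF fz] mfs_RT[OF M] mfs_RT[OF N]] sub) simp_all
  then have G: "G \<in> hm T False (sumr ?X ?X) (sumr ?Y ?Y)" and Gc: "?KN * G = G * ?KM"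
    by (simp_all add: cocyc_def)
  note fr = kn_mor_rules(3,4)[OF f] and fa = idm_absorb[OF f] idm_absorb[OF a] idm_absorb[OF b]
  have G11: "pr1 ?Y * (G * in1 ?X) = 0"
  proof -
    have "pr1 ?Y * (G * in1 ?X) = F11 - f - (y \<odot> b + x \<odot> a)"
      unfolding G_def H_def F11_def
      by (simp add: algebra_simps Qr Pr fr fa smul_simps)
    then show ?thesis by (simp add: F11)
  qed
  define G12 G21 G22 where "G12 = pr1 ?Y * (G * in2 ?X ?X)" and "G21 = pr2 ?Y ?Y * (G * in1 ?X)"
    and "G22 = pr2 ?Y ?Y * (G * in2 ?X ?X)"
  have GG: "G12 \<in> hm T True ?X ?Y" "G21 \<in> hm T True ?X ?Y" "G22 \<in> hm T False ?X ?Y"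
    unfolding G12_def G21_def G22_def by (intro T.hext[OF G] | simp)+
  note G11' = G11 G11[THEN arg_cong, of "\<lambda>Z. Z * A" for A, unfolded mult.assoc mult_zero_left]
  have "pr1 ?Y * (?KN * G * in1 ?X) = pr1 ?Y * (G * ?KM * in1 ?X)"
    "pr2 ?Y ?Y * (?KN * G * in1 ?X) = pr2 ?Y ?Y * (G * ?KM * in1 ?X)" by (simp_all add: Gc)
  then have g11: "y \<odot> G21 + x \<odot> G12 = 0" and g21: "x \<odot> G22 + (?P * G21 + G21 * ?Q) = 0"
    unfolding G12_def G21_def G22_def
    by (simp_all add: algebra_simps Qr Pr smul_simps G11') (simp_all add: neg_eq_iff_add_eq_0 ac_simps)
  obtain c0 c where c0: "c0 \<in> hm T0 True ?X ?Y" and c: "c \<in> hm T True ?X ?Y" and G21: "G21 = c0 + x \<odot> c"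
    by (rule split_x[OF GG(2)])
  have "y \<odot> c0 + x \<odot> (y \<odot> c + G12) = 0"
    using g11 unfolding G21 by (simp add: algebra_simps smul_simps)
  moreover have "y \<odot> c0 \<in> hm T0 True ?X ?Y" "y \<odot> c + G12 \<in> hm T True ?X ?Y"
    by (intro T0.hsmul T.hsmul T.hadd c0 c GG sub)+
  ultimately have "y \<odot> c0 = 0" and G12: "y \<odot> c + G12 = 0" using unique_x by blast+
  then have "c0 = 0" using unique_y(2)[OF R.h0 c0] by simp
  then have G21: "G21 = x \<odot> c" using G21 by simp
  have "0 + x \<odot> (G22 + (?P * c + c * ?Q)) = 0"
    using g21 unfolding G21 by (simp add: algebra_simps smul_simps)
  moreover have "G22 + (?P * c + c * ?Q) \<in> hm T False ?X ?Y"
    by (intro T.hadd GG T.hmul[OF RT[OF P] c] T.hmul[OF c RT[OF Q]]) simp_all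
  ultimately have G22: "G22 + (?P * c + c * ?Q) = 0" using unique_x(2)[OF T0.h0] by blast
  define H' where "H' = in2 ?Y ?Y * (c * pr2 ?X ?X)"
  have H': "H' \<in> hm T True (sumr ?X ?X) (sumr ?Y ?Y)" unfolding H'_def by (rule T.hblk(4)[OF c])
  note ca = idm_absorb[OF c] idm_absorb[OF Q] idm_absorb[OF P]
  have "G = ?KN * H' + H' * ?KM"
  proof (rule block_ext[OF G])
    show "?KN * H' + H' * ?KM \<in> hm T False (sumr ?X ?X) (sumr ?Y ?Y)"
      using T.cocyc_hm[OF T.cocyc_boundary[OF _ kM kN, of H']] H' by simp
  next
    show "pr1 ?Y * (G * in1 ?X) = pr1 ?Y * ((?KN * H' + H' * ?KM) * in1 ?X)"
      unfolding H'_def by (simp add: G11 algebra_simps Qr Pr ca smul_simps)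
  next
    have "pr1 ?Y * ((?KN * H' + H' * ?KM) * in2 ?X ?X) = - (y \<odot> c)"
      unfolding H'_def by (simp add: algebra_simps Qr Pr ca smul_simps)
    then show "pr1 ?Y * (G * in2 ?X ?X) = pr1 ?Y * ((?KN * H' + H' * ?KM) * in2 ?X ?X)"
      using G12[unfolded G12_def add_eq_0_iff] by simp
  next
    show "pr2 ?Y ?Y * (G * in1 ?X) = pr2 ?Y ?Y * ((?KN * H' + H' * ?KM) * in1 ?X)"
      using G21 unfolding H'_def G21_def by (simp add: algebra_simps Qr Pr ca smul_simps)
  next
    have "pr2 ?Y ?Y * ((?KN * H' + H' * ?KM) * in2 ?X ?X) = - (?P * c + c * ?Q)"
      unfolding H'_def by (simp add: algebra_simps Qr Pr ca smul_simps)
    then show "pr2 ?Y ?Y * (G * in2 ?X ?X) = pr2 ?Y ?Y * ((?KN * H' + H' * ?KM) * in2 ?X ?X)"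
      using G22[unfolded G22_def eq_neg_iff_add_eq_0[symmetric]] by simp
  qed
  then have "F - kn_mor ?X ?Y f = ?KN * (H + H') + (H + H') * ?KM"
    unfolding G_def by (simp add: algebra_simps)
  then have "homot T (kn x y M) (kn x y N) F (kn_mor ?X ?Y f)"
    by (intro T.htyI[of "H + H'"]) (simp_all add: T.hadd[OF H H'])
  then show ?thesis using fz T.homot_sym by blast
qed

end

text \<open>
  Write \<open>P = q + xB\<close> and \<open>q = Q + yl\<close> with \<open>q\<close> free of \<open>x\<close> and \<open>Q\<close> free of both variables, and let \<open>m\<close>
  and \<open>n\<close> be the values of \<open>B\<close> and \<open>l\<close> at \<open>x = y = 0\<close>. Comparing coefficients in \<open>P\<^sup>2 = w - xy\<close> shows
  that \<open>m\<close> and \<open>n\<close> anticommute with \<open>Q\<close>, and that modulo the maximal ideal \<open>m\<^sup>2 = n\<^sup>2 = 0\<close> and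
  \<open>mn + nm = -1\<close>. So \<open>-mn\<close> is an idempotent modulo the maximal ideal. On the image \<open>X\<close> of its lift the
  pair \<open>(l, Bl)\<close> defines a cocycle to \<open>P\<close>, because \<open>q l = - l Q\<close>; modulo the maximal ideal it is the
  isomorphism of the Clifford module \<open>Y\<close> with two copies of \<open>X\<close>.
\<close>

lemma kn_essentially_surjective:
  fixes x y w :: "'k::field mpow"
  assumes kn: "knoerrer (series_in V) (series_in U) (series_in W) x y"
    and xy: "mcoeff x {#} = 0" "mcoeff y {#} = 0" and w: "w \<in> series_in V"
    and N: "N \<in> mfs (series_in W) (w - x * y)" and red: "reduced N"
  shows "\<exists>M\<in>mfs (series_in V) w. reduced M \<and> (\<exists>F. strict_iso (series_in W) (kn x y M) N F)"
proof -
  interpret knoerrer "series_in V :: 'k mpow set" "series_in U" "series_in W" x y by (rule kn)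
  obtain Y P where NYP: "N = (Y, P)" by (cases N)
  have P: "P \<in> hm (series_in W) True Y Y" and PP: "P * P = (w - x * y) \<odot> idm Y"
    using T.mfs_hm[OF N] T.mfs_sq[OF N] by (simp_all add: NYP)
  obtain q B where q: "q \<in> hm (series_in U) True Y Y" and B: "B \<in> hm (series_in W) True Y Y"
    and P_eq: "P = q + x \<odot> B" by (rule split_x[OF P])
  obtain Q l where Q: "Q \<in> hm (series_in V) True Y Y" and l: "l \<in> hm (series_in U) True Y Y"
    and q_eq: "q = Q + y \<odot> l" by (rule split_y[OF q])
  have wU: "w \<in> series_in U" using w sub by blast
  have "(q * q - w \<odot> idm Y) + x \<odot> (q * B + B * q + x \<odot> (B * B) + y \<odot> idm Y) = 0"
    using PP unfolding P_eq by (simp add: algebra_simps smul_simps smul_diff_left)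
  moreover have "q * q - w \<odot> idm Y \<in> hm (series_in U) False Y Y"
    "q * B + B * q + x \<odot> (B * B) + y \<odot> idm Y \<in> hm (series_in W) False Y Y"
    by (rule T0.hdiff T0.hmul[OF q q] T0.hsmul wU T0.hid T.hadd T.hmul[OF T0T[OF q] B]
        T.hmul[OF B T0T[OF q]] T.hsmul T.hmul[OF B B] T.hid sub | simp)+
  ultimately have "q * q - w \<odot> idm Y = 0" and A2: "q * B + B * q + x \<odot> (B * B) + y \<odot> idm Y = 0"
    using unique_x by blast+
  then have qq: "q * q = w \<odot> idm Y" by simp
  have "(Q * Q - w \<odot> idm Y) + y \<odot> (Q * l + l * Q + y \<odot> (l * l)) = 0"
    using qq unfolding q_eq by (simp add: algebra_simps smul_simps)
  moreover have "Q * Q - w \<odot> idm Y \<in> hm (series_in V) False Y Y"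
    "Q * l + l * Q + y \<odot> (l * l) \<in> hm (series_in U) False Y Y"
    by (rule R.hdiff R.hmul[OF Q Q] R.hsmul w R.hid T0.hadd T0.hmul[OF RT0[OF Q] l]
        T0.hmul[OF l RT0[OF Q]] T0.hsmul T0.hmul[OF l l] sub | simp)+
  ultimately have "Q * Q - w \<odot> idm Y = 0" and B2: "Q * l + l * Q + y \<odot> (l * l) = 0"
    using unique_y by blast+
  then have QQ: "Q * Q = w \<odot> idm Y" by simp
  have ql: "q * l = - (l * Q)"
    using B2 unfolding q_eq by (simp add: algebra_simps eq_neg_iff_add_eq_0)
  obtain b0 b1 where b0: "b0 \<in> hm (series_in U) True Y Y" and b1: "b1 \<in> hm (series_in W) True Y Y"
    and B_eq: "B = b0 + x \<odot> b1" by (rule split_x[OF B])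
  have "(q * b0 + b0 * q + y \<odot> idm Y) + x \<odot> (q * b1 + b1 * q + B * B) = 0"
    using A2 by (subst (asm) (1 2) B_eq) (simp add: algebra_simps smul_simps)
  moreover have "q * b0 + b0 * q + y \<odot> idm Y \<in> hm (series_in U) False Y Y"
    "q * b1 + b1 * q + B * B \<in> hm (series_in W) False Y Y"
    by (rule T0.hadd T0.hmul[OF q b0] T0.hmul[OF b0 q] T0.hsmul T0.hid T.hadd T.hmul[OF T0T[OF q] b1]
        T.hmul[OF b1 T0T[OF q]] T.hmul[OF B B] sub | simp)+
  ultimately have C1: "q * b0 + b0 * q + y \<odot> idm Y = 0" and C2: "q * b1 + b1 * q + B * B = 0"
    using unique_x by blast+
  obtain m b2 where m: "m \<in> hm (series_in V) True Y Y" and b2: "b2 \<in> hm (series_in U) True Y Y"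
    and b0_eq: "b0 = m + y \<odot> b2" by (rule split_y[OF b0])
  have "(Q * m + m * Q) + y \<odot> (Q * b2 + b2 * Q + (l * m + m * l) + y \<odot> (l * b2 + b2 * l) + idm Y) = 0"
    using C1 unfolding b0_eq q_eq by (simp add: algebra_simps smul_simps)
  moreover have "Q * m + m * Q \<in> hm (series_in V) False Y Y"
    "Q * b2 + b2 * Q + (l * m + m * l) + y \<odot> (l * b2 + b2 * l) + idm Y \<in> hm (series_in U) False Y Y"
    by (rule R.hadd R.hmul[OF Q m] R.hmul[OF m Q] T0.hadd T0.hid T0.hsmul sub T0.hmul[OF RT0[OF Q] b2]
        T0.hmul[OF b2 RT0[OF Q]] T0.hmul[OF l RT0[OF m]] T0.hmul[OF RT0[OF m] l] T0.hmul[OF l b2] T0.hmul[OF b2 l] | simp)+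
  ultimately have D1: "Q * m + m * Q = 0"
    and D2: "Q * b2 + b2 * Q + (l * m + m * l) + y \<odot> (l * b2 + b2 * l) + idm Y = 0"
    using unique_y by blast+
  obtain n l2 where n: "n \<in> hm (series_in V) True Y Y" and l2: "l2 \<in> hm (series_in U) True Y Y"
    and l_eq: "l = n + y \<odot> l2" by (rule split_y[OF l])
  have "(Q * n + n * Q) + y \<odot> (Q * l2 + l2 * Q + l * l) = 0"
    using B2 by (subst (asm) (1 2) l_eq) (simp add: algebra_simps smul_simps)
  moreover have "Q * n + n * Q \<in> hm (series_in V) False Y Y" "Q * l2 + l2 * Q + l * l \<in> hm (series_in U) False Y Y"
    by (rule R.hadd R.hmul[OF Q n] R.hmul[OF n Q] T0.hadd T0.hmul[OF RT0[OF Q] l2]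
        T0.hmul[OF l2 RT0[OF Q]] T0.hmul[OF l l] | simp)+
  ultimately have E1: "Q * n + n * Q = 0" and E2: "Q * l2 + l2 * Q + l * l = 0"
    using unique_y by blast+
  \<comment> \<open>Modulo the maximal ideal, \<open>m\<close> and \<open>n\<close> generate a Clifford algebra.\<close>
  have "const_part P = 0" using red by (simp add: reduced_def NYP)
  then have const_part: "const_part q = 0" "const_part Q = 0" "const_part B = const_part m" "const_part l = const_part n"
    by (simp_all add: P_eq q_eq B_eq b0_eq l_eq xy)
  have mm: "const_part m * const_part m = 0" using arg_cong[OF C2, of const_part] by (simp add: const_part)
  have nn: "const_part n * const_part n = 0" using arg_cong[OF E2, of const_part] by (simp add: const_part)
  have nm: "const_part n * const_part m = - idm Y - const_part m * const_part n"
    using arg_cong[OF D2, of const_part] by (simp add: const_part xy algebra_simps eq_neg_iff_add_eq_0)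
  note cm = idm_absorb[OF const_part_hm[OF m]] idm_absorb[OF const_part_hm[OF n]]
  note nm' = nm[THEN mult_eq_assoc] and mm' = mm[THEN mult_eq_assoc] and nn' = nn[THEN mult_eq_assoc]
  note clifford = nm mm nn nm' mm' nn' cm algebra_simps
  define e where "e = - (m * n)"
  have e: "e \<in> hm (series_in V) False Y Y" unfolding e_def by (rule R.hminus, rule R.hmul[OF m n]) simp
  have Qm: "m * Q = - (Q * m)" and Qn: "n * Q = - (Q * n)"
    using D1 E1 by (simp_all add: eq_neg_iff_add_eq_0 add.commute)
  have eQ: "e * Q = Q * e"
    unfolding e_def by (simp add: mult.assoc Qn) (simp add: mult_eq_assoc[OF Qm] mult.assoc)
  have ee: "e * e - e \<in> hm (deg_ge 1) False Y Y"
    unfolding hm_deg1_iff[OF R.hdiff[OF R.hmul[OF e e, of False, simplified] e]]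
    by (simp add: e_def clifford)
  obtain E where E: "E \<in> hm (series_in V) False Y Y" "E * E = E" "E - e \<in> hm (deg_ge 1) False Y Y"
    and EQ: "E * Q = Q * E"
    using idempotent_lifting[OF e ee] eQ hm_mono[OF Q subset_UNIV] by blast
  have ctE: "const_part E = - (const_part m * const_part n)"
    using E(3) unfolding hm_deg1_iff[OF R.hdiff[OF E(1) e]] by (simp add: e_def eq_neg_iff_add_eq_0)
  obtain X f p where f: "f \<in> hm (series_in V) False X Y" and p: "p \<in> hm (series_in V) False Y X"
    and fp: "f * p = E" and pf: "p * f = idm X"
    using idempotent_splits[OF E(1,2)] by blast
  note fp' = mult_eq_assoc[OF fp] and pf' = mult_eq_assoc[OF pf]
  have Ef: "E * f = f" and pE: "p * E = p"
    by (simp_all add: mult.assoc pf flip: fp) (simp_all add: pf' idm_absorb[OF f] idm_absorb[OF p])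
  define M where "M = (X, - (p * (Q * f)))"
  have QQ': "Q * (Q * Z) = w \<odot> (idm Y * Z)" for Z by (simp add: mult_eq_assoc[OF QQ])
  have sq: "p * (Q * f) * (p * (Q * f)) = w \<odot> idm X"
  proof -
    have "p * (Q * f) * (p * (Q * f)) = p * (Q * (E * (Q * f)))" by (simp add: mult.assoc fp')
    also have "\<dots> = p * (E * (Q * (Q * f)))" by (simp add: mult_eq_assoc[OF EQ] mult.assoc)
    finally show ?thesis by (simp add: mult_eq_assoc[OF pE] QQ' idm_absorb[OF f] pf)
  qed
  have "- (p * (Q * f)) \<in> hm (series_in V) True X X"
    by (rule R.hminus, rule R.hmul[OF p R.hmul[OF Q f refl]]) simp
  then have M: "M \<in> mfs (series_in V) w" using sq by (simp add: mfs_def M_def)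
  have redM: "reduced M" by (simp add: reduced_def M_def const_part)
  have fQ: "f * (p * (Q * Z)) = Q * (E * Z)" for Z by (simp add: fp' mult_eq_assoc[OF EQ] mult.assoc)
  define F where "F = l * f * pr1 X + B * l * f * pr2 X X"
  have F: "F \<in> hm (series_in W) False (sumr X X) Y" unfolding F_def mult.assoc
    by (rule T.hadd T.hmul[OF T0T[OF l] T.hmul[OF RT[OF f] T.hpr1 refl]]
        T.hmul[OF B T.hmul[OF T0T[OF l] T.hmul[OF RT[OF f] T.hpr2 refl] refl]] | simp)+
  have PBl: "P * (B * (l * f)) = B * (l * (Q * f)) - y \<odot> (l * f)"
  proof -
    have "P * B = - (B * q) - y \<odot> idm Y"
      using A2 unfolding P_eq by (simp add: algebra_simps eq_neg_iff_add_eq_0)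
    then have "P * (B * (l * f)) = (- (B * q) - y \<odot> idm Y) * (l * f)" by (rule mult_eq_assoc)
    also have "\<dots> = B * (l * (Q * f)) - y \<odot> (l * f)"
      by (simp add: algebra_simps mult_eq_assoc[OF ql] idm_absorb[OF l])
    finally show ?thesis .
  qed
  have Pl: "P * (l * f) = - (l * (Q * f)) + x \<odot> (B * (l * f))"
    unfolding P_eq by (simp add: algebra_simps mult_eq_assoc[OF ql])
  have "P * F = F * kmat x y X (snd M)"
  proof -
    have Ms: "snd M \<in> hm (series_in V) True X X" using R.mfs_hm[OF M] by (simp add: M_def)
    have "F * kmat x y X (snd M) = l * f * (snd M * pr1 X - y \<odot> pr2 X X) + B * l * f * (x \<odot> pr1 X - snd M * pr2 X X)"
      unfolding F_def by (simp add: distrib_right mult.assoc kmat_rules[OF Ms])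
    also have "\<dots> = - (l * (Q * f)) * pr1 X - y \<odot> (l * f * pr2 X X) + x \<odot> (B * (l * f) * pr1 X) + B * (l * (Q * f)) * pr2 X X"
      by (simp add: M_def algebra_simps fQ mult_eq_assoc[OF Ef])
    also have "\<dots> = P * (l * f) * pr1 X + P * (B * (l * f)) * pr2 X X"
      unfolding PBl Pl by (simp add: algebra_simps)
    also have "\<dots> = P * F" unfolding F_def by (simp add: algebra_simps)
    finally show ?thesis ..
  qed
  then have Fz: "F \<in> cocyc (series_in W) (kn x y M) N"
    using F by (simp add: cocyc_def M_def NYP)
  define G where "G = - (in1 X * (p * m)) - in2 X X * p"
  have G: "G \<in> hm (series_in W) False Y (sumr X X)" unfolding G_def
    by (rule T.hdiff T.hminus T.hmul[OF T.hin1 T.hmul[OF RT[OF p] RT[OF m] refl]] T.hmul[OF T.hin2 RT[OF p]] | simp)+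
  have cfp: "const_part f * (const_part p * Z) = - (const_part m * (const_part n * Z))" for Z
    using arg_cong[OF fp, of "\<lambda>F. const_part F * Z"] by (simp add: ctE mult.assoc)
  have cf: "const_part f * const_part p = - (const_part m * const_part n)" using arg_cong[OF fp, of const_part] by (simp add: ctE)
  have cpf: "const_part p * const_part f = idm X" using arg_cong[OF pf, of const_part] by simp
  have cpE: "const_part p * (const_part m * (const_part n * Z)) = - (const_part p * Z)" for Z
    using arg_cong[OF pE, of "\<lambda>F. const_part F * Z"] by (simp add: ctE mult.assoc eq_neg_iff_add_eq_0 neg_eq_iff_add_eq_0 add.commute)
  have cEf: "const_part m * (const_part n * const_part f) = - const_part f"
    using arg_cong[OF Ef, of const_part] by (simp add: ctE mult.assoc eq_neg_iff_add_eq_0 neg_eq_iff_add_eq_0 add.commute)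
  note cfa = idm_absorb[OF const_part_hm[OF f]] idm_absorb[OF const_part_hm[OF p]]
  have ctF: "const_part F = const_part n * (const_part f * pr1 X) + const_part m * (const_part n * (const_part f * pr2 X X))"
    by (simp add: F_def const_part mult.assoc)
  have FG: "const_part F * const_part G = idm Y"
    unfolding ctF by (simp add: G_def algebra_simps cfa cf cfp) (simp add: clifford)
  have nf: "const_part p * (const_part n * (const_part f * Z)) = 0" for Z
  proof -
    have "const_part p * (const_part n * (const_part f * Z)) = - (const_part p * (const_part m * (const_part n * (const_part n * (const_part f * Z)))))" by (simp add: cpE)
    then show ?thesis by (simp add: nn')
  qed
  have GF: "const_part G * const_part F = idm (sumr X X)"
    unfolding ctF G_def in_pr[symmetric]
    by (simp add: algebra_simps cpE nf mult_eq_assoc[OF cpf] mm' cpf)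
  have "strict_iso (series_in W) (kn x y M) N F"
    using FG GF G by (intro strict_iso_from_const_part[OF Fz T.kn_mfs[OF mfs_RT[OF M] sub(4,5)] N, of G])
      (simp_all add: M_def NYP)
  then show ?thesis using M redM by blast
qed


section \<open>Parity operators, shift and cone\<close>

text \<open>
  The odd identification of a module with its shift, and the sign operator: conjugation by \<open>flp\<close>
  exchanges the two parities.
\<close>

definition flp :: "'a::comm_ring_1 gmat" where "flp = pinj flip UNIV"

definition eps :: "'a::comm_ring_1 gmat" where
  "eps = GMat (\<lambda>i j. if i = j then (if gpar i then - 1 else 1) else 0)"

lemma ent_eps: "ent eps i j = (if i = j then (if gpar i then - 1 else 1) else 0)"
proof -
  have "finite {j. (if i = j then (if gpar i then - 1 else 1) else 0 :: 'a) \<noteq> 0}"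
    "finite {i. (if i = j then (if gpar i then - 1 else 1) else 0 :: 'a) \<noteq> 0}" for i j
    by (auto intro: finite_subset[of _ "{i}"] finite_subset[of _ "{j}"])
  then show ?thesis by (simp add: eps_def ent_GMat)
qed

lemma ent_eps_mult: "ent (eps * F) i j = (if gpar i then - ent F i j else ent F i j)"
  by (subst ent_times_single[of i]) (auto simp: ent_eps)

lemma ent_mult_eps: "ent (F * eps) i j = (if gpar j then - ent F i j else ent F i j)"
  by (subst ent_times_single[of j]) (auto simp: ent_eps)

lemma ent_mult_flp: "ent (F * flp) i j = ent F i (flip j)"
  by (simp add: flp_def ent_mult_pinj)

lemma tr_flp [simp]: "tr flp = flp"
  by (rule ent_eqI) (auto simp: flp_def ent_pinj)

lemma ent_flp_mult: "ent (flp * F) i j = ent F (flip i) j"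
proof -
  have "ent (flp * F) i j = ent (tr F * flp) j i" by (metis ent_tr tr_flp tr_mult tr_tr)
  then show ?thesis by (simp add: ent_mult_flp)
qed

lemma tr_eps [simp]: "tr eps = eps"
  by (rule ent_eqI) (auto simp: ent_eps)

lemma gpar_flip [simp]: "gpar (flip i) = (\<not> gpar i)"
  by (simp add: flip_def)

lemma flp_flp [simp]: "flp * flp = (1 :: 'a::comm_ring_1 gmat)"
proof (rule ent_eqI)
  fix i j show "ent (flp * flp) i j = ent (1 :: 'a gmat) i j"
    unfolding ent_flp_mult by (auto simp: flp_def ent_pinj ent_1 dest: arg_cong[of _ _ flip])
qed

lemma eps_eps [simp]: "eps * eps = (1 :: 'a::comm_ring_1 gmat)"
  by (rule ent_eqI) (simp add: ent_eps_mult ent_eps ent_1)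

lemma eps_flp: "eps * flp = (- (flp * eps) :: 'a::comm_ring_1 gmat)"
  by (rule ent_eqI) (auto simp: ent_eps_mult ent_mult_eps flp_def ent_pinj)

lemma flp_flp_assoc [simp]: "flp * (flp * Z) = Z"
  and eps_eps_assoc [simp]: "eps * (eps * Z) = Z"
  and eps_flp_assoc: "eps * (flp * Z) = - (flp * (eps * Z))"
  by (simp_all add: eps_flp flip: mult.assoc)

lemma eps_even:
  assumes "F \<in> hm S False X Y" shows "eps * F = F * eps"
proof (rule ent_eqI)
  fix i j show "ent (eps * F) i j = ent (F * eps) i j"
    using hm_zero[OF assms, of i j] by (auto simp: ent_eps_mult ent_mult_eps)
qed

lemma eps_odd:
  assumes "F \<in> hm S True X Y" shows "eps * F = - (F * eps)"
proof (rule ent_eqI)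
  fix i j show "ent (eps * F) i j = ent (- (F * eps)) i j"
    using hm_zero[OF assms, of i j] by (auto simp: ent_eps_mult ent_mult_eps)
qed

lemma eps_even_assoc: "F \<in> hm S False X Y \<Longrightarrow> eps * (F * Z) = F * (eps * Z)"
  by (simp add: mult.assoc[symmetric] eps_even)

lemma eps_odd_assoc: "F \<in> hm S True X Y \<Longrightarrow> eps * (F * Z) = - (F * (eps * Z))"
  by (simp add: mult.assoc[symmetric] eps_odd)

lemmas eps_block =
  eps_odd[OF subring.hin1[OF subring_UNIV]] eps_even[OF subring.hin2[OF subring_UNIV]]
  eps_odd[OF subring.hpr1[OF subring_UNIV]] eps_even[OF subring.hpr2[OF subring_UNIV]]
  eps_even[OF subring.hid[OF subring_UNIV]]
  eps_odd_assoc[OF subring.hin1[OF subring_UNIV]] eps_even_assoc[OF subring.hin2[OF subring_UNIV]]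
  eps_odd_assoc[OF subring.hpr1[OF subring_UNIV]] eps_even_assoc[OF subring.hpr2[OF subring_UNIV]]
  eps_even_assoc[OF subring.hid[OF subring_UNIV]]

lemma flip_idx [simp]: "flip i \<in> idx X \<longleftrightarrow> i \<in> idx (prod.swap X)"
  by (cases i) (auto simp: rkof_def)

lemma flp_idm: "flp * idm X = (idm (prod.swap X) * flp :: 'a::comm_ring_1 gmat)"
proof (rule ent_eqI)
  fix i j show "ent (flp * idm X) i j = ent (idm (prod.swap X) * flp :: 'a gmat) i j"
    by (auto simp: ent_flp_mult ent_mult_flp ent_idm simp flip: flip_idx)
qed

lemma flp_idm_assoc: "flp * (idm X * Z) = idm (prod.swap X) * (flp * Z)"
  by (simp add: flp_idm flip: mult.assoc)

lemma hm_flp_left: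
  assumes "F \<in> hm S p X Y" "q = (\<not> p)" shows "flp * F \<in> hm S q X (prod.swap Y)"
proof (rule hmI_zero)
  fix i j
  show "ent (flp * F) i j \<in> S" using hm_entD(1)[OF assms(1)] by (simp add: ent_flp_mult)
  assume "\<not> (i \<in> idx (prod.swap Y) \<and> j \<in> idx X \<and> gpar i = (gpar j \<noteq> q))"
  then show "ent (flp * F) i j = 0"
    using hm_zero[OF assms(1), of "flip i" j] assms(2) by (auto simp: ent_flp_mult)
qed

lemma hm_flp_right:
  assumes "F \<in> hm S p X Y" "q = (\<not> p)" shows "F * flp \<in> hm S q (prod.swap X) Y"
  using hm_tr[OF hm_flp_left[OF hm_tr[OF assms(1)] assms(2)]] by simp

lemma (in subring) heps:
  assumes "F \<in> hm S p X Y"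
  shows "F * eps \<in> hm S p X Y" "eps * F \<in> hm S p X Y"
proof -
  have "ent (F * eps) i j \<in> S" and "ent (eps * F) i j \<in> S" for i j
    using hm_entD(1)[OF assms] by (auto simp: ent_mult_eps ent_eps_mult)
  note S = this
  have "ent (F * eps) i j = 0" and "ent (eps * F) i j = 0"
    if "\<not> (i \<in> idx Y \<and> j \<in> idx X \<and> gpar i = (gpar j \<noteq> p))" for i j
    using hm_zero[OF assms that] by (auto simp: ent_mult_eps ent_eps_mult)
  note zero = this
  show "F * eps \<in> hm S p X Y" by (rule hmI_zero, rule S, rule zero, assumption)
  show "eps * F \<in> hm S p X Y" by (rule hmI_zero, rule S, rule zero, assumption)
qed

definition sh :: "'a::comm_ring_1 gmat \<Rightarrow> 'a gmat" where
  "sh F = flp * F * flp"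

definition shift :: "'a::comm_ring_1 mfo \<Rightarrow> 'a mfo" where
  "shift M = (prod.swap (fst M), - sh (snd M))"

text \<open>
  The first summand is the shift: the odd maps \<open>in1\<close> and \<open>pr1\<close> interchange the components of \<open>Q\<close>, so
  that only the sign has to be added.
\<close>

definition mcone :: "'a::comm_ring_1 mfo \<Rightarrow> 'a mfo \<Rightarrow> 'a gmat \<Rightarrow> 'a mfo" where
  "mcone M N F = (sumr (fst M) (fst N), - (in1 (fst M) * snd M * pr1 (fst M)) +
    in2 (fst M) (fst N) * F * pr1 (fst M) + in2 (fst M) (fst N) * snd N * pr2 (fst M) (fst N))"

lemma fst_shift [simp]: "fst (shift M) = prod.swap (fst M)"
  and fst_mcone [simp]: "fst (mcone M N F) = sumr (fst M) (fst N)"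
  by (simp_all add: shift_def mcone_def)

lemma sh_hm: "F \<in> hm S p X Y \<Longrightarrow> sh F \<in> hm S p (prod.swap X) (prod.swap Y)"
  unfolding sh_def by (rule hm_flp_right[OF hm_flp_left]) auto

lemma sh_mult: "sh F * sh G = sh (F * G)"
  and sh_add: "sh (F + G) = sh F + sh G" and sh_diff: "sh (F - G) = sh F - sh G"
  and sh_minus: "sh (- F) = - sh F" and sh_sh [simp]: "sh (sh F) = F"
  and sh_idm [simp]: "sh (idm X) = idm (prod.swap X)"
  and sh_smul: "sh (c \<odot> F) = c \<odot> sh F"
  by (simp_all add: sh_def algebra_simps flp_idm flp_idm_assoc)

lemma shift_shift [simp]: "shift (shift M) = M"
  by (simp add: shift_def sh_minus)

lemma snd_shift: "snd (shift M) = - sh (snd M)"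
  by (simp add: shift_def)

context subring begin

lemma shift_mfs: "M \<in> mfs S w \<Longrightarrow> shift M \<in> mfs S w"
  by (simp add: mfs_def snd_shift hminus sh_hm sh_mult sh_smul)

lemma sh_cocyc: "F \<in> cocyc S M N \<Longrightarrow> sh F \<in> cocyc S (shift M) (shift N)"
  by (simp add: cocyc_def snd_shift sh_hm sh_mult)

lemma sh_homot:
  assumes "homot S M N F G" shows "homot S (shift M) (shift N) (sh F) (sh G)"
proof -
  obtain H where H: "H \<in> hm S True (fst M) (fst N)" "F - G = snd N * H + H * snd M"
    using assms by (auto simp: homot_def)
  have "sh F - sh G = snd (shift N) * (- sh H) + (- sh H) * snd (shift M)"
    by (simp add: sh_diff[symmetric] H(2) snd_shift sh_mult sh_add)
  then show ?thesis by (rule htyI[rotated]) (simp add: hminus sh_hm H)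
qed

lemma mcone_rules:
  assumes M: "M \<in> mfs S w" and N: "N \<in> mfs S w" and F: "F \<in> cocyc S M N"
  shows "pr1 (fst M) * snd (mcone M N F) = - (snd M * pr1 (fst M))"
    and "pr2 (fst M) (fst N) * snd (mcone M N F) = F * pr1 (fst M) + snd N * pr2 (fst M) (fst N)"
    and "snd (mcone M N F) * in1 (fst M) = in2 (fst M) (fst N) * F - in1 (fst M) * snd M"
    and "snd (mcone M N F) * in2 (fst M) (fst N) = in2 (fst M) (fst N) * snd N"
  unfolding mcone_def
  by (simp_all add: algebra_simps idm_absorb[OF mfs_hm[OF M]] idm_absorb[OF mfs_hm[OF N]] idm_absorb[OF cocyc_hm[OF F]])

lemma mcone_hm:
  assumes M: "M \<in> mfs S w" and N: "N \<in> mfs S w" and F: "F \<in> cocyc S M N"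
  shows "snd (mcone M N F) \<in> hm S True (sumr (fst M) (fst N)) (sumr (fst M) (fst N))"
  unfolding mcone_def snd_conv mult.assoc
  by (intro hadd hminus hblk(1)[OF mfs_hm[OF M]] hblk(4)[OF mfs_hm[OF N]] hblk(3)[OF cocyc_hm[OF F]]) simp

lemma mcone_mfs:
  assumes M: "M \<in> mfs S w" and N: "N \<in> mfs S w" and F: "F \<in> cocyc S M N"
  shows "mcone M N F \<in> mfs S w"
proof -
  note r = mcone_rules[OF assms] mcone_rules[OF assms, THEN mult_eq_assoc]
  have "snd (mcone M N F) * snd (mcone M N F) = w \<odot> idm (sumr (fst M) (fst N))"
    by (rule block_ext[OF hmul[OF mcone_hm[OF assms] mcone_hm[OF assms] refl]
          subring.hsmul[OF subring_UNIV UNIV_I subring.hid[OF subring_UNIV]]])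
      (simp_all add: algebra_simps r mfs_sq[OF M] mfs_sq[OF N] cocyc_comm[OF F])
  then show ?thesis using mcone_hm[OF assms] by (simp add: mfs_def)
qed

lemma mcone_incl:
  assumes M: "M \<in> mfs S w" and N: "N \<in> mfs S w" and F: "F \<in> cocyc S M N"
  shows "in2 (fst M) (fst N) \<in> cocyc S N (mcone M N F)"
  by (simp add: cocyc_def hin2 mcone_rules[OF assms])

lemma mcone_proj:
  assumes M: "M \<in> mfs S w" and N: "N \<in> mfs S w" and F: "F \<in> cocyc S M N"
  shows "flp * pr1 (fst M) \<in> cocyc S (mcone M N F) (shift M)"
  by (simp add: cocyc_def hm_flp_left[OF hpr1] mult.assoc mcone_rules[OF assms] snd_shift sh_def)

end


section \<open>Strict equivalences\<close>

text \<open>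
  What is needed of a functor between homotopy categories that is induced by a functor of the
  strict categories; \<open>\<eta>\<close> and \<open>\<gamma>\<close> compare shifts and cones. Essential surjectivity is required in the
  strict sense, but for reduced matrix factorizations only, and the preimage has to be reduced again,
  so that such functors compose.
\<close>

locale strict_equiv =
  S: subring S + S': subring S'
  for S S' :: "'k::field mpow set" +
  fixes w w' :: "'k mpow" and A :: "'k mpow mfo \<Rightarrow> 'k mpow mfo"
    and a :: "'k mpow mfo \<Rightarrow> 'k mpow mfo \<Rightarrow> 'k mpow gmat \<Rightarrow> 'k mpow gmat"
    and \<eta> :: "'k mpow mfo \<Rightarrow> 'k mpow gmat"
    and \<gamma> :: "'k mpow mfo \<Rightarrow> 'k mpow mfo \<Rightarrow> 'k mpow gmat \<Rightarrow> 'k mpow gmat"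
  assumes obj: "M \<in> mfs S w \<Longrightarrow> A M \<in> mfs S' w'"
    and mor: "M \<in> mfs S w \<Longrightarrow> N \<in> mfs S w \<Longrightarrow> F \<in> cocyc S M N \<Longrightarrow> a M N F \<in> cocyc S' (A M) (A N)"
    and ident: "M \<in> mfs S w \<Longrightarrow> a M M (idm (fst M)) = idm (fst (A M))"
    and comp: "L \<in> mfs S w \<Longrightarrow> M \<in> mfs S w \<Longrightarrow> N \<in> mfs S w \<Longrightarrow> F \<in> cocyc S L M \<Longrightarrow> G \<in> cocyc S M N \<Longrightarrow>
      a L N (G * F) = a M N G * a L M F"
    and homotopy: "M \<in> mfs S w \<Longrightarrow> N \<in> mfs S w \<Longrightarrow> F \<in> cocyc S M N \<Longrightarrow> G \<in> cocyc S M N \<Longrightarrow>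
      homot S' (A M) (A N) (a M N F) (a M N G) \<longleftrightarrow> homot S M N F G"
    and full: "M \<in> mfs S w \<Longrightarrow> N \<in> mfs S w \<Longrightarrow> G \<in> cocyc S' (A M) (A N) \<Longrightarrow>
      \<exists>F\<in>cocyc S M N. homot S' (A M) (A N) (a M N F) G"
    and reach: "N \<in> mfs S' w' \<Longrightarrow> reduced N \<Longrightarrow> \<exists>M\<in>mfs S w. reduced M \<and> (\<exists>F. strict_iso S' (A M) N F)"
    and shift: "M \<in> mfs S w \<Longrightarrow> strict_iso S' (A (shift M)) (shift (A M)) (\<eta> M)"
    and shift_natural: "M \<in> mfs S w \<Longrightarrow> N \<in> mfs S w \<Longrightarrow> F \<in> cocyc S M N \<Longrightarrow>
      \<eta> N * a (shift M) (shift N) (sh F) = sh (a M N F) * \<eta> M"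
    and cone: "M \<in> mfs S w \<Longrightarrow> N \<in> mfs S w \<Longrightarrow> F \<in> cocyc S M N \<Longrightarrow>
      strict_iso S' (A (mcone M N F)) (mcone (A M) (A N) (a M N F)) (\<gamma> M N F)"
    and cone_incl: "M \<in> mfs S w \<Longrightarrow> N \<in> mfs S w \<Longrightarrow> F \<in> cocyc S M N \<Longrightarrow>
      \<gamma> M N F * a N (mcone M N F) (in2 (fst M) (fst N)) = in2 (fst (A M)) (fst (A N))"
    and cone_proj: "M \<in> mfs S w \<Longrightarrow> N \<in> mfs S w \<Longrightarrow> F \<in> cocyc S M N \<Longrightarrow>
      flp * pr1 (fst (A M)) * \<gamma> M N F = \<eta> M * a (mcone M N F) (shift M) (flp * pr1 (fst M))"
begin

lemma strict_iso_mor: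
  assumes M: "M \<in> mfs S w" and N: "N \<in> mfs S w" and F: "strict_iso S M N F"
  shows "strict_iso S' (A M) (A N) (a M N F)"
proof -
  obtain G where "F \<in> cocyc S M N" and G: "G \<in> cocyc S N M" "G * F = idm (fst M)" "F * G = idm (fst N)"
    using F unfolding strict_iso_def by (elim conjE bexE)
  then show ?thesis unfolding strict_iso_def
    by (intro conjI bexI[of _ "a N M G"])
      (simp_all add: M N mor comp[symmetric] ident)
qed

end

lemma strict_iso_cocyc: "strict_iso S M N F \<Longrightarrow> F \<in> cocyc S M N"
  by (simp add: strict_iso_def)

lemma strict_equiv_comp:
  assumes "strict_equiv S S' w w' A a \<eta> \<gamma>" and "strict_equiv S' S'' w' w'' B b \<eta>' \<gamma>'"
  shows "strict_equiv S S'' w w'' (\<lambda>M. B (A M)) (\<lambda>M N F. b (A M) (A N) (a M N F))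
    (\<lambda>M. \<eta>' (A M) * b (A (shift M)) (shift (A M)) (\<eta> M))
    (\<lambda>M N F. \<gamma>' (A M) (A N) (a M N F) *
      b (A (mcone M N F)) (mcone (A M) (A N) (a M N F)) (\<gamma> M N F))"
proof -
  interpret A: strict_equiv S S' w w' A a \<eta> \<gamma> by (rule assms(1))
  interpret B: strict_equiv S' S'' w' w'' B b \<eta>' \<gamma>' by (rule assms(2))
  show ?thesis
  proof
    fix L M N F G
    assume M: "M \<in> mfs S w"
    note AM = A.obj[OF M] and sM = A.S.shift_mfs[OF M]
    show "B (A M) \<in> mfs S'' w''" by (rule B.obj[OF AM])
    show "b (A M) (A M) (a M M (idm (fst M))) = idm (fst (B (A M)))"
      by (simp add: A.ident[OF M] B.ident[OF AM])
    note eM = A.shift[OF M]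
    show "strict_iso S'' (B (A (shift M))) (shift (B (A M))) (\<eta>' (A M) * b (A (shift M)) (shift (A M)) (\<eta> M))"
      by (rule A.S'.strict_iso_comp B.S'.strict_iso_comp[OF B.strict_iso_mor[OF A.obj[OF sM] A.S'.shift_mfs[OF AM] eM] B.shift[OF AM]])+
    assume N: "N \<in> mfs S w"
    note AN = A.obj[OF N] and sN = A.S.shift_mfs[OF N]
    show "\<exists>F\<in>cocyc S M N. homot S'' (B (A M)) (B (A N)) (b (A M) (A N) (a M N F)) G"
      if G: "G \<in> cocyc S'' (B (A M)) (B (A N))"
    proof -
      obtain F' where F': "F' \<in> cocyc S' (A M) (A N)" "homot S'' (B (A M)) (B (A N)) (b (A M) (A N) F') G"
        using B.full[OF AM AN G] by (elim bexE)
      obtain F where F: "F \<in> cocyc S M N" "homot S' (A M) (A N) (a M N F) F'"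
        using A.full[OF M N F'(1)] by (elim bexE)
      have "homot S'' (B (A M)) (B (A N)) (b (A M) (A N) (a M N F)) (b (A M) (A N) F')"
        using B.homotopy[OF AM AN A.mor[OF M N F(1)] F'(1)] F(2) by simp
      from B.S'.homot_trans[OF this F'(2)] F(1) show ?thesis by (rule bexI)
    qed
    show "homot S'' (B (A M)) (B (A N)) (b (A M) (A N) (a M N F)) (b (A M) (A N) (a M N G)) \<longleftrightarrow> homot S M N F G"
      if "F \<in> cocyc S M N" "G \<in> cocyc S M N"
      by (simp add: B.homotopy[OF AM AN A.mor[OF M N that(1)] A.mor[OF M N that(2)]] A.homotopy[OF M N that])
    show "b (A L) (A N) (a L N (G * F)) = b (A M) (A N) (a M N G) * b (A L) (A M) (a L M F)"
      if L: "L \<in> mfs S w" and F: "F \<in> cocyc S L M" and G: "G \<in> cocyc S M N"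
      by (simp add: A.comp[OF L M N F G] B.comp[OF A.obj[OF L] AM AN A.mor[OF L M F] A.mor[OF M N G]])
    assume F: "F \<in> cocyc S M N"
    note aF = A.mor[OF M N F]
    show "b (A M) (A N) (a M N F) \<in> cocyc S'' (B (A M)) (B (A N))" by (rule B.mor[OF AM AN aF])
    note eN = A.shift[OF N]
    show "\<eta>' (A N) * b (A (shift N)) (shift (A N)) (\<eta> N) * b (A (shift M)) (A (shift N)) (a (shift M) (shift N) (sh F)) =
      sh (b (A M) (A N) (a M N F)) * (\<eta>' (A M) * b (A (shift M)) (shift (A M)) (\<eta> M))"
    proof -
      have "b (A (shift N)) (shift (A N)) (\<eta> N) * b (A (shift M)) (A (shift N)) (a (shift M) (shift N) (sh F))
          = b (A (shift M)) (shift (A N)) (\<eta> N * a (shift M) (shift N) (sh F))"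
        by (rule B.comp[symmetric]) (intro A.obj sM sN A.S'.shift_mfs AN A.mor A.S.sh_cocyc F strict_iso_cocyc[OF eN])+
      also have "\<dots> = b (A (shift M)) (shift (A N)) (sh (a M N F) * \<eta> M)"
        by (simp only: A.shift_natural[OF M N F])
      also have "\<dots> = b (shift (A M)) (shift (A N)) (sh (a M N F)) * b (A (shift M)) (shift (A M)) (\<eta> M)"
        by (rule B.comp) (intro A.obj sM A.S'.shift_mfs AM AN A.S'.sh_cocyc aF strict_iso_cocyc[OF eM])+
      finally show ?thesis
        using B.shift_natural[OF AM AN aF] by (simp add: mult.assoc) (simp flip: mult.assoc)
    qed
    let ?C = "mcone M N F" and ?C' = "mcone (A M) (A N) (a M N F)"
    have C: "?C \<in> mfs S w" and C': "?C' \<in> mfs S' w'"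
      by (rule A.S.mcone_mfs[OF M N F] A.S'.mcone_mfs[OF AM AN aF])+
    note AC = A.obj[OF C] and g = A.cone[OF M N F]
    show "strict_iso S'' (B (A ?C)) (mcone (B (A M)) (B (A N)) (b (A M) (A N) (a M N F)))
      (\<gamma>' (A M) (A N) (a M N F) * b (A ?C) ?C' (\<gamma> M N F))"
      by (rule B.S'.strict_iso_comp[OF B.strict_iso_mor[OF AC C' g] B.cone[OF AM AN aF]])
    have i: "in2 (fst M) (fst N) \<in> cocyc S N ?C" by (rule A.S.mcone_incl[OF M N F])
    have "b (A ?C) ?C' (\<gamma> M N F) * b (A N) (A ?C) (a N ?C (in2 (fst M) (fst N))) = b (A N) ?C' (in2 (fst (A M)) (fst (A N)))"
      by (simp only: B.comp[OF AN AC C' A.mor[OF N C i] strict_iso_cocyc[OF g], symmetric] A.cone_incl[OF M N F])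
    then show "\<gamma>' (A M) (A N) (a M N F) * b (A ?C) ?C' (\<gamma> M N F) * b (A N) (A ?C) (a N ?C (in2 (fst M) (fst N))) =
        in2 (fst (B (A M))) (fst (B (A N)))"
      by (simp add: mult.assoc B.cone_incl[OF AM AN aF])
    have p: "flp * pr1 (fst M) \<in> cocyc S ?C (shift M)" by (rule A.S.mcone_proj[OF M N F])
    have p': "flp * pr1 (fst (A M)) \<in> cocyc S' ?C' (shift (A M))" by (rule A.S'.mcone_proj[OF AM AN aF])
    have "b (A (shift M)) (shift (A M)) (\<eta> M) * b (A ?C) (A (shift M)) (a ?C (shift M) (flp * pr1 (fst M)))
        = b (A ?C) (shift (A M)) (\<eta> M * a ?C (shift M) (flp * pr1 (fst M)))"
      by (rule B.comp[symmetric]) (intro AC A.obj sM A.S'.shift_mfs AM A.mor C p strict_iso_cocyc[OF eM])+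
    also have "\<dots> = b (A ?C) (shift (A M)) (flp * pr1 (fst (A M)) * \<gamma> M N F)"
      by (simp only: A.cone_proj[OF M N F])
    also have "\<dots> = b ?C' (shift (A M)) (flp * pr1 (fst (A M))) * b (A ?C) ?C' (\<gamma> M N F)"
      by (rule B.comp[OF AC C' A.S'.shift_mfs[OF AM] strict_iso_cocyc[OF g] p'])
    finally show "flp * pr1 (fst (B (A M))) * (\<gamma>' (A M) (A N) (a M N F) * b (A ?C) ?C' (\<gamma> M N F)) =
        \<eta>' (A M) * b (A (shift M)) (shift (A M)) (\<eta> M) * b (A ?C) (A (shift M)) (a ?C (shift M) (flp * pr1 (fst M)))"
      using B.cone_proj[OF AM AN aF] by (simp add: mult.assoc) (simp flip: mult.assoc)
  next
    fix N assume N: "N \<in> mfs S'' w''" "reduced N"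
    obtain N' F' where N': "N' \<in> mfs S' w'" "reduced N'" and F': "strict_iso S'' (B N') N F'"
      using B.reach[OF N] by (elim bexE conjE exE)
    obtain M F where M: "M \<in> mfs S w" "reduced M" and F: "strict_iso S' (A M) N' F"
      using A.reach[OF N'] by (elim bexE conjE exE)
    have "strict_iso S'' (B (A M)) N (F' * b (A M) N' F)"
      by (rule B.S'.strict_iso_comp[OF B.strict_iso_mor[OF A.obj[OF M(1)] N'(1) F] F'])
    with M show "\<exists>M\<in>mfs S w. reduced M \<and> (\<exists>F. strict_iso S'' (B (A M)) N F)" by blast
  qed
qed


subsection \<open>Changing the sign of the potential\<close>

text \<open>
  \<open>(\<phi>, \<psi>) \<mapsto> (\<phi>, -\<psi>)\<close>. The restrictions of \<open>Q eps\<close> to the even and to the odd part are \<open>\<phi>\<close> and \<open>-\<psi>\<close>.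
\<close>

definition twist :: "'a::comm_ring_1 mfo \<Rightarrow> 'a mfo" where
  "twist M = (fst M, snd M * eps)"

lemma fst_twist [simp]: "fst (twist M) = fst M" and snd_twist [simp]: "snd (twist M) = snd M * eps"
  and twist_twist [simp]: "twist (twist M) = M"
  by (simp_all add: twist_def mult.assoc)

context subring begin

lemma twist_mfs:
  assumes M: "M \<in> mfs S w" shows "twist M \<in> mfs S (- w)"
proof -
  have "snd M * eps * (snd M * eps) = - (snd M * snd M)"
    by (simp add: mult.assoc eps_odd_assoc[OF mfs_hm[OF M]])
  then show ?thesis using mfs_hm[OF M] mfs_sq[OF M] by (simp add: mfs_def heps)
qed

lemma twist_cocyc: "F \<in> cocyc S (twist M) (twist N) \<longleftrightarrow> F \<in> cocyc S M N"
proof -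
  have "snd N * (eps * F) = F * (snd M * eps) \<longleftrightarrow> snd N * F = F * snd M" if "F \<in> hm S False (fst M) (fst N)"
  proof -
    have "snd N * (eps * F) = snd N * F * eps" "F * (snd M * eps) = F * snd M * eps"
      by (simp_all add: eps_even[OF that] mult.assoc)
    moreover have "A * eps = B * eps \<longleftrightarrow> A = B" for A B :: "'a gmat"
      by (metis eps_eps(1) mult.assoc mult.right_neutral)
    ultimately show ?thesis by simp
  qed
  then show ?thesis by (auto simp: cocyc_def mult.assoc)
qed

lemma twist_homot:
  assumes M: "M \<in> mfs S w" and "homot S M N F G"
  shows "homot S (twist M) (twist N) F G"
proof -
  obtain H where H: "H \<in> hm S True (fst M) (fst N)" "F - G = snd N * H + H * snd M"
    using assms by (auto simp: homot_def)
  have "F - G = snd (twist N) * - (H * eps) + - (H * eps) * snd (twist M)"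
    by (simp add: H(2) mult.assoc eps_odd_assoc[OF H(1)] eps_odd_assoc[OF mfs_hm[OF M]])
  then show ?thesis by (rule htyI[rotated]) (simp add: hminus heps H)
qed

end

text \<open>
  The summand \<open>M[1]\<close> of a cone is embedded by an odd map, which explains the sign operator on it.
\<close>

lemma twist_strict_equiv:
  fixes S :: "'k::field mpow set"
  assumes "subring S"
  shows "strict_equiv S S w (- w) twist (\<lambda>_ _ F. F) (\<lambda>M. eps * idm (prod.swap (fst M)))
    (\<lambda>M N F. in2 (fst M) (fst N) * pr2 (fst M) (fst N) - in1 (fst M) * (eps * pr1 (fst M)))"
proof -
  interpret subring S by (rule assms)
  show ?thesis
  proof
    fix L M N F G assume M: "M \<in> mfs S w"
    note Q = mfs_hm[OF M]
    show "twist M \<in> mfs S (- w)" by (rule twist_mfs[OF M])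
    show "idm (fst M) = idm (fst (twist M))" by simp
    have sQ: "idm (prod.swap (fst M)) * (flp * (snd M * Z)) = flp * (snd M * Z)" for Z
      by (simp add: idm_absorb[OF Q] flip: flp_idm_assoc)
    have e: "eps * idm (prod.swap (fst M)) \<in> cocyc S (twist (shift M)) (shift (twist M))"
      by (simp add: cocyc_def heps hid snd_shift sh_def mult.assoc eps_block eps_flp eps_flp_assoc
          eps_odd_assoc[OF Q] flp_idm flp_idm_assoc idm_absorb[OF Q] sQ)
    show "strict_iso S (twist (shift M)) (shift (twist M)) (eps * idm (prod.swap (fst M)))"
    proof -
      have "eps * idm (prod.swap (fst M)) \<in> cocyc S (shift (twist M)) (twist (shift M))"
        by (simp add: cocyc_def heps hid snd_shift sh_def mult.assoc eps_block eps_flp eps_flp_assoc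
          eps_odd_assoc[OF Q] flp_idm flp_idm_assoc idm_absorb[OF Q] sQ)
      with e show ?thesis unfolding strict_iso_def
        by (intro conjI bexI[of _ "eps * idm (prod.swap (fst M))"]) (simp_all add: mult.assoc eps_block)
    qed
    assume N: "N \<in> mfs S w"
    note P = mfs_hm[OF N]
    show "F \<in> cocyc S M N \<Longrightarrow> F \<in> cocyc S (twist M) (twist N)" by (simp add: twist_cocyc)
    show "homot S (twist M) (twist N) F G \<longleftrightarrow> homot S M N F G"
      using twist_homot[OF M, of N F G] twist_homot[OF twist_mfs[OF M], of "twist N" F G] by (auto simp only: twist_twist)
    show "\<exists>F\<in>cocyc S M N. homot S (twist M) (twist N) F G" if "G \<in> cocyc S (twist M) (twist N)"
      using that by (intro bexI[of _ G]) (simp_all add: twist_cocyc)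
    assume F: "F \<in> cocyc S M N"
    note F' = cocyc_hm[OF F]
    show "eps * idm (prod.swap (fst N)) * sh F = sh F * (eps * idm (prod.swap (fst M)))"
      by (simp add: mult.assoc idm_absorb[OF sh_hm[OF F']] eps_block eps_even[OF sh_hm[OF F']])
    let ?g = "in2 (fst M) (fst N) * pr2 (fst M) (fst N) - in1 (fst M) * (eps * pr1 (fst M))"
    have g: "?g \<in> hm S False (sumr (fst M) (fst N)) (sumr (fst M) (fst N))"
      by (rule hdiff hmul[OF hin2 hpr2] hmul[OF hin1 heps(2)[OF hpr1]] | simp)+
    note r = mcone_rules[OF M N F]
    have tr: "snd (mcone (twist M) (twist N) F) = in2 (fst M) (fst N) * (F * pr1 (fst M))
       + in2 (fst M) (fst N) * (snd N * (eps * pr2 (fst M) (fst N))) - in1 (fst M) * (snd M * (eps * pr1 (fst M)))"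
      by (simp add: mcone_def mult.assoc)
    have cr: "snd (mcone M N F) = in2 (fst M) (fst N) * (F * pr1 (fst M))
       + in2 (fst M) (fst N) * (snd N * (pr2 (fst M) (fst N))) - in1 (fst M) * (snd M * pr1 (fst M))"
      by (simp add: mcone_def mult.assoc)
    have "?g \<in> cocyc S (twist (mcone M N F)) (mcone (twist M) (twist N) F)"
      using g by (simp add: cocyc_def tr cr algebra_simps eps_block eps_odd_assoc[OF Q] eps_odd_assoc[OF P] eps_even_assoc[OF F']
          idm_absorb[OF Q] idm_absorb[OF P] idm_absorb[OF F'])
    moreover have "?g \<in> cocyc S (mcone (twist M) (twist N) F) (twist (mcone M N F))"
      using g by (simp add: cocyc_def tr cr algebra_simps eps_block eps_odd_assoc[OF Q] eps_odd_assoc[OF P] eps_even_assoc[OF F']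
          idm_absorb[OF Q] idm_absorb[OF P] idm_absorb[OF F'])
    moreover have "?g * ?g = idm (sumr (fst M) (fst N))"
      by (simp add: algebra_simps eps_block flip: in_pr)
    ultimately show "strict_iso S (twist (mcone M N F)) (mcone (twist M) (twist N) F) ?g"
      unfolding strict_iso_def by (intro conjI bexI[of _ ?g]) simp_all
    show "?g * in2 (fst M) (fst N) = in2 (fst (twist M)) (fst (twist N))"
      by (simp add: algebra_simps eps_block)
    show "flp * pr1 (fst (twist M)) * ?g = eps * idm (prod.swap (fst M)) * (flp * pr1 (fst M))"
      by (simp add: algebra_simps eps_block eps_flp eps_flp_assoc flp_idm_assoc[symmetric])
  next
    fix N assume N: "N \<in> mfs S (- w)" "reduced N"
    have "twist N \<in> mfs S w" using twist_mfs[OF N(1)] by simp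
    moreover have "reduced (twist N)" using N(2) by (simp add: reduced_def)
    moreover have "strict_iso S (twist (twist N)) N (idm (fst N))"
      using cocyc_id[OF N(1)] unfolding strict_iso_def by (intro conjI bexI[of _ "idm (fst N)"]) simp_all
    ultimately show "\<exists>M\<in>mfs S w. reduced M \<and> (\<exists>F. strict_iso S (twist M) N F)" by blast
  qed (rule refl)
qed


subsection \<open>The Knoerrer functor is a strict equivalence\<close>

text \<open>
  Before and after the shift the module is a sum of two copies of one module, but only one of the
  two inclusions is odd and changes its sign when it passes the shift.
\<close>

definition kn_shift :: "'a::comm_ring_1 mfo \<Rightarrow> 'a gmat" where
  "kn_shift M = (let X = fst M; X' = prod.swap X in
    flp * (in1 X * (flp * pr1 X')) - flp * (in2 X X * (flp * pr2 X' X')))"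

definition kn_cone :: "'a::comm_ring_1 mfo \<Rightarrow> 'a mfo \<Rightarrow> 'a gmat" where
  "kn_cone M N = (let X = fst M; Y = fst N; Z = sumr X Y; XX = sumr X X; YY = sumr Y Y in
    in1 XX * (in1 X * (pr1 X * pr1 Z)) - in1 XX * (in2 X X * (pr1 X * pr2 Z Z)) +
    in2 XX YY * (in1 Y * (pr2 X Y * pr1 Z)) + in2 XX YY * (in2 Y Y * (pr2 X Y * pr2 Z Z)))"

definition kn_cone_inv :: "'a::comm_ring_1 mfo \<Rightarrow> 'a mfo \<Rightarrow> 'a gmat" where
  "kn_cone_inv M N = (let X = fst M; Y = fst N; Z = sumr X Y; XX = sumr X X; YY = sumr Y Y in
    in1 Z * (in1 X * (pr1 X * pr1 XX)) - in2 Z Z * (in1 X * (pr2 X X * pr1 XX)) +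
    in1 Z * (in2 X Y * (pr1 Y * pr2 XX YY)) + in2 Z Z * (in2 X Y * (pr2 Y Y * pr2 XX YY)))"

lemma in_pr_twice:
  "(idm (sumr (sumr X Y) (sumr X' Y')) :: 'a::comm_ring_1 gmat) =
    in1 (sumr X Y) * (in1 X * (pr1 X * pr1 (sumr X Y))) +
    in1 (sumr X Y) * (in2 X Y * (pr2 X Y * pr1 (sumr X Y))) +
    in2 (sumr X Y) (sumr X' Y') * (in1 X' * (pr1 X' * pr2 (sumr X Y) (sumr X' Y'))) +
    in2 (sumr X Y) (sumr X' Y') * (in2 X' Y' * (pr2 X' Y' * pr2 (sumr X Y) (sumr X' Y')))"
  (is "_ = ?r")
proof -
  let ?Z = "sumr X Y" and ?Z' = "sumr X' Y'"
  have "idm (sumr ?Z ?Z') = in1 ?Z * (idm ?Z * pr1 ?Z) + in2 ?Z ?Z' * (idm ?Z' * (pr2 ?Z ?Z' :: 'a gmat))"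
    by (simp add: in_pr)
  also have "\<dots> = ?r" by (simp add: algebra_simps flip: in_pr)
  finally show ?thesis .
qed

lemma strict_iso_inverseI:
  assumes "subring S" and M: "M \<in> mfs S w" and N: "N \<in> mfs S w'" and F: "F \<in> cocyc S M N"
    and G: "G \<in> hm S False (fst N) (fst M)" and inv: "G * F = idm (fst M)" "F * G = idm (fst N)"
  shows "strict_iso S M N F"
proof -
  interpret subring S by (rule assms(1))
  have "snd M * G = G * F * (snd M * G)"
    by (simp add: inv idm_absorb[OF mfs_hm[OF M]])
  also have "\<dots> = G * (snd N * (F * G))"
    by (simp add: mult.assoc mult_eq_assoc[OF cocyc_comm[OF F]])
  also have "\<dots> = G * snd N" by (simp add: inv idm_absorb[OF mfs_hm[OF N]])
  finally show ?thesis using F G inv by (auto simp: cocyc_def strict_iso_def)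
qed

lemma kn_strict_equiv:
  fixes x y w :: "'k::field mpow"
  assumes kn: "knoerrer (series_in V) (series_in U) (series_in W) x y"
    and xy: "mcoeff x {#} = 0" "mcoeff y {#} = 0" and w: "w \<in> series_in V"
  shows "strict_equiv (series_in V) (series_in W) w (w - x * y) (kn x y)
    (\<lambda>M N. kn_mor (fst M) (fst N)) kn_shift (\<lambda>M N _. kn_cone M N)"
proof -
  interpret knoerrer "series_in V :: 'k mpow set" "series_in U" "series_in W" x y by (rule kn)
  let ?S = "series_in V :: 'k mpow set" and ?T = "series_in W :: 'k mpow set"
  show ?thesis
  proof
    fix L M N F G assume M: "M \<in> mfs ?S w"
    note M' = mfs_RT[OF M] and Q = R.mfs_hm[OF M]
    show kM: "kn x y M \<in> mfs ?T (w - x * y)" by (rule T.kn_mfs[OF M' sub(4,5)])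
    show "kn_mor (fst M) (fst M) (idm (fst M)) = idm (fst (kn x y M))" by (simp add: kn_mor_id)
    let ?X = "fst M" let ?X' = "prod.swap ?X" and ?Q = "snd M"
    have sQ: "snd (shift M) \<in> hm ?T True ?X' ?X'" using T.mfs_hm[OF T.shift_mfs[OF M']] by simp
    note sr = kmat_rules[OF sQ] kmat_rules[OF sQ, THEN mult_eq_assoc]
    note Qr = kmat_rules[OF Q] kmat_rules[OF Q, THEN mult_eq_assoc]
    show "strict_iso ?T (kn x y (shift M)) (shift (kn x y M)) (kn_shift M)"
    proof (rule strict_iso_inverseI[OF T.subring_axioms T.kn_mfs[OF T.shift_mfs[OF M'] sub(4,5)] T.shift_mfs[OF kM]])
      have "kn_shift M \<in> hm ?T False (sumr ?X' ?X') (prod.swap (sumr ?X ?X))"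
        unfolding kn_shift_def Let_def
        by (intro T.hdiff hm_flp_left[OF T.hmul[OF T.hin1 hm_flp_left[OF T.hpr1, of False ?X' ?X', simplified] refl]]
            hm_flp_left[OF T.hmul[OF T.hin2 hm_flp_left[OF T.hpr2, of True ?X' ?X', simplified] refl]]) simp_all
      moreover have "snd (shift (kn x y M)) * kn_shift M = kn_shift M * snd (kn x y (shift M))"
        unfolding kn_shift_def Let_def
        by (simp add: algebra_simps sr Qr snd_shift[of "kn x y M"] sh_def smul_simps)
          (simp add: algebra_simps snd_shift sh_def smul_simps)
      ultimately show "kn_shift M \<in> cocyc ?T (kn x y (shift M)) (shift (kn x y M))" by (simp add: cocyc_def)
      show "in1 ?X' * (flp * (pr1 ?X * flp)) - in2 ?X' ?X' * (flp * (pr2 ?X ?X * flp))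
          \<in> hm ?T False (fst (shift (kn x y M))) (fst (kn x y (shift M)))"
        by simp
          (intro T.hdiff T.hmul[OF T.hin1 hm_flp_left[OF hm_flp_right[OF T.hpr1, of False ?X ?X, simplified], of True, simplified]]
            T.hmul[OF T.hin2 hm_flp_left[OF hm_flp_right[OF T.hpr2, of True ?X ?X, simplified], of False, simplified]], simp_all)
      have "flp * (in1 ?X * (pr1 ?X * flp)) + flp * (in2 ?X ?X * (pr2 ?X ?X * flp)) =
          sh (idm (sumr ?X ?X) :: 'k mpow gmat)"
        unfolding sh_def in_pr[symmetric] by (simp add: algebra_simps)
      then show "kn_shift M * (in1 ?X' * (flp * (pr1 ?X * flp)) - in2 ?X' ?X' * (flp * (pr2 ?X ?X * flp))) =
          idm (fst (shift (kn x y M)))"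
        by (simp add: kn_shift_def Let_def algebra_simps flp_idm flp_idm_assoc)
    qed (simp_all add: kn_shift_def Let_def algebra_simps flp_idm flp_idm_assoc flip: in_pr)
    assume N: "N \<in> mfs ?S w"
    note N' = mfs_RT[OF N] and P = R.mfs_hm[OF N]
    have kN: "kn x y N \<in> mfs ?T (w - x * y)" by (rule T.kn_mfs[OF N' sub(4,5)])
    note Pr = kmat_rules[OF P] kmat_rules[OF P, THEN mult_eq_assoc]
    show "\<exists>F\<in>cocyc ?S M N. homot ?T (kn x y M) (kn x y N) (kn_mor (fst M) (fst N) F) G"
      if "G \<in> cocyc ?T (kn x y M) (kn x y N)" by (rule kn_full[OF that M N])
    show "homot ?T (kn x y M) (kn x y N) (kn_mor (fst M) (fst N) F) (kn_mor (fst M) (fst N) G) \<longleftrightarrow> homot ?S M N F G"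
      if "F \<in> cocyc ?S M N" "G \<in> cocyc ?S M N"
      using kn_faithful[OF that M N] T.kn_mor_homot[OF homot_RT M' N'] by blast
    show "kn_mor (fst L) (fst N) (G * F) = kn_mor (fst M) (fst N) G * kn_mor (fst L) (fst M) F"
      if "F \<in> cocyc ?S L M" "G \<in> cocyc ?S M N"
      by (simp add: kn_mor_comp[OF R.cocyc_hm[OF that(2)] R.cocyc_hm[OF that(1)]])
    assume F: "F \<in> cocyc ?S M N"
    note Fh = R.cocyc_hm[OF F]
    show kF: "kn_mor (fst M) (fst N) F \<in> cocyc ?T (kn x y M) (kn x y N)"
      by (rule T.kn_mor_cocyc[OF cocyc_RT[OF F] M' N' sub(4,5)])
    note Fr = kn_mor_rules[OF Fh] kn_mor_rules[OF Fh, THEN mult_eq_assoc]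
    note sFr = kn_mor_rules[OF sh_hm[OF Fh]] kn_mor_rules[OF sh_hm[OF Fh], THEN mult_eq_assoc]
    show "kn_shift N * kn_mor (fst (shift M)) (fst (shift N)) (sh F) = sh (kn_mor (fst M) (fst N) F) * kn_shift M"
      unfolding kn_shift_def Let_def by (simp add: algebra_simps sFr) (simp add: sh_def algebra_simps Fr)
    let ?C = "mcone M N F"
    have C: "?C \<in> mfs ?S w" by (rule R.mcone_mfs[OF M N F])
    note cr = R.mcone_rules[OF M N F] R.mcone_rules[OF M N F, THEN mult_eq_assoc]
    note kcr = T.mcone_rules[OF kM kN kF] T.mcone_rules[OF kM kN kF, THEN mult_eq_assoc]
    note Cr = kmat_rules[OF R.mfs_hm[OF C], unfolded fst_mcone] kmat_rules[OF R.mfs_hm[OF C], unfolded fst_mcone, THEN mult_eq_assoc]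
    show "strict_iso ?T (kn x y ?C) (mcone (kn x y M) (kn x y N) (kn_mor (fst M) (fst N) F)) (kn_cone M N)"
    proof (rule strict_iso_inverseI[OF T.subring_axioms T.kn_mfs[OF mfs_RT[OF C] sub(4,5)] T.mcone_mfs[OF kM kN kF]])
      have "kn_cone M N \<in> hm ?T False (sumr (sumr (fst M) (fst N)) (sumr (fst M) (fst N)))
          (sumr (sumr (fst M) (fst M)) (sumr (fst N) (fst N)))"
        unfolding kn_cone_def Let_def
        by (intro T.hadd T.hdiff T.hmul[OF T.hin1 T.hmul[OF T.hin1 T.hmul[OF T.hpr1 T.hpr1 refl] refl]]
            T.hmul[OF T.hin1 T.hmul[OF T.hin2 T.hmul[OF T.hpr1 T.hpr2 refl] refl]]
            T.hmul[OF T.hin2 T.hmul[OF T.hin1 T.hmul[OF T.hpr2 T.hpr1 refl] refl]]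
            T.hmul[OF T.hin2 T.hmul[OF T.hin2 T.hmul[OF T.hpr2 T.hpr2 refl] refl]]) simp_all
      moreover have "snd (mcone (kn x y M) (kn x y N) (kn_mor (fst M) (fst N) F)) * kn_cone M N = kn_cone M N * snd (kn x y ?C)"
        unfolding kn_cone_def Let_def
        by (simp add: algebra_simps kcr[simplified] Cr) (simp add: algebra_simps cr Qr Pr Fr smul_simps)
      ultimately show "kn_cone M N \<in> cocyc ?T (kn x y ?C) (mcone (kn x y M) (kn x y N) (kn_mor (fst M) (fst N) F))"
        by (simp add: cocyc_def)
      show "kn_cone_inv M N \<in> hm ?T False (fst (mcone (kn x y M) (kn x y N) (kn_mor (fst M) (fst N) F))) (fst (kn x y ?C))"
        unfolding kn_cone_inv_def Let_def fst_mcone fst_kn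
        by (intro T.hadd T.hdiff T.hmul[OF T.hin1 T.hmul[OF T.hin1 T.hmul[OF T.hpr1 T.hpr1 refl] refl]]
            T.hmul[OF T.hin2 T.hmul[OF T.hin1 T.hmul[OF T.hpr2 T.hpr1 refl] refl]]
            T.hmul[OF T.hin1 T.hmul[OF T.hin2 T.hmul[OF T.hpr1 T.hpr2 refl] refl]]
            T.hmul[OF T.hin2 T.hmul[OF T.hin2 T.hmul[OF T.hpr2 T.hpr2 refl] refl]]) simp_all
      show "kn_cone_inv M N * kn_cone M N = idm (fst (kn x y ?C))"
        "kn_cone M N * kn_cone_inv M N = idm (fst (mcone (kn x y M) (kn x y N) (kn_mor (fst M) (fst N) F)))"
        unfolding kn_cone_inv_def kn_cone_def Let_def fst_mcone fst_kn
        by (simp_all add: algebra_simps in_pr_twice)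
    qed
    show "kn_cone M N * kn_mor (fst N) (fst ?C) (in2 (fst M) (fst N)) = in2 (fst (kn x y M)) (fst (kn x y N))"
      unfolding kn_cone_def kn_mor_def Let_def fst_mcone fst_kn
      by (simp add: algebra_simps) (simp add: in_pr flip: distrib_left)
    show "flp * pr1 (fst (kn x y M)) * kn_cone M N = kn_shift M * kn_mor (fst ?C) (fst (shift M)) (flp * pr1 (fst M))"
      unfolding kn_cone_def kn_mor_def kn_shift_def Let_def fst_mcone fst_kn fst_shift
      by (simp add: algebra_simps flp_idm_assoc[symmetric])
  next
    fix N assume "N \<in> mfs ?T (w - x * y)" "reduced N"
    then show "\<exists>M\<in>mfs ?S w. reduced M \<and> (\<exists>F. strict_iso ?T (kn x y M) N F)"
      by (rule kn_essentially_surjective[OF kn xy w])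
  qed
qed


section \<open>Pairs of matrices as graded maps\<close>

lemma mats_iff: "A \<in> mats S r c \<longleftrightarrow> dim_row A = r \<and> dim_col A = c \<and> (\<forall>i<r. \<forall>j<c. A $$ (i, j) \<in> S)"
proof
  assume "A \<in> mats S r c"
  then have "A \<in> carrier_mat r c" "elements_mat A \<subseteq> S" by (auto simp: mats_def)
  moreover from this(1) have "A $$ (i, j) \<in> elements_mat A" if "i < r" "j < c" for i j
    by (rule elements_matI) (simp_all add: that)
  ultimately show "dim_row A = r \<and> dim_col A = c \<and> (\<forall>i<r. \<forall>j<c. A $$ (i, j) \<in> S)" by auto
next
  assume "dim_row A = r \<and> dim_col A = c \<and> (\<forall>i<r. \<forall>j<c. A $$ (i, j) \<in> S)"
  then show "A \<in> mats S r c" by (auto simp: mats_def)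
qed

definition rk :: "'a hmap \<Rightarrow> nat \<times> nat" where "rk M = (rk0 M, rk1 M)"

definition maps :: "'a set \<Rightarrow> bool \<Rightarrow> nat \<times> nat \<Rightarrow> nat \<times> nat \<Rightarrow> 'a hmap set" where
  "maps S p X Y = mats S (rkof Y p) (rkof X False) \<times> mats S (rkof Y (\<not> p)) (rkof X True)"

lemma even_maps_eq: "even_maps S M N = maps S False (rk M) (rk N)"
  and odd_maps_eq: "odd_maps S M N = maps S True (rk M) (rk N)"
  by (simp_all add: even_maps_def odd_maps_def maps_def rk_def rkof_def)

definition part :: "'a hmap \<Rightarrow> bool \<Rightarrow> 'a mat" where
  "part f b = (if b then snd f else fst f)"

lemma maps_iff: "f \<in> maps S p X Y \<longleftrightarrow> (\<forall>b. part f b \<in> mats S (rkof Y (b \<noteq> p)) (rkof X b))"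
  by (cases f) (auto simp: maps_def part_def split: if_splits)

lemma maps_dims:
  assumes "f \<in> maps S p X Y"
  shows "dim_row (part f b) = rkof Y (b \<noteq> p)" "dim_col (part f b) = rkof X b"
  using assms by (auto simp: maps_iff mats_iff)

lemma maps_mono: "f \<in> maps S p X Y \<Longrightarrow> S \<subseteq> S' \<Longrightarrow> f \<in> maps S' p X Y"
  by (auto simp: maps_iff mats_iff)

lemma part_ext: "(\<And>b. part f b = part g b) \<Longrightarrow> f = g"
  by (metis part_def prod_eqI)

text \<open>
  The parity \<open>p\<close> is an argument because the pair of matrices alone does not show it.
\<close>

definition gm :: "bool \<Rightarrow> 'a hmap \<Rightarrow> 'a::comm_ring_1 gmat" where
  "gm p f = (let X = (dim_col (fst f), dim_col (snd f)); d = (\<lambda>b. dim_row (part f b));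
    Y = (d p, d (\<not> p)) in
    hmat p X Y (\<lambda>i j. part f (gpar j) $$ (gpos i, gpos j)))"

lemma ent_gm: "ent (gm p f) i j = (if gpar i = (gpar j \<noteq> p) \<and> gpos i < dim_row (part f (gpar j)) \<and>
    gpos j < dim_col (part f (gpar j)) then part f (gpar j) $$ (gpos i, gpos j) else 0)"
  by (cases i; cases j) (auto simp: gm_def Let_def ent_hmat part_def rkof_def)

lemma gm_hm:
  assumes f: "f \<in> maps S p X Y" and "0 \<in> S"
  shows "gm p f \<in> hm S p X Y"
proof (rule hmI_zero)
  fix i j
  note d = maps_dims[OF f, of "gpar j"]
  show "ent (gm p f) i j \<in> S"
    using f assms(2) by (auto simp: ent_gm maps_iff mats_iff d)
  assume "\<not> (i \<in> idx Y \<and> j \<in> idx X \<and> gpar i = (gpar j \<noteq> p))"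
  then show "ent (gm p f) i j = 0"
    by (cases p; cases "gpar i"; cases "gpar j") (auto simp: ent_gm maps_dims[OF f] idx_def)
qed

lemma gm_surj:
  assumes F: "F \<in> hm S p X Y"
  obtains f where "f \<in> maps S p X Y" "gm p f = F"
proof
  define g where "g = (\<lambda>b. mat (rkof Y (b \<noteq> p)) (rkof X b) (\<lambda>(i, j). ent F (Ix (b \<noteq> p) i) (Ix b j)))"
  define f where "f = (g False, g True)"
  have part: "part f b = g b" for b by (simp add: part_def f_def)
  show "f \<in> maps S p X Y"
    unfolding maps_iff part mats_iff g_def using hm_entD(1)[OF F] by simp
  show "gm p f = F"
  proof (rule ent_eqI)
    fix i j
    show "ent (gm p f) i j = ent F i j"
    proof (cases "i \<in> idx Y \<and> j \<in> idx X \<and> gpar i = (gpar j \<noteq> p)")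
      case True
      then show ?thesis unfolding ent_gm part g_def
        by (cases i; cases j) (auto simp: idx_def)
    next
      case False
      then have "ent (gm p f) i j = 0" unfolding ent_gm part g_def
        by (cases p; cases "gpar i"; cases "gpar j") (auto simp: idx_def)
      then show ?thesis by (simp add: hm_zero[OF F False])
    qed
  qed
qed

lemma gm_inj:
  assumes f: "f \<in> maps S p X Y" and g: "g \<in> maps S' p X Y" and eq: "gm p f = gm p g"
  shows "f = g"
proof (rule part_ext)
  fix b
  show "part f b = part g b"
  proof (rule eq_matI)
    fix i j assume "i < dim_row (part g b)" "j < dim_col (part g b)"
    then show "part f b $$ (i, j) = part g b $$ (i, j)"
      using arg_cong[OF eq, of "\<lambda>G. ent G (Ix (b \<noteq> p) i) (Ix b j)"]
      by (simp add: ent_gm maps_dims[OF f] maps_dims[OF g])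
  qed (simp_all add: maps_dims[OF f] maps_dims[OF g])
qed

lemma part_add [simp]: "part (f + g) b = part f b + part g b"
  and part_diff [simp]: "part (f - g) b = part f b - part g b"
  and part_minus [simp]: "part (- f) b = - part f b"
  by (simp_all add: part_def)

lemma gm_minus: "gm p (- f) = - gm p f"
  by (rule ent_eqI) (auto simp: ent_gm)

lemma gm_diff:
  assumes f: "f \<in> maps S p X Y" and g: "g \<in> maps S' p X Y"
  shows "gm p (f - g) = gm p f - gm p g"
  by (rule ent_eqI) (auto simp: ent_gm maps_dims[OF f] maps_dims[OF g])

lemma gm_add:
  assumes f: "f \<in> maps S p X Y" and g: "g \<in> maps S' p X Y"
  shows "gm p (f + g) = gm p f + gm p g"
  by (rule ent_eqI) (auto simp: ent_gm maps_dims[OF f] maps_dims[OF g])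

text \<open>
  The parity \<open>q\<close> of \<open>f\<close> decides which component of \<open>g\<close> is composed with which one of \<open>f\<close>.
\<close>

definition hcomp :: "bool \<Rightarrow> 'a hmap \<Rightarrow> 'a hmap \<Rightarrow> 'a::comm_ring_1 hmap" where
  "hcomp q g f = (part g q * fst f, part g (\<not> q) * snd f)"

lemma part_hcomp: "part (hcomp q g f) b = part g (b \<noteq> q) * part f b"
  by (simp add: part_def hcomp_def)

lemma gm_hcomp:
  assumes f: "f \<in> maps S q X Y" and g: "g \<in> maps S' p Y Z" and r: "r = (p \<noteq> q)"
  shows "gm r (hcomp q g f) = gm p g * gm q f"
proof (rule ent_eqI)
  fix i j
  obtain b k where i: "i = Ix b k" by (cases i)
  obtain c l where j: "j = Ix c l" by (cases j)
  let ?c = "c \<noteq> q" and ?n = "rkof Y (c \<noteq> q)"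
  have "ent (gm p g * gm q f) i j = (\<Sum>m\<in>Ix ?c ` {0..<?n}. ent (gm p g) i m * ent (gm q f) m j)"
  proof (rule ent_times)
    fix m assume m: "m \<notin> Ix ?c ` {0..<?n}"
    have "ent (gm q f) m j = 0"
    proof (cases m)
      case (Ix d e)
      with m have "\<not> (d = ?c \<and> e < ?n)" by auto
      then show ?thesis by (auto simp: ent_gm Ix j maps_dims[OF f])
    qed
    then show "ent (gm p g) i m * ent (gm q f) m j = 0" by simp
  qed simp
  also have "\<dots> = (\<Sum>m\<in>{0..<?n}. ent (gm p g) i (Ix ?c m) * ent (gm q f) (Ix ?c m) j)"
    by (subst sum.reindex) (auto intro: inj_onI)
  also have "\<dots> = ent (gm r (hcomp q g f)) i j"
  proof (cases "b = (c \<noteq> r) \<and> k < rkof Z b \<and> l < rkof X c")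
    case True
    then have "ent (gm r (hcomp q g f)) i j = (part g ?c * part f c) $$ (k, l)"
      by (auto simp: ent_gm i j part_hcomp maps_dims[OF f] maps_dims[OF g] r)
    also have "\<dots> = (\<Sum>m\<in>{0..<?n}. part g ?c $$ (k, m) * part f c $$ (m, l))"
      using True by (subst index_mult_mat) (auto simp: scalar_prod_def maps_dims[OF f] maps_dims[OF g] r)
    also have "\<dots> = (\<Sum>m\<in>{0..<?n}. ent (gm p g) i (Ix ?c m) * ent (gm q f) (Ix ?c m) j)"
      by (rule sum.cong) (use True in \<open>auto simp: ent_gm i j maps_dims[OF f] maps_dims[OF g] r\<close>)
    finally show ?thesis by simp
  next
    case False
    then have "ent (gm p g) i (Ix ?c m) * ent (gm q f) (Ix ?c m) j = 0" for m
      by (auto simp: ent_gm i j maps_dims[OF f] maps_dims[OF g] r)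
    moreover have "ent (gm r (hcomp q g f)) i j = 0"
      using False by (auto simp: ent_gm i j part_hcomp maps_dims[OF f] maps_dims[OF g] r)
    ultimately show ?thesis by (simp only: sum.neutral_const)
  qed
  finally show "ent (gm r (hcomp q g f)) i j = ent (gm p g * gm q f) i j" by simp
qed

lemma hcomp_maps:
  assumes f: "f \<in> maps S q X Y" and g: "g \<in> maps S p Y Z" and r: "r = (p \<noteq> q)" and S: "subring S"
  shows "hcomp q g f \<in> maps S r X Z"
proof -
  interpret subring S by (rule S)
  obtain h where h: "h \<in> maps S r X Z" "gm r h = gm p g * gm q f"
    using gm_surj[OF hmul[OF gm_hm[OF g zero] gm_hm[OF f zero] r]] by blast
  have "hcomp q g f \<in> maps UNIV r X Z"
    unfolding maps_iff mats_iff
    by (cases p; cases q) (auto simp: part_hcomp maps_dims[OF f] maps_dims[OF g] r)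
  then have "hcomp q g f = h" using gm_inj[OF _ h(1)] gm_hcomp[OF f g r] h(2) by simp
  with h(1) show ?thesis by simp
qed

lemma even_comp_eq: "even_comp g f = hcomp False g f"
  by (simp add: even_comp_def hcomp_def part_def)

lemma gm_swap: "gm False (prod.swap f) = sh (gm False f)"
  by (rule ent_eqI) (auto simp: ent_gm part_def sh_def mult.assoc ent_flp_mult ent_mult_flp flip_def)

lemma gm_odd_swap: "gm True f = flp * gm False f"
  by (rule ent_eqI) (auto simp: ent_gm part_def ent_flp_mult flip_def)

lemma gm_twist: "gm p (fst f, - snd f) = gm p f * eps"
  by (rule ent_eqI) (auto simp: ent_gm part_def ent_mult_eps)

lemma gm_transpose: "gm True (odd_transpose f) = tr (gm True f)"
  by (rule ent_eqI) (auto simp: ent_gm part_def odd_transpose_def)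

lemma gm_id: "gm False (c \<cdot>\<^sub>m 1\<^sub>m (fst X), c \<cdot>\<^sub>m 1\<^sub>m (snd X)) = c \<odot> idm X"
proof (rule ent_eqI)
  fix i j show "ent (gm False (c \<cdot>\<^sub>m 1\<^sub>m (fst X), c \<cdot>\<^sub>m 1\<^sub>m (snd X))) i j = ent (c \<odot> idm X) i j"
    by (cases i; cases j) (auto simp: ent_gm part_def ent_idm rkof_def)
qed

lemma gm_mf_id: "gm False (mf_id M) = idm (rk M)"
proof -
  have "mf_id M = (1 \<cdot>\<^sub>m 1\<^sub>m (fst (rk M)), 1 \<cdot>\<^sub>m 1\<^sub>m (snd (rk M)))"
    by (auto simp: mf_id_def rk_def intro!: eq_matI)
  then show ?thesis by (simp only: gm_id smul_1)
qed


subsection \<open>Block maps\<close>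

lemma pr1_eq: "pr1 X = tr (pinj flip (idx X))" and pr2_eq: "pr2 X Y = tr (pinj (offset X) (idx Y))"
  by (simp_all only: pr1_def pr2_def in1_def in2_def)

text \<open>
  The block map from \<open>X[1] \<oplus> X'\<close> to \<open>Y[1] \<oplus> Y'\<close>. The maps \<open>a\<close> and \<open>c\<close> start at the shifted summand, so
  their components appear interchanged.
\<close>

definition blk :: "'a hmap \<Rightarrow> 'a hmap \<Rightarrow> 'a hmap \<Rightarrow> 'a hmap \<Rightarrow> 'a::comm_ring_1 hmap" where
  "blk a b c d = (four_block_mat (snd a) (fst b) (snd c) (fst d), four_block_mat (fst a) (snd b) (fst c) (snd d))"

lemma part_blk: "part (blk a b c d) e = four_block_mat (part a (\<not> e)) (part b e) (part c (\<not> e)) (part d e)"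
  by (simp add: part_def blk_def)

lemma gm_blk:
  assumes a: "a \<in> maps S p X Y" and b: "b \<in> maps S (\<not> p) X' Y"
    and c: "c \<in> maps S (\<not> p) X Y'" and d: "d \<in> maps S p X' Y'"
  shows "gm p (blk a b c d) = in1 Y * gm p a * pr1 X + in1 Y * gm (\<not> p) b * pr2 X X' +
    in2 Y Y' * gm (\<not> p) c * pr1 X + in2 Y Y' * gm p d * pr2 X X'"
    and "blk a b c d \<in> maps UNIV p (sumr X X') (sumr Y Y')"
proof -
  note dims = maps_dims[OF a] maps_dims[OF b] maps_dims[OF c] maps_dims[OF d]
  show B: "blk a b c d \<in> maps UNIV p (sumr X X') (sumr Y Y')"
    unfolding maps_iff mats_iff by (auto simp: part_blk dims)
  let ?G = "gm p (blk a b c d)"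
  have G: "?G \<in> hm UNIV p (sumr X X') (sumr Y Y')" using gm_hm[OF B] by simp
  have dd: "dim_row (fst f) = rkof W' p" "dim_col (fst f) = rkof W False"
    "dim_row (snd f) = rkof W' (\<not> p)" "dim_col (snd f) = rkof W True"
    if "f \<in> maps S p W W'" for f :: "'a hmap" and W W' p
    using maps_dims[OF that, of False] maps_dims[OF that, of True] by (simp_all add: part_def)
  note d' = dd[OF a] dd[OF b] dd[OF c] dd[OF d]
  note e = ent_gm part_def blk_def d'
  have 11: "pr1 Y * (?G * in1 X) = gm p a"
  proof (rule ent_eqI)
    fix i j
    have "ent (pr1 Y * (?G * in1 X)) i j = (if i \<in> idx Y \<and> j \<in> idx X then ent ?G (flip i) (flip j) else 0)"
      by (simp add: pr1_eq in1_def ent_tr_pinj_mult ent_mult_pinj)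
    then show "ent (pr1 Y * (?G * in1 X)) i j = ent (gm p a) i j"
      by (cases i; cases j; cases p; cases "gpar i"; cases "gpar j") (auto simp: e)
  qed
  have 12: "pr1 Y * (?G * in2 X X') = gm (\<not> p) b"
  proof (rule ent_eqI)
    fix i j
    have "ent (pr1 Y * (?G * in2 X X')) i j = (if i \<in> idx Y \<and> j \<in> idx X' then ent ?G (flip i) (offset X j) else 0)"
      by (simp add: pr1_eq in2_def ent_tr_pinj_mult ent_mult_pinj)
    then show "ent (pr1 Y * (?G * in2 X X')) i j = ent (gm (\<not> p) b) i j"
      by (cases i; cases j; cases p; cases "gpar i"; cases "gpar j") (auto simp: e)
  qed
  have 21: "pr2 Y Y' * (?G * in1 X) = gm (\<not> p) c"
  proof (rule ent_eqI)
    fix i j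
    have "ent (pr2 Y Y' * (?G * in1 X)) i j = (if i \<in> idx Y' \<and> j \<in> idx X then ent ?G (offset Y i) (flip j) else 0)"
      by (simp add: pr2_eq in1_def ent_tr_pinj_mult ent_mult_pinj)
    then show "ent (pr2 Y Y' * (?G * in1 X)) i j = ent (gm (\<not> p) c) i j"
      by (cases i; cases j; cases p; cases "gpar i"; cases "gpar j") (auto simp: e)
  qed
  have 22: "pr2 Y Y' * (?G * in2 X X') = gm p d"
  proof (rule ent_eqI)
    fix i j
    have "ent (pr2 Y Y' * (?G * in2 X X')) i j = (if i \<in> idx Y' \<and> j \<in> idx X' then ent ?G (offset Y i) (offset X j) else 0)"
      by (simp add: pr2_eq in2_def ent_tr_pinj_mult ent_mult_pinj)
    then show "ent (pr2 Y Y' * (?G * in2 X X')) i j = ent (gm p d) i j"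
      by (cases i; cases j; cases p; cases "gpar i"; cases "gpar j") (auto simp: e)
  qed
  show "?G = in1 Y * gm p a * pr1 X + in1 Y * gm (\<not> p) b * pr2 X X' +
    in2 Y Y' * gm (\<not> p) c * pr1 X + in2 Y Y' * gm p d * pr2 X X'"
    by (subst block_expand[OF G]) (simp only: 11 12 21 22)
qed

lemma blk_maps:
  assumes a: "a \<in> maps S p X Y" and b: "b \<in> maps S (\<not> p) X' Y"
    and c: "c \<in> maps S (\<not> p) X Y'" and d: "d \<in> maps S p X' Y'" and S: "subring S"
  shows "blk a b c d \<in> maps S p (sumr X X') (sumr Y Y')"
proof -
  interpret subring S by (rule S)
  have "gm p (blk a b c d) \<in> hm S p (sumr X X') (sumr Y Y')"
    unfolding gm_blk(1)[OF a b c d] mult.assoc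
    by (intro hadd hblk(1)[OF gm_hm[OF a zero]] hblk(2)[OF gm_hm[OF b zero]]
        hblk(3)[OF gm_hm[OF c zero]] hblk(4)[OF gm_hm[OF d zero]]) simp_all
  then obtain f where f: "f \<in> maps S p (sumr X X') (sumr Y Y')" "gm p f = gm p (blk a b c d)"
    by (rule gm_surj)
  have "f = blk a b c d" by (rule gm_inj[OF f(1) gm_blk(2)[OF a b c d] f(2)])
  with f show ?thesis by simp
qed


subsection \<open>Matrix factorizations\<close>

definition rep :: "'a::comm_ring_1 hmap \<Rightarrow> 'a mfo" where
  "rep M = (rk M, gm True M)"

lemma fst_rep [simp]: "fst (rep M) = rk M" and snd_rep [simp]: "snd (rep M) = gm True M"
  by (simp_all add: rep_def)

lemma rk_maps: "M \<in> maps S True X X \<Longrightarrow> rk M = X"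
  by (cases X) (auto simp: maps_def mats_iff rk_def rk0_def rk1_def rkof_def)

lemma smult_maps: "(c \<cdot>\<^sub>m 1\<^sub>m (fst X), c \<cdot>\<^sub>m 1\<^sub>m (snd X)) \<in> maps UNIV False X X"
  by (simp add: maps_def mats_iff rkof_def)

lemma zero_maps: "(0\<^sub>m (rkof Y p) (rkof X False), 0\<^sub>m (rkof Y (\<not> p)) (rkof X True)) \<in> maps UNIV p X Y"
  by (simp add: maps_def mats_iff)

lemma gm_zero: "gm p (0\<^sub>m a b, 0\<^sub>m c d) = 0"
  by (rule ent_eqI) (auto simp: ent_gm part_def)

lemma is_MF_iff: "is_MF S w M \<longleftrightarrow> M \<in> maps S True (rk M) (rk M) \<and> gm True M * gm True M = w \<odot> idm (rk M)"
proof -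
  have 1: "M \<in> maps S True (rk M) (rk M) \<longleftrightarrow>
      fst M \<in> mats S (rk1 M) (rk0 M) \<and> snd M \<in> mats S (rk0 M) (rk1 M)"
    by (cases M) (auto simp: maps_def rk_def rkof_def)
  have "snd M * fst M = w \<cdot>\<^sub>m 1\<^sub>m (rk0 M) \<and> fst M * snd M = w \<cdot>\<^sub>m 1\<^sub>m (rk1 M) \<longleftrightarrow>
      gm True M * gm True M = w \<odot> idm (rk M)" if M: "M \<in> maps S True (rk M) (rk M)"
  proof -
    have MM: "hcomp True M M \<in> maps UNIV False (rk M) (rk M)"
      by (rule hcomp_maps[OF maps_mono[OF M] maps_mono[OF M]]) (simp_all add: subring_UNIV)
    have "gm True M * gm True M = w \<odot> idm (rk M) \<longleftrightarrow>
        gm False (hcomp True M M) = gm False (w \<cdot>\<^sub>m 1\<^sub>m (fst (rk M)), w \<cdot>\<^sub>m 1\<^sub>m (snd (rk M)))"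
      by (simp only: gm_id) (simp add: gm_hcomp[OF M M])
    also have "\<dots> \<longleftrightarrow> hcomp True M M = (w \<cdot>\<^sub>m 1\<^sub>m (fst (rk M)), w \<cdot>\<^sub>m 1\<^sub>m (snd (rk M)))"
      using gm_inj[OF MM smult_maps] by auto
    finally show ?thesis by (auto simp: hcomp_def part_def rk_def)
  qed
  with 1 show ?thesis unfolding is_MF_def by auto
qed

lemma MF_maps: "is_MF S w M \<Longrightarrow> M \<in> maps S True (rk M) (rk M)"
  by (simp add: is_MF_iff)

lemma rep_mfs:
  assumes "is_MF S w M" "0 \<in> S"
  shows "rep M \<in> mfs S w"
  using gm_hm[OF MF_maps[OF assms(1)] assms(2)] assms(1) by (simp add: mfs_def is_MF_iff)

lemma rep_surj:
  assumes "N \<in> mfs S w"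
  obtains M where "is_MF S w M" "rep M = N"
proof -
  have "snd N \<in> hm S True (fst N) (fst N)" using assms by (simp add: mfs_def)
  then obtain M where M: "M \<in> maps S True (fst N) (fst N)" "gm True M = snd N" by (rule gm_surj)
  have rk: "rk M = fst N" by (rule rk_maps[OF M(1)])
  then have "is_MF S w M" using M assms by (simp add: is_MF_iff mfs_def)
  moreover have "rep M = N" using M rk by (simp add: rep_def)
  ultimately show ?thesis by (rule that)
qed

lemma cocycles_iff:
  assumes M: "is_MF S w M" and N: "is_MF S w' N" and S: "0 \<in> S"
  shows "f \<in> cocycles S M N \<longleftrightarrow> f \<in> maps S False (rk M) (rk N) \<and> gm False f \<in> cocyc S (rep M) (rep N)"
proof -
  have "D_even M N f = (0\<^sub>m (rk1 N) (rk0 M), 0\<^sub>m (rk0 N) (rk1 M)) \<longleftrightarrow> gm True N * gm False f = gm False f * gm True M"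
    if f: "f \<in> maps S False (rk M) (rk N)"
  proof -
    have m: "hcomp False N f \<in> maps UNIV True (rk M) (rk N)" "hcomp True f M \<in> maps UNIV True (rk M) (rk N)"
      using f MF_maps[OF M] MF_maps[OF N]
      by (auto intro!: hcomp_maps[OF _ _ _ subring_UNIV] intro: maps_mono)
    have D: "D_even M N f = hcomp False N f - hcomp True f M"
      by (simp add: D_even_def hcomp_def part_def)
    have Dm: "D_even M N f \<in> maps UNIV True (rk M) (rk N)"
      unfolding D maps_iff mats_iff by (simp add: maps_dims[OF m(1)] maps_dims[OF m(2)])
    have "D_even M N f = (0\<^sub>m (rk1 N) (rk0 M), 0\<^sub>m (rk0 N) (rk1 M)) \<longleftrightarrow> gm True (D_even M N f) = 0"
      using gm_inj[OF Dm, of "(0\<^sub>m (rk1 N) (rk0 M), 0\<^sub>m (rk0 N) (rk1 M))" UNIV] zero_maps[of "rk N" True "rk M"]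
      by (auto simp: gm_zero rk_def rkof_def)
    also have "gm True (D_even M N f) = gm True N * gm False f - gm False f * gm True M"
      unfolding D gm_diff[OF m]
      by (simp add: gm_hcomp[OF f MF_maps[OF N]] gm_hcomp[OF MF_maps[OF M] f])
    finally show ?thesis by simp
  qed
  moreover have "gm False f \<in> hm S False (rk M) (rk N)" if "f \<in> maps S False (rk M) (rk N)"
    by (rule gm_hm[OF that S])
  ultimately show ?thesis unfolding cocycles_def even_maps_eq cocyc_def by auto
qed

lemma D_odd_gm:
  assumes M: "is_MF S w M" and N: "is_MF S w' N" and h: "h \<in> maps S True (rk M) (rk N)"
  shows "gm False (D_odd M N h) = gm True N * gm True h + gm True h * gm True M"
    and "D_odd M N h \<in> maps UNIV False (rk M) (rk N)"
proof -
  have m: "hcomp True N h \<in> maps UNIV False (rk M) (rk N)" "hcomp True h M \<in> maps UNIV False (rk M) (rk N)"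
    using h MF_maps[OF M] MF_maps[OF N]
    by (auto intro!: hcomp_maps[OF _ _ _ subring_UNIV] intro: maps_mono)
  have D: "D_odd M N h = hcomp True N h + hcomp True h M"
    by (simp add: D_odd_def hcomp_def part_def)
  show "gm False (D_odd M N h) = gm True N * gm True h + gm True h * gm True M"
    unfolding D gm_add[OF m] by (simp add: gm_hcomp[OF h MF_maps[OF N]] gm_hcomp[OF MF_maps[OF M] h])
  show "D_odd M N h \<in> maps UNIV False (rk M) (rk N)"
    unfolding D maps_iff mats_iff by (simp add: maps_dims[OF m(1)] maps_dims[OF m(2)])
qed

lemma homotopic_iff:
  assumes M: "is_MF S w M" and N: "is_MF S w' N" and S: "0 \<in> S"
  shows "(f, g) \<in> homotopic S M N \<longleftrightarrow> f \<in> cocycles S M N \<and> g \<in> cocycles S M N \<and>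
    homot S (rep M) (rep N) (gm False f) (gm False g)"
proof -
  have "(\<exists>h\<in>odd_maps S M N. f - g = D_odd M N h) \<longleftrightarrow> homot S (rep M) (rep N) (gm False f) (gm False g)"
    if "f \<in> cocycles S M N" "g \<in> cocycles S M N"
  proof -
    have f: "f \<in> maps S False (rk M) (rk N)" and g: "g \<in> maps S False (rk M) (rk N)"
      using that by (auto simp: cocycles_iff[OF M N S])
    have fg: "f - g \<in> maps UNIV False (rk M) (rk N)"
      unfolding maps_iff mats_iff by (simp add: maps_dims[OF f] maps_dims[OF g])
    have *: "f - g = D_odd M N h \<longleftrightarrow> gm False f - gm False g = gm True N * gm True h + gm True h * gm True M"
      if "h \<in> maps S True (rk M) (rk N)" for h
      using gm_inj[OF fg D_odd_gm(2)[OF M N that]]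
      unfolding gm_diff[OF f g, symmetric] D_odd_gm(1)[OF M N that, symmetric] by auto
    show ?thesis
    proof
      assume "\<exists>h\<in>odd_maps S M N. f - g = D_odd M N h"
      then obtain h where h: "h \<in> maps S True (rk M) (rk N)" "f - g = D_odd M N h"
        unfolding odd_maps_eq by blast
      then show "homot S (rep M) (rep N) (gm False f) (gm False g)"
        unfolding homot_def using * gm_hm[OF h(1) S] by (intro bexI[of _ "gm True h"]) simp_all
    next
      assume "homot S (rep M) (rep N) (gm False f) (gm False g)"
      then obtain H where H: "H \<in> hm S True (rk M) (rk N)"
        "gm False f - gm False g = gm True N * H + H * gm True M" by (auto simp: homot_def)
      obtain h where h: "h \<in> maps S True (rk M) (rk N)" "gm True h = H" by (rule gm_surj[OF H(1)])
      show "\<exists>h\<in>odd_maps S M N. f - g = D_odd M N h"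
        unfolding odd_maps_eq using * h H by (intro bexI[of _ h]) simp_all
    qed
  qed
  then show ?thesis unfolding homotopic_def by blast
qed

lemma rep_shift: "M \<in> maps S True (rk M) (rk M) \<Longrightarrow> rep (mf_shift M) = shift (rep M)"
proof -
  assume M: "M \<in> maps S True (rk M) (rk M)"
  have "rk (mf_shift M) = prod.swap (rk M)"
    using M by (auto simp: rk_def rk0_def rk1_def mf_shift_def maps_def mats_iff rkof_def)
  moreover have "gm True (mf_shift M) = - sh (gm True M)"
    by (rule ent_eqI)
      (auto simp: ent_gm part_def sh_def mult.assoc ent_flp_mult ent_mult_flp flip_def mf_shift_def)
  ultimately show ?thesis by (simp add: rep_def shift_def)
qed

lemma minus_maps: "f \<in> maps S p X Y \<Longrightarrow> subring S \<Longrightarrow> - f \<in> maps S p X Y"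
  by (auto simp: maps_iff mats_iff subring.minus)

lemma rk_rep_eqI: "M \<in> maps S True X X \<Longrightarrow> gm True M = Q \<Longrightarrow> rep M = (X, Q)"
  by (simp add: rep_def rk_maps)

lemma zero_maps': "0 \<in> S \<Longrightarrow> (0\<^sub>m (rkof Y p) (rkof X False), 0\<^sub>m (rkof Y (\<not> p)) (rkof X True)) \<in> maps S p X Y"
  by (simp add: maps_def mats_iff)

lemma rep_cone:
  assumes M: "is_MF S w M" and N: "is_MF S w N" and f: "f \<in> maps S False (rk M) (rk N)" and S: "subring S"
  shows "rep (cone M N f) = mcone (rep M) (rep N) (gm False f)"
    and "cone M N f \<in> maps S True (sumr (rk M) (rk N)) (sumr (rk M) (rk N))"
proof -
  interpret subring S by (rule S)
  let ?z = "(0\<^sub>m (rkof (rk M) False) (rkof (rk N) False), 0\<^sub>m (rkof (rk M) (\<not> False)) (rkof (rk N) True)) :: 'a hmap"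
  have eq: "cone M N f = blk (- M) ?z f N"
    by (simp add: cone_def blk_def rk_def rkof_def)
  note a = minus_maps[OF MF_maps[OF M] S] and d = MF_maps[OF N]
  have b: "?z \<in> maps S (\<not> True) (rk N) (rk M)" and c: "f \<in> maps S (\<not> True) (rk M) (rk N)"
    using zero_maps'[of S "rk M" False "rk N"] f by simp_all
  show m: "cone M N f \<in> maps S True (sumr (rk M) (rk N)) (sumr (rk M) (rk N))"
    unfolding eq by (rule blk_maps[OF a b c d S])
  have "gm True (cone M N f) = snd (mcone (rep M) (rep N) (gm False f))"
    unfolding eq gm_blk(1)[OF a b c d] by (simp add: mcone_def gm_minus gm_zero)
  from rk_rep_eqI[OF m this] show "rep (cone M N f) = mcone (rep M) (rep N) (gm False f)"
    by (simp add: mcone_def)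
qed

lemma gm_cone_incl:
  "gm False (cone_incl M N) = in2 (rk M) (rk N)"
  "cone_incl M N \<in> maps UNIV False (rk N) (sumr (rk M) (rk N))"
proof -
  have part: "part (cone_incl M N) b = 0\<^sub>m (rkof (rk M) (\<not> b)) (rkof (rk N) b) @\<^sub>r 1\<^sub>m (rkof (rk N) b)" for b
    by (simp add: part_def cone_incl_def rk_def rkof_def)
  show "gm False (cone_incl M N) = in2 (rk M) (rk N)"
  proof (rule ent_eqI)
    fix i j show "ent (gm False (cone_incl M N)) i j = ent (in2 (rk M) (rk N)) i j"
      by (cases i; cases j) (auto simp: ent_gm part append_rows_def ent_in2)
  qed
  show "cone_incl M N \<in> maps UNIV False (rk N) (sumr (rk M) (rk N))"
    unfolding maps_iff mats_iff part by (simp add: append_rows_def)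
qed

lemma gm_cone_proj:
  "gm False (cone_proj M N) = flp * pr1 (rk M)"
  "cone_proj M N \<in> maps UNIV False (sumr (rk M) (rk N)) (prod.swap (rk M))"
proof -
  have part: "part (cone_proj M N) b = transpose_mat (1\<^sub>m (rkof (rk M) (\<not> b)) @\<^sub>r 0\<^sub>m (rkof (rk N) b) (rkof (rk M) (\<not> b)))" for b
    by (simp add: part_def cone_proj_def rk_def rkof_def)
  show "gm False (cone_proj M N) = flp * pr1 (rk M)"
  proof (rule ent_eqI)
    fix i j show "ent (gm False (cone_proj M N)) i j = ent (flp * pr1 (rk M)) i j"
      unfolding ent_flp_mult ent_pr1
      by (cases i; cases j) (auto simp: ent_gm part append_rows_def)
  qed
  show "cone_proj M N \<in> maps UNIV False (sumr (rk M) (rk N)) (prod.swap (rk M))"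
    unfolding maps_iff mats_iff part by (auto simp: append_rows_def rkof_def sumr_def)
qed


subsection \<open>The functor on pairs of matrices\<close>

lemma kron_1:
  "dim_row B = 1 \<Longrightarrow> dim_col B = 1 \<Longrightarrow> kron A B = mat (dim_row A) (dim_col A) (\<lambda>ij. A $$ ij * B $$ (0, 0))"
  unfolding kron_def by (intro cong_mat) auto

definition scal :: "'a::comm_ring_1 \<Rightarrow> nat \<times> nat \<Rightarrow> 'a hmap" where
  "scal c X = (c \<cdot>\<^sub>m 1\<^sub>m (fst X), c \<cdot>\<^sub>m 1\<^sub>m (snd X))"

lemma gm_scal: "gm False (scal c X) = c \<odot> idm X"
  unfolding scal_def by (rule gm_id)

lemma scal_maps: "c \<in> S \<Longrightarrow> 0 \<in> S \<Longrightarrow> scal c X \<in> maps S False X X"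
  by (simp add: maps_def mats_iff rkof_def scal_def)

lemma MF_dims:
  assumes "M \<in> maps S True X X"
  shows "dim_row (fst M) = snd X" "dim_col (fst M) = fst X" "dim_row (snd M) = fst X" "dim_col (snd M) = snd X"
  using assms by (auto simp: maps_def mats_iff rkof_def)

lemma theta_eq:
  assumes M: "M \<in> maps S True X X"
  shows "theta x y M = (fst (blk M (scal (- y) X) (scal x X) (- M)), - snd (blk M (scal (- y) X) (scal x X) (- M)))"
proof -
  note d = MF_dims[OF M]
  show ?thesis
    unfolding theta_def mf_tensor_def tensor_even_def tensor_odd_def mf_id_def rank_one_def rk0_def rk1_def
    by (intro prod_eqI eq_matI)
      (auto simp: kron_1 block_diag_def block_anti_def blk_def scal_def d plus_prod_def)
qed

lemma theta_mor_eq: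
  assumes f: "f \<in> maps S False X Y"
  shows "theta_mor f = blk f (0\<^sub>m (rkof Y True) (rkof X False), 0\<^sub>m (rkof Y (\<not> True)) (rkof X True))
    (0\<^sub>m (rkof Y True) (rkof X False), 0\<^sub>m (rkof Y (\<not> True)) (rkof X True)) f"
proof -
  have d: "dim_row (fst f) = fst Y" "dim_col (fst f) = fst X" "dim_row (snd f) = snd Y" "dim_col (snd f) = snd X"
    using f by (auto simp: maps_def mats_iff rkof_def)
  show ?thesis
    unfolding theta_mor_def tensor_even_def
    by (intro prod_eqI eq_matI)
      (auto simp: kron_1 block_diag_def blk_def d rkof_def)
qed

lemma gm_theta_mor:
  assumes f: "f \<in> maps S False X Y" and S: "subring S"
  shows "gm False (theta_mor f) = kn_mor X Y (gm False f)"
    and "theta_mor f \<in> maps S False (sumr X X) (sumr Y Y)"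
proof -
  note z = zero_maps'[OF subring.zero[OF S], of Y True X]
  have z': "(0\<^sub>m (rkof Y True) (rkof X False), 0\<^sub>m (rkof Y (\<not> True)) (rkof X True)) \<in> maps S (\<not> False) X Y"
    using z by simp
  show "gm False (theta_mor f) = kn_mor X Y (gm False f)"
    unfolding theta_mor_eq[OF f] gm_blk(1)[OF f z' z' f] by (simp add: gm_zero kn_mor_def)
  show "theta_mor f \<in> maps S False (sumr X X) (sumr Y Y)"
    unfolding theta_mor_eq[OF f] by (rule blk_maps[OF f z' z' f S])
qed

lemma gm_kblk:
  assumes M: "M \<in> maps S True X X" and S: "subring S" and xy: "x \<in> S" "y \<in> S"
  shows "gm True (blk M (scal (- y) X) (scal x X) (- M)) = kmat x y X (gm True M)"
    and "blk M (scal (- y) X) (scal x X) (- M) \<in> maps S True (sumr X X) (sumr X X)"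
proof -
  interpret subring S by (rule S)
  have b: "scal (- y) X \<in> maps S (\<not> True) X X" "scal x X \<in> maps S (\<not> True) X X"
    using scal_maps[of "- y" S X] scal_maps[of x S X] xy by simp_all
  note m = minus_maps[OF M S]
  show "gm True (blk M (scal (- y) X) (scal x X) (- M)) = kmat x y X (gm True M)"
    unfolding gm_blk(1)[OF M b m] by (simp add: kmat_def gm_scal gm_minus)
  show "blk M (scal (- y) X) (scal x X) (- M) \<in> maps S True (sumr X X) (sumr X X)"
    by (rule blk_maps[OF M b m S])
qed

lemma theta_maps:
  assumes M: "M \<in> maps S True X X" and S: "subring S" and xy: "x \<in> S" "y \<in> S"
  shows "gm True (theta x y M) = kmat x y X (gm True M) * eps"
    and "theta x y M \<in> maps S True (sumr X X) (sumr X X)"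
proof -
  interpret subring S by (rule S)
  show "gm True (theta x y M) = kmat x y X (gm True M) * eps"
    unfolding theta_eq[OF M] gm_twist gm_kblk(1)[OF M S xy] ..
  show "theta x y M \<in> maps S True (sumr X X) (sumr X X)"
    using gm_kblk(2)[OF M S xy] unfolding theta_eq[OF M] by (auto simp: maps_def mats_iff)
qed

definition subst :: "nat \<Rightarrow> 'a::comm_ring_1 mpow hmap \<Rightarrow> 'a mpow hmap" where
  "subst i = map_prod (map_mat (neg_var i)) (map_mat (neg_var i))"

lemma neg_var_id: "f \<in> series_in V \<Longrightarrow> i \<notin> V \<Longrightarrow> neg_var i f = f"
proof (rule mpow_eqI)
  fix m assume "f \<in> series_in V" "i \<notin> V"
  then have "mcoeff f m \<noteq> 0 \<Longrightarrow> i \<notin># m" by (auto simp: series_in_def)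
  then show "mcoeff (neg_var i f) m = mcoeff f m"
    by (cases "mcoeff f m = 0") (simp_all add: neg_var_def not_in_iff)
qed

lemma neg_var_0 [simp]: "neg_var i 0 = 0"
  by (rule mpow_eqI) (simp add: neg_var_def)

lemma neg_var_Var: "neg_var i (Var i) = - Var i"
  by (rule mpow_eqI) (simp add: neg_var_def Var_def)

lemma part_subst: "part (subst i f) b = map_mat (neg_var i) (part f b)"
  by (simp add: part_def subst_def)

lemma subst_id: "f \<in> maps (series_in V) p X Y \<Longrightarrow> i \<notin> V \<Longrightarrow> subst i f = f"
  by (rule part_ext, rule eq_matI) (auto simp: part_subst maps_iff mats_iff intro!: neg_var_id)

lemma subst_scal: "subst i (scal c X) = scal (neg_var i c) X"
  by (auto simp: subst_def scal_def intro!: eq_matI)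

lemma subst_blk:
  assumes "a \<in> maps S p X Y" "b \<in> maps S (\<not> p) X' Y" "c \<in> maps S (\<not> p) X Y'" "d \<in> maps S p X' Y'"
  shows "subst i (blk a b c d) = blk (subst i a) (subst i b) (subst i c) (subst i d)"
proof (rule part_ext)
  fix e
  note d = maps_dims[OF assms(1)] maps_dims[OF assms(2)] maps_dims[OF assms(3)] maps_dims[OF assms(4)]
  show "part (subst i (blk a b c d)) e = part (blk (subst i a) (subst i b) (subst i c) (subst i d)) e"
    by (rule eq_matI) (auto simp: part_subst part_blk d)
qed

text \<open>
  The substitution \<open>u \<mapsto> -u\<close> reaches only the entries \<open>u\<close> themselves, and the final sign
  \<open>(\<phi>, \<psi>) \<mapsto> (\<phi>, -\<psi>)\<close> cancels the one by which \<open>\<theta>\<close> differs from the Knoerrer functor. Only the sign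
  between the two steps is left.
\<close>

lemma theta_theta_eq:
  fixes M :: "'a::comm_ring_1 mpow hmap"
  assumes M: "M \<in> maps (power_series n) True X X"
  shows "rep (theta_theta n M) =
      kn (- Var (n + 2)) (Var (n + 3)) (twist (kn (Var n) (Var (n + 1)) (X, gm True M)))"
    and "theta_theta n M \<in> maps (power_series (n + 4)) True (sumr (sumr X X) (sumr X X)) (sumr (sumr X X) (sumr X X))"
proof -
  let ?x = "Var n :: 'a mpow" and ?y = "Var (n + 1) :: 'a mpow" and ?u = "Var (n + 2) :: 'a mpow" and ?v = "Var (n + 3) :: 'a mpow"
  let ?S = "\<lambda>k. power_series k :: 'a mpow set"
  have S: "subring (?S k)" for k unfolding power_series_eq by (rule subring_series_in)
  have Var: "i < k \<Longrightarrow> Var i \<in> ?S k" for i k by (auto simp: power_series_def Var_def)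
  have mono: "k \<le> l \<Longrightarrow> ?S k \<subseteq> ?S l" for k l
    unfolding power_series_eq by (rule series_in_mono) auto
  let ?N = "theta ?x ?y M" and ?Z = "sumr X X"
  have M2: "M \<in> maps (?S (n + 2)) True X X" by (rule maps_mono[OF M mono]) simp
  have xy: "?x \<in> ?S (n + 2)" "?y \<in> ?S (n + 2)" by (rule Var, simp)+
  note N = theta_maps[OF M2 S xy]
  have N4: "?N \<in> maps (?S (n + 4)) True ?Z ?Z" by (rule maps_mono[OF N(2) mono]) simp
  have uv: "?u \<in> ?S (n + 4)" "?v \<in> ?S (n + 4)" by (rule Var, simp)+
  let ?B = "blk ?N (scal (- ?v) ?Z) (scal ?u ?Z) (- ?N)"
  have b: "scal (- ?v) ?Z \<in> maps (?S (n + 4)) (\<not> True) ?Z ?Z" "scal ?u ?Z \<in> maps (?S (n + 4)) (\<not> True) ?Z ?Z"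
    using scal_maps[of "- ?v" "?S (n + 4)" ?Z] scal_maps[of ?u "?S (n + 4)" ?Z] uv subring.minus[OF S uv(2)] subring.zero[OF S]
    by simp_all
  note m = minus_maps[OF N4 S]
  have N_id: "subst (n + 2) ?N = ?N" "subst (n + 2) (- ?N) = - ?N"
    by (rule subst_id[where V = "{..<n + 2}"], use N(2) minus_maps[OF N(2) S] in \<open>simp_all add: power_series_eq\<close>)+
  have v_id: "neg_var (n + 2) (- ?v) = - ?v"
    by (rule neg_var_id[where V = "{n + 3}"]) (auto simp: series_in_def Var_def)
  have neg: "- map_mat (neg_var i) (- A) = map_mat (neg_var i) A" for i and A :: "'a mpow mat"
    by (rule eq_matI) (auto simp: neg_var_def intro: mpow_eqI)
  have "theta_theta n M = subst (n + 2) ?B"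
    unfolding theta_theta_def Let_def theta_eq[OF N4] subst_def fst_conv snd_conv neg
    by (simp add: map_prod_def split: prod.splits)
  then have eq: "theta_theta n M = blk ?N (scal (- ?v) ?Z) (scal (- ?u) ?Z) (- ?N)"
    unfolding subst_blk[OF N4 b m] by (simp only: N_id subst_scal v_id neg_var_Var)
  have mu: "- ?u \<in> ?S (n + 4)" by (rule subring.minus[OF S uv(1)])
  show t: "theta_theta n M \<in> maps (?S (n + 4)) True (sumr ?Z ?Z) (sumr ?Z ?Z)"
    unfolding eq by (rule gm_kblk(2)[OF N4 S mu uv(2)])
  have "gm True (theta_theta n M) = kmat (- ?u) ?v ?Z (kmat ?x ?y X (gm True M) * eps)"
    unfolding eq gm_kblk(1)[OF N4 S mu uv(2)] N(1) ..
  from rk_rep_eqI[OF t this] show "rep (theta_theta n M) = kn (- ?u) ?v (twist (kn ?x ?y (X, gm True M)))"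
    by (simp add: kn_def twist_def)
qed

lemma theta_theta_mor_eq:
  fixes f :: "'a::comm_ring_1 mpow hmap"
  assumes f: "f \<in> maps (power_series n) False X Y"
  shows "gm False (subst (n + 2) (theta_mor (theta_mor f))) = kn_mor (sumr X X) (sumr Y Y) (kn_mor X Y (gm False f))"
    and "subst (n + 2) (theta_mor (theta_mor f)) \<in> maps (power_series n) False (sumr (sumr X X) (sumr X X)) (sumr (sumr Y Y) (sumr Y Y))"
proof -
  have S: "subring (power_series n :: 'a mpow set)" unfolding power_series_eq by (rule subring_series_in)
  note 1 = gm_theta_mor[OF f S]
  note 2 = gm_theta_mor[OF 1(2) S]
  have "subst (n + 2) (theta_mor (theta_mor f)) = theta_mor (theta_mor f)"
    by (rule subst_id[where V = "{..<n}"], use 2(2) in \<open>simp_all add: power_series_eq\<close>)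
  with 1 2 show "gm False (subst (n + 2) (theta_mor (theta_mor f))) = kn_mor (sumr X X) (sumr Y Y) (kn_mor X Y (gm False f))"
    "subst (n + 2) (theta_mor (theta_mor f)) \<in> maps (power_series n) False (sumr (sumr X X) (sumr X X)) (sumr (sumr Y Y) (sumr Y Y))"
    by simp_all
qed

text \<open>
  A form is read as an odd map to the transpose and a twisted form as an even one. Hence each of
  the two steps changes the parity with which the pair of matrices is encoded.
\<close>

lemma gm_theta_form:
  fixes b :: "'a::comm_ring_1 hmap"
  assumes b: "b \<in> maps S True X X" and S: "subring S"
  shows "gm False (theta_form b) = in1 X * (gm True b * eps) * pr2 X X - in2 X X * (gm True b * eps) * pr1 X"
    and "theta_form b \<in> maps S False (sumr X X) (sumr X X)"
proof -
  let ?z = "(0\<^sub>m (rkof X False) (rkof X False), 0\<^sub>m (rkof X (\<not> False)) (rkof X True)) :: 'a hmap"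
  let ?b = "(fst b, - snd b)"
  note d = MF_dims[OF b]
  have z: "?z \<in> maps S False X X" by (rule zero_maps'[OF subring.zero[OF S]])
  have b': "?b \<in> maps S (\<not> False) X X"
    using b subring.minus[OF S] by (auto simp: maps_def mats_iff)
  have mb': "- ?b \<in> maps S (\<not> False) X X" by (rule minus_maps[OF b' S])
  have eq: "theta_form b = blk ?z ?b (- ?b) ?z"
    unfolding theta_form_def tensor_odd_def rank_one_form_def
    by (intro prod_eqI eq_matI) (auto simp: kron_1 block_anti_def blk_def d rkof_def)
  show "gm False (theta_form b) = in1 X * (gm True b * eps) * pr2 X X - in2 X X * (gm True b * eps) * pr1 X"
    unfolding eq gm_blk(1)[OF z b' mb' z]
    by (simp only: gm_zero gm_minus gm_twist not_False_eq_True) simp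
  show "theta_form b \<in> maps S False (sumr X X) (sumr X X)"
    unfolding eq by (rule blk_maps[OF z b' mb' z S])
qed

lemma gm_theta_twisted:
  fixes q :: "'a::comm_ring_1 hmap"
  assumes q: "q \<in> maps S False X X" and S: "subring S"
  shows "gm True (theta_twisted q) = in2 X X * gm False q * pr1 X - in1 X * gm False q * pr2 X X"
    and "theta_twisted q \<in> maps S True (sumr X X) (sumr X X)"
proof -
  let ?z = "(0\<^sub>m (rkof X True) (rkof X False), 0\<^sub>m (rkof X (\<not> True)) (rkof X True)) :: 'a hmap"
  have d: "dim_row (fst q) = fst X" "dim_col (fst q) = fst X" "dim_row (snd q) = snd X" "dim_col (snd q) = snd X"
    using q by (auto simp: maps_def mats_iff rkof_def)
  have z: "?z \<in> maps S True X X" by (rule zero_maps'[OF subring.zero[OF S]])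
  have q': "q \<in> maps S (\<not> True) X X" using q by simp
  have mq': "- q \<in> maps S (\<not> True) X X" by (rule minus_maps[OF q' S])
  have eq: "theta_twisted q = blk ?z (- q) q ?z"
    unfolding theta_twisted_def tensor_odd_def rank_one_form_def
    by (intro prod_eqI eq_matI) (auto simp: kron_1 block_anti_def blk_def d rkof_def)
  show "gm True (theta_twisted q) = in2 X X * gm False q * pr1 X - in1 X * gm False q * pr2 X X"
    unfolding eq gm_blk(1)[OF z mq' q' z] by (simp add: gm_zero gm_minus)
  show "theta_twisted q \<in> maps S True (sumr X X) (sumr X X)"
    unfolding eq by (rule blk_maps[OF z mq' q' z S])
qed


section \<open>Triangles\<close>

context subring begin

lemma heqI:
  "F \<in> cocyc S M N \<Longrightarrow> G \<in> cocyc S N M \<Longrightarrow> homot S M M (G * F) (idm (fst M)) \<Longrightarrow> homot S N N (F * G) (idm (fst N)) \<Longrightarrow>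
    hequiv S M N F"
  by (auto simp: hequiv_def)

lemma heqE:
  assumes "hequiv S M N F"
  obtains G where "F \<in> cocyc S M N" "G \<in> cocyc S N M" "hequiv S N M G"
    "homot S M M (G * F) (idm (fst M))" "homot S N N (F * G) (idm (fst N))"
proof -
  obtain G where G: "F \<in> cocyc S M N" "G \<in> cocyc S N M" "homot S M M (G * F) (idm (fst M))" "homot S N N (F * G) (idm (fst N))"
    using assms unfolding hequiv_def by (elim conjE bexE)
  from that[OF G(1,2) heqI[OF G(2,1,4,3)] G(3,4)] show thesis .
qed

lemma cocyc_absorb:
  assumes "F \<in> cocyc S M N"
  shows "idm (fst N) * F = F" "F * idm (fst M) = F" "idm (fst N) * (F * Z) = F * Z" "F * (idm (fst M) * Z) = F * Z"
  by (rule idm_absorb[OF cocyc_hm[OF assms]])+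

text \<open>
  The homotopy inverses of \<open>G F\<close> and of \<open>F G\<close> give a left and a right homotopy inverse of \<open>F\<close>.
\<close>

lemma hequiv_two_sided:
  assumes F: "F \<in> cocyc S M N" and G: "G \<in> cocyc S N M"
    and GF: "hequiv S M M (G * F)" and FG: "hequiv S N N (F * G)"
  shows "hequiv S M N F"
proof -
  obtain L where L: "L \<in> cocyc S M M" "homot S M M (L * (G * F)) (idm (fst M))"
    by (rule heqE[OF GF])
  obtain R where R: "R \<in> cocyc S N N" "homot S N N (F * G * R) (idm (fst N))"
    by (rule heqE[OF FG])
  have LG: "L * G \<in> cocyc S N M" and GR: "G * R \<in> cocyc S N M" by (rule cocyc_mult[OF G L(1)], rule cocyc_mult[OF R(1) G])
  have 1: "homot S N M (L * (G * (F * (G * R)))) (G * R)"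
    using homot_mult_right[OF L(2) GR] by (simp add: mult.assoc cocyc_absorb[OF GR])
  have 2: "homot S N M (L * (G * (F * (G * R)))) (L * G)"
    using homot_mult_left[OF R(2) LG] by (simp add: mult.assoc cocyc_absorb[OF G])
  have 3: "homot S N N (F * (G * R)) (idm (fst N))" using R(2) by (simp add: mult.assoc)
  have "homot S N N (F * (L * G)) (F * (G * R))"
    by (rule homot_mult_left[OF homot_trans[OF homot_sym[OF 2] 1] F])
  from homot_trans[OF this 3] have "homot S N N (F * (L * G)) (idm (fst N))" .
  then show ?thesis using L(2) by (intro heqI[OF F LG]) (simp_all add: mult.assoc)
qed

text \<open>
  A triangular endomorphism of a cone with diagonal homotopic to the identity is homotopic to the
  sum of the identity and a cocycle of square zero, which is invertible.
\<close>

lemma cone_endo_hequiv: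
  assumes M: "M \<in> mfs S w" and N: "N \<in> mfs S w" and k: "k \<in> cocyc S M N"
    and t: "in1 (fst M) * (u * pr1 (fst M)) + in2 (fst M) (fst N) * (c * pr1 (fst M)) +
      in2 (fst M) (fst N) * (v * pr2 (fst M) (fst N)) \<in> cocyc S (mcone M N k) (mcone M N k)" (is "?t \<in> cocyc S ?C ?C")
    and u: "homot S M M u (idm (fst M))" and v: "homot S N N v (idm (fst N))" and c: "c \<in> hm S True (fst M) (fst N)"
  shows "hequiv S ?C ?C ?t"
proof -
  let ?X = "fst M" and ?Y = "fst N"
  note C = mcone_mfs[OF M N k]
  obtain A where A: "A \<in> hm S True ?X ?X" "u - idm ?X = snd M * A + A * snd M" using u by (auto simp: homot_def)
  obtain B where B: "B \<in> hm S True ?Y ?Y" "v - idm ?Y = snd N * B + B * snd N" using v by (auto simp: homot_def)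
  have u': "u = idm ?X + (snd M * A + A * snd M)" and v': "v = idm ?Y + (snd N * B + B * snd N)"
    using A(2) B(2) by (simp_all add: algebra_simps)
  define K where "K = in2 ?X ?Y * (B * pr2 ?X ?Y) - in1 ?X * (A * pr1 ?X)"
  have K: "K \<in> hm S True (sumr ?X ?Y) (sumr ?X ?Y)"
    unfolding K_def by (intro hdiff hblk(1)[OF A(1)] hblk(4)[OF B(1)])
  define d where "d = c + k * A - B * k"
  have d: "d \<in> hm S True ?X ?Y"
    unfolding d_def by (intro hdiff hadd c hmul[OF cocyc_hm[OF k] A(1)] hmul[OF B(1) cocyc_hm[OF k]]) simp_all
  define n where "n = in2 ?X ?Y * (d * pr1 ?X)"
  note abs = idm_absorb[OF mfs_hm[OF M]] idm_absorb[OF mfs_hm[OF N]] idm_absorb[OF A(1)] idm_absorb[OF B(1)]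
    idm_absorb[OF c] cocyc_absorb[OF k]
  have eq: "?t - (idm (sumr ?X ?Y) + n) = snd ?C * K + K * snd ?C"
    unfolding K_def n_def d_def u' v' mcone_def in_pr[symmetric]
    by (simp add: algebra_simps abs)
  have "homot S ?C ?C ?t (idm (sumr ?X ?Y) + n)" by (rule htyI[OF _ eq]) (simp add: K)
  have "idm (sumr ?X ?Y) + n = ?t - (snd ?C * K + K * snd ?C)" using eq by (simp add: algebra_simps)
  then have idn: "idm (sumr ?X ?Y) + n \<in> cocyc S ?C ?C"
    using cocyc_diff[OF t cocyc_boundary[OF _ C C, of K]] K by simp
  have id: "idm (sumr ?X ?Y) \<in> cocyc S ?C ?C" using cocyc_id[OF C] by simp
  have "n = idm (sumr ?X ?Y) + n - idm (sumr ?X ?Y)" by simp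
  then have nz: "n \<in> cocyc S ?C ?C" using cocyc_diff[OF idn id] by simp
  have nn: "n * n = 0" unfolding n_def by (simp add: mult.assoc)
  have "strict_iso S ?C ?C (idm (sumr ?X ?Y) + n)"
    unfolding strict_iso_def
    using idn cocyc_diff[OF id nz] cocyc_absorb[OF nz]
    by (intro conjI bexI[of _ "idm (sumr ?X ?Y) - n"]) (simp_all add: algebra_simps nn)
  then have "hequiv S ?C ?C (idm (sumr ?X ?Y) + n)" by (rule strict_iso_hequiv)
  from hequiv_homot[OF this homot_sym t] \<open>homot S ?C ?C ?t (idm (sumr ?X ?Y) + n)\<close> show ?thesis by simp
qed

lemma cone_map:
  assumes M: "M \<in> mfs S w" and N: "N \<in> mfs S w" and X: "X \<in> mfs S w" and Y: "Y \<in> mfs S w"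
    and k: "k \<in> cocyc S M N" and f: "f \<in> cocyc S X Y" and a: "a \<in> cocyc S M X" and b: "b \<in> cocyc S N Y"
    and H: "H \<in> hm S True (fst M) (fst Y)" "b * k - f * a = snd Y * H + H * snd M"
  shows "in1 (fst X) * (a * pr1 (fst M)) + in2 (fst X) (fst Y) * (H * pr1 (fst M)) +
      in2 (fst X) (fst Y) * (b * pr2 (fst M) (fst N)) \<in> cocyc S (mcone M N k) (mcone X Y f)" (is "?d \<in> _")
proof -
  have bk: "b * k = f * a + (snd Y * H + H * snd M)" using H(2) by (simp add: algebra_simps)
  have "snd (mcone X Y f) * ?d = ?d * snd (mcone M N k)"
    unfolding mcone_def
    by (simp add: algebra_simps mult_eq_assoc[OF bk] idm_absorb[OF mfs_hm[OF M]] idm_absorb[OF mfs_hm[OF N]]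
      idm_absorb[OF mfs_hm[OF X]] idm_absorb[OF mfs_hm[OF Y]]
      cocyc_absorb[OF k] cocyc_absorb[OF f] cocyc_absorb[OF a] cocyc_absorb[OF b] idm_absorb[OF H(1)]
      mult_eq_assoc[OF cocyc_comm[OF a]] mult_eq_assoc[OF cocyc_comm[OF b]])
  moreover have "?d \<in> hm S False (sumr (fst M) (fst N)) (sumr (fst X) (fst Y))"
    by (intro hadd hblk(1)[OF cocyc_hm[OF a]] hblk(3)[OF H(1)] hblk(4)[OF cocyc_hm[OF b]]) simp
  ultimately show ?thesis by (simp add: cocyc_def)
qed

text \<open>
  A homotopy \<open>b k \<simeq> f a\<close> fills in a map of cones. The homotopy inverses of \<open>a\<close> and \<open>b\<close> give a map in the
  opposite direction, and both composites are triangular as in \<open>cone_endo_hequiv\<close>.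
\<close>

lemma cone_comparison:
  assumes M: "M \<in> mfs S w" and N: "N \<in> mfs S w" and X: "X \<in> mfs S w" and Y: "Y \<in> mfs S w"
    and k: "k \<in> cocyc S M N" and f: "f \<in> cocyc S X Y" and a: "hequiv S M X a" and b: "hequiv S N Y b"
    and h: "homot S M Y (b * k) (f * a)"
  shows "\<exists>d. hequiv S (mcone M N k) (mcone X Y f) d \<and> d * in2 (fst M) (fst N) = in2 (fst X) (fst Y) * b \<and>
    flp * (pr1 (fst X) * d) = sh a * (flp * pr1 (fst M))"
proof -
  obtain a' where a': "a \<in> cocyc S M X" "a' \<in> cocyc S X M" "homot S M M (a' * a) (idm (fst M))" "homot S X X (a * a') (idm (fst X))"
    by (rule heqE[OF a])
  obtain b' where b': "b \<in> cocyc S N Y" "b' \<in> cocyc S Y N" "homot S N N (b' * b) (idm (fst N))" "homot S Y Y (b * b') (idm (fst Y))"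
    by (rule heqE[OF b])
  have h': "homot S X N (b' * f) (k * a')"
  proof -
    have 1: "homot S X N (b' * (f * (a * a'))) (b' * f)"
      using homot_mult_left[OF a'(4) cocyc_mult[OF f b'(2)]] by (simp add: mult.assoc cocyc_absorb[OF f])
    have 2: "homot S X N (b' * (b * (k * a'))) (b' * (f * (a * a')))"
      using homot_mult_right[OF homot_mult_left[OF h b'(2)] a'(2)] by (simp add: mult.assoc)
    have 3: "homot S X N (b' * (b * (k * a'))) (k * a')"
      using homot_mult_right[OF b'(3) cocyc_mult[OF a'(2) k]] by (simp add: mult.assoc cocyc_absorb[OF k])
    show ?thesis by (rule homot_trans[OF homot_sym[OF 1] homot_trans[OF homot_sym[OF 2] 3]])
  qed
  obtain H where H: "H \<in> hm S True (fst M) (fst Y)" "b * k - f * a = snd Y * H + H * snd M"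
    using h by (auto simp: homot_def)
  obtain H' where H': "H' \<in> hm S True (fst X) (fst N)" "b' * f - k * a' = snd N * H' + H' * snd X"
    using h' by (auto simp: homot_def)
  define d where "d = in1 (fst X) * (a * pr1 (fst M)) + in2 (fst X) (fst Y) * (H * pr1 (fst M)) +
      in2 (fst X) (fst Y) * (b * pr2 (fst M) (fst N))"
  define d' where "d' = in1 (fst M) * (a' * pr1 (fst X)) + in2 (fst M) (fst N) * (H' * pr1 (fst X)) +
      in2 (fst M) (fst N) * (b' * pr2 (fst X) (fst Y))"
  have d: "d \<in> cocyc S (mcone M N k) (mcone X Y f)"
    unfolding d_def by (rule cone_map[OF M N X Y k f a'(1) b'(1) H])
  have d': "d' \<in> cocyc S (mcone X Y f) (mcone M N k)"
    unfolding d'_def by (rule cone_map[OF X Y M N f k a'(2) b'(2) H'])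
  note abs = cocyc_absorb[OF a'(1)] cocyc_absorb[OF a'(2)] cocyc_absorb[OF b'(1)] cocyc_absorb[OF b'(2)]
    idm_absorb[OF H(1)] idm_absorb[OF H'(1)]
  have dd: "d' * d = in1 (fst M) * (a' * a * pr1 (fst M)) + in2 (fst M) (fst N) * ((H' * a + b' * H) * pr1 (fst M)) +
      in2 (fst M) (fst N) * (b' * b * pr2 (fst M) (fst N))"
    unfolding d_def d'_def by (simp add: algebra_simps abs)
  have dd': "d * d' = in1 (fst X) * (a * a' * pr1 (fst X)) + in2 (fst X) (fst Y) * ((H * a' + b * H') * pr1 (fst X)) +
      in2 (fst X) (fst Y) * (b * b' * pr2 (fst X) (fst Y))"
    unfolding d_def d'_def by (simp add: algebra_simps abs)
  have "hequiv S (mcone M N k) (mcone M N k) (d' * d)"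
    unfolding dd
    by (rule cone_endo_hequiv[OF M N k _ a'(3) b'(3)], unfold dd[symmetric], rule cocyc_mult[OF d d'])
      (intro hadd hmul[OF H'(1) cocyc_hm[OF a'(1)]] hmul[OF cocyc_hm[OF b'(2)] H(1)], simp_all)
  moreover have "hequiv S (mcone X Y f) (mcone X Y f) (d * d')"
    unfolding dd'
    by (rule cone_endo_hequiv[OF X Y f _ a'(4) b'(4)], unfold dd'[symmetric], rule cocyc_mult[OF d' d])
      (intro hadd hmul[OF H(1) cocyc_hm[OF a'(2)]] hmul[OF cocyc_hm[OF b'(1)] H'(1)], simp_all)
  ultimately have "hequiv S (mcone M N k) (mcone X Y f) d" by (rule hequiv_two_sided[OF d d'])
  moreover have "d * in2 (fst M) (fst N) = in2 (fst X) (fst Y) * b"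
    unfolding d_def by (simp add: algebra_simps abs)
  moreover have "flp * (pr1 (fst X) * d) = sh a * (flp * pr1 (fst M))"
    unfolding d_def by (simp add: algebra_simps abs sh_def)
  ultimately show ?thesis by blast
qed

definition tri :: "'a \<Rightarrow> 'a mfo \<Rightarrow> 'a mfo \<Rightarrow> 'a mfo \<Rightarrow> 'a gmat \<Rightarrow> 'a gmat \<Rightarrow> 'a gmat \<Rightarrow> bool" where
  "tri w X Y Z f g h \<longleftrightarrow> (\<exists>M\<in>mfs S w. \<exists>N\<in>mfs S w. \<exists>k\<in>cocyc S M N. \<exists>a b c.
    hequiv S X M a \<and> hequiv S Y N b \<and> hequiv S Z (mcone M N k) c \<and>
    homot S X N (b * f) (k * a) \<and> homot S Y (mcone M N k) (c * g) (in2 (fst M) (fst N) * b) \<and>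
    homot S Z (shift M) (sh a * h) (flp * pr1 (fst M) * c))"

text \<open>
  Distinguished triangles are isomorphic to the cone of some map; by \<open>cone_comparison\<close> it may be
  replaced by the cone of the first map of the triangle itself.
\<close>

lemma tri_iff_own_cone:
  assumes X: "X \<in> mfs S w" and Y: "Y \<in> mfs S w" and Z: "Z \<in> mfs S w"
    and f: "f \<in> cocyc S X Y" and g: "g \<in> cocyc S Y Z" and h: "h \<in> cocyc S Z (shift X)"
  shows "tri w X Y Z f g h \<longleftrightarrow> (\<exists>c. hequiv S Z (mcone X Y f) c \<and>
    homot S Y (mcone X Y f) (c * g) (in2 (fst X) (fst Y)) \<and> homot S Z (shift X) h (flp * pr1 (fst X) * c))"
proof
  assume "tri w X Y Z f g h"
  then obtain M N k a b c where M: "M \<in> mfs S w" and N: "N \<in> mfs S w" and k: "k \<in> cocyc S M N"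
    and a: "hequiv S X M a" and b: "hequiv S Y N b" and c: "hequiv S Z (mcone M N k) c"
    and eqs: "homot S X N (b * f) (k * a)" "homot S Y (mcone M N k) (c * g) (in2 (fst M) (fst N) * b)"
    "homot S Z (shift M) (sh a * h) (flp * pr1 (fst M) * c)"
    unfolding tri_def by (elim bexE exE conjE)
  obtain a' where a': "a \<in> cocyc S X M" "a' \<in> cocyc S M X" "hequiv S M X a'" "homot S X X (a' * a) (idm (fst X))"
    "homot S M M (a * a') (idm (fst M))" by (rule heqE[OF a])
  obtain b' where b': "b \<in> cocyc S Y N" "b' \<in> cocyc S N Y" "hequiv S N Y b'" "homot S Y Y (b' * b) (idm (fst Y))"
    by (rule heqE[OF b])
  have "homot S M Y (b' * k) (f * a')"
  proof -
    have 1: "homot S M Y (b' * (k * (a * a'))) (b' * k)"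
      using homot_mult_left[OF a'(5) cocyc_mult[OF k b'(2)]] by (simp add: mult.assoc cocyc_absorb[OF k])
    have 2: "homot S M Y (b' * (b * (f * a'))) (b' * (k * (a * a')))"
      using homot_mult_right[OF homot_mult_left[OF eqs(1) b'(2)] a'(2)] by (simp add: mult.assoc)
    have 3: "homot S M Y (b' * (b * (f * a'))) (f * a')"
      using homot_mult_right[OF b'(4) cocyc_mult[OF a'(2) f]] by (simp add: mult.assoc cocyc_absorb[OF f])
    show ?thesis by (rule homot_trans[OF homot_sym[OF 1] homot_trans[OF homot_sym[OF 2] 3]])
  qed
  from cone_comparison[OF M N X Y k f a'(3) b'(3) this] obtain d where
    d: "hequiv S (mcone M N k) (mcone X Y f) d" and d2: "d * in2 (fst M) (fst N) = in2 (fst X) (fst Y) * b'"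
    and d1: "flp * (pr1 (fst X) * d) = sh a' * (flp * pr1 (fst M))" by (elim exE conjE)
  note CM = mcone_mfs[OF M N k] and CX = mcone_mfs[OF X Y f]
  have "hequiv S Z (mcone X Y f) (d * c)" by (rule hequiv_comp[OF c d Z CM CX])
  moreover have "homot S Y (mcone X Y f) (d * c * g) (in2 (fst X) (fst Y))"
  proof -
    have 1: "homot S Y (mcone X Y f) (d * c * g) (in2 (fst X) (fst Y) * (b' * b))"
      using homot_mult_left[OF eqs(2) hequiv_cocyc[OF d]] by (simp add: mult.assoc mult_eq_assoc[OF d2])
    have 2: "homot S Y (mcone X Y f) (in2 (fst X) (fst Y) * (b' * b)) (in2 (fst X) (fst Y))"
      using homot_mult_left[OF b'(4) mcone_incl[OF X Y f]] by simp
    show ?thesis by (rule homot_trans[OF 1 2])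
  qed
  moreover have "homot S Z (shift X) h (flp * pr1 (fst X) * (d * c))"
  proof -
    have a'z: "sh a' \<in> cocyc S (shift M) (shift X)" by (rule sh_cocyc[OF a'(2)])
    have "flp * pr1 (fst X) * (d * c) = sh a' * (flp * pr1 (fst M) * c)"
      using arg_cong[OF d1, of "\<lambda>F. F * c"] by (simp add: mult.assoc)
    then have 1: "homot S Z (shift X) (sh a' * (sh a * h)) (flp * pr1 (fst X) * (d * c))"
      using homot_mult_left[OF eqs(3) a'z] by simp
    have "sh (a' * a) * h = sh a' * (sh a * h)" by (simp add: sh_mult[symmetric] mult.assoc)
    then have 2: "homot S Z (shift X) (sh a' * (sh a * h)) h"
      using homot_mult_right[OF sh_homot[OF a'(4)] h] cocyc_absorb(1)[OF h] by simp
    show ?thesis by (rule homot_trans[OF homot_sym[OF 2] 1])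
  qed
  ultimately show "\<exists>c. hequiv S Z (mcone X Y f) c \<and>
    homot S Y (mcone X Y f) (c * g) (in2 (fst X) (fst Y)) \<and> homot S Z (shift X) h (flp * pr1 (fst X) * c)" by blast
next
  assume "\<exists>c. hequiv S Z (mcone X Y f) c \<and>
    homot S Y (mcone X Y f) (c * g) (in2 (fst X) (fst Y)) \<and> homot S Z (shift X) h (flp * pr1 (fst X) * c)"
  then obtain c where c: "hequiv S Z (mcone X Y f) c" "homot S Y (mcone X Y f) (c * g) (in2 (fst X) (fst Y))"
    "homot S Z (shift X) h (flp * pr1 (fst X) * c)" by (elim exE conjE)
  have "idm (prod.swap (fst X)) * h = h" using cocyc_absorb(1)[OF h] by simp
  with c X Y f show "tri w X Y Z f g h" unfolding tri_def
    by (intro bexI[of _ X] bexI[of _ Y] bexI[of _ f] exI[of _ "idm (fst X)"] exI[of _ "idm (fst Y)"] exI[of _ c] conjI)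
      (simp_all add: cocyc_absorb[OF f] hequiv_id[OF X] hequiv_id[OF Y])
qed

end

context strict_equiv begin

lemma mor_hequiv:
  assumes M: "M \<in> mfs S w" and N: "N \<in> mfs S w" and F: "F \<in> cocyc S M N"
  shows "hequiv S' (A M) (A N) (a M N F) \<longleftrightarrow> hequiv S M N F"
proof
  assume "hequiv S M N F"
  then obtain G where G: "G \<in> cocyc S N M" "homot S M M (G * F) (idm (fst M))" "homot S N N (F * G) (idm (fst N))"
    by (rule S.heqE)
  have "homot S' (A M) (A M) (a M M (G * F)) (a M M (idm (fst M)))"
    "homot S' (A N) (A N) (a N N (F * G)) (a N N (idm (fst N)))"
    using G by (simp_all add: homotopy[OF M M] homotopy[OF N N] S.cocyc_mult[OF F G(1)] S.cocyc_mult[OF G(1) F] S.cocyc_id[OF M] S.cocyc_id[OF N])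
  then show "hequiv S' (A M) (A N) (a M N F)"
    by (intro S'.heqI[OF mor[OF M N F] mor[OF N M G(1)]])
      (simp_all add: comp[OF M N M F G(1)] comp[OF N M N G(1) F] ident M N)
next
  assume "hequiv S' (A M) (A N) (a M N F)"
  then obtain G' where G': "G' \<in> cocyc S' (A N) (A M)" "homot S' (A M) (A M) (G' * a M N F) (idm (fst (A M)))"
    "homot S' (A N) (A N) (a M N F * G') (idm (fst (A N)))" by (rule S'.heqE)
  obtain G where G: "G \<in> cocyc S N M" "homot S' (A N) (A M) (a N M G) G'"
    using full[OF N M G'(1)] by (elim bexE)
  have "homot S' (A M) (A M) (a M M (G * F)) (a M M (idm (fst M)))"
    using S'.homot_trans[OF S'.homot_mult_right[OF G(2) mor[OF M N F]] G'(2)]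
    by (simp add: comp[OF M N M F G(1)] ident M)
  moreover have "homot S' (A N) (A N) (a N N (F * G)) (a N N (idm (fst N)))"
    using S'.homot_trans[OF S'.homot_mult_left[OF G(2) mor[OF M N F]] G'(3)]
    by (simp add: comp[OF N M N G(1) F] ident N)
  ultimately show "hequiv S M N F"
    by (intro S.heqI[OF F G(1)])
      (simp_all add: homotopy[OF M M] homotopy[OF N N] S.cocyc_mult[OF F G(1)] S.cocyc_mult[OF G(1) F] S.cocyc_id[OF M] S.cocyc_id[OF N])
qed

text \<open>
  By \<open>tri_iff_own_cone\<close> both sides ask for a homotopy equivalence from the third object to a cone,
  compatible with the structure maps; full faithfulness and \<open>\<gamma>\<close> translate one into the other.
\<close>

lemma tri_mor:
  assumes X: "X \<in> mfs S w" and Y: "Y \<in> mfs S w" and Z: "Z \<in> mfs S w"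
    and f: "f \<in> cocyc S X Y" and g: "g \<in> cocyc S Y Z" and h: "h \<in> cocyc S Z (shift X)"
  shows "S'.tri w' (A X) (A Y) (A Z) (a X Y f) (a Y Z g) (\<eta> X * a Z (shift X) h) \<longleftrightarrow> S.tri w X Y Z f g h"
proof -
  let ?C = "mcone X Y f" and ?C' = "mcone (A X) (A Y) (a X Y f)" and ?\<gamma> = "\<gamma> X Y f"
  note C = S.mcone_mfs[OF X Y f] and sX = S.shift_mfs[OF X]
  note AX = obj[OF X] and AY = obj[OF Y] and AZ = obj[OF Z] and AC = obj[OF C]
  note af = mor[OF X Y f] and ag = mor[OF Y Z g] and ah = mor[OF Z sX h]
  note C' = S'.mcone_mfs[OF AX AY af] and gm = cone[OF X Y f]
  note i = S.mcone_incl[OF X Y f] and p = S.mcone_proj[OF X Y f]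
  note p' = S'.mcone_proj[OF AX AY af]
  note eX = shift[OF X]
  have eh: "\<eta> X * a Z (shift X) h \<in> cocyc S' (A Z) (shift (A X))"
    by (rule S'.cocyc_mult[OF ah strict_iso_cocyc[OF eX]])
  obtain \<rho> where r: "\<rho> \<in> cocyc S' ?C' (A ?C)" "\<rho> * ?\<gamma> = idm (fst (A ?C))" "?\<gamma> * \<rho> = idm (fst ?C')"
    using gm unfolding strict_iso_def by (elim conjE bexE)
  obtain e where e: "e \<in> cocyc S' (shift (A X)) (A (shift X))" "e * \<eta> X = idm (fst (A (shift X)))"
    using eX unfolding strict_iso_def by (elim conjE bexE)
  show ?thesis
    unfolding S.tri_iff_own_cone[OF X Y Z f g h] S'.tri_iff_own_cone[OF AX AY AZ af ag eh]
  proof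
    assume "\<exists>c. hequiv S Z ?C c \<and> homot S Y ?C (c * g) (in2 (fst X) (fst Y)) \<and> homot S Z (shift X) h (flp * pr1 (fst X) * c)"
    then obtain c where c: "hequiv S Z ?C c" "homot S Y ?C (c * g) (in2 (fst X) (fst Y))"
      "homot S Z (shift X) h (flp * pr1 (fst X) * c)" by (elim exE conjE)
    note cz = S.hequiv_cocyc[OF c(1)]
    note ac = mor[OF Z C cz]
    have "hequiv S' (A Z) ?C' (?\<gamma> * a Z ?C c)"
      by (rule S'.hequiv_comp[OF _ S'.strict_iso_hequiv[OF gm] AZ AC C']) (simp add: mor_hequiv[OF Z C cz] c)
    moreover have "homot S' (A Y) ?C' (?\<gamma> * a Z ?C c * a Y Z g) (in2 (fst (A X)) (fst (A Y)))"
    proof -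
      have "homot S' (A Y) (A ?C) (a Y ?C (c * g)) (a Y ?C (in2 (fst X) (fst Y)))"
        using c(2) by (simp add: homotopy[OF Y C S.cocyc_mult[OF g cz] i])
      from S'.homot_mult_left[OF this strict_iso_cocyc[OF gm]] show ?thesis
        by (simp add: comp[OF Y Z C g cz] cone_incl[OF X Y f] mult.assoc)
    qed
    moreover have "homot S' (A Z) (shift (A X)) (\<eta> X * a Z (shift X) h) (flp * pr1 (fst (A X)) * (?\<gamma> * a Z ?C c))"
    proof -
      have "homot S' (A Z) (A (shift X)) (a Z (shift X) h) (a Z (shift X) (flp * pr1 (fst X) * c))"
        using c(3) by (simp add: homotopy[OF Z sX h S.cocyc_mult[OF cz p]])
      from S'.homot_mult_left[OF this[unfolded comp[OF Z C sX cz p]] strict_iso_cocyc[OF eX]] show ?thesis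
        using cone_proj[OF X Y f, THEN arg_cong, of "\<lambda>F. F * a Z ?C c"]
        by (simp add: mult.assoc)
    qed
    ultimately show "\<exists>c. hequiv S' (A Z) ?C' c \<and> homot S' (A Y) ?C' (c * a Y Z g) (in2 (fst (A X)) (fst (A Y))) \<and>
      homot S' (A Z) (shift (A X)) (\<eta> X * a Z (shift X) h) (flp * pr1 (fst (A X)) * c)" by blast
  next
    assume "\<exists>c. hequiv S' (A Z) ?C' c \<and> homot S' (A Y) ?C' (c * a Y Z g) (in2 (fst (A X)) (fst (A Y))) \<and>
      homot S' (A Z) (shift (A X)) (\<eta> X * a Z (shift X) h) (flp * pr1 (fst (A X)) * c)"
    then obtain d where d: "hequiv S' (A Z) ?C' d" "homot S' (A Y) ?C' (d * a Y Z g) (in2 (fst (A X)) (fst (A Y)))"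
      "homot S' (A Z) (shift (A X)) (\<eta> X * a Z (shift X) h) (flp * pr1 (fst (A X)) * d)" by (elim exE conjE)
    note dz = S'.hequiv_cocyc[OF d(1)]
    have rho: "strict_iso S' ?C' (A ?C) \<rho>"
      using r strict_iso_cocyc[OF gm] unfolding strict_iso_def by (intro conjI bexI[of _ ?\<gamma>]) simp_all
    have rd: "hequiv S' (A Z) (A ?C) (\<rho> * d)" by (rule S'.hequiv_comp[OF d(1) S'.strict_iso_hequiv[OF rho] AZ C' AC])
    obtain c where c: "c \<in> cocyc S Z ?C" "homot S' (A Z) (A ?C) (a Z ?C c) (\<rho> * d)"
      using full[OF Z C S'.hequiv_cocyc[OF rd]] by (elim bexE)
    note ac = mor[OF Z C c(1)]
    have "hequiv S Z ?C c"
      using S'.hequiv_homot[OF rd S'.homot_sym[OF c(2)] ac] by (simp add: mor_hequiv[OF Z C c(1)])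
    moreover have "homot S Y ?C (c * g) (in2 (fst X) (fst Y))"
    proof -
      have 1: "homot S' (A Y) (A ?C) (a Z ?C c * a Y Z g) (\<rho> * (d * a Y Z g))"
        using S'.homot_mult_right[OF c(2) ag] by (simp add: mult.assoc)
      have 2: "homot S' (A Y) (A ?C) (\<rho> * (d * a Y Z g)) (\<rho> * in2 (fst (A X)) (fst (A Y)))"
        by (rule S'.homot_mult_left[OF d(2) r(1)])
      have "\<rho> * in2 (fst (A X)) (fst (A Y)) = a Y ?C (in2 (fst X) (fst Y))"
        unfolding cone_incl[OF X Y f, symmetric]
        by (simp add: mult_eq_assoc[OF r(2)] S'.cocyc_absorb[OF mor[OF Y C i]])
      with S'.homot_trans[OF 1 2] have "homot S' (A Y) (A ?C) (a Y ?C (c * g)) (a Y ?C (in2 (fst X) (fst Y)))"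
        by (simp add: comp[OF Y Z C g c(1)])
      then show ?thesis by (simp add: homotopy[OF Y C S.cocyc_mult[OF g c(1)] i])
    qed
    moreover have "homot S Z (shift X) h (flp * pr1 (fst X) * c)"
    proof -
      have 1: "homot S' (A Z) (shift (A X)) (flp * pr1 (fst (A X)) * (?\<gamma> * a Z ?C c)) (flp * pr1 (fst (A X)) * (?\<gamma> * (\<rho> * d)))"
        by (rule S'.homot_mult_left[OF S'.homot_mult_left[OF c(2) strict_iso_cocyc[OF gm]] p'])
      have 2: "flp * pr1 (fst (A X)) * (?\<gamma> * (\<rho> * d)) = flp * pr1 (fst (A X)) * d"
        using S'.cocyc_absorb(1)[OF dz] by (simp add: mult_eq_assoc[OF r(3)])
      have 3: "flp * pr1 (fst (A X)) * (?\<gamma> * a Z ?C c) = \<eta> X * a Z (shift X) (flp * pr1 (fst X) * c)"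
        using cone_proj[OF X Y f, THEN arg_cong, of "\<lambda>F. F * a Z ?C c"]
        unfolding comp[OF Z C sX c(1) p] by (simp add: mult.assoc)
      have "homot S' (A Z) (shift (A X)) (\<eta> X * a Z (shift X) h) (\<eta> X * a Z (shift X) (flp * pr1 (fst X) * c))"
        by (rule S'.homot_trans[OF d(3) S'.homot_sym[OF 1[unfolded 2 3]]])
      from S'.homot_mult_left[OF this e(1)]
      have "homot S' (A Z) (A (shift X)) (a Z (shift X) h) (a Z (shift X) (flp * pr1 (fst X) * c))"
        using S'.cocyc_absorb(1)[OF ah] S'.cocyc_absorb(1)[OF mor[OF Z sX S.cocyc_mult[OF c(1) p]]]
        by (simp add: mult_eq_assoc[OF e(2)])
      then show ?thesis by (simp add: homotopy[OF Z sX h S.cocyc_mult[OF c(1) p]])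
    qed
    ultimately show "\<exists>c. hequiv S Z ?C c \<and> homot S Y ?C (c * g) (in2 (fst X) (fst Y)) \<and>
      homot S Z (shift X) h (flp * pr1 (fst X) * c)" by blast
  qed
qed

end


section \<open>Duals and forms\<close>

definition mdual :: "'a::comm_ring_1 mfo \<Rightarrow> 'a mfo" where
  "mdual M = (prod.swap (fst M), - sh (tr (snd M)))"

lemma fst_mdual [simp]: "fst (mdual M) = prod.swap (fst M)"
  and snd_mdual: "snd (mdual M) = - sh (tr (snd M))"
  by (simp_all add: mdual_def)

lemma tr_sh [simp]: "tr (sh F) = sh (tr F)"
  by (simp add: sh_def mult.assoc)

lemma mdual_mdual [simp]: "mdual (mdual M) = M"
  by (simp add: mdual_def sh_minus)

text \<open>
  The sign is the one for a form regarded as an even map \<open>M \<rightarrow> M\<^sup>*\<close>, whose transpose is \<open>sh (tr b)\<close>.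
\<close>

definition fsign :: "form_type \<Rightarrow> 'a::comm_ring_1" where
  "fsign \<epsilon> = (case \<epsilon> of Orthogonal \<Rightarrow> - 1 | Symplectic \<Rightarrow> 1)"

lemma fsign_opposite [simp]: "fsign (opposite \<epsilon>) = - fsign \<epsilon>"
  by (cases \<epsilon>) (simp_all add: fsign_def)

lemma fsign_square [simp]: "fsign \<epsilon> * fsign \<epsilon> = 1" "fsign \<epsilon> \<odot> (fsign \<epsilon> \<odot> F) = F"
  by (cases \<epsilon>; simp add: fsign_def)+

definition rform :: "'a set \<Rightarrow> form_type \<Rightarrow> 'a::comm_ring_1 mfo \<Rightarrow> 'a gmat \<Rightarrow> bool" where
  "rform S \<epsilon> M b \<longleftrightarrow> strict_iso S M (mdual M) b \<and> sh (tr b) = fsign \<epsilon> \<odot> b"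

context subring begin

lemma fsign_in: "fsign \<epsilon> \<in> S"
  by (cases \<epsilon>) (simp_all add: fsign_def)

lemma mdual_mfs:
  assumes M: "M \<in> mfs S w" shows "mdual M \<in> mfs S w"
proof -
  have "tr (snd M) * tr (snd M) = w \<odot> idm (fst M)"
    using arg_cong[OF mfs_sq[OF M], of tr] by simp
  then show ?thesis using mfs_hm[OF M]
    by (simp add: mfs_def snd_mdual hminus sh_hm hm_tr sh_mult sh_smul)
qed

lemma mdual_cocyc:
  assumes F: "F \<in> cocyc S M N" shows "sh (tr F) \<in> cocyc S (mdual N) (mdual M)"
proof -
  have "tr F * tr (snd N) = tr (snd M) * tr F"
    using arg_cong[OF cocyc_comm[OF F], of tr] by simp
  then show ?thesis using cocyc_hm[OF F]
    by (simp add: cocyc_def snd_mdual sh_hm hm_tr sh_mult)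
qed

lemma mdual_homot:
  assumes "homot S M N F G" shows "homot S (mdual N) (mdual M) (sh (tr F)) (sh (tr G))"
proof -
  obtain H where H: "H \<in> hm S True (fst M) (fst N)" "F - G = snd N * H + H * snd M"
    using assms by (auto simp: homot_def)
  have "tr F - tr G = tr H * tr (snd N) + tr (snd M) * tr H"
    using arg_cong[OF H(2), of tr] by simp
  then have "sh (tr F) - sh (tr G) = snd (mdual M) * (- sh (tr H)) + (- sh (tr H)) * snd (mdual N)"
    by (simp add: sh_diff[symmetric] snd_mdual sh_mult sh_add)
  then show ?thesis by (rule htyI[rotated]) (simp add: hminus sh_hm hm_tr H)
qed

lemma mdual_hequiv:
  assumes "hequiv S M N F" shows "hequiv S (mdual N) (mdual M) (sh (tr F))"
proof -
  obtain G where G: "F \<in> cocyc S M N" "G \<in> cocyc S N M" "homot S M M (G * F) (idm (fst M))" "homot S N N (F * G) (idm (fst N))"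
    by (rule heqE[OF assms])
  show ?thesis
    using mdual_homot[OF G(3)] mdual_homot[OF G(4)]
    by (intro heqI[OF mdual_cocyc[OF G(1)] mdual_cocyc[OF G(2)]]) (simp_all add: sh_mult)
qed

lemma cocyc_transpose: "b \<in> cocyc S M (mdual M) \<Longrightarrow> sh (tr b) \<in> cocyc S M (mdual M)"
  using mdual_cocyc[of b M "mdual M"] by simp

lemma homot_transpose: "homot S M (mdual M) b c \<Longrightarrow> homot S M (mdual M) (sh (tr b)) (sh (tr c))"
  using mdual_homot[of M "mdual M" b c] by simp

lemma strict_iso_comp_inverse:
  assumes "strict_iso S M N F" obtains G where "strict_iso S N M G" "G * F = idm (fst M)" "F * G = idm (fst N)"
proof -
  obtain G where "F \<in> cocyc S M N" "G \<in> cocyc S N M" "G * F = idm (fst M)" "F * G = idm (fst N)"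
    using assms unfolding strict_iso_def by (elim conjE bexE)
  then have "strict_iso S N M G" unfolding strict_iso_def by (intro conjI bexI[of _ F])
  then show thesis using that \<open>G * F = idm (fst M)\<close> \<open>F * G = idm (fst N)\<close> by blast
qed

lemma homot_minus: "homot S M N F G \<Longrightarrow> homot S M N (- F) (- G)"
  using homot_smul[of "- 1" M N F G] by simp

end

lemma reduced_mdual: "reduced M \<Longrightarrow> reduced (mdual M)"
  by (simp add: reduced_def snd_mdual sh_def)

text \<open>
  The isomorphisms \<open>Z\<close> from the image of the dual to the dual of the image carry the sign by which
  the type of the form changes. For surjectivity a form on \<open>N\<close> is pulled back to the image of a
  reduced \<open>M\<close>, lifted to \<open>M\<close> and averaged with its transpose: the average is homotopic to the lift,
  hence a homotopy equivalence, hence an isomorphism, as \<open>M\<close> and its dual are reduced.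
\<close>

lemma strict_equiv_forms:
  fixes A :: "'k::field mpow mfo \<Rightarrow> 'k mpow mfo"
  assumes se: "strict_equiv (series_in V) (series_in W) w w' A a \<eta> \<gamma>"
    and Z: "\<And>M. M \<in> mfs (series_in V) w \<Longrightarrow> strict_iso (series_in W) (A (mdual M)) (mdual (A M)) (Z M)"
    and Z_transpose: "\<And>M b. M \<in> mfs (series_in V) w \<Longrightarrow> b \<in> cocyc (series_in V) M (mdual M) \<Longrightarrow>
      sh (tr (Z M * a M (mdual M) b)) = - (Z M * a M (mdual M) (sh (tr b)))"
    and a_minus: "\<And>M N F. a M N (- F) = - a M N F"
  shows "M \<in> mfs (series_in V) w \<Longrightarrow> rform (series_in V) \<epsilon> M b \<Longrightarrow>
      rform (series_in W) (opposite \<epsilon>) (A M) (Z M * a M (mdual M) b)"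
    and "N \<in> mfs (series_in W) w' \<Longrightarrow> rform (series_in W) (opposite \<epsilon>) N c \<Longrightarrow> (2 :: 'k) \<noteq> 0 \<Longrightarrow>
      \<exists>M\<in>mfs (series_in V) w. \<exists>b. rform (series_in V) \<epsilon> M b \<and> (\<exists>F. hequiv (series_in W) (A M) N F)"
proof -
  interpret strict_equiv "series_in V" "series_in W" w w' A a \<eta> \<gamma> by (rule se)
  have a_sign: "a M N (fsign \<epsilon> \<odot> F) = fsign \<epsilon> \<odot> a M N F" for M N F
    by (cases \<epsilon>) (simp_all add: fsign_def a_minus)
  show "rform (series_in W) (opposite \<epsilon>) (A M) (Z M * a M (mdual M) b)"
    if M: "M \<in> mfs (series_in V) w" and b: "rform (series_in V) \<epsilon> M b"
  proof -
    have b': "strict_iso (series_in V) M (mdual M) b" "sh (tr b) = fsign \<epsilon> \<odot> b" using b by (simp_all add: rform_def)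
    have "strict_iso (series_in W) (A M) (mdual (A M)) (Z M * a M (mdual M) b)"
      by (rule S'.strict_iso_comp[OF strict_iso_mor[OF M S.mdual_mfs[OF M] b'(1)] Z[OF M]])
    then show ?thesis using Z_transpose[OF M strict_iso_cocyc[OF b'(1)]]
      by (simp add: rform_def b'(2) a_sign)
  qed
  assume N: "N \<in> mfs (series_in W) w'" and c: "rform (series_in W) (opposite \<epsilon>) N c" and two: "(2 :: 'k) \<noteq> 0"
  have c': "strict_iso (series_in W) N (mdual N) c" "sh (tr c) = - fsign \<epsilon> \<odot> c" using c by (simp_all add: rform_def)
  obtain N0 F0 where N0: "N0 \<in> mfs (series_in W) w'" "reduced N0" and F0: "hequiv (series_in W) N0 N F0"
    using reduction[OF N] by (elim bexE conjE exE)
  obtain M F1 where M: "M \<in> mfs (series_in V) w" "reduced M" and F1: "strict_iso (series_in W) (A M) N0 F1"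
    using reach[OF N0] by (elim bexE conjE exE)
  note AM = obj[OF M(1)] and dM = S.mdual_mfs[OF M(1)]
  note AdM = obj[OF dM] and dAM = S'.mdual_mfs[OF AM]
  define F where "F = F0 * F1"
  have F: "hequiv (series_in W) (A M) N F"
    unfolding F_def by (rule S'.hequiv_comp[OF S'.strict_iso_hequiv[OF F1] F0 AM N0(1) N])
  define B where "B = sh (tr F) * (c * F)"
  have cF: "hequiv (series_in W) (A M) (mdual N) (c * F)"
    by (rule S'.hequiv_comp[OF F S'.strict_iso_hequiv[OF c'(1)] AM N S'.mdual_mfs[OF N]])
  have B: "hequiv (series_in W) (A M) (mdual (A M)) B"
    unfolding B_def by (rule S'.hequiv_comp[OF cF S'.mdual_hequiv[OF F] AM S'.mdual_mfs[OF N] dAM])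
  have B_sym: "sh (tr B) = - fsign \<epsilon> \<odot> B"
  proof -
    have "sh (tr B) = sh (tr F * tr c * sh F)" by (simp add: B_def mult.assoc)
    also have "\<dots> = sh (tr F) * (sh (tr c) * F)" by (simp only: sh_mult[symmetric] sh_sh mult.assoc)
    finally show ?thesis by (simp add: c'(2) B_def)
  qed
  obtain Z' where Z': "strict_iso (series_in W) (mdual (A M)) (A (mdual M)) Z'" "Z' * Z M = idm (fst (A (mdual M)))"
    "Z M * Z' = idm (fst (mdual (A M)))" by (rule S'.strict_iso_comp_inverse[OF Z[OF M(1)]])
  have Z'B: "hequiv (series_in W) (A M) (A (mdual M)) (Z' * B)"
    by (rule S'.hequiv_comp[OF B S'.strict_iso_hequiv[OF Z'(1)] AM dAM AdM])
  obtain b0 where b0: "b0 \<in> cocyc (series_in V) M (mdual M)"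
    "homot (series_in W) (A M) (A (mdual M)) (a M (mdual M) b0) (Z' * B)"
    using full[OF M(1) dM S'.hequiv_cocyc[OF Z'B]] by (elim bexE)
  note b0t = S.cocyc_transpose[OF b0(1)]
  note ab0 = mor[OF M(1) dM b0(1)] and ab0t = mor[OF M(1) dM b0t]
  have b0_hequiv: "hequiv (series_in V) M (mdual M) b0"
    using S'.hequiv_homot[OF Z'B S'.homot_sym[OF b0(2)] ab0] by (simp add: mor_hequiv[OF M(1) dM b0(1)])
  have ZB: "homot (series_in W) (A M) (mdual (A M)) (Z M * a M (mdual M) b0) B"
    using S'.homot_mult_left[OF b0(2) strict_iso_cocyc[OF Z[OF M(1)]]] S'.cocyc_absorb(1)[OF S'.hequiv_cocyc[OF B]]
    by (simp add: mult_eq_assoc[OF Z'(3)])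
  \<comment> \<open>\<open>b\<^sub>0\<close> is symmetric up to homotopy, since its image is homotopic to the symmetric map \<open>B\<close>.\<close>
  have "homot (series_in W) (A M) (mdual (A M)) (- (Z M * a M (mdual M) (sh (tr b0)))) (- fsign \<epsilon> \<odot> B)"
    using S'.homot_transpose[OF ZB] by (simp only: B_sym Z_transpose[OF M(1) b0(1)])
  then have 1: "homot (series_in W) (A M) (mdual (A M)) (Z M * a M (mdual M) (sh (tr b0))) (fsign \<epsilon> \<odot> B)"
    using S'.homot_minus by fastforce
  have 2: "homot (series_in W) (A M) (mdual (A M)) (Z M * (fsign \<epsilon> \<odot> a M (mdual M) b0)) (fsign \<epsilon> \<odot> B)"
    using S'.homot_smul[OF S'.fsign_in ZB] by simp
  have "homot (series_in W) (A M) (A (mdual M)) (Z' * (Z M * a M (mdual M) (sh (tr b0)))) (Z' * (Z M * (fsign \<epsilon> \<odot> a M (mdual M) b0)))"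
    by (rule S'.homot_mult_left[OF S'.homot_trans[OF 1 S'.homot_sym[OF 2]] strict_iso_cocyc[OF Z'(1)]])
  then have "homot (series_in W) (A M) (A (mdual M)) (a M (mdual M) (sh (tr b0))) (a M (mdual M) (fsign \<epsilon> \<odot> b0))"
    using S'.cocyc_absorb(1)[OF ab0] S'.cocyc_absorb(1)[OF ab0t]
    by (simp add: mult_eq_assoc[OF Z'(2)] a_sign)
  then have sym: "homot (series_in V) M (mdual M) (sh (tr b0)) (fsign \<epsilon> \<odot> b0)"
    by (simp add: homotopy[OF M(1) dM b0t S.cocyc_smul[OF S.fsign_in b0(1)]])
  define h :: "'k mpow" where "h = MPow (\<lambda>m. if m = {#} then 1 / 2 else 0)"
  have h: "h \<in> series_in V" unfolding h_def by (rule const_in_series_in)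
  have hh: "h + h = 1"
    by (rule mpow_eqI, unfold mcoeff_add h_def mcoeff_MPow mcoeff_1) (use two in \<open>simp add: field_simps\<close>)
  define b where "b = h \<odot> (b0 + fsign \<epsilon> \<odot> sh (tr b0))"
  have bz: "b \<in> cocyc (series_in V) M (mdual M)"
    unfolding b_def by (intro S.cocyc_smul S.cocyc_add h b0(1) b0t S.fsign_in)
  have "homot (series_in V) M (mdual M) (b0 + fsign \<epsilon> \<odot> sh (tr b0)) (b0 + fsign \<epsilon> \<odot> (fsign \<epsilon> \<odot> b0))"
    by (rule S.homot_add[OF S.homot_refl S.homot_smul[OF S.fsign_in sym]])
  then have "homot (series_in V) M (mdual M) b (h \<odot> (b0 + b0))"
    unfolding b_def using S.homot_smul[OF h] by simp
  also have "h \<odot> (b0 + b0) = b0" by (simp add: smul_add hh flip: smul_add_left)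
  finally have "homot (series_in V) M (mdual M) b b0" .
  then have "hequiv (series_in V) M (mdual M) b" by (rule S.hequiv_homot[OF b0_hequiv S.homot_sym bz])
  then have "strict_iso (series_in V) M (mdual M) b"
    by (rule hequiv_reduced_strict_iso[OF _ M(1) dM M(2) reduced_mdual[OF M(2)]])
  moreover have "sh (tr b) = fsign \<epsilon> \<odot> b"
    by (cases \<epsilon>) (simp_all add: b_def fsign_def sh_smul sh_add sh_diff smul_simps add.commute)
  ultimately have "rform (series_in V) \<epsilon> M b" by (simp add: rform_def)
  with M(1) F show "\<exists>M\<in>mfs (series_in V) w. \<exists>b. rform (series_in V) \<epsilon> M b \<and> (\<exists>F. hequiv (series_in W) (A M) N F)"
    by blast
qed


subsection \<open>Forms under the iterated functor\<close>

text \<open>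
  The comparisons of the functors with duality. For the inner functor the values lie in the
  transpose, which is where twisted forms live, so \<open>zinner\<close> is tensoring with the quadratic form on
  the factorization of rank one. The outer functor leads back to forms, and \<open>zouter\<close> takes values in
  the dual.
\<close>

definition zinner :: "nat \<times> nat \<Rightarrow> nat \<times> nat \<Rightarrow> 'a::comm_ring_1 gmat" where
  "zinner X' X = in1 X * (flp * (eps * pr2 X' X')) - in2 X X * (flp * (eps * pr1 X'))"

definition zouter :: "nat \<times> nat \<Rightarrow> 'a::comm_ring_1 gmat" where
  "zouter X = (let X' = prod.swap X; Z = sumr X X; Z' = sumr X' X' in
    flp * (in2 Z Z * (zinner X' X * pr1 Z') - in1 Z * (zinner X' X * pr2 Z' Z')))"

definition zouter_inv :: "nat \<times> nat \<Rightarrow> 'a::comm_ring_1 gmat" where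
  "zouter_inv X = (let X' = prod.swap X; Z = sumr X X; Z' = sumr X' X' in
    in1 Z' * (zinner X X' * (pr2 Z Z * flp)) - in2 Z' Z' * (zinner X X' * (pr1 Z * flp)))"

definition theta_theta_form :: "nat \<times> nat \<Rightarrow> 'a::comm_ring_1 gmat \<Rightarrow> 'a gmat" where
  "theta_theta_form X b = (let Z = sumr X X;
    q = in1 X * (flp * b * eps) * pr2 X X - in2 X X * (flp * b * eps) * pr1 X
    in flp * (in2 Z Z * q * pr1 Z - in1 Z * q * pr2 Z Z))"

lemma theta_theta_form_eq:
  assumes b: "b \<in> hm S False X (prod.swap X)"
  shows "zouter X * kn_mor (sumr X X) (sumr (prod.swap X) (prod.swap X)) (kn_mor X (prod.swap X) b) = theta_theta_form X b"
proof -
  let ?X' = "prod.swap X"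
  have k: "zinner ?X' X * kn_mor X ?X' b = in1 X * (flp * b * eps) * pr2 X X - in2 X X * (flp * b * eps) * pr1 X"
    unfolding zinner_def kn_mor_def by (simp add: algebra_simps idm_absorb[OF b] eps_even_assoc[OF b])
  have kb: "kn_mor X ?X' b \<in> hm UNIV False (sumr X X) (sumr ?X' ?X')"
    by (rule subring.kn_mor_hm[OF subring_UNIV hm_mono[OF b subset_UNIV]])
  show ?thesis
    unfolding theta_theta_form_def Let_def k[symmetric] zouter_def
    by (simp add: algebra_simps kn_mor_rules[OF kb, THEN mult_eq_assoc] kn_mor_rules[OF kb] idm_absorb[OF kb])
qed

lemma theta_theta_form_transpose:
  assumes b: "b \<in> hm S False X (prod.swap X)"
  shows "sh (tr (theta_theta_form X b)) = - theta_theta_form X (sh (tr b))"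
  unfolding theta_theta_form_def Let_def sh_def
  by (simp add: algebra_simps eps_flp eps_flp_assoc eps_even[OF hm_tr[OF b]] eps_even_assoc[OF hm_tr[OF b]])

context subring begin

lemma zinner_hm:
  assumes X': "X' = prod.swap X"
  shows "zinner X' X \<in> hm S False (sumr X' X') (sumr X X)"
proof -
  have 2: "flp * (eps * pr2 X' X') \<in> hm S True (sumr X' X') X"
    using hm_flp_left[OF heps(2)[OF hpr2[of X' X']], of True] X' by simp
  have 1: "flp * (eps * pr1 X') \<in> hm S False (sumr X' X') X"
    using hm_flp_left[OF heps(2)[OF hpr1[of X' X']], of False] X' by simp
  show ?thesis unfolding zinner_def by (intro hdiff hmul[OF hin1 2] hmul[OF hin2 1]) simp_all
qed

lemma zouter_hm: "zouter X \<in> hm S False (sumr (sumr (prod.swap X) (prod.swap X)) (sumr (prod.swap X) (prod.swap X)))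
    (prod.swap (sumr (sumr X X) (sumr X X)))"
  unfolding zouter_def Let_def
  by (rule hm_flp_left, rule hdiff[OF hblk(3)[OF zinner_hm] hblk(2)[OF zinner_hm]]) simp_all

lemma zouter_inv_hm: "zouter_inv X \<in> hm S False (prod.swap (sumr (sumr X X) (sumr X X)))
   (sumr (sumr (prod.swap X) (prod.swap X)) (sumr (prod.swap X) (prod.swap X)))"
proof -
  let ?X' = "prod.swap X"
  let ?Z = "sumr X X" and ?Z' = "sumr ?X' ?X'"
  have "in1 ?Z' * (zinner X ?X' * pr2 ?Z ?Z) - in2 ?Z' ?Z' * (zinner X ?X' * pr1 ?Z) \<in> hm S True (sumr ?Z ?Z) (sumr ?Z' ?Z')"
  proof (rule hdiff)
    show "in1 ?Z' * (zinner X ?X' * pr2 ?Z ?Z) \<in> hm S True (sumr ?Z ?Z) (sumr ?Z' ?Z')"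
      by (rule hblk(2)[OF zinner_hm]) simp_all
    show "in2 ?Z' ?Z' * (zinner X ?X' * pr1 ?Z) \<in> hm S True (sumr ?Z ?Z) (sumr ?Z' ?Z')"
      by (rule hblk(3)[OF zinner_hm]) simp_all
  qed
  from hm_flp_right[OF this, of False] show ?thesis
    unfolding zouter_inv_def Let_def by (simp add: algebra_simps)
qed

lemma zinner_inverse:
  fixes X :: "nat \<times> nat"
  shows "X' = prod.swap X \<Longrightarrow> zinner X X' * zinner X' X = (idm (sumr X' X') :: 'a gmat)"
  unfolding zinner_def by (simp add: algebra_simps flp_idm flp_idm_assoc eps_block eps_flp eps_flp_assoc flip: in_pr)

lemma zouter_strict_iso:
  assumes M: "M \<in> mfs S w" and xy: "x \<in> S" "y \<in> S" "u \<in> S" "v \<in> S"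
  shows "strict_iso S (kn u v (twist (kn x y (mdual M)))) (mdual (kn u v (twist (kn x y M)))) (zouter (fst M))"
proof -
  let ?X = "fst M" let ?X' = "prod.swap ?X"
  let ?Z = "sumr ?X ?X" and ?Z' = "sumr ?X' ?X'"
  note Q = mfs_hm[OF M] and D = mdual_mfs[OF M]
  have Q': "snd (mdual M) \<in> hm S True ?X' ?X'" using mfs_hm[OF D] by simp
  let ?W = "kmat x y ?X (snd M) * eps" and ?W' = "kmat x y ?X' (snd (mdual M)) * eps"
  have W: "?W \<in> hm S True ?Z ?Z" and W': "?W' \<in> hm S True ?Z' ?Z'"
    by (intro heps kmat_hm Q Q' xy)+
  have T1: "twist (kn x y M) \<in> mfs S (- (w - x * y))" and T2: "twist (kn x y (mdual M)) \<in> mfs S (- (w - x * y))"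
    by (intro twist_mfs kn_mfs M D xy)+
  have inner: "tr ?W * zinner ?X' ?X = zinner ?X' ?X * ?W'"
    unfolding kmat_def zinner_def snd_mdual sh_def
    by (simp add: algebra_simps eps_block eps_flp eps_flp_assoc idm_absorb[OF Q] idm_absorb[OF hm_tr[OF Q]]
        eps_odd_assoc[OF Q] eps_odd_assoc[OF hm_tr[OF Q]] flp_idm flp_idm_assoc smul_simps)
  note zi = idm_absorb[OF zinner_hm[of ?X' ?X], OF refl]
  define W0 where "W0 = ?W"
  define W0' where "W0' = ?W'"
  note W'r = kmat_rules[OF W'[folded W0'_def], of u v] kmat_rules[OF W'[folded W0'_def], of u v, THEN mult_eq_assoc]
  note inner' = inner[folded W0_def W0'_def]
  note Wa = idm_absorb[OF hm_tr[OF W[folded W0_def]]] idm_absorb[OF W'[folded W0'_def]]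
  have trK: "tr (kmat u v ?Z W0) = in1 ?Z * (tr W0 * pr1 ?Z) - in2 ?Z ?Z * (tr W0 * pr2 ?Z ?Z) +
      u \<odot> (in1 ?Z * pr2 ?Z ?Z) - v \<odot> (in2 ?Z ?Z * pr1 ?Z)"
    unfolding kmat_def[of u v] by (simp add: mult.assoc)
  let ?R = "in2 ?Z ?Z * (zinner ?X' ?X * pr1 ?Z') - in1 ?Z * (zinner ?X' ?X * pr2 ?Z' ?Z')"
  have "- (tr (kmat u v ?Z W0) * ?R) = ?R * kmat u v ?Z' W0'"
    unfolding trK by (simp add: algebra_simps W'r zi Wa smul_simps inner' mult_eq_assoc[OF inner'])
  then have "flp * (- (tr (kmat u v ?Z W0) * ?R)) = flp * (?R * kmat u v ?Z' W0')" by simp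
  moreover have "snd (mdual (kn u v (twist (kn x y M)))) * zouter ?X = flp * (- (tr (kmat u v ?Z W0) * ?R))"
    by (simp add: snd_mdual[of "kn u v (twist (kn x y M))"] sh_def zouter_def Let_def mult.assoc W0_def)
  moreover have "zouter ?X * snd (kn u v (twist (kn x y (mdual M)))) = flp * (?R * kmat u v ?Z' W0')"
    by (simp add: zouter_def Let_def mult.assoc W0'_def)
  ultimately have "snd (mdual (kn u v (twist (kn x y M)))) * zouter ?X = zouter ?X * snd (kn u v (twist (kn x y (mdual M))))"
    by simp
  then have "zouter ?X \<in> cocyc S (kn u v (twist (kn x y (mdual M)))) (mdual (kn u v (twist (kn x y M))))"
    using zouter_hm[of ?X] by (simp add: cocyc_def)
  moreover have "zouter_inv ?X * zouter ?X = (idm (sumr ?Z' ?Z') :: 'a gmat)"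
  proof -
    have "zouter_inv ?X * zouter ?X = (in1 ?Z' * pr1 ?Z' + in2 ?Z' ?Z' * pr2 ?Z' ?Z' :: 'a gmat)"
      unfolding zouter_inv_def zouter_def Let_def
      by (simp add: algebra_simps zi zinner_inverse mult_eq_assoc[OF zinner_inverse])
    then show ?thesis by (simp add: in_pr)
  qed
  moreover have "zouter ?X * zouter_inv ?X = (idm (prod.swap (sumr ?Z ?Z)) :: 'a gmat)"
  proof -
    have i: "zinner ?X' ?X * zinner ?X ?X' = (idm ?Z :: 'a gmat)" using zinner_inverse[of ?X ?X'] by simp
    have zi': "idm ?Z' * (zinner ?X ?X' * Z) = zinner ?X ?X' * Z" for Z :: "'a gmat"
      using idm_absorb(3)[OF zinner_hm[of ?X ?X']] by simp
    have "zouter ?X * zouter_inv ?X = (sh (idm (sumr ?Z ?Z)) :: 'a gmat)"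
      unfolding zouter_inv_def zouter_def Let_def sh_def in_pr[symmetric]
      by (simp add: algebra_simps zi zi' i mult_eq_assoc[OF i])
    then show ?thesis by simp
  qed
  ultimately show ?thesis
    using zouter_inv_hm[of ?X]
    by (intro strict_iso_inverseI[OF subring_axioms kn_mfs[OF T2 xy(3,4)] mdual_mfs[OF kn_mfs[OF T1 xy(3,4)]], of _ "zouter_inv ?X"])
      simp_all
qed

end


section \<open>Homotopy categories\<close>

subsection \<open>Fully faithful and essentially surjective functors\<close>

lemma isosI:
  "f \<in> Mor C X Y \<Longrightarrow> g \<in> Mor C Y X \<Longrightarrow> Cmp C X Y X g f = Idt C X \<Longrightarrow> Cmp C Y X Y f g = Idt C Y \<Longrightarrow>
    f \<in> isos C X Y"
  by (auto simp: isos_def)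

lemma categoryD:
  assumes "is_category C"
  shows "X \<in> Obj C \<Longrightarrow> Idt C X \<in> Mor C X X"
    and "X \<in> Obj C \<Longrightarrow> Y \<in> Obj C \<Longrightarrow> Z \<in> Obj C \<Longrightarrow> f \<in> Mor C X Y \<Longrightarrow> g \<in> Mor C Y Z \<Longrightarrow> Cmp C X Y Z g f \<in> Mor C X Z"
    and "X \<in> Obj C \<Longrightarrow> Y \<in> Obj C \<Longrightarrow> f \<in> Mor C X Y \<Longrightarrow> Cmp C X X Y f (Idt C X) = f"
    and "X \<in> Obj C \<Longrightarrow> Y \<in> Obj C \<Longrightarrow> f \<in> Mor C X Y \<Longrightarrow> Cmp C X Y Y (Idt C Y) f = f"
    and "W \<in> Obj C \<Longrightarrow> X \<in> Obj C \<Longrightarrow> Y \<in> Obj C \<Longrightarrow> Z \<in> Obj C \<Longrightarrow> f \<in> Mor C W X \<Longrightarrow> g \<in> Mor C X Y \<Longrightarrow>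
      h \<in> Mor C Y Z \<Longrightarrow> Cmp C W X Z (Cmp C X Y Z h g) f = Cmp C W Y Z h (Cmp C W X Y g f)"
  using assms unfolding is_category_def by simp_all

lemma functorD:
  assumes "is_functor C D Fo Fm"
  shows "X \<in> Obj C \<Longrightarrow> Fo X \<in> Obj D"
    and "X \<in> Obj C \<Longrightarrow> Y \<in> Obj C \<Longrightarrow> f \<in> Mor C X Y \<Longrightarrow> Fm X Y f \<in> Mor D (Fo X) (Fo Y)"
    and "X \<in> Obj C \<Longrightarrow> Fm X X (Idt C X) = Idt D (Fo X)"
    and "X \<in> Obj C \<Longrightarrow> Y \<in> Obj C \<Longrightarrow> Z \<in> Obj C \<Longrightarrow> f \<in> Mor C X Y \<Longrightarrow> g \<in> Mor C Y Z \<Longrightarrow>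
      Fm X Z (Cmp C X Y Z g f) = Cmp D (Fo X) (Fo Y) (Fo Z) (Fm Y Z g) (Fm X Y f)"
  using assms unfolding is_functor_def by simp_all

text \<open>
  The usual construction of a quasi-inverse: objects of the image and isomorphisms are chosen, and
  morphisms are conjugated by these isomorphisms and lifted along the bijections.
\<close>

lemma is_equivalenceI:
  assumes C: "is_category C" and D: "is_category D" and F: "is_functor C D Fo Fm"
    and ff: "\<And>X Y. X \<in> Obj C \<Longrightarrow> Y \<in> Obj C \<Longrightarrow> bij_betw (Fm X Y) (Mor C X Y) (Mor D (Fo X) (Fo Y))"
    and es: "\<And>Y. Y \<in> Obj D \<Longrightarrow> \<exists>X\<in>Obj C. \<exists>m. m \<in> isos D (Fo X) Y"
  shows "is_equivalence C D Fo Fm"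
proof -
  note Cc = categoryD[OF C] and Dc = categoryD[OF D] and Ff = functorD[OF F]
  have "\<forall>Y. \<exists>X m. Y \<in> Obj D \<longrightarrow> X \<in> Obj C \<and> m \<in> isos D (Fo X) Y" using es by blast
  then obtain Go \<mu> where GM: "\<And>Y. Y \<in> Obj D \<Longrightarrow> Go Y \<in> Obj C \<and> \<mu> Y \<in> isos D (Fo (Go Y)) Y"
    by metis
  then have Go: "Y \<in> Obj D \<Longrightarrow> Go Y \<in> Obj C" and mu: "Y \<in> Obj D \<Longrightarrow> \<mu> Y \<in> isos D (Fo (Go Y)) Y" for Y by auto
  have FGo: "Y \<in> Obj D \<Longrightarrow> Fo (Go Y) \<in> Obj D" for Y using Go Ff(1) by simp
  have "\<forall>Y. \<exists>n. Y \<in> Obj D \<longrightarrow> n \<in> Mor D Y (Fo (Go Y)) \<and>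
      Cmp D (Fo (Go Y)) Y (Fo (Go Y)) n (\<mu> Y) = Idt D (Fo (Go Y)) \<and> Cmp D Y (Fo (Go Y)) Y (\<mu> Y) n = Idt D Y"
    using mu unfolding isos_def by blast
  then obtain \<nu> where nu: "\<And>Y. Y \<in> Obj D \<Longrightarrow> \<nu> Y \<in> Mor D Y (Fo (Go Y)) \<and>
      Cmp D (Fo (Go Y)) Y (Fo (Go Y)) (\<nu> Y) (\<mu> Y) = Idt D (Fo (Go Y)) \<and> Cmp D Y (Fo (Go Y)) Y (\<mu> Y) (\<nu> Y) = Idt D Y"
    by metis
  have muM: "\<mu> Y \<in> Mor D (Fo (Go Y)) Y" and nuM: "\<nu> Y \<in> Mor D Y (Fo (Go Y))" if "Y \<in> Obj D" for Y
    using mu[OF that] nu[OF that] by (simp_all add: isos_def)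
  have numu: "Y \<in> Obj D \<Longrightarrow> Cmp D (Fo (Go Y)) Y (Fo (Go Y)) (\<nu> Y) (\<mu> Y) = Idt D (Fo (Go Y))"
    and munu: "Y \<in> Obj D \<Longrightarrow> Cmp D Y (Fo (Go Y)) Y (\<mu> Y) (\<nu> Y) = Idt D Y" for Y using nu by simp_all
  define pre where "pre X Y = inv_into (Mor C X Y) (Fm X Y)" for X Y
  have pre_in: "pre X Y g \<in> Mor C X Y" and F_pre: "Fm X Y (pre X Y g) = g"
    if X: "X \<in> Obj C" and Y: "Y \<in> Obj C" and g: "g \<in> Mor D (Fo X) (Fo Y)" for X Y g
  proof -
    have "g \<in> Fm X Y ` Mor C X Y" using g bij_betw_imp_surj_on[OF ff[OF X Y]] by simp
    then show "pre X Y g \<in> Mor C X Y" "Fm X Y (pre X Y g) = g"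
      unfolding pre_def by (rule inv_into_into, rule f_inv_into_f)
  qed
  have inj: "f = g" if "X \<in> Obj C" "Y \<in> Obj C" "f \<in> Mor C X Y" "g \<in> Mor C X Y" "Fm X Y f = Fm X Y g" for X Y f g
    by (rule inj_onD[OF bij_betw_imp_inj_on[OF ff[OF that(1,2)]] that(5,3,4)])
  define \<phi> where "\<phi> Y Y' g = Cmp D (Fo (Go Y)) Y' (Fo (Go Y')) (\<nu> Y') (Cmp D (Fo (Go Y)) Y Y' g (\<mu> Y))" for Y Y' g
  have phi: "\<phi> Y Y' g \<in> Mor D (Fo (Go Y)) (Fo (Go Y'))" if "Y \<in> Obj D" "Y' \<in> Obj D" "g \<in> Mor D Y Y'" for Y Y' g
    unfolding \<phi>_def using that by (intro Dc(2) FGo muM nuM)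
  define Gm where "Gm Y Y' g = pre (Go Y) (Go Y') (\<phi> Y Y' g)" for Y Y' g
  have Gm: "Gm Y Y' g \<in> Mor C (Go Y) (Go Y')" and FGm: "Fm (Go Y) (Go Y') (Gm Y Y' g) = \<phi> Y Y' g"
    if "Y \<in> Obj D" "Y' \<in> Obj D" "g \<in> Mor D Y Y'" for Y Y' g
    unfolding Gm_def using pre_in F_pre Go phi that by simp_all
  have mu_phi: "Cmp D (Fo (Go Y)) (Fo (Go Y')) Y' (\<mu> Y') (\<phi> Y Y' g) = Cmp D (Fo (Go Y)) Y Y' g (\<mu> Y)"
    if Y: "Y \<in> Obj D" and Y': "Y' \<in> Obj D" and g: "g \<in> Mor D Y Y'" for Y Y' g
  proof -
    have m: "Cmp D (Fo (Go Y)) Y Y' g (\<mu> Y) \<in> Mor D (Fo (Go Y)) Y'" by (intro Dc(2) FGo muM Y Y' g)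
    show ?thesis unfolding \<phi>_def
      by (subst Dc(5)[symmetric, OF FGo[OF Y] Y' FGo[OF Y'] Y' m nuM[OF Y'] muM[OF Y']])
        (simp add: munu[OF Y'] Dc(4)[OF FGo[OF Y] Y' m])
  qed
  have G: "is_functor D C Go Gm"
    unfolding is_functor_def
  proof (intro conjI ballI)
    fix X assume X: "X \<in> Obj D"
    show "Go X \<in> Obj C" by (rule Go[OF X])
    show "Gm X X (Idt D X) = Idt C (Go X)"
    proof (rule inj[OF Go[OF X] Go[OF X] Gm[OF X X Dc(1)[OF X]] Cc(1)[OF Go[OF X]]])
      show "Fm (Go X) (Go X) (Gm X X (Idt D X)) = Fm (Go X) (Go X) (Idt C (Go X))"
        by (simp add: FGm[OF X X Dc(1)[OF X]] Ff(3)[OF Go[OF X]] \<phi>_def Dc(4)[OF FGo[OF X] X muM[OF X]] numu[OF X])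
    qed
    fix Y assume Y: "Y \<in> Obj D"
    show "Gm X Y f \<in> Mor C (Go X) (Go Y)" if "f \<in> Mor D X Y" for f by (rule Gm[OF X Y that])
    fix Z assume Z: "Z \<in> Obj D"
    fix f g assume f: "f \<in> Mor D X Y" and g: "g \<in> Mor D Y Z"
    have gf: "Cmp D X Y Z g f \<in> Mor D X Z" by (rule Dc(2)[OF X Y Z f g])
    show "Gm X Z (Cmp D X Y Z g f) = Cmp C (Go X) (Go Y) (Go Z) (Gm Y Z g) (Gm X Y f)"
    proof (rule inj[OF Go[OF X] Go[OF Z] Gm[OF X Z gf] Cc(2)[OF Go[OF X] Go[OF Y] Go[OF Z] Gm[OF X Y f] Gm[OF Y Z g]]])
      have fm: "Cmp D (Fo (Go X)) X Y f (\<mu> X) \<in> Mor D (Fo (Go X)) Y" by (intro Dc(2) FGo muM X Y f)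
      have "Cmp D (Fo (Go X)) (Fo (Go Y)) (Fo (Go Z)) (\<phi> Y Z g) (\<phi> X Y f) =
          Cmp D (Fo (Go X)) Z (Fo (Go Z)) (\<nu> Z) (Cmp D (Fo (Go X)) (Fo (Go Y)) Z (Cmp D (Fo (Go Y)) Y Z g (\<mu> Y)) (\<phi> X Y f))"
        unfolding \<phi>_def[of Y Z g]
        by (rule Dc(5)) (intro FGo X Y Z phi f Dc(2) muM nuM g)+
      also have "Cmp D (Fo (Go X)) (Fo (Go Y)) Z (Cmp D (Fo (Go Y)) Y Z g (\<mu> Y)) (\<phi> X Y f) =
          Cmp D (Fo (Go X)) Y Z g (Cmp D (Fo (Go X)) (Fo (Go Y)) Y (\<mu> Y) (\<phi> X Y f))"
        by (rule Dc(5)) (intro FGo X Y Z phi f muM g)+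
      also have "\<dots> = Cmp D (Fo (Go X)) Y Z g (Cmp D (Fo (Go X)) X Y f (\<mu> X))"
        by (simp only: mu_phi[OF X Y f])
      also have "\<dots> = Cmp D (Fo (Go X)) X Z (Cmp D X Y Z g f) (\<mu> X)"
        by (rule Dc(5)[symmetric]) (intro FGo X Y Z f g muM)+
      finally have "Cmp D (Fo (Go X)) (Fo (Go Y)) (Fo (Go Z)) (\<phi> Y Z g) (\<phi> X Y f) = \<phi> X Z (Cmp D X Y Z g f)"
        by (simp only: \<phi>_def[of X Z])
      then show "Fm (Go X) (Go Z) (Gm X Z (Cmp D X Y Z g f)) =
          Fm (Go X) (Go Z) (Cmp C (Go X) (Go Y) (Go Z) (Gm Y Z g) (Gm X Y f))"
        by (simp add: FGm[OF X Z gf] FGm[OF X Y f] FGm[OF Y Z g] Ff(4)[OF Go[OF X] Go[OF Y] Go[OF Z] Gm[OF X Y f] Gm[OF Y Z g]])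
    qed
  qed
  have M: "natural_iso D D (\<lambda>X. Fo (Go X)) (\<lambda>X Y f. Fm (Go X) (Go Y) (Gm X Y f)) (\<lambda>X. X) (\<lambda>_ _ f. f) \<mu>"
    unfolding natural_iso_def using mu by (simp add: FGm mu_phi)
  define \<eta> where "\<eta> X = pre (Go (Fo X)) X (\<mu> (Fo X))" for X
  have eta: "\<eta> X \<in> Mor C (Go (Fo X)) X" and Feta: "Fm (Go (Fo X)) X (\<eta> X) = \<mu> (Fo X)" if X: "X \<in> Obj C" for X
    unfolding \<eta>_def using pre_in F_pre Go Ff(1)[OF X] muM X by simp_all
  have N: "natural_iso C C (\<lambda>X. Go (Fo X)) (\<lambda>X Y f. Gm (Fo X) (Fo Y) (Fm X Y f)) (\<lambda>X. X) (\<lambda>_ _ f. f) \<eta>"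
    unfolding natural_iso_def
  proof (intro conjI ballI)
    fix X assume X: "X \<in> Obj C"
    note FX = Ff(1)[OF X] and GX = Go[OF Ff(1)[OF X]]
    let ?n = "pre X (Go (Fo X)) (\<nu> (Fo X))"
    have n: "?n \<in> Mor C X (Go (Fo X))" and Fn: "Fm X (Go (Fo X)) ?n = \<nu> (Fo X)"
      using pre_in[OF X GX nuM[OF FX]] F_pre[OF X GX nuM[OF FX]] .
    show "\<eta> X \<in> isos C (Go (Fo X)) X"
    proof (rule isosI[OF eta[OF X] n])
      show "Cmp C (Go (Fo X)) X (Go (Fo X)) ?n (\<eta> X) = Idt C (Go (Fo X))"
        by (rule inj[OF GX GX Cc(2)[OF GX X GX eta[OF X] n] Cc(1)[OF GX]])
          (simp add: Ff(4)[OF GX X GX eta[OF X] n] Ff(3)[OF GX] Feta[OF X] Fn numu[OF FX])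
      show "Cmp C X (Go (Fo X)) X (\<eta> X) ?n = Idt C X"
        by (rule inj[OF X X Cc(2)[OF X GX X n eta[OF X]] Cc(1)[OF X]])
          (simp add: Ff(4)[OF X GX X n eta[OF X]] Ff(3)[OF X] Feta[OF X] Fn munu[OF FX])
    qed
    fix Y f assume Y: "Y \<in> Obj C" and f: "f \<in> Mor C X Y"
    note FY = Ff(1)[OF Y] and GY = Go[OF Ff(1)[OF Y]] and Fmf = Ff(2)[OF X Y f]
    note Gf = Gm[OF FX FY Fmf]
    show "Cmp C (Go (Fo X)) (Go (Fo Y)) Y (\<eta> Y) (Gm (Fo X) (Fo Y) (Fm X Y f)) = Cmp C (Go (Fo X)) X Y f (\<eta> X)"
      by (rule inj[OF GX Y Cc(2)[OF GX GY Y Gf eta[OF Y]] Cc(2)[OF GX X Y eta[OF X] f]])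
        (simp add: Ff(4)[OF GX GY Y Gf eta[OF Y]] Ff(4)[OF GX X Y eta[OF X] f] Feta[OF X] Feta[OF Y]
          FGm[OF FX FY Fmf] mu_phi[OF FX FY Fmf])
  qed
  show ?thesis unfolding is_equivalence_def using F G M N by blast
qed


subsection \<open>Morphisms as homotopy classes\<close>

text \<open>
  The morphisms of the homotopy category are sets of pairs of matrices; here such a set is named by a
  representative in the ring of matrices.
\<close>

definition hclass :: "'a set \<Rightarrow> 'a::comm_ring_1 hmap \<Rightarrow> 'a hmap \<Rightarrow> 'a gmat \<Rightarrow> 'a hmap set" where
  "hclass S M N G = {f \<in> cocycles S M N. homot S (rep M) (rep N) G (gm False f)}"

context subring begin

lemma cls_eq:
  assumes "is_MF S w M" "is_MF S w N" "f \<in> cocycles S M N"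
  shows "homotopic S M N `` {f} = hclass S M N (gm False f)"
proof (rule Set.set_eqI)
  fix g show "g \<in> homotopic S M N `` {f} \<longleftrightarrow> g \<in> hclass S M N (gm False f)"
    unfolding Image_singleton_iff homotopic_iff[OF assms(1,2) zero] hclass_def mem_Collect_eq using assms(3) by blast
qed

lemma cocycle_cocyc: "is_MF S w M \<Longrightarrow> is_MF S w N \<Longrightarrow> f \<in> cocycles S M N \<Longrightarrow> gm False f \<in> cocyc S (rep M) (rep N)"
  by (simp add: cocycles_iff)

lemma cocycle_maps: "is_MF S w M \<Longrightarrow> is_MF S w N \<Longrightarrow> f \<in> cocycles S M N \<Longrightarrow> f \<in> maps S False (rk M) (rk N)"
  by (simp add: cocycles_iff)

lemma cocycle_surj:
  assumes "is_MF S w M" "is_MF S w N" "G \<in> cocyc S (rep M) (rep N)"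
  obtains f where "f \<in> cocycles S M N" "gm False f = G"
proof -
  obtain f where "f \<in> maps S False (rk M) (rk N)" "gm False f = G"
    using gm_surj[OF cocyc_hm[OF assms(3)]] by auto
  then show thesis using assms by (intro that[of f]) (simp_all add: cocycles_iff)
qed

lemma Ext0_eq:
  assumes "is_MF S w M" "is_MF S w N"
  shows "Ext0 S M N = hclass S M N ` cocyc S (rep M) (rep N)"
proof -
  have "Ext0 S M N = (\<lambda>f. hclass S M N (gm False f)) ` cocycles S M N"
    unfolding Ext0_def quotient_def using cls_eq[OF assms] by auto
  also have "\<dots> = hclass S M N ` cocyc S (rep M) (rep N)"
  proof (intro equalityI subsetI)
    fix F assume "F \<in> (\<lambda>f. hclass S M N (gm False f)) ` cocycles S M N"
    then show "F \<in> hclass S M N ` cocyc S (rep M) (rep N)" using cocycle_cocyc[OF assms] by auto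
  next
    fix F assume "F \<in> hclass S M N ` cocyc S (rep M) (rep N)"
    then obtain G where G: "G \<in> cocyc S (rep M) (rep N)" "F = hclass S M N G" by blast
    obtain f where "f \<in> cocycles S M N" "gm False f = G" by (rule cocycle_surj[OF assms G(1)])
    with G show "F \<in> (\<lambda>f. hclass S M N (gm False f)) ` cocycles S M N" by auto
  qed
  finally show ?thesis .
qed

lemma hclass_cong: "homot S (rep M) (rep N) F G \<Longrightarrow> hclass S M N F = hclass S M N G"
  unfolding hclass_def using homot_trans homot_sym by (intro Collect_cong) blast

lemma hclass_eq_iff:
  assumes "is_MF S w M" "is_MF S w N" "F \<in> cocyc S (rep M) (rep N)" "G \<in> cocyc S (rep M) (rep N)"
  shows "hclass S M N F = hclass S M N G \<longleftrightarrow> homot S (rep M) (rep N) F G"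
proof
  assume eq: "hclass S M N F = hclass S M N G"
  obtain f where f: "f \<in> cocycles S M N" "gm False f = G" by (rule cocycle_surj[OF assms(1,2,4)])
  then have "f \<in> hclass S M N G" by (simp add: hclass_def)
  then have "f \<in> hclass S M N F" by (simp only: eq)
  then show "homot S (rep M) (rep N) F G" using f by (simp add: hclass_def)
qed (rule hclass_cong)

text \<open>
  Operations on classes are defined as unions over all representatives; the union collapses if all
  of them give the same class.
\<close>

lemma hclass_UN:
  assumes "is_MF S w M" "is_MF S w N" "F \<in> cocyc S (rep M) (rep N)"
    and "\<And>f. f \<in> cocycles S M N \<Longrightarrow> homot S (rep M) (rep N) F (gm False f) \<Longrightarrow> \<Phi> f = A"
  shows "(\<Union>f\<in>hclass S M N F. \<Phi> f) = A"
proof -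
  obtain f where f: "f \<in> cocycles S M N" "gm False f = F" by (rule cocycle_surj[OF assms(1-3)])
  then have "f \<in> hclass S M N F" by (simp add: hclass_def)
  moreover have "\<Phi> f = A" if "f \<in> hclass S M N F" for f using assms(4) that by (simp add: hclass_def)
  ultimately show ?thesis by blast
qed

lemma even_comp_cocycle:
  assumes L: "is_MF S w L" and M: "is_MF S w M" and N: "is_MF S w N"
    and f: "f \<in> cocycles S L M" and g: "g \<in> cocycles S M N"
  shows "even_comp g f \<in> cocycles S L N" "gm False (even_comp g f) = gm False g * gm False f"
proof -
  note fm = cocycle_maps[OF L M f] and gm' = cocycle_maps[OF M N g]
  show eq: "gm False (even_comp g f) = gm False g * gm False f"
    unfolding even_comp_eq by (rule gm_hcomp[OF fm gm']) simp
  have "even_comp g f \<in> maps S False (rk L) (rk N)"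
    unfolding even_comp_eq by (rule hcomp_maps[OF fm gm' _ subring_axioms]) simp
  then show "even_comp g f \<in> cocycles S L N"
    using cocyc_mult[OF cocycle_cocyc[OF L M f] cocycle_cocyc[OF M N g]] by (simp add: cocycles_iff[OF L N] eq)
qed

lemma Cmp_hclass:
  assumes L: "is_MF S w L" and M: "is_MF S w M" and N: "is_MF S w N"
    and F: "F \<in> cocyc S (rep L) (rep M)" and G: "G \<in> cocyc S (rep M) (rep N)"
  shows "Cmp (MF_shift_cat S w) L M N (hclass S M N G) (hclass S L M F) = hclass S L N (G * F)"
proof -
  have "homotopic S L N `` {even_comp g f} = hclass S L N (G * F)"
    if g: "g \<in> cocycles S M N" "homot S (rep M) (rep N) G (gm False g)"
      and f: "f \<in> cocycles S L M" "homot S (rep L) (rep M) F (gm False f)" for f g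
    using cls_eq[OF L N even_comp_cocycle(1)[OF L M N f(1) g(1)]] even_comp_cocycle(2)[OF L M N f(1) g(1)]
      hclass_cong[OF homot_mult[OF f(2) g(2) F cocycle_cocyc[OF M N g(1)]]] by simp
  then have "(\<Union>g\<in>hclass S M N G. \<Union>f\<in>hclass S L M F. homotopic S L N `` {even_comp g f}) = hclass S L N (G * F)"
    by (intro hclass_UN[OF M N G] hclass_UN[OF L M F])
  then show ?thesis by (simp add: MF_shift_cat_def)
qed

lemma Idt_hclass:
  assumes M: "is_MF S w M" shows "Idt (MF_shift_cat S w) M = hclass S M M (idm (rk M))"
proof -
  have "mf_id M = scal 1 (rk M)" by (auto simp: mf_id_def scal_def rk_def intro!: eq_matI)
  then have "mf_id M \<in> maps S False (rk M) (rk M)" using scal_maps[of 1 S "rk M"] by simp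
  then have "mf_id M \<in> cocycles S M M"
    using cocyc_id[OF rep_mfs[OF M zero]] by (simp add: cocycles_iff[OF M M] gm_mf_id)
  from cls_eq[OF M M this] show ?thesis by (simp add: MF_shift_cat_def gm_mf_id)
qed

lemma shift_MF:
  assumes M: "is_MF S w M"
  shows "is_MF S w (mf_shift M)" "rep (mf_shift M) = shift (rep M)"
proof -
  show r: "rep (mf_shift M) = shift (rep M)" by (rule rep_shift[OF MF_maps[OF M]])
  have rk: "rk (mf_shift M) = prod.swap (rk M)" using arg_cong[OF r, of fst] by simp
  have "mf_shift M \<in> maps S True (prod.swap (rk M)) (prod.swap (rk M))"
    using MF_maps[OF M] by (auto simp: mf_shift_def maps_def mats_iff rkof_def)
  then have "mf_shift M \<in> maps S True (rk (mf_shift M)) (rk (mf_shift M))" by (simp only: rk)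
  then show "is_MF S w (mf_shift M)"
    using shift_mfs[OF rep_mfs[OF M zero]] unfolding r[symmetric] is_MF_iff mfs_def by simp
qed

lemma ShM_hclass:
  assumes M: "is_MF S w M" and N: "is_MF S w N" and F: "F \<in> cocyc S (rep M) (rep N)"
  shows "ShM (MF_shift_cat S w) M N (hclass S M N F) = hclass S (mf_shift M) (mf_shift N) (sh F)"
proof -
  note sM = shift_MF[OF M] and sN = shift_MF[OF N]
  have "homotopic S (mf_shift M) (mf_shift N) `` {prod.swap f} = hclass S (mf_shift M) (mf_shift N) (sh F)"
    if f: "f \<in> cocycles S M N" "homot S (rep M) (rep N) F (gm False f)" for f
  proof -
    have rk: "rk (mf_shift M) = prod.swap (rk M)" "rk (mf_shift N) = prod.swap (rk N)"
      using arg_cong[OF sM(2), of fst] arg_cong[OF sN(2), of fst] by simp_all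
    have "prod.swap f \<in> maps S False (prod.swap (rk M)) (prod.swap (rk N))"
      using cocycle_maps[OF M N f(1)] by (auto simp: maps_def rkof_def)
    then have "prod.swap f \<in> cocycles S (mf_shift M) (mf_shift N)"
      using sh_cocyc[OF cocycle_cocyc[OF M N f(1)]]
      by (simp add: cocycles_iff[OF sM(1) sN(1) zero] rk sM(2) sN(2) gm_swap)
    from cls_eq[OF sM(1) sN(1) this] show ?thesis
      using hclass_cong[of "mf_shift M" "mf_shift N" "sh F" "sh (gm False f)"] sh_homot[OF f(2)]
      by (simp add: gm_swap sM(2) sN(2))
  qed
  then have "(\<Union>f\<in>hclass S M N F. homotopic S (mf_shift M) (mf_shift N) `` {prod.swap f}) = hclass S (mf_shift M) (mf_shift N) (sh F)"
    by (intro hclass_UN[OF M N F])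
  then show ?thesis by (simp add: MF_shift_cat_def)
qed

lemma isos_hclass:
  assumes M: "is_MF S w M" and N: "is_MF S w N"
  shows "isos (MF_shift_cat S w) M N = hclass S M N ` {F. hequiv S (rep M) (rep N) F}"
proof (intro equalityI subsetI)
  have Mor: "Mor (MF_shift_cat S w) = Ext0 S" by (simp add: MF_shift_cat_def)
  note rM = rep_mfs[OF M zero] and rN = rep_mfs[OF N zero]
  note idM = cocyc_id[OF rM] and idN = cocyc_id[OF rN]
  {
    fix \<alpha> assume "\<alpha> \<in> isos (MF_shift_cat S w) M N"
    then obtain \<beta> where ab: "\<alpha> \<in> Ext0 S M N" "\<beta> \<in> Ext0 S N M"
      "Cmp (MF_shift_cat S w) M N M \<beta> \<alpha> = Idt (MF_shift_cat S w) M"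
      "Cmp (MF_shift_cat S w) N M N \<alpha> \<beta> = Idt (MF_shift_cat S w) N"
      unfolding isos_def Mor by blast
    obtain F G where F: "F \<in> cocyc S (rep M) (rep N)" "\<alpha> = hclass S M N F"
      and G: "G \<in> cocyc S (rep N) (rep M)" "\<beta> = hclass S N M G"
      using ab(1,2) unfolding Ext0_eq[OF M N] Ext0_eq[OF N M] by blast
    have "homot S (rep M) (rep M) (G * F) (idm (rk M))" "homot S (rep N) (rep N) (F * G) (idm (rk N))"
      using ab(3,4) idM idN
      by (simp_all add: F(2) G(2) Cmp_hclass[OF M N M F(1) G(1)] Cmp_hclass[OF N M N G(1) F(1)] Idt_hclass[OF M] Idt_hclass[OF N]
          hclass_eq_iff[OF M M cocyc_mult[OF F(1) G(1)]] hclass_eq_iff[OF N N cocyc_mult[OF G(1) F(1)]])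
    then have "hequiv S (rep M) (rep N) F" by (intro heqI[OF F(1) G(1)]) simp_all
    then show "\<alpha> \<in> hclass S M N ` {F. hequiv S (rep M) (rep N) F}" using F(2) by blast
  }
  fix \<alpha> assume "\<alpha> \<in> hclass S M N ` {F. hequiv S (rep M) (rep N) F}"
  then obtain F where F: "hequiv S (rep M) (rep N) F" "\<alpha> = hclass S M N F" by blast
  obtain G where G: "F \<in> cocyc S (rep M) (rep N)" "G \<in> cocyc S (rep N) (rep M)"
    "homot S (rep M) (rep M) (G * F) (idm (fst (rep M)))" "homot S (rep N) (rep N) (F * G) (idm (fst (rep N)))"
    by (rule heqE[OF F(1)])
  show "\<alpha> \<in> isos (MF_shift_cat S w) M N"
  proof (rule isosI)
    show "\<alpha> \<in> Mor (MF_shift_cat S w) M N" "hclass S N M G \<in> Mor (MF_shift_cat S w) N M"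
      unfolding Mor Ext0_eq[OF M N] Ext0_eq[OF N M] using F(2) G by auto
    show "Cmp (MF_shift_cat S w) M N M (hclass S N M G) \<alpha> = Idt (MF_shift_cat S w) M"
      using hclass_cong[OF G(3)] by (simp add: F(2) Cmp_hclass[OF M N M G(1,2)] Idt_hclass[OF M])
    show "Cmp (MF_shift_cat S w) N M N \<alpha> (hclass S N M G) = Idt (MF_shift_cat S w) N"
      using hclass_cong[OF G(4)] by (simp add: F(2) Cmp_hclass[OF N M N G(2,1)] Idt_hclass[OF N])
  qed
qed

lemma cone_triangle_hclass:
  assumes M: "is_MF S w M" and N: "is_MF S w N" and f: "f \<in> cocycles S M N"
  shows "is_MF S w (cone M N f)" "rep (cone M N f) = mcone (rep M) (rep N) (gm False f)"
    and "cone_triangle S M N f = (M, N, cone M N f, hclass S M N (gm False f),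
      hclass S N (cone M N f) (in2 (rk M) (rk N)), hclass S (cone M N f) (mf_shift M) (flp * pr1 (rk M)))"
proof -
  note rM = rep_mfs[OF M zero] and rN = rep_mfs[OF N zero]
  note fz = cocycle_cocyc[OF M N f] and fm = cocycle_maps[OF M N f]
  note rc = rep_cone[OF M N fm subring_axioms]
  have rkc: "rk (cone M N f) = sumr (rk M) (rk N)" using arg_cong[OF rc(1), of fst] by simp
  show "rep (cone M N f) = mcone (rep M) (rep N) (gm False f)" by (rule rc(1))
  show C: "is_MF S w (cone M N f)"
    using mcone_mfs[OF rM rN fz] rc(2) unfolding rc(1)[symmetric] is_MF_iff mfs_def by (simp add: rkc)
  note sM = shift_MF[OF M]
  have rks: "rk (mf_shift M) = prod.swap (rk M)" using arg_cong[OF sM(2), of fst] by simp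
  have incl: "cone_incl M N \<in> cocycles S N (cone M N f)"
  proof -
    obtain g where g: "g \<in> maps S False (rk N) (sumr (rk M) (rk N))" "gm False g = in2 (rk M) (rk N)"
      by (rule gm_surj[OF hin2])
    have "g = cone_incl M N" by (rule gm_inj[OF g(1) gm_cone_incl(2)]) (simp add: g gm_cone_incl)
    with g(1) mcone_incl[OF rM rN fz] show ?thesis
      by (simp add: cocycles_iff[OF N C] rkc rc(1) gm_cone_incl)
  qed
  have proj: "cone_proj M N \<in> cocycles S (cone M N f) (mf_shift M)"
  proof -
    have "flp * pr1 (rk M) \<in> hm S False (sumr (rk M) (rk N)) (prod.swap (rk M))"
      by (rule hm_flp_left[OF hpr1]) simp
    then obtain g where g: "g \<in> maps S False (sumr (rk M) (rk N)) (prod.swap (rk M))" "gm False g = flp * pr1 (rk M)"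
      by (rule gm_surj)
    have "g = cone_proj M N" by (rule gm_inj[OF g(1) gm_cone_proj(2)]) (simp add: g gm_cone_proj)
    with g(1) mcone_proj[OF rM rN fz] show ?thesis
      by (simp add: cocycles_iff[OF C sM(1)] rkc rks rc(1) sM(2) gm_cone_proj)
  qed
  show "cone_triangle S M N f = (M, N, cone M N f, hclass S M N (gm False f),
      hclass S N (cone M N f) (in2 (rk M) (rk N)), hclass S (cone M N f) (mf_shift M) (flp * pr1 (rk M)))"
    unfolding cone_triangle_def
    by (simp add: cls_eq[OF M N f] cls_eq[OF N C incl] cls_eq[OF C sM(1) proj] gm_cone_incl gm_cone_proj)
qed

lemma MF_triangles_iff:
  assumes X: "is_MF S w X" and Y: "is_MF S w Y" and Z: "is_MF S w Z"
    and f: "f \<in> cocyc S (rep X) (rep Y)" and g: "g \<in> cocyc S (rep Y) (rep Z)" and h: "h \<in> cocyc S (rep Z) (shift (rep X))"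
  shows "(X, Y, Z, hclass S X Y f, hclass S Y Z g, hclass S Z (mf_shift X) h) \<in> MF_triangles S w \<longleftrightarrow>
    tri w (rep X) (rep Y) (rep Z) f g h"
proof -
  let ?C = "MF_shift_cat S w"
  note sX = shift_MF[OF X]
  have h': "h \<in> cocyc S (rep Z) (rep (mf_shift X))" using h by (simp add: sX(2))
  have ShO: "ShO ?C = mf_shift" and ObjC: "Obj ?C = {M. is_MF S w M}" and MorC: "Mor ?C = Ext0 S"
    by (simp_all add: MF_shift_cat_def)
  have typed: "triangle_typed ?C (X, Y, Z, hclass S X Y f, hclass S Y Z g, hclass S Z (mf_shift X) h)"
    using X Y Z f g h' by (simp add: triangle_typed_def ObjC MorC ShO Ext0_eq[OF X Y] Ext0_eq[OF Y Z] Ext0_eq[OF Z sX(1)])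
  have eqs: "Cmp ?C X Y N (hclass S Y N b) (hclass S X Y f) = Cmp ?C X M N (hclass S M N (gm False k)) (hclass S X M a) \<longleftrightarrow>
        homot S (rep X) (rep N) (b * f) (gm False k * a)" (is ?e1)
      "Cmp ?C Y Z (cone M N k) (hclass S Z (cone M N k) c) (hclass S Y Z g) =
        Cmp ?C Y N (cone M N k) (hclass S N (cone M N k) (in2 (rk M) (rk N))) (hclass S Y N b) \<longleftrightarrow>
        homot S (rep Y) (mcone (rep M) (rep N) (gm False k)) (c * g) (in2 (rk M) (rk N) * b)" (is ?e2)
      "Cmp ?C Z (mf_shift X) (mf_shift M) (ShM ?C X M (hclass S X M a)) (hclass S Z (mf_shift X) h) =
        Cmp ?C Z (cone M N k) (mf_shift M) (hclass S (cone M N k) (mf_shift M) (flp * pr1 (rk M))) (hclass S Z (cone M N k) c) \<longleftrightarrow>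
        homot S (rep Z) (shift (rep M)) (sh a * h) (flp * pr1 (rk M) * c)" (is ?e3)
    if M: "is_MF S w M" and N: "is_MF S w N" and k: "k \<in> cocycles S M N"
      and a: "a \<in> cocyc S (rep X) (rep M)" and b: "b \<in> cocyc S (rep Y) (rep N)"
      and c: "c \<in> cocyc S (rep Z) (mcone (rep M) (rep N) (gm False k))" for M N k a b c
  proof -
    note kz = cocycle_cocyc[OF M N k] and C = cone_triangle_hclass[OF M N k] and sM = shift_MF[OF M]
    note rM = rep_mfs[OF M zero] and rN = rep_mfs[OF N zero]
    have c': "c \<in> cocyc S (rep Z) (rep (cone M N k))" using c by (simp add: C(2))
    have i: "in2 (rk M) (rk N) \<in> cocyc S (rep N) (rep (cone M N k))"
      using mcone_incl[OF rM rN kz] by (simp add: C(2))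
    have p: "flp * pr1 (rk M) \<in> cocyc S (rep (cone M N k)) (rep (mf_shift M))"
      using mcone_proj[OF rM rN kz] by (simp add: C(2) sM(2))
    have sa: "sh a \<in> cocyc S (rep (mf_shift X)) (rep (mf_shift M))" using sh_cocyc[OF a] by (simp add: sX(2) sM(2))
    show ?e1
      by (simp add: Cmp_hclass[OF X Y N f b] Cmp_hclass[OF X M N a kz] hclass_eq_iff[OF X N cocyc_mult[OF f b] cocyc_mult[OF a kz]])
    show ?e2
      by (simp add: Cmp_hclass[OF Y Z C(1) g c'] Cmp_hclass[OF Y N C(1) b i] hclass_eq_iff[OF Y C(1) cocyc_mult[OF g c'] cocyc_mult[OF b i]] C(2))
    show ?e3
      by (simp add: ShM_hclass[OF X M a] Cmp_hclass[OF Z sX(1) sM(1) h' sa] Cmp_hclass[OF Z C(1) sM(1) c' p]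
          hclass_eq_iff[OF Z sM(1) cocyc_mult[OF h' sa] cocyc_mult[OF c' p]] sM(2))
  qed
  show ?thesis
  proof
    assume "(X, Y, Z, hclass S X Y f, hclass S Y Z g, hclass S Z (mf_shift X) h) \<in> MF_triangles S w"
    then obtain M N k where M: "is_MF S w M" and N: "is_MF S w N" and k: "k \<in> cocycles S M N"
      and ti: "triangle_iso ?C (X, Y, Z, hclass S X Y f, hclass S Y Z g, hclass S Z (mf_shift X) h) (cone_triangle S M N k)"
      unfolding MF_triangles_def by blast
    note C = cone_triangle_hclass[OF M N k]
    obtain a b c where a: "hequiv S (rep X) (rep M) a" and b: "hequiv S (rep Y) (rep N) b"
      and c: "hequiv S (rep Z) (mcone (rep M) (rep N) (gm False k)) c"
      and e: "Cmp ?C X Y N (hclass S Y N b) (hclass S X Y f) = Cmp ?C X M N (hclass S M N (gm False k)) (hclass S X M a)"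
      "Cmp ?C Y Z (cone M N k) (hclass S Z (cone M N k) c) (hclass S Y Z g) =
        Cmp ?C Y N (cone M N k) (hclass S N (cone M N k) (in2 (rk M) (rk N))) (hclass S Y N b)"
      "Cmp ?C Z (mf_shift X) (mf_shift M) (ShM ?C X M (hclass S X M a)) (hclass S Z (mf_shift X) h) =
        Cmp ?C Z (cone M N k) (mf_shift M) (hclass S (cone M N k) (mf_shift M) (flp * pr1 (rk M))) (hclass S Z (cone M N k) c)"
      using ti unfolding triangle_iso_def C(3) prod.case ShO isos_hclass[OF X M] isos_hclass[OF Y N] isos_hclass[OF Z C(1)] C(2)
      by (elim bexE imageE conjE) simp
    show "tri w (rep X) (rep Y) (rep Z) f g h"
      unfolding tri_def
      using eqs[OF M N k hequiv_cocyc[OF a] hequiv_cocyc[OF b] hequiv_cocyc[OF c]] e a b c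
      by (intro bexI[OF _ rep_mfs[OF M zero]] bexI[OF _ rep_mfs[OF N zero]] bexI[OF _ cocycle_cocyc[OF M N k]] exI[of _ a] exI[of _ b] exI[of _ c]) simp
  next
    assume "tri w (rep X) (rep Y) (rep Z) f g h"
    then obtain M' N' k' a b c where M': "M' \<in> mfs S w" and N': "N' \<in> mfs S w" and k': "k' \<in> cocyc S M' N'"
      and abc: "hequiv S (rep X) M' a" "hequiv S (rep Y) N' b" "hequiv S (rep Z) (mcone M' N' k') c"
      and e: "homot S (rep X) N' (b * f) (k' * a)" "homot S (rep Y) (mcone M' N' k') (c * g) (in2 (fst M') (fst N') * b)"
        "homot S (rep Z) (shift M') (sh a * h) (flp * pr1 (fst M') * c)"
      unfolding tri_def by (elim bexE exE conjE)
    obtain M where M: "is_MF S w M" "rep M = M'" by (rule rep_surj[OF M'])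
    obtain N where N: "is_MF S w N" "rep N = N'" by (rule rep_surj[OF N'])
    obtain k where k: "k \<in> cocycles S M N" "gm False k = k'"
      using cocycle_surj[OF M(1) N(1), of k'] k' M(2) N(2) by auto
    note C = cone_triangle_hclass[OF M(1) N(1) k(1)]
    have a: "hequiv S (rep X) (rep M) a" and b: "hequiv S (rep Y) (rep N) b"
      and c: "hequiv S (rep Z) (mcone (rep M) (rep N) (gm False k)) c"
      using abc by (simp_all add: M N k)
    have rk: "fst M' = rk M" "fst N' = rk N" by (simp_all flip: M(2) N(2))
    have "triangle_iso ?C (X, Y, Z, hclass S X Y f, hclass S Y Z g, hclass S Z (mf_shift X) h) (cone_triangle S M N k)"
      unfolding triangle_iso_def C(3) prod.case ShO isos_hclass[OF X M(1)] isos_hclass[OF Y N(1)] isos_hclass[OF Z C(1)] C(2)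
      using eqs[OF M(1) N(1) k(1) hequiv_cocyc[OF a] hequiv_cocyc[OF b] hequiv_cocyc[OF c]] e a b c
      by (intro bexI[of _ "hclass S X M a"] bexI[of _ "hclass S Y N b"] bexI[of _ "hclass S Z (cone M N k) c"])
        (simp_all add: M(2) N(2) k(2) rk)
    then show "(X, Y, Z, hclass S X Y f, hclass S Y Z g, hclass S Z (mf_shift X) h) \<in> MF_triangles S w"
      unfolding MF_triangles_def by (intro CollectI conjI typed exI[of _ M] exI[of _ N] exI[of _ k] M(1) N(1) k(1))
  qed
qed

end


section \<open>Triangulated equivalences\<close>

subsection \<open>Matrix factorizations with a form\<close>

lemma MF_form_simps:
  "X \<in> Obj (MF_form S \<epsilon> w) \<longleftrightarrow> is_MF S w (fst X) \<and> is_form S \<epsilon> (fst X) (snd X)"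
  "Mor (MF_form S \<epsilon> w) X Y = Ext0 S (fst X) (fst Y)"
  "Idt (MF_form S \<epsilon> w) X = Idt (MF_shift_cat S w) (fst X)"
  "Cmp (MF_form S \<epsilon> w) X Y Z = Cmp (MF_shift_cat S w) (fst X) (fst Y) (fst Z)"
  "ShO (MF_form S \<epsilon> w) X = (mf_shift (fst X), prod.swap (snd X))"
  "ShM (MF_form S \<epsilon> w) X Y = ShM (MF_shift_cat S w) (fst X) (fst Y)"
  "isos (MF_form S \<epsilon> w) X Y = isos (MF_shift_cat S w) (fst X) (fst Y)"
  by (simp_all add: MF_form_def Let_def isos_def split_beta) (simp_all add: MF_shift_cat_def)

lemma MF_form_Tri:
  "(X, Y, Z, f, g, h) \<in> Tri (MF_form S \<epsilon> w) \<longleftrightarrow> X \<in> Obj (MF_form S \<epsilon> w) \<and> Y \<in> Obj (MF_form S \<epsilon> w) \<and>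
    Z \<in> Obj (MF_form S \<epsilon> w) \<and> (fst X, fst Y, fst Z, f, g, h) \<in> MF_triangles S w"
  by (simp add: MF_form_def Let_def)

lemma shift_mdual: "mdual (shift M) = shift (mdual M)"
  by (simp add: mdual_def shift_def sh_minus)

lemma maps_swap: "maps S False X (prod.swap X) = maps S True X X"
  by (simp add: maps_def rkof_def)

lemma mf_shift_shift [simp]: "mf_shift (mf_shift M) = M"
  by (auto simp: mf_shift_def intro!: prod_eqI eq_matI)

lemma odd_transpose_maps: "b \<in> maps S True X X \<Longrightarrow> odd_transpose b \<in> maps S True X X"
  by (auto simp: odd_transpose_def maps_def mats_iff rkof_def)

context subring begin

lemma strict_iso_shift:
  assumes "strict_iso S M N F" shows "strict_iso S (shift M) (shift N) (sh F)"
proof -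
  obtain G where G: "strict_iso S N M G" "G * F = idm (fst M)" "F * G = idm (fst N)"
    by (rule strict_iso_comp_inverse[OF assms])
  show ?thesis
    unfolding strict_iso_def
    using sh_cocyc[OF strict_iso_cocyc[OF assms]] by (intro conjI bexI[OF _ sh_cocyc[OF strict_iso_cocyc[OF G(1)]]]) (simp_all add: sh_mult G)
qed

lemma rform_shift: "rform S \<epsilon> M b \<Longrightarrow> rform S \<epsilon> (shift M) (sh b)"
  using strict_iso_shift[of M "mdual M" b] by (simp add: rform_def shift_mdual sh_smul)

lemma is_MF_rep:
  assumes "M \<in> maps S True X X" "rep M \<in> mfs S w" shows "is_MF S w M"
proof -
  have "rk M = X" by (rule rk_maps[OF assms(1)])
  with assms show ?thesis by (simp add: is_MF_iff mfs_def)
qed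

lemma dual_MF:
  assumes M: "is_MF S w M"
  shows "is_MF S w (mf_dual M)" "rep (mf_dual M) = mdual (rep M)"
proof -
  let ?T = "odd_transpose M"
  have T: "?T \<in> maps S True (rk M) (rk M)"
    by (rule odd_transpose_maps[OF MF_maps[OF M]])
  have rT: "rep ?T = (rk M, tr (gm True M))"
    by (rule rk_rep_eqI[OF T gm_transpose])
  have sq: "gm True M * gm True M = w \<odot> idm (rk M)" using M by (simp add: is_MF_iff)
  have "tr (gm True M) * tr (gm True M) = w \<odot> idm (rk M)"
    using arg_cong[OF sq, of tr] by simp
  then have "rep ?T \<in> mfs S w" using hm_tr[OF mfs_hm[OF rep_mfs[OF M zero]]] by (simp add: rT mfs_def)
  from shift_MF[OF is_MF_rep[OF T this]]
  show "is_MF S w (mf_dual M)" "rep (mf_dual M) = mdual (rep M)"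
    by (simp_all add: mf_dual_def rT shift_def mdual_def)
qed

text \<open>
  A form is odd as a map to the transpose and even as a map to the dual; the two readings differ by
  \<open>flp\<close>, which turns the transpose of pairs into \<open>sh (tr b)\<close>.
\<close>

lemma is_form_iff:
  assumes M: "is_MF S w M"
  shows "is_form S \<epsilon> M b \<longleftrightarrow> b \<in> maps S False (rk M) (prod.swap (rk M)) \<and> rform S \<epsilon> (rep M) (gm False b)"
proof -
  let ?D = "mf_dual M" and ?B = "gm False b"
  note D = dual_MF[OF M]
  have rkD: "rk ?D = prod.swap (rk M)" using arg_cong[OF D(2), of fst] by simp
  have sign: "odd_transpose b = (case \<epsilon> of Orthogonal \<Rightarrow> - b | Symplectic \<Rightarrow> b) \<longleftrightarrow> sh (tr ?B) = fsign \<epsilon> \<odot> ?B"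
    if b: "b \<in> maps S False (rk M) (prod.swap (rk M))"
  proof -
    let ?b = "case \<epsilon> of Orthogonal \<Rightarrow> - b | Symplectic \<Rightarrow> b"
    have b': "b \<in> maps S True (rk M) (rk M)" using b by (simp add: maps_swap)
    have T: "odd_transpose b \<in> maps S True (rk M) (rk M)"
      by (rule odd_transpose_maps[OF b'])
    have s: "?b \<in> maps S True (rk M) (rk M)"
      using b' minus_maps[OF b' subring_axioms] by (cases \<epsilon>) simp_all
    have gs: "gm True ?b = flp * (fsign \<epsilon> \<odot> ?B)"
      by (cases \<epsilon>) (simp_all add: fsign_def gm_minus gm_odd_swap)
    have "odd_transpose b = ?b \<longleftrightarrow> gm True (odd_transpose b) = gm True ?b"
      using gm_inj[OF T s] by auto
    also have "\<dots> \<longleftrightarrow> tr ?B * flp = flp * (fsign \<epsilon> \<odot> ?B)"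
      by (simp add: gm_transpose gs gm_odd_swap[of b])
    also have "\<dots> \<longleftrightarrow> sh (tr ?B) = fsign \<epsilon> \<odot> ?B"
    proof
      assume "tr ?B * flp = flp * (fsign \<epsilon> \<odot> ?B)"
      from arg_cong[OF this, of "\<lambda>Z. flp * Z"] show "sh (tr ?B) = fsign \<epsilon> \<odot> ?B"
        by (simp add: sh_def mult.assoc)
    next
      assume "sh (tr ?B) = fsign \<epsilon> \<odot> ?B"
      from arg_cong[OF this, of "\<lambda>Z. flp * Z"] show "tr ?B * flp = flp * (fsign \<epsilon> \<odot> ?B)"
        by (simp add: sh_def mult.assoc)
    qed
    finally show ?thesis .
  qed
  have inv: "(\<exists>c\<in>cocycles S ?D M. even_comp c b = mf_id M \<and> even_comp b c = mf_id ?D) \<longleftrightarrow>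
      (\<exists>G\<in>cocyc S (mdual (rep M)) (rep M). G * ?B = idm (rk M) \<and> ?B * G = idm (prod.swap (rk M)))"
    if b: "b \<in> cocycles S M ?D"
  proof -
    have eq: "even_comp c b = mf_id M \<longleftrightarrow> gm False c * ?B = idm (rk M)"
      "even_comp b c = mf_id ?D \<longleftrightarrow> ?B * gm False c = idm (prod.swap (rk M))"
      if c: "c \<in> cocycles S ?D M" for c
    proof -
      note cb = even_comp_cocycle[OF M D(1) M b c] and bc = even_comp_cocycle[OF D(1) M D(1) c b]
      have idM: "mf_id M \<in> maps UNIV False (rk M) (rk M)" and idD: "mf_id ?D \<in> maps UNIV False (rk ?D) (rk ?D)"
        by (simp_all add: mf_id_def maps_def mats_iff rkof_def rk_def)
      show "even_comp c b = mf_id M \<longleftrightarrow> gm False c * ?B = idm (rk M)"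
        using gm_inj[OF cocycle_maps[OF M M cb(1)] idM] cb(2) by (auto simp: gm_mf_id)
      show "even_comp b c = mf_id ?D \<longleftrightarrow> ?B * gm False c = idm (prod.swap (rk M))"
        using gm_inj[OF cocycle_maps[OF D(1) D(1) bc(1)] idD] bc(2) by (auto simp: gm_mf_id rkD)
    qed
    show ?thesis
    proof
      assume "\<exists>c\<in>cocycles S ?D M. even_comp c b = mf_id M \<and> even_comp b c = mf_id ?D"
      then obtain c where c: "c \<in> cocycles S ?D M" "even_comp c b = mf_id M" "even_comp b c = mf_id ?D" by (elim bexE conjE)
      then show "\<exists>G\<in>cocyc S (mdual (rep M)) (rep M). G * ?B = idm (rk M) \<and> ?B * G = idm (prod.swap (rk M))"
        using cocycle_cocyc[OF D(1) M c(1)] unfolding D(2) eq[OF c(1)] by (intro bexI[of _ "gm False c"] conjI)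
    next
      assume "\<exists>G\<in>cocyc S (mdual (rep M)) (rep M). G * ?B = idm (rk M) \<and> ?B * G = idm (prod.swap (rk M))"
      then obtain G where G: "G \<in> cocyc S (rep ?D) (rep M)" "G * ?B = idm (rk M)" "?B * G = idm (prod.swap (rk M))"
        unfolding D(2) by (elim bexE conjE)
      obtain c where c: "c \<in> cocycles S ?D M" "gm False c = G" by (rule cocycle_surj[OF D(1) M G(1)])
      show "\<exists>c\<in>cocycles S ?D M. even_comp c b = mf_id M \<and> even_comp b c = mf_id ?D"
        using G(2,3) by (intro bexI[OF _ c(1)]) (simp add: eq[OF c(1)] c(2))
    qed
  qed
  show ?thesis
  proof (cases "b \<in> cocycles S M ?D")
    case True
    then have "b \<in> maps S False (rk M) (prod.swap (rk M))" "?B \<in> cocyc S (rep M) (mdual (rep M))"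
      by (simp_all add: cocycles_iff[OF M D(1) zero] rkD D(2))
    then show ?thesis
      using True inv[OF True] sign unfolding is_form_def rform_def strict_iso_def by simp
  next
    case False
    then have "\<not> (b \<in> maps S False (rk M) (prod.swap (rk M)) \<and> ?B \<in> cocyc S (rep M) (mdual (rep M)))"
      by (simp add: cocycles_iff[OF M D(1) zero] rkD D(2))
    with False show ?thesis unfolding is_form_def rform_def strict_iso_def by blast
  qed
qed

lemma is_form_shift:
  assumes M: "is_MF S w M" and b: "is_form S \<epsilon> M b"
  shows "is_form S \<epsilon> (mf_shift M) (prod.swap b)"
proof -
  note sM = shift_MF[OF M]
  have rk: "rk (mf_shift M) = prod.swap (rk M)" using arg_cong[OF sM(2), of fst] by simp
  show ?thesis
    using b rform_shift[of \<epsilon> "rep M" "gm False b"] unfolding is_form_iff[OF M] is_form_iff[OF sM(1)] sM(2) gm_swap rk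
    by (auto simp: maps_def rkof_def)
qed

lemma shift_Obj: "X \<in> Obj (MF_form S \<epsilon> w) \<Longrightarrow> ShO (MF_form S \<epsilon> w) X \<in> Obj (MF_form S \<epsilon> w)"
  by (auto simp: MF_form_simps shift_MF intro: is_form_shift)

lemma MF_form_category: "is_category (MF_form S \<epsilon> w)"
  unfolding is_category_def
proof (intro conjI ballI)
  let ?K = "MF_form S \<epsilon> w"
  have MF: "X \<in> Obj ?K \<Longrightarrow> is_MF S w (fst X)" for X by (simp add: MF_form_simps)
  fix X assume "X \<in> Obj ?K"
  note X = MF[OF this] and idX = cocyc_id[OF rep_mfs[OF MF[OF this] zero], unfolded fst_rep]
  show "Idt ?K X \<in> Mor ?K X X" using idX by (simp add: MF_form_simps Ext0_eq[OF X X] Idt_hclass[OF X])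
  fix Y assume "Y \<in> Obj ?K"
  note Y = MF[OF this] and idY = cocyc_id[OF rep_mfs[OF MF[OF this] zero], unfolded fst_rep]
  {
    fix f assume "f \<in> Mor ?K X Y"
    then obtain F where F: "F \<in> cocyc S (rep (fst X)) (rep (fst Y))" "f = hclass S (fst X) (fst Y) F"
      by (auto simp: MF_form_simps Ext0_eq[OF X Y])
    show "Cmp ?K X X Y f (Idt ?K X) = f" "Cmp ?K X Y Y (Idt ?K Y) f = f"
      using cocyc_absorb(1,2)[OF F(1)]
      by (simp_all add: MF_form_simps F(2) Idt_hclass[OF X] Idt_hclass[OF Y] Cmp_hclass[OF X X Y idX F(1)] Cmp_hclass[OF X Y Y F(1) idY])
  }
  fix Z assume "Z \<in> Obj ?K"
  note Z = MF[OF this]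
  show "Cmp ?K X Y Z g f \<in> Mor ?K X Z" if fg: "f \<in> Mor ?K X Y" "g \<in> Mor ?K Y Z" for f g
  proof -
    obtain F G where F: "F \<in> cocyc S (rep (fst X)) (rep (fst Y))" "f = hclass S (fst X) (fst Y) F"
      and G: "G \<in> cocyc S (rep (fst Y)) (rep (fst Z))" "g = hclass S (fst Y) (fst Z) G"
      using fg by (auto simp: MF_form_simps Ext0_eq[OF X Y] Ext0_eq[OF Y Z])
    show ?thesis using cocyc_mult[OF F(1) G(1)]
      by (simp add: MF_form_simps F(2) G(2) Cmp_hclass[OF X Y Z F(1) G(1)] Ext0_eq[OF X Z])
  qed
  fix V assume "V \<in> Obj ?K"
  note V = MF[OF this]
  show "Cmp ?K X Y V (Cmp ?K Y Z V h g) f = Cmp ?K X Z V h (Cmp ?K X Y Z g f)"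
    if fgh: "f \<in> Mor ?K X Y" "g \<in> Mor ?K Y Z" "h \<in> Mor ?K Z V" for f g h
  proof -
    obtain F G H where F: "F \<in> cocyc S (rep (fst X)) (rep (fst Y))" "f = hclass S (fst X) (fst Y) F"
      and G: "G \<in> cocyc S (rep (fst Y)) (rep (fst Z))" "g = hclass S (fst Y) (fst Z) G"
      and H: "H \<in> cocyc S (rep (fst Z)) (rep (fst V))" "h = hclass S (fst Z) (fst V) H"
      using fgh by (auto simp: MF_form_simps Ext0_eq[OF X Y] Ext0_eq[OF Y Z] Ext0_eq[OF Z V])
    show ?thesis
      by (simp add: MF_form_simps F(2) G(2) H(2) Cmp_hclass[OF X Y Z F(1) G(1)] Cmp_hclass[OF Y Z V G(1) H(1)]
          Cmp_hclass[OF X Y V F(1) cocyc_mult[OF G(1) H(1)]] Cmp_hclass[OF X Z V cocyc_mult[OF F(1) G(1)] H(1)] mult.assoc)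
  qed
qed

lemma MF_form_shift_equivalence: "is_equivalence (MF_form S \<epsilon> w) (MF_form S \<epsilon> w) (ShO (MF_form S \<epsilon> w)) (ShM (MF_form S \<epsilon> w))"
proof (rule is_equivalenceI[OF MF_form_category MF_form_category])
  let ?K = "MF_form S \<epsilon> w"
  have MF: "X \<in> Obj ?K \<Longrightarrow> is_MF S w (fst X)" for X by (simp add: MF_form_simps)
  have id: "is_MF S w M \<Longrightarrow> idm (rk M) \<in> cocyc S (rep M) (rep M)" for M
    using cocyc_id[OF rep_mfs[OF _ zero]] by simp
  show "is_functor ?K ?K (ShO ?K) (ShM ?K)"
    unfolding is_functor_def
  proof (intro conjI ballI)
    fix X assume X': "X \<in> Obj ?K"
    note X = MF[OF X'] and sX = shift_MF[OF MF[OF X']]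
    have rk: "rk (mf_shift (fst X)) = prod.swap (rk (fst X))" using arg_cong[OF sX(2), of fst] by simp
    show "ShO ?K X \<in> Obj ?K" by (rule shift_Obj[OF X'])
    show "ShM ?K X X (Idt ?K X) = Idt ?K (ShO ?K X)"
      by (simp add: MF_form_simps Idt_hclass[OF X] Idt_hclass[OF sX(1)] ShM_hclass[OF X X id[OF X]] rk)
    fix Y assume "Y \<in> Obj ?K"
    note Y = MF[OF this] and sY = shift_MF[OF MF[OF this]]
    show "ShM ?K X Y f \<in> Mor ?K (ShO ?K X) (ShO ?K Y)" if f: "f \<in> Mor ?K X Y" for f
    proof -
      obtain F where F: "F \<in> cocyc S (rep (fst X)) (rep (fst Y))" "f = hclass S (fst X) (fst Y) F"
        using f by (auto simp: MF_form_simps Ext0_eq[OF X Y])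
      show ?thesis using sh_cocyc[OF F(1)]
        by (simp add: MF_form_simps F(2) ShM_hclass[OF X Y F(1)] Ext0_eq[OF sX(1) sY(1)] sX(2) sY(2))
    qed
    fix Z assume "Z \<in> Obj ?K"
    note Z = MF[OF this] and sZ = shift_MF[OF MF[OF this]]
    show "ShM ?K X Z (Cmp ?K X Y Z g f) = Cmp ?K (ShO ?K X) (ShO ?K Y) (ShO ?K Z) (ShM ?K Y Z g) (ShM ?K X Y f)"
      if fg: "f \<in> Mor ?K X Y" "g \<in> Mor ?K Y Z" for f g
    proof -
      obtain F G where F: "F \<in> cocyc S (rep (fst X)) (rep (fst Y))" "f = hclass S (fst X) (fst Y) F"
        and G: "G \<in> cocyc S (rep (fst Y)) (rep (fst Z))" "g = hclass S (fst Y) (fst Z) G"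
        using fg by (auto simp: MF_form_simps Ext0_eq[OF X Y] Ext0_eq[OF Y Z])
      have sF: "sh F \<in> cocyc S (rep (mf_shift (fst X))) (rep (mf_shift (fst Y)))"
        and sG: "sh G \<in> cocyc S (rep (mf_shift (fst Y))) (rep (mf_shift (fst Z)))"
        using sh_cocyc[OF F(1)] sh_cocyc[OF G(1)] by (simp_all add: sX(2) sY(2) sZ(2))
      show ?thesis
        by (simp add: MF_form_simps F(2) G(2) Cmp_hclass[OF X Y Z F(1) G(1)] ShM_hclass[OF X Z cocyc_mult[OF F(1) G(1)]]
            ShM_hclass[OF X Y F(1)] ShM_hclass[OF Y Z G(1)] Cmp_hclass[OF sX(1) sY(1) sZ(1) sF sG] sh_mult)
    qed
  qed
  show "bij_betw (ShM ?K X Y) (Mor ?K X Y) (Mor ?K (ShO ?K X) (ShO ?K Y))" if X': "X \<in> Obj ?K" and Y': "Y \<in> Obj ?K" for X Y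
  proof -
    note X = MF[OF X'] and Y = MF[OF Y'] and sX = shift_MF[OF MF[OF X']] and sY = shift_MF[OF MF[OF Y']]
    have "bij_betw (ShM (MF_shift_cat S w) (fst X) (fst Y)) (hclass S (fst X) (fst Y) ` cocyc S (rep (fst X)) (rep (fst Y)))
        (hclass S (mf_shift (fst X)) (mf_shift (fst Y)) ` cocyc S (shift (rep (fst X))) (shift (rep (fst Y))))"
    proof (rule bij_betw_imageI)
      show "inj_on (ShM (MF_shift_cat S w) (fst X) (fst Y)) (hclass S (fst X) (fst Y) ` cocyc S (rep (fst X)) (rep (fst Y)))"
      proof (rule inj_onI)
        fix f g assume "f \<in> hclass S (fst X) (fst Y) ` cocyc S (rep (fst X)) (rep (fst Y))"
          "g \<in> hclass S (fst X) (fst Y) ` cocyc S (rep (fst X)) (rep (fst Y))"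
          and eq: "ShM (MF_shift_cat S w) (fst X) (fst Y) f = ShM (MF_shift_cat S w) (fst X) (fst Y) g"
        then obtain F G where F: "F \<in> cocyc S (rep (fst X)) (rep (fst Y))" "f = hclass S (fst X) (fst Y) F"
          and G: "G \<in> cocyc S (rep (fst X)) (rep (fst Y))" "g = hclass S (fst X) (fst Y) G" by (elim imageE)
        have z: "sh F \<in> cocyc S (rep (mf_shift (fst X))) (rep (mf_shift (fst Y)))"
          "sh G \<in> cocyc S (rep (mf_shift (fst X))) (rep (mf_shift (fst Y)))"
          using sh_cocyc[OF F(1)] sh_cocyc[OF G(1)] by (simp_all add: sX(2) sY(2))
        have "homot S (shift (rep (fst X))) (shift (rep (fst Y))) (sh F) (sh G)"
          using eq by (simp add: F(2) G(2) ShM_hclass[OF X Y F(1)] ShM_hclass[OF X Y G(1)] hclass_eq_iff[OF sX(1) sY(1) z] sX(2) sY(2))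
        from sh_homot[OF this] show "f = g" unfolding F(2) G(2) by (intro hclass_cong) simp
      qed
      show "ShM (MF_shift_cat S w) (fst X) (fst Y) ` hclass S (fst X) (fst Y) ` cocyc S (rep (fst X)) (rep (fst Y)) =
          hclass S (mf_shift (fst X)) (mf_shift (fst Y)) ` cocyc S (shift (rep (fst X))) (shift (rep (fst Y)))"
      proof (intro equalityI subsetI)
        fix f assume "f \<in> ShM (MF_shift_cat S w) (fst X) (fst Y) ` hclass S (fst X) (fst Y) ` cocyc S (rep (fst X)) (rep (fst Y))"
        then obtain F where F: "F \<in> cocyc S (rep (fst X)) (rep (fst Y))" "f = ShM (MF_shift_cat S w) (fst X) (fst Y) (hclass S (fst X) (fst Y) F)"
          by (elim imageE) simp
        show "f \<in> hclass S (mf_shift (fst X)) (mf_shift (fst Y)) ` cocyc S (shift (rep (fst X))) (shift (rep (fst Y)))"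
          unfolding F(2) ShM_hclass[OF X Y F(1)] by (intro imageI sh_cocyc F(1))
      next
        fix g assume "g \<in> hclass S (mf_shift (fst X)) (mf_shift (fst Y)) ` cocyc S (shift (rep (fst X))) (shift (rep (fst Y)))"
        then obtain G where G: "G \<in> cocyc S (shift (rep (fst X))) (shift (rep (fst Y)))" "g = hclass S (mf_shift (fst X)) (mf_shift (fst Y)) G"
          by (elim imageE)
        have sG: "sh G \<in> cocyc S (rep (fst X)) (rep (fst Y))" using sh_cocyc[OF G(1)] by simp
        have "g = ShM (MF_shift_cat S w) (fst X) (fst Y) (hclass S (fst X) (fst Y) (sh G))"
          by (simp add: ShM_hclass[OF X Y sG] G(2))
        then show "g \<in> ShM (MF_shift_cat S w) (fst X) (fst Y) ` hclass S (fst X) (fst Y) ` cocyc S (rep (fst X)) (rep (fst Y))"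
          using sG by blast
      qed
    qed
    then show ?thesis by (simp add: MF_form_simps Ext0_eq[OF X Y] Ext0_eq[OF sX(1) sY(1)] sX(2) sY(2))
  qed
  show "\<exists>X\<in>Obj ?K. \<exists>m. m \<in> isos ?K (ShO ?K X) Y" if Y': "Y \<in> Obj ?K" for Y
  proof (intro bexI exI)
    note Y = MF[OF Y']
    have "hequiv S (rep (fst Y)) (rep (fst Y)) (idm (rk (fst Y)))"
      by (rule heqI[OF id[OF Y] id[OF Y]]) (simp_all add: homot_refl)
    then show "hclass S (fst Y) (fst Y) (idm (rk (fst Y))) \<in> isos ?K (ShO ?K (ShO ?K Y)) Y"
      by (simp add: MF_form_simps isos_hclass[OF Y Y])
    show "ShO ?K Y \<in> Obj ?K" by (rule shift_Obj[OF Y'])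
  qed
qed

end


subsection \<open>Descent to homotopy classes\<close>

text \<open>
  Forms enter only through the objects. All conditions on morphisms and triangles are those of the
  underlying matrix factorizations, where they hold by \<open>strict_equiv\<close>.
\<close>

lemma strict_equiv_triangulated:
  assumes se: "strict_equiv S S' w w' A a \<eta> \<gamma>"
    and FoD: "\<And>X. X \<in> Obj (MF_form S \<epsilon> w) \<Longrightarrow> Fo X \<in> Obj (MF_form S' \<epsilon>' w')"
    and rep_Fo: "\<And>X. X \<in> Obj (MF_form S \<epsilon> w) \<Longrightarrow> rep (fst (Fo X)) = A (rep (fst X))"
    and Fm_hclass: "\<And>X Y F. X \<in> Obj (MF_form S \<epsilon> w) \<Longrightarrow> Y \<in> Obj (MF_form S \<epsilon> w) \<Longrightarrow> F \<in> cocyc S (rep (fst X)) (rep (fst Y)) \<Longrightarrow>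
      Fm X Y (hclass S (fst X) (fst Y) F) = hclass S' (fst (Fo X)) (fst (Fo Y)) (a (rep (fst X)) (rep (fst Y)) F)"
    and es: "\<And>Y. Y \<in> Obj (MF_form S' \<epsilon>' w') \<Longrightarrow> \<exists>X\<in>Obj (MF_form S \<epsilon> w). \<exists>F. hequiv S' (A (rep (fst X))) (rep (fst Y)) F"
  shows "triangulated_equivalence (MF_form S \<epsilon> w) (MF_form S' \<epsilon>' w') Fo Fm"
proof -
  interpret strict_equiv S S' w w' A a \<eta> \<gamma> by (rule se)
  let ?C = "MF_form S \<epsilon> w" and ?D = "MF_form S' \<epsilon>' w'"
  have MF: "X \<in> Obj ?C \<Longrightarrow> is_MF S w (fst X)" for X by (simp add: MF_form_simps)
  have MFD: "X \<in> Obj ?D \<Longrightarrow> is_MF S' w' (fst X)" for X by (simp add: MF_form_simps)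
  note FM = MFD[OF FoD]
  have r: "rep (fst X) \<in> mfs S w" if "X \<in> Obj ?C" for X by (rule rep_mfs[OF MF[OF that] S.zero])
  have id: "idm (rk (fst X)) \<in> cocyc S (rep (fst X)) (rep (fst X))" if "X \<in> Obj ?C" for X
    using S.cocyc_id[OF r[OF that]] by simp
  have az: "a (rep (fst X)) (rep (fst Y)) F \<in> cocyc S' (rep (fst (Fo X))) (rep (fst (Fo Y)))"
    if "X \<in> Obj ?C" "Y \<in> Obj ?C" "F \<in> cocyc S (rep (fst X)) (rep (fst Y))" for X Y F
    using mor[OF r[OF that(1)] r[OF that(2)] that(3)] by (simp add: rep_Fo[OF that(1)] rep_Fo[OF that(2)])
  have morE: thesis if "X \<in> Obj ?C" "Y \<in> Obj ?C" "f \<in> Mor ?C X Y"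
    "\<And>F. F \<in> cocyc S (rep (fst X)) (rep (fst Y)) \<Longrightarrow> f = hclass S (fst X) (fst Y) F \<Longrightarrow> thesis" for X Y f thesis
    using that(3,4) by (auto simp: MF_form_simps S.Ext0_eq[OF MF[OF that(1)] MF[OF that(2)]])
  have fctr: "is_functor ?C ?D Fo Fm"
    unfolding is_functor_def
  proof (intro conjI ballI)
    fix X assume X: "X \<in> Obj ?C"
    show "Fo X \<in> Obj ?D" by (rule FoD[OF X])
    have rk: "rk (fst (Fo X)) = fst (A (rep (fst X)))" using arg_cong[OF rep_Fo[OF X], of fst] by simp
    have "a (rep (fst X)) (rep (fst X)) (idm (rk (fst X))) = idm (rk (fst (Fo X)))"
      using ident[OF r[OF X]] by (simp add: rk)
    then show "Fm X X (Idt ?C X) = Idt ?D (Fo X)"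
      by (simp add: MF_form_simps S.Idt_hclass[OF MF[OF X]] S'.Idt_hclass[OF FM[OF X]] Fm_hclass[OF X X id[OF X]])
    fix Y assume Y: "Y \<in> Obj ?C"
    show "Fm X Y f \<in> Mor ?D (Fo X) (Fo Y)" if f: "f \<in> Mor ?C X Y" for f
    proof (rule morE[OF X Y f])
      fix F assume F: "F \<in> cocyc S (rep (fst X)) (rep (fst Y))" "f = hclass S (fst X) (fst Y) F"
      show ?thesis using az[OF X Y F(1)]
        by (simp add: F(2) Fm_hclass[OF X Y F(1)] MF_form_simps S'.Ext0_eq[OF FM[OF X] FM[OF Y]])
    qed
    fix Z assume Z: "Z \<in> Obj ?C"
    fix f g assume f: "f \<in> Mor ?C X Y" and g: "g \<in> Mor ?C Y Z"
    obtain F where F: "F \<in> cocyc S (rep (fst X)) (rep (fst Y))" "f = hclass S (fst X) (fst Y) F" by (rule morE[OF X Y f])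
    obtain G where G: "G \<in> cocyc S (rep (fst Y)) (rep (fst Z))" "g = hclass S (fst Y) (fst Z) G" by (rule morE[OF Y Z g])
    show "Fm X Z (Cmp ?C X Y Z g f) = Cmp ?D (Fo X) (Fo Y) (Fo Z) (Fm Y Z g) (Fm X Y f)"
      by (simp add: F(2) G(2) MF_form_simps S.Cmp_hclass[OF MF[OF X] MF[OF Y] MF[OF Z] F(1) G(1)]
          Fm_hclass[OF X Z S.cocyc_mult[OF F(1) G(1)]] Fm_hclass[OF X Y F(1)] Fm_hclass[OF Y Z G(1)]
          S'.Cmp_hclass[OF FM[OF X] FM[OF Y] FM[OF Z] az[OF X Y F(1)] az[OF Y Z G(1)]]
          comp[OF r[OF X] r[OF Y] r[OF Z] F(1) G(1)])
  qed
  have equiv: "is_equivalence ?C ?D Fo Fm"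
  proof (rule is_equivalenceI[OF S.MF_form_category S'.MF_form_category fctr])
    show "bij_betw (Fm X Y) (Mor ?C X Y) (Mor ?D (Fo X) (Fo Y))" if X: "X \<in> Obj ?C" and Y: "Y \<in> Obj ?C" for X Y
    proof (rule bij_betw_imageI)
      show "inj_on (Fm X Y) (Mor ?C X Y)"
      proof (rule inj_onI)
        fix f g assume f: "f \<in> Mor ?C X Y" and g: "g \<in> Mor ?C X Y" and eq: "Fm X Y f = Fm X Y g"
        obtain F where F: "F \<in> cocyc S (rep (fst X)) (rep (fst Y))" "f = hclass S (fst X) (fst Y) F" by (rule morE[OF X Y f])
        obtain G where G: "G \<in> cocyc S (rep (fst X)) (rep (fst Y))" "g = hclass S (fst X) (fst Y) G" by (rule morE[OF X Y g])
        have "homot S' (A (rep (fst X))) (A (rep (fst Y))) (a (rep (fst X)) (rep (fst Y)) F) (a (rep (fst X)) (rep (fst Y)) G)"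
          using eq by (simp add: F(2) G(2) Fm_hclass[OF X Y F(1)] Fm_hclass[OF X Y G(1)] rep_Fo[OF X] rep_Fo[OF Y]
              S'.hclass_eq_iff[OF FM[OF X] FM[OF Y] az[OF X Y F(1)] az[OF X Y G(1)]])
        then show "f = g" unfolding F(2) G(2) homotopy[OF r[OF X] r[OF Y] F(1) G(1)] by (rule S.hclass_cong)
      qed
      show "Fm X Y ` Mor ?C X Y = Mor ?D (Fo X) (Fo Y)"
      proof (intro equalityI subsetI)
        fix g assume "g \<in> Fm X Y ` Mor ?C X Y"
        then show "g \<in> Mor ?D (Fo X) (Fo Y)" using functorD(2)[OF fctr X Y] by blast
      next
        fix g assume "g \<in> Mor ?D (Fo X) (Fo Y)"
        then obtain G where G: "G \<in> cocyc S' (A (rep (fst X))) (A (rep (fst Y)))" "g = hclass S' (fst (Fo X)) (fst (Fo Y)) G"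
          by (auto simp: MF_form_simps S'.Ext0_eq[OF FM[OF X] FM[OF Y]] rep_Fo[OF X] rep_Fo[OF Y])
        obtain F where F: "F \<in> cocyc S (rep (fst X)) (rep (fst Y))"
          "homot S' (A (rep (fst X))) (A (rep (fst Y))) (a (rep (fst X)) (rep (fst Y)) F) G"
          using full[OF r[OF X] r[OF Y] G(1)] by (elim bexE)
        have "Fm X Y (hclass S (fst X) (fst Y) F) = g"
          unfolding Fm_hclass[OF X Y F(1)] G(2) using F(2) by (intro S'.hclass_cong) (simp add: rep_Fo[OF X] rep_Fo[OF Y])
        moreover have "hclass S (fst X) (fst Y) F \<in> Mor ?C X Y"
          using F(1) by (simp add: MF_form_simps S.Ext0_eq[OF MF[OF X] MF[OF Y]])
        ultimately show "g \<in> Fm X Y ` Mor ?C X Y" by blast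
      qed
    qed
    show "\<exists>X\<in>Obj ?C. \<exists>m. m \<in> isos ?D (Fo X) Y" if Y: "Y \<in> Obj ?D" for Y
    proof -
      obtain X F where X: "X \<in> Obj ?C" and F: "hequiv S' (A (rep (fst X))) (rep (fst Y)) F"
        using es[OF Y] by (elim bexE exE)
      have "hclass S' (fst (Fo X)) (fst Y) F \<in> isos ?D (Fo X) Y"
        using F by (simp add: MF_form_simps S'.isos_hclass[OF FM[OF X] MFD[OF Y]] rep_Fo[OF X])
      with X show ?thesis by blast
    qed
  qed
  define \<theta> where "\<theta> X = hclass S' (fst (Fo (ShO ?C X))) (fst (ShO ?D (Fo X))) (\<eta> (rep (fst X)))" for X
  note sO = S.shift_Obj[of _ \<epsilon> w] and sFO = S'.shift_Obj[OF FoD]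
  have rsX: "rep (fst (ShO ?C X)) = shift (rep (fst X))" if "X \<in> Obj ?C" for X
    using S.shift_MF(2)[OF MF[OF that]] by (simp add: MF_form_simps)
  have rFsX: "rep (fst (Fo (ShO ?C X))) = A (shift (rep (fst X)))" if "X \<in> Obj ?C" for X
    using rep_Fo[OF sO[OF that]] by (simp add: rsX[OF that])
  have rsFX: "rep (fst (ShO ?D (Fo X))) = shift (A (rep (fst X)))" if "X \<in> Obj ?C" for X
    using S'.shift_MF(2)[OF FM[OF that]] by (simp add: MF_form_simps rep_Fo[OF that])
  have \<eta>z: "\<eta> (rep (fst X)) \<in> cocyc S' (rep (fst (Fo (ShO ?C X)))) (rep (fst (ShO ?D (Fo X))))" if "X \<in> Obj ?C" for X
    using strict_iso_cocyc[OF shift[OF r[OF that]]] by (simp add: rFsX[OF that] rsFX[OF that])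
  have nat: "natural_iso ?C ?D (\<lambda>X. Fo (ShO ?C X)) (\<lambda>X Y f. Fm (ShO ?C X) (ShO ?C Y) (ShM ?C X Y f))
        (\<lambda>X. ShO ?D (Fo X)) (\<lambda>X Y f. ShM ?D (Fo X) (Fo Y) (Fm X Y f)) \<theta>"
    unfolding natural_iso_def
  proof (intro conjI ballI)
    fix X assume X: "X \<in> Obj ?C"
    have "hequiv S' (rep (fst (Fo (ShO ?C X)))) (rep (fst (ShO ?D (Fo X)))) (\<eta> (rep (fst X)))"
      using S'.strict_iso_hequiv[OF shift[OF r[OF X]]] by (simp add: rFsX[OF X] rsFX[OF X])
    then show "\<theta> X \<in> isos ?D (Fo (ShO ?C X)) (ShO ?D (Fo X))"
      unfolding \<theta>_def MF_form_simps(7) S'.isos_hclass[OF FM[OF sO[OF X]] MFD[OF sFO[OF X]]] by blast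
    fix Y f assume Y: "Y \<in> Obj ?C" and f: "f \<in> Mor ?C X Y"
    obtain F where F: "F \<in> cocyc S (rep (fst X)) (rep (fst Y))" "f = hclass S (fst X) (fst Y) F" by (rule morE[OF X Y f])
    have sF: "sh F \<in> cocyc S (rep (fst (ShO ?C X))) (rep (fst (ShO ?C Y)))"
      using S.sh_cocyc[OF F(1)] by (simp add: rsX[OF X] rsX[OF Y])
    have ShF: "ShM ?C X Y f = hclass S (fst (ShO ?C X)) (fst (ShO ?C Y)) (sh F)"
      by (simp add: F(2) MF_form_simps S.ShM_hclass[OF MF[OF X] MF[OF Y] F(1)])
    let ?aF = "a (rep (fst X)) (rep (fst Y)) F"
    have ShaF: "ShM ?D (Fo X) (Fo Y) (Fm X Y f) = hclass S' (fst (ShO ?D (Fo X))) (fst (ShO ?D (Fo Y))) (sh ?aF)"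
      by (simp add: F(2) Fm_hclass[OF X Y F(1)] MF_form_simps S'.ShM_hclass[OF FM[OF X] FM[OF Y] az[OF X Y F(1)]])
    have saF: "sh ?aF \<in> cocyc S' (rep (fst (ShO ?D (Fo X)))) (rep (fst (ShO ?D (Fo Y))))"
      using S'.sh_cocyc[OF mor[OF r[OF X] r[OF Y] F(1)]] by (simp add: rsFX[OF X] rsFX[OF Y])
    show "Cmp ?D (Fo (ShO ?C X)) (Fo (ShO ?C Y)) (ShO ?D (Fo Y)) (\<theta> Y) (Fm (ShO ?C X) (ShO ?C Y) (ShM ?C X Y f)) =
        Cmp ?D (Fo (ShO ?C X)) (ShO ?D (Fo X)) (ShO ?D (Fo Y)) (ShM ?D (Fo X) (Fo Y) (Fm X Y f)) (\<theta> X)"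
      unfolding ShF Fm_hclass[OF sO[OF X] sO[OF Y] sF] ShaF MF_form_simps(4) \<theta>_def
        S'.Cmp_hclass[OF FM[OF sO[OF X]] FM[OF sO[OF Y]] MFD[OF sFO[OF Y]] az[OF sO[OF X] sO[OF Y] sF] \<eta>z[OF Y]]
        S'.Cmp_hclass[OF FM[OF sO[OF X]] MFD[OF sFO[OF X]] MFD[OF sFO[OF Y]] \<eta>z[OF X] saF]
      by (simp add: rsX[OF X] rsX[OF Y] shift_natural[OF r[OF X] r[OF Y] F(1)])
  qed
  have tri: "(X, Y, Z, f, g, h) \<in> Tri ?C \<longleftrightarrow> (Fo X, Fo Y, Fo Z, Fm X Y f, Fm Y Z g,
      Cmp ?D (Fo Z) (Fo (ShO ?C X)) (ShO ?D (Fo X)) (\<theta> X) (Fm Z (ShO ?C X) h)) \<in> Tri ?D"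
    if t: "triangle_typed ?C (X, Y, Z, f, g, h)" for X Y Z f g h
  proof -
    have X: "X \<in> Obj ?C" and Y: "Y \<in> Obj ?C" and Z: "Z \<in> Obj ?C" and f: "f \<in> Mor ?C X Y" and g: "g \<in> Mor ?C Y Z"
      and h: "h \<in> Mor ?C Z (ShO ?C X)" using t by (simp_all add: triangle_typed_def)
    note sX = sO[OF X]
    obtain F where F: "F \<in> cocyc S (rep (fst X)) (rep (fst Y))" "f = hclass S (fst X) (fst Y) F" by (rule morE[OF X Y f])
    obtain G where G: "G \<in> cocyc S (rep (fst Y)) (rep (fst Z))" "g = hclass S (fst Y) (fst Z) G" by (rule morE[OF Y Z g])
    obtain H where H: "H \<in> cocyc S (rep (fst Z)) (rep (fst (ShO ?C X)))" "h = hclass S (fst Z) (fst (ShO ?C X)) H" by (rule morE[OF Z sX h])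
    have H': "H \<in> cocyc S (rep (fst Z)) (shift (rep (fst X)))" using H(1) by (simp add: rsX[OF X])
    let ?H = "\<eta> (rep (fst X)) * a (rep (fst Z)) (rep (fst (ShO ?C X))) H"
    have H2: "?H \<in> cocyc S' (rep (fst (Fo Z))) (rep (fst (ShO ?D (Fo X))))"
      by (rule S'.cocyc_mult[OF az[OF Z sX H(1)] \<eta>z[OF X]])
    then have H3: "?H \<in> cocyc S' (rep (fst (Fo Z))) (shift (rep (fst (Fo X))))"
      by (simp add: rsFX[OF X] rep_Fo[OF X])
    have sC: "fst (ShO ?C X) = mf_shift (fst X)" and sD: "fst (ShO ?D (Fo X)) = mf_shift (fst (Fo X))"
      by (simp_all add: MF_form_simps)
    have C: "Cmp ?D (Fo Z) (Fo (ShO ?C X)) (ShO ?D (Fo X)) (\<theta> X) (Fm Z (ShO ?C X) h) =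
        hclass S' (fst (Fo Z)) (mf_shift (fst (Fo X))) ?H"
      unfolding H(2) Fm_hclass[OF Z sX H(1)] MF_form_simps(4) \<theta>_def
        S'.Cmp_hclass[OF FM[OF Z] FM[OF sX] MFD[OF sFO[OF X]] az[OF Z sX H(1)] \<eta>z[OF X]] by (simp only: sD)
    show ?thesis
      unfolding C
      unfolding MF_form_Tri F(2) G(2) Fm_hclass[OF X Y F(1)] Fm_hclass[OF Y Z G(1)] H(2)
        S'.MF_triangles_iff[OF FM[OF X] FM[OF Y] FM[OF Z] az[OF X Y F(1)] az[OF Y Z G(1)] H3]
      unfolding sC S.MF_triangles_iff[OF MF[OF X] MF[OF Y] MF[OF Z] F(1) G(1) H']
        S.shift_MF(2)[OF MF[OF X]] rep_Fo[OF X] rep_Fo[OF Y] rep_Fo[OF Z]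
        tri_mor[OF r[OF X] r[OF Y] r[OF Z] F(1) G(1) H']
      using X Y Z FoD by simp
  qed
  show ?thesis
    unfolding triangulated_equivalence_def
    using S.MF_form_category S.MF_form_shift_equivalence S'.MF_form_category S'.MF_form_shift_equivalence equiv nat tri
    by blast
qed


subsection \<open>The iterated functor\<close>

text \<open>
  The second variable is adjoined first, because the coefficient of \<open>x\<close> is split off first. The
  negative of \<open>x\<close> occurs in the outer functor.
\<close>

lemma knoerrer_Var:
  assumes "subring (series_in {..<n + 2} :: 'k::field mpow set)"
  shows "knoerrer (series_in {..<n}) (series_in (insert (n + 1) {..<n})) (series_in {..<n + 2} :: 'k mpow set) (Var n) (Var (n + 1))"
    and "knoerrer (series_in {..<n}) (series_in (insert (n + 1) {..<n})) (series_in {..<n + 2} :: 'k mpow set) (- Var n) (Var (n + 1))"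
proof -
  have eq: "{..<n + 2} = insert n (insert (n + 1) {..<n})" by auto
  have x: "adjoins (Var n) (series_in (insert (n + 1) {..<n})) (series_in {..<n + 2} :: 'k mpow set)"
    unfolding eq by (rule adjoins_Var) simp
  have y: "adjoins (Var (n + 1)) (series_in {..<n}) (series_in (insert (n + 1) {..<n}) :: 'k mpow set)"
    by (rule adjoins_Var) simp
  show "knoerrer (series_in {..<n}) (series_in (insert (n + 1) {..<n})) (series_in {..<n + 2} :: 'k mpow set) (Var n) (Var (n + 1))"
    "knoerrer (series_in {..<n}) (series_in (insert (n + 1) {..<n})) (series_in {..<n + 2} :: 'k mpow set) (- Var n) (Var (n + 1))"
    by (intro knoerrer.intro knoerrer_axioms.intro subring_series_in x y adjoins_minus[OF x])+
qed

lemma theta_theta_strict_equiv: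
  fixes \<pi> :: "'k::field mpow"
  assumes \<pi>: "\<pi> \<in> power_series n"
  obtains \<eta> \<gamma> where "strict_equiv (power_series n) (power_series (n + 4)) \<pi> (Var n * Var (n + 1) + Var (n + 2) * Var (n + 3) - \<pi>)
    (\<lambda>M. kn (- Var (n + 2)) (Var (n + 3)) (twist (kn (Var n) (Var (n + 1)) M)))
    (\<lambda>M N F. kn_mor (sumr (fst M) (fst M)) (sumr (fst N) (fst N)) (kn_mor (fst M) (fst N) F)) \<eta> \<gamma>"
proof -
  let ?w = "- (\<pi> - Var n * Var (n + 1))"
  have c: "mcoeff (Var i :: 'k mpow) {#} = 0" "mcoeff (- Var i :: 'k mpow) {#} = 0" for i
    by (simp_all add: Var_def uminus_mpow_def)
  have V: "i < k \<Longrightarrow> (Var i :: 'k mpow) \<in> power_series k" for i k by (auto simp: power_series_def Var_def)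
  interpret S2: subring "power_series (n + 2) :: 'k mpow set" unfolding power_series_eq by (rule subring_series_in)
  have "\<pi> \<in> power_series (n + 2)" using \<pi> series_in_mono[of "{..<n}" "{..<n + 2}"] by (auto simp: power_series_eq)
  then have w: "?w \<in> power_series (n + 2)"
    by (intro S2.minus S2.diff S2.mult V) simp_all
  have 1: "strict_equiv (power_series n) (power_series (n + 2)) \<pi> (\<pi> - Var n * Var (n + 1)) (kn (Var n) (Var (n + 1)))
      (\<lambda>M N. kn_mor (fst M) (fst N)) kn_shift (\<lambda>M N _. kn_cone M N)"
    using \<pi> unfolding power_series_eq by (intro kn_strict_equiv[OF knoerrer_Var(1)[OF subring_series_in]] c)
  have "strict_equiv (series_in {..<n + 2}) (series_in {..<n + 2 + 2}) ?w (?w - (- Var (n + 2)) * Var (n + 2 + 1))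
      (kn (- Var (n + 2)) (Var (n + 2 + 1))) (\<lambda>M N. kn_mor (fst M) (fst N)) kn_shift (\<lambda>M N _. kn_cone M N)"
    using w unfolding power_series_eq by (intro kn_strict_equiv[OF knoerrer_Var(2)[OF subring_series_in]] c)
  moreover have "?w - (- Var (n + 2)) * Var (n + 2 + 1) = Var n * Var (n + 1) + Var (n + 2) * Var (n + 3) - \<pi>"
    "n + 2 + 2 = n + 4" "n + 2 + 1 = n + 3"
    by (simp_all add: numeral_3_eq_3)
  ultimately have 2: "strict_equiv (power_series (n + 2)) (power_series (n + 4)) ?w (Var n * Var (n + 1) + Var (n + 2) * Var (n + 3) - \<pi>)
      (kn (- Var (n + 2)) (Var (n + 3))) (\<lambda>M N. kn_mor (fst M) (fst N)) kn_shift (\<lambda>M N _. kn_cone M N)"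
    by (simp only: power_series_eq)
  from strict_equiv_comp[OF strict_equiv_comp[OF 1 twist_strict_equiv[OF S2.subring_axioms]] 2]
  show thesis by (intro that) (simp add: kn_def)
qed

theorem mainTheorem1:
  fixes n :: nat
    and \<pi> :: "'k::{alg_closed_field, field_char_0} mpow"
    and \<epsilon> :: form_type
  assumes "\<pi> \<in> power_series n"
    and "mcoeff \<pi> {#} = 0"
  shows "triangulated_equivalence
    (MF_form (power_series n) \<epsilon> \<pi>)
    (MF_form (power_series (n + 4)) (opposite \<epsilon>)
      (Var n * Var (n + 1) + Var (n + 2) * Var (n + 3) - \<pi>))
    (theta_theta_obj n) (theta_theta_mor n)"
proof -
  let ?S = "power_series n :: 'k mpow set" and ?S' = "power_series (n + 4) :: 'k mpow set"
  let ?w = "Var n * Var (n + 1) + Var (n + 2) * Var (n + 3) - \<pi>"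
  let ?C = "MF_form ?S \<epsilon> \<pi>" and ?D = "MF_form ?S' (opposite \<epsilon>) ?w"
  let ?x = "Var n :: 'k mpow" and ?y = "Var (n + 1) :: 'k mpow" and ?u = "- Var (n + 2) :: 'k mpow" and ?v = "Var (n + 3) :: 'k mpow"
  define A :: "'k mpow mfo \<Rightarrow> 'k mpow mfo" where "A M = kn ?u ?v (twist (kn ?x ?y M))" for M
  define a :: "'k mpow mfo \<Rightarrow> 'k mpow mfo \<Rightarrow> 'k mpow gmat \<Rightarrow> 'k mpow gmat"
    where "a M N F = kn_mor (sumr (fst M) (fst M)) (sumr (fst N) (fst N)) (kn_mor (fst M) (fst N) F)" for M N F
  obtain \<eta> \<gamma> where se: "strict_equiv ?S ?S' \<pi> ?w A a \<eta> \<gamma>"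
    unfolding A_def a_def by (rule theta_theta_strict_equiv[OF assms(1)])
  interpret strict_equiv ?S ?S' \<pi> ?w A a \<eta> \<gamma> by (rule se)
  have V: "i < k \<Longrightarrow> (Var i :: 'k mpow) \<in> power_series k" for i k by (auto simp: power_series_def Var_def)
  have sub: "?S \<subseteq> ?S'" unfolding power_series_eq by (rule series_in_mono) auto
  have Z: "strict_iso ?S' (A (mdual M)) (mdual (A M)) (zouter (fst M))" if M: "M \<in> mfs ?S \<pi>" for M
  proof -
    have "M \<in> mfs ?S' \<pi>" using M hm_mono[OF _ sub] by (auto simp: mfs_def)
    then show ?thesis unfolding A_def by (rule S'.zouter_strict_iso) (intro V S'.minus; simp)+
  qed
  have form: "zouter (fst M) * a M (mdual M) b = theta_theta_form (fst M) b" if "b \<in> hm ?S False (fst M) (prod.swap (fst M))" for M b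
    unfolding a_def fst_mdual by (rule theta_theta_form_eq[OF that])
  have Z_transpose: "sh (tr (zouter (fst M) * a M (mdual M) b)) = - (zouter (fst M) * a M (mdual M) (sh (tr b)))"
    if b: "b \<in> cocyc ?S M (mdual M)" for M b
    using S.cocyc_hm[OF b] S.cocyc_hm[OF S.cocyc_transpose[OF b]] by (simp add: form theta_theta_form_transpose)
  have a_minus: "a M N (- F) = - a M N F" for M N F by (simp add: a_def kn_mor_def algebra_simps)
  note se' = se[unfolded power_series_eq]
  have forms: "rform ?S' (opposite \<epsilon>) (A M) (zouter (fst M) * a M (mdual M) b)"
    if "M \<in> mfs ?S \<pi>" "rform ?S \<epsilon> M b" for M b
    by (rule strict_equiv_forms(1)[where Z = "\<lambda>M. zouter (fst M)", OF se', folded power_series_eq])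
      (rule Z Z_transpose a_minus that | assumption)+
  have forms_surj: "\<exists>M\<in>mfs ?S \<pi>. \<exists>b. rform ?S \<epsilon> M b \<and> (\<exists>F. hequiv ?S' (A M) N F)"
    if "N \<in> mfs ?S' ?w" "rform ?S' (opposite \<epsilon>) N c" for N c
    by (rule strict_equiv_forms(2)[where Z = "\<lambda>M. zouter (fst M)", OF se', folded power_series_eq])
      (rule Z Z_transpose a_minus that | assumption | simp)+
  have tt: "rep (theta_theta n M) = A (rep M)" "theta_theta n M \<in> maps ?S' True (rk (theta_theta n M)) (rk (theta_theta n M))"
    "is_MF ?S' ?w (theta_theta n M)" if M: "is_MF ?S \<pi> M" for M
  proof -
    note t = theta_theta_eq[OF MF_maps[OF M]]
    show r: "rep (theta_theta n M) = A (rep M)" using t(1) by (simp add: A_def rep_def)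
    show "is_MF ?S' ?w (theta_theta n M)"
      by (rule S'.is_MF_rep[OF t(2)]) (simp only: r obj[OF rep_mfs[OF M S.zero]])
    then show "theta_theta n M \<in> maps ?S' True (rk (theta_theta n M)) (rk (theta_theta n M))" by (rule MF_maps)
  qed
  have rk_tt: "rk (theta_theta n M) = sumr (sumr (rk M) (rk M)) (sumr (rk M) (rk M))" if "is_MF ?S \<pi> M" for M
    by (rule rk_maps[OF theta_theta_eq(2)[OF MF_maps[OF that]]])
  have tt_form: "is_form ?S' (opposite \<epsilon>) (theta_theta n M) (subst (n + 2) (theta_twisted (theta_form b)))"
    if M: "is_MF ?S \<pi> M" and b: "is_form ?S \<epsilon> M b" for M b
  proof -
    let ?X = "rk M" and ?B = "gm False b" and ?t = "subst (n + 2) (theta_twisted (theta_form b))"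
    have b': "b \<in> maps ?S False ?X (prod.swap ?X)" "rform ?S \<epsilon> (rep M) ?B" using b by (simp_all add: S.is_form_iff[OF M])
    note bo = b'(1)[unfolded maps_swap]
    note q = gm_theta_form[OF bo S.subring_axioms]
    note t = gm_theta_twisted[OF q(2) S.subring_axioms]
    have id: "?t = theta_twisted (theta_form b)"
      by (rule subst_id[where V = "{..<n}"], use t(2) in \<open>simp_all add: power_series_eq\<close>)
    have "gm False ?t = flp * gm True ?t" by (simp add: gm_odd_swap)
    then have eq: "gm False ?t = theta_theta_form ?X ?B"
      by (simp only: id t(1) q(1) gm_odd_swap[of b] theta_theta_form_def Let_def)
    have B: "?B \<in> hm ?S False (fst (rep M)) (prod.swap (fst (rep M)))" using gm_hm[OF b'(1) S.zero] by simp
    have "rform ?S' (opposite \<epsilon>) (A (rep M)) (theta_theta_form ?X ?B)"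
      using forms[OF rep_mfs[OF M S.zero] b'(2)] unfolding form[OF B] by simp
    moreover have "?t \<in> maps ?S' False (rk (theta_theta n M)) (prod.swap (rk (theta_theta n M)))"
      unfolding id rk_tt[OF M] maps_swap by (rule maps_mono[OF t(2) sub])
    ultimately show ?thesis unfolding S'.is_form_iff[OF tt(3)[OF M]] tt(1)[OF M] eq by (intro conjI)
  qed
  have fst_obj: "fst (theta_theta_obj n X) = theta_theta n (fst X)" for X :: "'k mpow hmap \<times> 'k mpow hmap"
    by (simp add: theta_theta_obj_def split_beta)
  show ?thesis
  proof (rule strict_equiv_triangulated[OF se])
    fix X assume X: "X \<in> Obj ?C"
    then have M: "is_MF ?S \<pi> (fst X)" by (simp add: MF_form_simps)
    show "theta_theta_obj n X \<in> Obj ?D"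
      using X tt(3)[OF M] tt_form[OF M] by (simp add: MF_form_simps theta_theta_obj_def split_beta subst_def)
    show "rep (fst (theta_theta_obj n X)) = A (rep (fst X))" by (simp add: fst_obj tt(1)[OF M])
    fix Y F assume Y: "Y \<in> Obj ?C" and F: "F \<in> cocyc ?S (rep (fst X)) (rep (fst Y))"
    have N: "is_MF ?S \<pi> (fst Y)" using Y by (simp add: MF_form_simps)
    show "theta_theta_mor n X Y (hclass ?S (fst X) (fst Y) F) =
        hclass ?S' (fst (theta_theta_obj n X)) (fst (theta_theta_obj n Y)) (a (rep (fst X)) (rep (fst Y)) F)"
      unfolding theta_theta_mor_def fst_obj subst_def[symmetric]
    proof (rule S.hclass_UN[OF M N F])
      fix f assume f: "f \<in> cocycles ?S (fst X) (fst Y)" and Ff: "homot ?S (rep (fst X)) (rep (fst Y)) F (gm False f)"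
      let ?f = "subst (n + 2) (theta_mor (theta_mor f))"
      note t = theta_theta_mor_eq[OF S.cocycle_maps[OF M N f]]
      note fz = S.cocycle_cocyc[OF M N f] and r = rep_mfs[OF M S.zero] rep_mfs[OF N S.zero]
      have eq: "gm False ?f = a (rep (fst X)) (rep (fst Y)) (gm False f)"
        unfolding t(1) a_def fst_rep ..
      have "?f \<in> cocycles ?S' (theta_theta n (fst X)) (theta_theta n (fst Y))"
        unfolding cocycles_iff[OF tt(3)[OF M] tt(3)[OF N] S'.zero] rk_tt[OF M] rk_tt[OF N] tt(1)[OF M] tt(1)[OF N] eq
        by (intro conjI maps_mono[OF t(2) sub] mor[OF r fz])
      from S'.cls_eq[OF tt(3)[OF M] tt(3)[OF N] this]
      have "homotopic ?S' (theta_theta n (fst X)) (theta_theta n (fst Y)) `` {?f} =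
          hclass ?S' (theta_theta n (fst X)) (theta_theta n (fst Y)) (a (rep (fst X)) (rep (fst Y)) (gm False f))"
        by (simp only: eq)
      also have "\<dots> = hclass ?S' (theta_theta n (fst X)) (theta_theta n (fst Y)) (a (rep (fst X)) (rep (fst Y)) F)"
        by (rule S'.hclass_cong, unfold tt(1)[OF M] tt(1)[OF N] homotopy[OF r fz F]) (rule S.homot_sym[OF Ff])
      finally show "homotopic ?S' (theta_theta n (fst X)) (theta_theta n (fst Y)) `` {?f} =
          hclass ?S' (theta_theta n (fst X)) (theta_theta n (fst Y)) (a (rep (fst X)) (rep (fst Y)) F)" .
    qed
  next
    fix Y assume Y: "Y \<in> Obj ?D"
    then have N: "is_MF ?S' ?w (fst Y)" and "is_form ?S' (opposite \<epsilon>) (fst Y) (snd Y)"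
      unfolding MF_form_simps by (rule conjunct1, rule conjunct2)
    from this(2) have c: "rform ?S' (opposite \<epsilon>) (rep (fst Y)) (gm False (snd Y))"
      unfolding S'.is_form_iff[OF N] by (rule conjunct2)
    obtain M' b' F where M': "M' \<in> mfs ?S \<pi>" "rform ?S \<epsilon> M' b'" and F: "hequiv ?S' (A M') (rep (fst Y)) F"
      using forms_surj[OF rep_mfs[OF N S'.zero] c] by auto
    obtain M where M: "is_MF ?S \<pi> M" "rep M = M'" by (rule rep_surj[OF M'(1)])
    have "b' \<in> hm ?S False (rk M) (prod.swap (rk M))"
      using S.cocyc_hm[OF strict_iso_cocyc] M'(2) unfolding rform_def by (metis M(2) fst_mdual fst_rep)
    then obtain b where b: "b \<in> maps ?S False (rk M) (prod.swap (rk M))" "gm False b = b'" by (rule gm_surj)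
    have "(M, b) \<in> Obj ?C" using M b M'(2) by (simp add: MF_form_simps S.is_form_iff[OF M(1)])
    then show "\<exists>X\<in>Obj ?C. \<exists>F. hequiv ?S' (A (rep (fst X))) (rep (fst Y)) F"
      using F M(2) by (intro bexI[of _ "(M, b)"] exI[of _ F]) simp_all
  qed
qed

end
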